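(* Let $T>0$, let $(H_t)_{t\in[0,T]}$ be a continuous real-valued process, $(k_t)_{t\in[0,T]}$ a jointly measurable real-valued process such that $\int_0^T k_s^2\,\mathrm{d}s<\infty$ a.s., and $(W_t)_{t\in[0,T]}$ a Brownian motion independent of $(H,k)$, all defined on a complete probability space $(\Omega,\mathscr{F},\mathbf{P})$. If $$\lambda\big(\{t\in[0,T]: k_t=0\}\big)=0\quad\text{a.s.},$$ where $\lambda$ is the Lebesgue measure on $\mathbb{R}$, then the process $$Z_t := H_t+\int_0^t k_s\,\mathrm{d}W_s,\quad t\in[0,T],$$ has conditional full support (CFS) with respect to its natural filtration, as a process in $\mathbb{R}$.
   Context: Conditional full support. Let $I\subset\mathbb{R}$ be an open interval and $(X_t)_{t\in[0,T]}$ a continuous process with values in $I$ on a complete probability space $(\Omega,\mathscr{F},\mathbf{P})$, and let $\mathbb{F}=(\mathscr{F}_t)_{t\in[0,T]}$ be a filtration. For $x\in I$, $C_x([u,v],I)$ is the set of $f\in C([u,v],I)$ with $f(u)=x$; these spaces carry the uniform topology. The support of a Borel probability measure on a separable metric space is the minimal closed set of measure one. $X$ has $\mathbb{F}$-CFS if (a) $X$ is adapted to $\mathbb{F}$, and (b) for all $t\in[0,T)$ and $\mathbf{P}$-almost all $\omega$, $\mathrm{supp}\big(\mathrm{Law}[(X_u)_{u\in[t,T]}\mid\mathscr{F}_t](\omega)\big)=C_{X_t(\omega)}([t,T],I)$, where the law is a regular conditional law on $C([t,T],I)$. Here $I=\mathbb{R}$. When no filtration is mentioned, it is the natural filtration of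 the process. "Jointly measurable" means $(t,\omega)\mapsto k_t(\omega)$ is $\mathscr{B}([0,T])\otimes\mathscr{F}$-measurable. The stochastic integral is the Itô integral, taken in a filtration with respect to which $W$ is a Brownian motion and $k$ is adapted (for instance the augmented filtration generated by $\sigma(H_s,k_s:s\in[0,T])$ and $W$). *)

theory Defs
  imports "HOL-Probability.Probability"
begin

text \<open>A process indexed by \<^term>\<open>{0..T}\<close> is a function \<^typ>\<open>real \<Rightarrow> 'a \<Rightarrow> real\<close>; its values at times
  outside \<^term>\<open>{0..T}\<close> are never used. The same applies to filtrations.\<close>

section \<open>Processes and filtrations\<close>

definition continuous_process :: "'a measure \<Rightarrow> real \<Rightarrow> (real \<Rightarrow> 'a \<Rightarrow> real) \<Rightarrow> bool" where
  "continuous_process M T X \<longleftrightarrow>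
     (\<forall>t\<in>{0..T}. X t \<in> borel_measurable M) \<and>
     (\<forall>\<omega>\<in>space M. continuous_on {0..T} (\<lambda>t. X t \<omega>))"

definition filtration_on :: "'a measure \<Rightarrow> real \<Rightarrow> (real \<Rightarrow> 'a measure) \<Rightarrow> bool" where
  "filtration_on M T F \<longleftrightarrow>
     (\<forall>t\<in>{0..T}. subalgebra M (F t)) \<and>
     (\<forall>s\<in>{0..T}. \<forall>t\<in>{0..T}. s \<le> t \<longrightarrow> sets (F s) \<subseteq> sets (F t))"

definition adapted :: "real \<Rightarrow> (real \<Rightarrow> 'a measure) \<Rightarrow> (real \<Rightarrow> 'a \<Rightarrow> real) \<Rightarrow> bool" where
  "adapted T F X \<longleftrightarrow> (\<forall>t\<in>{0..T}. X t \<in> borel_measurable (F t))"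

text \<open>The natural filtration is not augmented by null sets.\<close>

definition natural_filtration :: "'a measure \<Rightarrow> (real \<Rightarrow> 'a \<Rightarrow> real) \<Rightarrow> real \<Rightarrow> 'a measure" where
  "natural_filtration M X t =
     sigma (space M) (\<Union>s\<in>{0..t}. {X s -` A \<inter> space M | A. A \<in> sets borel})"

section \<open>Conditional full support\<close>

text \<open>\<open>C([u,v], I)\<close> with the uniform metric. Its elements are \<^const>\<open>extensional\<close> functions, i.e.
  equal to \<^const>\<open>undefined\<close> outside \<^term>\<open>{u..v}\<close>.\<close>

definition path_space :: "real \<Rightarrow> real \<Rightarrow> real set \<Rightarrow> (real \<Rightarrow> real) metric" where
  "path_space u v I = cfunspace (top_of_set {u..v}) (submetric euclidean_metric I)"

lemma mspace_path_space:
  "mspace (path_space u v I) = {f \<in> extensional {u..v}. continuous_on {u..v} f \<and> f ` {u..v} \<subseteq> I}"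
proof -
  interpret S: Submetric "UNIV :: real set" dist I
    by unfold_locales auto
  have top: "mtopology_of (submetric euclidean_metric I) = top_of_set I"
    by (simp add: mtopology_of_submetric)
  have "Metric_space.mbounded I dist (f ` {u..v})"
    if "continuous_on {u..v} f" "f ` {u..v} \<subseteq> I" for f :: "real \<Rightarrow> real"
  proof -
    have "bounded (f ` {u..v})"
      using that by (intro compact_imp_bounded compact_continuous_image) auto
    with that show ?thesis
      by (simp add: S.mbounded_submetric)
  qed
  then show ?thesis
    by (auto simp: path_space_def top)
qed

definition paths_from :: "real \<Rightarrow> real \<Rightarrow> real set \<Rightarrow> real \<Rightarrow> (real \<Rightarrow> real) set" where
  "paths_from u v I x = {f \<in> mspace (path_space u v I). f u = x}"

definition borel_of :: "'b topology \<Rightarrow> 'b measure" where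
  "borel_of X = sigma (topspace X) {U. openin X U}"

text \<open>The minimal closed set of measure one. It exists for every Borel probability measure on a
  separable metric space; otherwise \<open>LEAST\<close> may be unspecified.\<close>

definition support :: "'b topology \<Rightarrow> 'b measure \<Rightarrow> 'b set" where
  "support X \<mu> = (LEAST S. closedin X S \<and> emeasure \<mu> S = 1)"

definition regular_conditional_law ::
  "'a measure \<Rightarrow> 'a measure \<Rightarrow> 'b measure \<Rightarrow> ('a \<Rightarrow> 'b) \<Rightarrow> ('a \<Rightarrow> 'b measure) \<Rightarrow> bool" where
  "regular_conditional_law M F N Y \<kappa> \<longleftrightarrow>
     subalgebra M F \<and> Y \<in> M \<rightarrow>\<^sub>M N \<and> \<kappa> \<in> F \<rightarrow>\<^sub>M prob_algebra N \<and>
     (\<forall>A\<in>sets N. AE \<omega> in M.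
        real_cond_exp M F (indicator (Y -` A \<inter> space M)) \<omega> = measure (\<kappa> \<omega>) A)"

text \<open>A regular conditional law on \<open>C([t,T], I)\<close> given \<open>F t\<close> is unique up to almost sure equality, so
  asking for one version with the support property is the same as asking it of all versions.\<close>

definition conditional_full_support ::
  "'a measure \<Rightarrow> real \<Rightarrow> (real \<Rightarrow> 'a measure) \<Rightarrow> real set \<Rightarrow> (real \<Rightarrow> 'a \<Rightarrow> real) \<Rightarrow> bool" where
  "conditional_full_support M T F I X \<longleftrightarrow>
     adapted T F X \<and>
     (\<forall>t\<in>{0..<T}.
        let C = mtopology_of (path_space t T I) in
        \<exists>\<kappa>. regular_conditional_law M (F t) (borel_of C) (\<lambda>\<omega>. \<lambda>u\<in>{t..T}. X u \<omega>) \<kappa> \<and>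
            (AE \<omega> in M. support C (\<kappa> \<omega>) = paths_from t T I (X t \<omega>)))"

section \<open>Brownian motion and the Ito integral\<close>

definition brownian_motion_wrt ::
  "'a measure \<Rightarrow> real \<Rightarrow> (real \<Rightarrow> 'a measure) \<Rightarrow> (real \<Rightarrow> 'a \<Rightarrow> real) \<Rightarrow> bool" where
  "brownian_motion_wrt M T G W \<longleftrightarrow>
     continuous_process M T W \<and> adapted T G W \<and>
     (AE \<omega> in M. W 0 \<omega> = 0) \<and>
     (\<forall>s t. 0 \<le> s \<and> s < t \<and> t \<le> T \<longrightarrow>
        distributed M lborel (\<lambda>\<omega>. W t \<omega> - W s \<omega>) (normal_density 0 (sqrt (t - s))) \<and>
        prob_space.indep_set M (sets (G s))
          (sets (vimage_algebra (space M) (\<lambda>\<omega>. W t \<omega> - W s \<omega>) borel)))"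

definition brownian_motion :: "'a measure \<Rightarrow> real \<Rightarrow> (real \<Rightarrow> 'a \<Rightarrow> real) \<Rightarrow> bool" where
  "brownian_motion M T W \<longleftrightarrow> brownian_motion_wrt M T (natural_filtration M W) W"

text \<open>Elementary integrands \<open>\<Sum>i<n. \<xi> i * indicator {\<tau> i<..\<tau> (Suc i)}\<close> with deterministic partition
  points \<open>0 = \<tau> 0 < \<dots> < \<tau> n = T\<close> and bounded \<open>G (\<tau> i)\<close>-measurable \<open>\<xi> i\<close>.\<close>

definition elementary_data ::
  "'a measure \<Rightarrow> real \<Rightarrow> (real \<Rightarrow> 'a measure) \<Rightarrow> nat \<Rightarrow> (nat \<Rightarrow> real) \<Rightarrow> (nat \<Rightarrow> 'a \<Rightarrow> real) \<Rightarrow> bool" where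
  "elementary_data M T G n \<tau> \<xi> \<longleftrightarrow>
     \<tau> 0 = 0 \<and> \<tau> n = T \<and> (\<forall>i<n. \<tau> i < \<tau> (Suc i)) \<and>
     (\<forall>i<n. \<xi> i \<in> borel_measurable (G (\<tau> i)) \<and> (\<exists>c. \<forall>\<omega>\<in>space M. \<bar>\<xi> i \<omega>\<bar> \<le> c))"

definition elementary_process ::
  "nat \<Rightarrow> (nat \<Rightarrow> real) \<Rightarrow> (nat \<Rightarrow> 'a \<Rightarrow> real) \<Rightarrow> real \<Rightarrow> 'a \<Rightarrow> real" where
  "elementary_process n \<tau> \<xi> t \<omega> = (\<Sum>i<n. \<xi> i \<omega> * indicator {\<tau> i<..\<tau> (Suc i)} t)"

definition elementary_integral ::
  "(real \<Rightarrow> 'a \<Rightarrow> real) \<Rightarrow> nat \<Rightarrow> (nat \<Rightarrow> real) \<Rightarrow> (nat \<Rightarrow> 'a \<Rightarrow> real) \<Rightarrow> real \<Rightarrow> 'a \<Rightarrow> real" where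
  "elementary_integral W n \<tau> \<xi> t \<omega> =
     (\<Sum>i<n. \<xi> i \<omega> * (W (min (\<tau> (Suc i)) t) \<omega> - W (min (\<tau> i) t) \<omega>))"

definition tends_to_0_in_probability :: "'a measure \<Rightarrow> (nat \<Rightarrow> 'a \<Rightarrow> ennreal) \<Rightarrow> bool" where
  "tends_to_0_in_probability M f \<longleftrightarrow>
     (\<forall>m. f m \<in> borel_measurable M) \<and>
     (\<forall>\<epsilon>>0. (\<lambda>m. measure M {\<omega> \<in> space M. f m \<omega> > ennreal \<epsilon>}) \<longlonglongrightarrow> 0)"

text \<open>\<open>J\<close> is a continuous version of \<open>t \<mapsto> \<integral>\<^sub>0\<^sup>t k dW\<close>. For integrands that are only locally square
  integrable in time almost surely, the integral is the limit, uniformly in time in probability, of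
  the integrals of elementary processes approximating \<open>k\<close> in \<open>L\<^sup>2([0,T])\<close> in probability. The limit
  does not depend on the approximating sequence, and it determines \<open>J\<close> up to indistinguishability.
  The approximation only sees \<open>k\<close> up to \<open>dt \<otimes> dP\<close>-null sets, so a jointly measurable adapted
  \<open>k\<close> need not itself be progressively measurable.\<close>

definition ito_integral ::
  "'a measure \<Rightarrow> real \<Rightarrow> (real \<Rightarrow> 'a measure) \<Rightarrow> (real \<Rightarrow> 'a \<Rightarrow> real) \<Rightarrow> (real \<Rightarrow> 'a \<Rightarrow> real) \<Rightarrow>
     (real \<Rightarrow> 'a \<Rightarrow> real) \<Rightarrow> bool" where
  "ito_integral M T G W k J \<longleftrightarrow>
     continuous_process M T J \<and>
     (\<exists>n \<tau> \<xi>.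
        (\<forall>m. elementary_data M T G (n m) (\<tau> m) (\<xi> m)) \<and>
        tends_to_0_in_probability M
          (\<lambda>m \<omega>. \<integral>\<^sup>+s\<in>{0..T}. ennreal ((elementary_process (n m) (\<tau> m) (\<xi> m) s \<omega> - k s \<omega>)\<^sup>2) \<partial>lborel) \<and>
        tends_to_0_in_probability M
          (\<lambda>m \<omega>. SUP t\<in>{0..T}. ennreal \<bar>elementary_integral W (n m) (\<tau> m) (\<xi> m) t \<omega> - J t \<omega>\<bar>))"

end

theory Submission
  imports Defs
begin

text \<open>The support of the conditional law is determined by the conditional probabilities of tubes around
  countably many polynomials, so it suffices to show that \<open>Z\<close> enters the tube around a polynomial
  after time \<open>t\<close> with positive probability on every event of positive probability from the past up
  to \<open>t\<close>. By countability, \<open>Z\<close> enters some tube of half the width; it remains to move it to the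
  prescribed one. Let \<open>q\<close> be the derivative of the difference of the two polynomials. As \<open>k\<close> does not
  vanish, \<open>\<integral> k h\<close> is uniformly close to \<open>\<integral> q\<close> for an elementary process \<open>h\<close> which vanishes up to \<open>t\<close>
  and samples a bounded truncation of \<open>q / k\<close>. Since \<open>h\<close> is a function of \<open>k\<close> and \<open>W\<close> is
  independent of \<open>(H, k)\<close>, Girsanov's theorem says that under an absolutely continuous change of
  measure \<open>Z - \<integral> k h\<close> has the law of \<open>Z\<close>, jointly with \<open>\<integral> k h\<close>. No small ball estimate is needed.

  The integrands that approximate \<open>k\<close> in the definition of the Ito integral are only adapted
  to \<open>G\<close> and may depend on \<open>W\<close>. They are replaced by step functions whose heights are values
  of \<open>k\<close> at the left end points: these are adapted and at the same time independent of \<open>W\<close>.\<close>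

section \<open>Path space\<close>

text \<open>Once \<open>(H, k)\<close> is frozen, every drift in question is deterministic.
  Girsanov's theorem then reduces to translating finitely many independent Gaussian increments, and
  the total mass of the density comes from that of the normal law. The price is that the integral of
  \<open>k h\<close> stays random: it is close to the wanted primitive only on an event of
  probability near one. This event must survive the change of measure, so laws are compared for the
  pair of \<open>Z\<close> and the drift, whose second component is the same on both sides. The past
  survives because \<open>h\<close> vanishes up to \<open>t\<close>, so the original and the
  translated path agree there. The truncation of \<open>q / k\<close> is forced by the fact that
  \<open>1 / k\<close> may fail to be integrable although \<open>k\<close> is almost nowhere zero.
  Tubes constrain increments after \<open>t\<close> instead of values, so one countable family
  serves all starting points and one null set collects all exceptions. The conclusion rests on
  absolute continuity: positive mass under the density forces positive probability under the
  original measure.\<close>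

definition rat_poly :: "rat list \<Rightarrow> real \<Rightarrow> real" where
  "rat_poly cs x = (\<Sum>i<length cs. of_rat (cs ! i) * x ^ i)"

definition rat_poly_deriv :: "rat list \<Rightarrow> real \<Rightarrow> real" where
  "rat_poly_deriv cs x = (\<Sum>i<length cs. of_rat (cs ! i) * (real i * x ^ (i - 1)))"

lemma rat_poly_has_derivative:
  "(rat_poly cs has_real_derivative rat_poly_deriv cs x) (at x within A)"
  unfolding rat_poly_def[abs_def] rat_poly_deriv_def
  by (auto intro!: derivative_eq_intros sum.cong simp: mult_ac)

lemma continuous_on_rat_poly: "continuous_on A (rat_poly cs)"
  unfolding rat_poly_def[abs_def] by (intro continuous_intros)

lemma continuous_on_rat_poly_deriv: "continuous_on A (rat_poly_deriv cs)"
  unfolding rat_poly_deriv_def[abs_def] by (intro continuous_intros)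

text \<open>Stone-Weierstrass, followed by rounding the coefficients to rationals. The gain is
  countability: exceptional null sets attached to single polynomials may be united.\<close>

lemma rat_poly_dense:
  fixes f :: "real \<Rightarrow> real"
  assumes f: "continuous_on {a..b} f" and e: "e > 0"
  shows "\<exists>cs. \<forall>u\<in>{a..b}. \<bar>f u - rat_poly cs u\<bar> < e"
proof -
  obtain g where g: "real_polynomial_function g" "\<And>u. u \<in> {a..b} \<Longrightarrow> \<bar>f u - g u\<bar> < e / 2"
    using Stone_Weierstrass_real_polynomial_function[OF _ f, of "e/2"] e by auto
  obtain c n where c: "g = (\<lambda>x. \<Sum>i\<le>n. c i * x ^ i)"
    using g(1) real_polynomial_function_iff_sum by blast
  \<comment> \<open>\<open>R\<close> bounds \<open>\<bar>u\<bar>\<close>, and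
    \<open>R \<ge> 1\<close> makes \<open>R ^ n\<close> dominate all lower powers;
    \<open>\<delta>\<close> is such that the \<open>Suc n\<close> rounding errors add up to
    \<open>e / 2\<close>.\<close>
  define R where "R = max 1 (max \<bar>a\<bar> \<bar>b\<bar>)"
  define \<delta> where "\<delta> = e / (2 * real (Suc n) * R ^ n)"
  have R: "R \<ge> 1" by (simp add: R_def)
  then have \<delta>: "\<delta> > 0" using e by (simp add: \<delta>_def)
  have "\<exists>r. \<bar>c i - of_rat r\<bar> < \<delta>" for i
  proof -
    obtain q where "q \<in> \<rat>" "c i < q" "q < c i + \<delta>"
      using Rats_dense_in_real[of "c i" "c i + \<delta>"] \<delta> by auto
    then obtain r where "c i < of_rat r" "of_rat r < c i + \<delta>" by (auto elim!: Rats_cases)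
    then show ?thesis by (intro exI[of _ r]) auto
  qed
  then obtain r where r: "\<bar>c i - of_rat (r i)\<bar> < \<delta>" for i by metis
  define cs where "cs = map r [0..<Suc n]"
  have rp: "rat_poly cs u = (\<Sum>i\<le>n. of_rat (r i) * u ^ i)" for u
    unfolding rat_poly_def lessThan_Suc_atMost[symmetric] by (rule sum.cong) (auto simp: cs_def simp del: upt_Suc)
  have "\<bar>f u - rat_poly cs u\<bar> < e" if u: "u \<in> {a..b}" for u
  proof -
    have uR: "\<bar>u\<bar> \<le> R" using u by (auto simp: R_def)
    have "\<bar>g u - rat_poly cs u\<bar> = \<bar>\<Sum>i\<le>n. (c i - of_rat (r i)) * u ^ i\<bar>"
      by (simp add: c rp sum_subtractf algebra_simps)
    also have "\<dots> \<le> (\<Sum>i\<le>n. \<bar>(c i - of_rat (r i)) * u ^ i\<bar>)" by (rule sum_abs)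
    also have "\<dots> \<le> (\<Sum>i\<le>n. \<delta> * R ^ n)"
    proof (rule sum_mono)
      fix i assume "i \<in> {..n}"
      have "\<bar>u\<bar> ^ i \<le> R ^ i" using uR by (intro power_mono) auto
      also have "\<dots> \<le> R ^ n" using R \<open>i \<in> {..n}\<close> by (intro power_increasing) auto
      finally show "\<bar>(c i - of_rat (r i)) * u ^ i\<bar> \<le> \<delta> * R ^ n"
        unfolding abs_mult power_abs using r[of i] \<delta> by (intro mult_mono) auto
    qed
    also have "\<dots> = real (Suc n) * (\<delta> * R ^ n)" by simp
    also have "\<dots> = e / 2"
    proof -
      have "real (Suc n) \<noteq> 0" "R ^ n \<noteq> 0" using R by auto
      then show ?thesis unfolding \<delta>_def by (simp del: of_nat_Suc)
    qed
    finally show ?thesis using g(2)[OF u] by linarith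
  qed
  then show ?thesis by blast
qed

text \<open>Clamping lets the whole type \<open>rat\<close> enumerate a countable dense set of times
  containing both end points. Quantifiers over these times carry no side condition and preserve
  measurability.\<close>

definition rat_time :: "real \<Rightarrow> real \<Rightarrow> rat \<Rightarrow> real" where
  "rat_time u v r = max u (min v (of_rat r))"

lemma rat_time_in: "u \<le> v \<Longrightarrow> rat_time u v r \<in> {u..v}"
  by (auto simp: rat_time_def)

lemma closure_rat_time:
  assumes "u \<le> v"
  shows "closure (range (rat_time u v)) = {u..v}"
proof
  show "closure (range (rat_time u v)) \<subseteq> {u..v}"
    using assms by (intro closure_minimal) (auto simp: rat_time_def)
  show "{u..v} \<subseteq> closure (range (rat_time u v))"
  proof (safe intro!: closure_approachable[THEN iffD2])
    fix x e :: real assume x: "x \<in> {u..v}" and e: "e > 0"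
    obtain q where "q \<in> \<rat>" "x < q" "q < x + e"
      using Rats_dense_in_real[of x "x+e"] e by auto
    then obtain r where r: "x < of_rat r" "of_rat r < x + e" by (auto elim!: Rats_cases)
    then have "dist (rat_time u v r) x < e"
      using x by (auto simp: rat_time_def dist_real_def max_def min_def)
    then show "\<exists>y\<in>range (rat_time u v). dist y x < e" by blast
  qed
qed

lemma le_on_Icc_if_le_rat_time:
  fixes f g :: "real \<Rightarrow> real"
  assumes "u \<le> v" "continuous_on {u..v} f" "continuous_on {u..v} g"
    and "\<And>r. f (rat_time u v r) \<le> g (rat_time u v r)" and "x \<in> {u..v}"
  shows "f x \<le> g x"
  using continuous_ge_on_closure[of "range (rat_time u v)" "\<lambda>x. g x - f x" x 0] assms
  by (auto simp: closure_rat_time continuous_on_diff)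

section \<open>Borel sets of the uniform topology\<close>

abbreviation path_topology :: "real \<Rightarrow> real \<Rightarrow> (real \<Rightarrow> real) topology" where
  "path_topology u v \<equiv> mtopology_of (path_space u v UNIV)"

lemma mspace_path_space_UNIV:
  "mspace (path_space u v UNIV) = {f \<in> extensional {u..v}. continuous_on {u..v} f}"
  by (simp add: mspace_path_space)

lemma topspace_path_topology [simp]: "topspace (path_topology u v) = mspace (path_space u v UNIV)"
  by (simp add: mtopology_of_def Metric_space.topspace_mtopology)

lemma space_borel_of_path [simp]: "space (borel_of (path_topology u v)) = mspace (path_space u v UNIV)"
  and sets_borel_of_path: "sets (borel_of (path_topology u v)) =
    sigma_sets (mspace (path_space u v UNIV)) {U. openin (path_topology u v) U}"
proof -
  have "{U. openin (path_topology u v) U} \<subseteq> Pow (topspace (path_topology u v))"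
    using openin_subset by blast
  then show "space (borel_of (path_topology u v)) = mspace (path_space u v UNIV)"
    and "sets (borel_of (path_topology u v)) =
      sigma_sets (mspace (path_space u v UNIV)) {U. openin (path_topology u v) U}"
    by (simp_all add: borel_of_def)
qed

lemma mdist_path_space_le_iff:
  assumes "f \<in> mspace (path_space u v UNIV)" "g \<in> mspace (path_space u v UNIV)" "u \<le> v"
  shows "mdist (path_space u v UNIV) f g \<le> a \<longleftrightarrow> (\<forall>x\<in>{u..v}. \<bar>f x - g x\<bar> \<le> a)"
  using assms unfolding path_space_def by (subst cfunspace_mdist_le) (auto simp: dist_real_def)

lemma openin_path_topology:
  "openin (path_topology u v) U \<longleftrightarrow> U \<subseteq> mspace (path_space u v UNIV) \<and>
    (\<forall>f\<in>U. \<exists>e>0. \<forall>g\<in>mspace (path_space u v UNIV). mdist (path_space u v UNIV) f g < e \<longrightarrow> g \<in> U)"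
proof -
  interpret P: Metric_space "mspace (path_space u v UNIV)" "mdist (path_space u v UNIV)" by simp
  show ?thesis
    unfolding mtopology_of_def P.openin_mtopology subset_iff P.in_mball by blast
qed

lemma openin_path_topology_le:
  assumes "openin (path_topology u v) U" "f \<in> U" "u \<le> v"
  obtains e where "e > 0" "\<And>g. g \<in> mspace (path_space u v UNIV) \<Longrightarrow> \<forall>x\<in>{u..v}. \<bar>f x - g x\<bar> \<le> e \<Longrightarrow> g \<in> U"
proof -
  obtain e where e: "e > 0" "\<forall>g\<in>mspace (path_space u v UNIV). mdist (path_space u v UNIV) f g < e \<longrightarrow> g \<in> U"
    and f: "f \<in> mspace (path_space u v UNIV)"
    using assms unfolding openin_path_topology by blast
  show thesis
  proof (rule that[of "e/2"])
    fix g assume g: "g \<in> mspace (path_space u v UNIV)" "\<forall>x\<in>{u..v}. \<bar>f x - g x\<bar> \<le> e/2"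
    then have "mdist (path_space u v UNIV) f g \<le> e/2" using mdist_path_space_le_iff[OF f] assms by blast
    then show "g \<in> U" using e g by auto
  qed (use e in simp)
qed

lemma measurable_path_eval:
  assumes "x \<in> {u..v}"
  shows "(\<lambda>f. f x) \<in> borel_measurable (borel_of (path_topology u v))"
proof (rule borel_measurableI)
  fix S :: "real set" assume S: "open S"
  have uv: "u \<le> v" using assms by auto
  have "openin (path_topology u v) ((\<lambda>f. f x) -` S \<inter> mspace (path_space u v UNIV))"
    unfolding openin_path_topology
  proof (intro conjI ballI)
    fix f assume f: "f \<in> (\<lambda>f. f x) -` S \<inter> mspace (path_space u v UNIV)"
    then obtain e where e: "e > 0" "\<And>y. dist y (f x) < e \<Longrightarrow> y \<in> S"
      using S by (force simp: open_dist)
    show "\<exists>e>0. \<forall>g\<in>mspace (path_space u v UNIV). mdist (path_space u v UNIV) f g < e \<longrightarrow>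
         g \<in> (\<lambda>f. f x) -` S \<inter> mspace (path_space u v UNIV)"
    proof (intro exI conjI ballI impI)
      fix g assume g: "g \<in> mspace (path_space u v UNIV)" "mdist (path_space u v UNIV) f g < e"
      then have "\<bar>f x - g x\<bar> \<le> mdist (path_space u v UNIV) f g"
        using mdist_path_space_le_iff[of f u v g] f uv assms by blast
      then show "g \<in> (\<lambda>f. f x) -` S \<inter> mspace (path_space u v UNIV)"
        using g e by (auto simp: dist_real_def)
    qed (use e in simp)
  qed auto
  then show "(\<lambda>f. f x) -` S \<inter> space (borel_of (path_topology u v)) \<in> sets (borel_of (path_topology u v))"
    by (simp add: sets_borel_of_path)
qed

text \<open>Separability makes evaluations generate the Borel sets: an open set is the union of the
  closed tubes of rational data that it contains, these are countably many, and by continuity each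
  is cut out by evaluations at the times \<open>rat_time\<close>.\<close>

lemma measurable_into_path_space:
  assumes uv: "u \<le> v"
    and Y: "\<And>\<omega>. \<omega> \<in> space M \<Longrightarrow> Y \<omega> \<in> mspace (path_space u v UNIV)"
    and ev[measurable]: "\<And>r. (\<lambda>\<omega>. Y \<omega> (rat_time u v r)) \<in> borel_measurable M"
  shows "Y \<in> M \<rightarrow>\<^sub>M borel_of (path_topology u v)"
proof (rule measurable_sigma_sets[OF sets_borel_of_path])
  show "{U. openin (path_topology u v) U} \<subseteq> Pow (mspace (path_space u v UNIV))"
    using openin_subset by fastforce
  show "Y \<in> space M \<rightarrow> mspace (path_space u v UNIV)" using Y by auto
  fix U assume "U \<in> {U. openin (path_topology u v) U}"
  then have U: "openin (path_topology u v) U" by simp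
  define A where "A cs e = {f \<in> mspace (path_space u v UNIV). \<forall>x\<in>{u..v}. \<bar>f x - rat_poly cs x\<bar> \<le> of_rat e}" for cs e
  have "U = (\<Union>(cs, e)\<in>{(cs, e). A cs e \<subseteq> U}. A cs e)"
  proof (intro equalityI subsetI)
    fix f assume f: "f \<in> U"
    then have fs: "f \<in> mspace (path_space u v UNIV)" using openin_subset[OF U] by auto
    obtain e where e: "e > 0" "\<And>g. g \<in> mspace (path_space u v UNIV) \<Longrightarrow> \<forall>x\<in>{u..v}. \<bar>f x - g x\<bar> \<le> e \<Longrightarrow> g \<in> U"
      using openin_path_topology_le[OF U f uv] by blast
    \<comment> \<open>Half of \<open>e\<close>, since two paths in one tube may be two widths
      apart.\<close>
    obtain q where "q \<in> \<rat>" "0 < q" "q < e/2" using Rats_dense_in_real[of 0 "e/2"] e by auto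
    then obtain r where r: "(0::real) < of_rat r" "of_rat r < e / 2" by (auto elim!: Rats_cases)
    obtain cs where cs: "\<forall>x\<in>{u..v}. \<bar>f x - rat_poly cs x\<bar> < of_rat r"
      using rat_poly_dense[of u v f "of_rat r"] fs r by (auto simp: mspace_path_space_UNIV)
    have "A cs r \<subseteq> U"
    proof
      fix g assume g: "g \<in> A cs r"
      have "\<bar>f x - g x\<bar> \<le> e" if "x \<in> {u..v}" for x
      proof -
        have "\<bar>g x - rat_poly cs x\<bar> \<le> of_rat r" "\<bar>f x - rat_poly cs x\<bar> < of_rat r"
          using g cs that by (auto simp: A_def)
        then show ?thesis using r(2) by linarith
      qed
      then show "g \<in> U" using e(2) g by (auto simp: A_def)
    qed
    moreover have "f \<in> A cs r" using fs cs by (auto simp: A_def less_imp_le)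
    ultimately show "f \<in> (\<Union>(cs, e)\<in>{(cs, e). A cs e \<subseteq> U}. A cs e)" by auto
  qed auto
  moreover have "Y -` A cs e \<inter> space M = {\<omega> \<in> space M. \<forall>r. \<bar>Y \<omega> (rat_time u v r) - rat_poly cs (rat_time u v r)\<bar> \<le> of_rat e}" for cs e
  proof (intro equalityI subsetI)
    fix \<omega> assume "\<omega> \<in> {\<omega> \<in> space M. \<forall>r. \<bar>Y \<omega> (rat_time u v r) - rat_poly cs (rat_time u v r)\<bar> \<le> of_rat e}"
    then have \<omega>: "\<omega> \<in> space M" "\<And>r. \<bar>Y \<omega> (rat_time u v r) - rat_poly cs (rat_time u v r)\<bar> \<le> of_rat e" by auto
    have "\<bar>Y \<omega> x - rat_poly cs x\<bar> \<le> of_rat e" if "x \<in> {u..v}" for x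
      by (rule le_on_Icc_if_le_rat_time[where f="\<lambda>x. \<bar>Y \<omega> x - rat_poly cs x\<bar>" and g="\<lambda>_. of_rat e", OF uv _ _ \<omega>(2) that])
         (use Y[OF \<omega>(1)] in \<open>auto simp: mspace_path_space_UNIV intro!: continuous_intros continuous_on_rat_poly\<close>)
    then show "\<omega> \<in> Y -` A cs e \<inter> space M" using \<omega> Y by (auto simp: A_def)
  qed (use rat_time_in[OF uv] in \<open>auto simp: A_def\<close>)
  then have "Y -` A cs e \<inter> space M \<in> sets M" for cs e by simp
  then have "(\<Union>p\<in>{(cs, e). A cs e \<subseteq> U}. Y -` (case p of (cs, e) \<Rightarrow> A cs e) \<inter> space M) \<in> sets M"
    by (intro sets.countable_UN') auto
  moreover have "Y -` U \<inter> space M = (\<Union>p\<in>{(cs, e). A cs e \<subseteq> U}. Y -` (case p of (cs, e) \<Rightarrow> A cs e) \<inter> space M)"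
    by (subst \<open>U = _\<close>) auto
  ultimately show "Y -` U \<inter> space M \<in> sets M" by simp
qed

section \<open>Regular conditional laws\<close>

text \<open>\<open>c\<close> stands for a conditional distribution function that is known at
  rationals only and may fail to be right continuous. The infimum over strictly larger rationals is
  its right-continuous regularisation; the last claim recovers it as a limit from above, which is
  how the kernel is identified later.\<close>

lemma interval_measure_INF_Rats:
  fixes c :: "rat \<Rightarrow> real"
  assumes mono: "\<And>r s. r \<le> s \<Longrightarrow> c r \<le> c s"
    and c0: "\<And>r. r < 0 \<Longrightarrow> c r = 0" and c1: "\<And>r. r \<ge> 1 \<Longrightarrow> c r = 1"
  defines "G \<equiv> \<lambda>x. INF r\<in>{r. x < of_rat r}. c r"
  shows "real_distribution (interval_measure G)" and "cdf (interval_measure G) = G"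
    and "(\<And>n. x < of_rat (r n)) \<Longrightarrow> (\<lambda>n. of_rat (r n)) \<longlonglongrightarrow> x \<Longrightarrow> (\<lambda>n. c (r n)) \<longlonglongrightarrow> G x"
proof -
  have nonneg: "c r \<ge> 0" for r
    using mono[of "min r (-1)" r] c0[of "min r (-1)"] by simp
  have bdd: "bdd_below (c ` A)" for A
    using nonneg by (intro bdd_belowI[of _ 0]) auto
  have le: "G x \<le> c r" if "x < of_rat r" for x r
    unfolding G_def using that bdd by (intro cINF_lower) auto
  have ne: "{r::rat. x < of_rat r} \<noteq> {}" for x :: real
  proof -
    obtain q where "q \<in> \<rat>" "x < q" using Rats_dense_in_real[of x "x+1"] by auto
    then show ?thesis by (auto elim!: Rats_cases)
  qed
  have G_mono: "G x \<le> G y" if "x \<le> y" for x y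
    unfolding G_def using that ne bdd by (intro cINF_superset_mono) auto
  have close: "\<exists>r. x < of_rat r \<and> c r < G x + e" if "e > 0" for x e
  proof (rule ccontr)
    assume "\<not> ?thesis"
    then have "G x + e \<le> c r" if "x < of_rat r" for r using that by force
    then have "G x + e \<le> (INF r\<in>{r. x < of_rat r}. c r)"
      using ne[of x] by (intro cINF_greatest) auto
    then have "G x + e \<le> G x" by (simp add: G_def)
    with that show False by simp
  qed
  have rc: "continuous (at_right a) G" for a
    unfolding continuous_within
  proof (rule order_tendstoI)
    fix l assume "l < G a"
    then show "\<forall>\<^sub>F x in at_right a. l < G x"
      unfolding eventually_at_filter
      by (intro always_eventually allI impI) (metis G_mono greaterThan_iff less_eq_real_def less_le_trans)
  next
    fix u assume "G a < u"
    then obtain r where r: "a < of_rat r" "c r < u" using close[of "u - G a" a] by auto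
    have "\<forall>\<^sub>F x in at_right a. x < of_rat r"
      using r(1) by (auto simp: eventually_at_right)
    then show "\<forall>\<^sub>F x in at_right a. G x < u"
    proof eventually_elim
      case (elim x)
      then show ?case using le[of x r] r(2) by linarith
    qed
  qed
  have G0: "G x = 0" if neg: "x < 0" for x
  proof -
    obtain q where "q \<in> \<rat>" "x < q" "q < 0" using Rats_dense_in_real[OF neg] by auto
    then obtain r :: rat where "x < of_rat r" "r < 0" by (auto elim!: Rats_cases)
    then have "G x \<le> 0" using le[of x r] c0 by simp
    moreover have "0 \<le> G x" unfolding G_def using ne nonneg by (intro cINF_greatest) auto
    ultimately show ?thesis by simp
  qed
  have G1: "G x = 1" if "x \<ge> 1" for x
  proof -
    have "c r = 1" if "x < of_rat r" for r
    proof -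
      have "(1::real) < of_rat r" using that \<open>x \<ge> 1\<close> by linarith
      then have "1 < r" by simp
      then show ?thesis using c1[of r] by simp
    qed
    then have "G x = (INF r\<in>{r::rat. x < of_rat r}. 1)"
      unfolding G_def by (intro INF_cong) auto
    with ne show ?thesis by simp
  qed
  have bot: "(G \<longlongrightarrow> 0) at_bot"
    by (rule tendsto_eventually) (use G0 eventually_at_bot_dense[of "\<lambda>x. G x = 0"] in auto)
  have top: "(G \<longlongrightarrow> 1) at_top"
    by (rule tendsto_eventually) (use G1 eventually_at_top_linorder[of "\<lambda>x. G x = 1"] in auto)
  show "real_distribution (interval_measure G)"
    by (rule real_distribution_interval_measure[OF G_mono rc bot top])
  show "cdf (interval_measure G) = G"
    by (rule cdf_interval_measure[OF G_mono rc bot])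
  assume r: "\<And>n. x < of_rat (r n)" and lim: "(\<lambda>n. of_rat (r n)) \<longlonglongrightarrow> x"
  show "(\<lambda>n. c (r n)) \<longlonglongrightarrow> G x"
  proof (rule order_tendstoI)
    fix l assume "l < G x"
    then show "\<forall>\<^sub>F n in sequentially. l < c (r n)"
      using le[OF r] by (intro always_eventually) (auto intro: less_le_trans)
  next
    fix u assume "G x < u"
    then obtain s where s: "x < of_rat s" "c s < u" using close[of "u - G x" x] by auto
    have "\<forall>\<^sub>F n in sequentially. of_rat (r n) < (of_rat s :: real)"
      using lim s(1) by (rule order_tendstoD)
    then show "\<forall>\<^sub>F n in sequentially. c (r n) < u"
    proof eventually_elim
      case (elim n)
      then have "r n \<le> s" by (simp add: of_rat_less less_imp_le)
      then show ?case using mono[of "r n" s] s(2) by linarith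
    qed
  qed
qed

section \<open>Disintegration on the real line\<close>

lemma (in prob_space) regular_conditional_law_charact:
  assumes sub: "subalgebra M F" and Y: "Y \<in> M \<rightarrow>\<^sub>M N" and \<kappa>: "\<kappa> \<in> F \<rightarrow>\<^sub>M prob_algebra N"
    and eq: "\<And>A B. A \<in> sets N \<Longrightarrow> B \<in> sets F \<Longrightarrow>
      (\<integral>\<omega>\<in>B. measure (\<kappa> \<omega>) A \<partial>M) = prob (B \<inter> (Y -` A \<inter> space M))"
  shows "regular_conditional_law M F N Y \<kappa>"
  unfolding regular_conditional_law_def
proof (intro conjI ballI sub Y \<kappa>)
  interpret finite_measure_subalgebra M F
    by unfold_locales (rule sub)
  fix A assume A: "A \<in> sets N"
  have [measurable]: "Y -` A \<inter> space M \<in> sets M" using Y A by measurable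
  have m: "(\<lambda>\<omega>. measure (\<kappa> \<omega>) A) \<in> borel_measurable F"
    using \<kappa> A measurable_compose[OF measurable_prob_algebraD measurable_measure_subprob_algebra] by blast
  have m': "(\<lambda>\<omega>. measure (\<kappa> \<omega>) A) \<in> borel_measurable M"
    using m sub by (rule measurable_from_subalg[rotated])
  have le: "measure (\<kappa> \<omega>) A \<le> 1" if "\<omega> \<in> space M" for \<omega>
  proof -
    have "prob_space (\<kappa> \<omega>)" using \<kappa> that sub
      by (auto simp: subalgebra_def space_prob_algebra dest!: measurable_space)
    then show ?thesis by (rule prob_space.prob_le_1)
  qed
  show "AE \<omega> in M. real_cond_exp M F (indicator (Y -` A \<inter> space M)) \<omega> = measure (\<kappa> \<omega>) A"
  proof (rule real_cond_exp_charact)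
    show "integrable M (\<lambda>\<omega>. measure (\<kappa> \<omega>) A)"
      by (rule integrable_const_bound[of _ 1]) (use le m' in auto)
    fix B assume B: "B \<in> sets F"
    then have [measurable]: "B \<in> sets M" using sub by (auto simp: subalgebra_def)
    have "(\<integral>\<omega>\<in>B. indicator (Y -` A \<inter> space M) \<omega> \<partial>M) = (\<integral>\<omega>. indicator (B \<inter> (Y -` A \<inter> space M)) \<omega> \<partial>M)"
      unfolding set_lebesgue_integral_def by (intro Bochner_Integration.integral_cong) (auto split: split_indicator)
    also have "\<dots> = prob (B \<inter> (Y -` A \<inter> space M))" by simp
    finally show "(\<integral>\<omega>\<in>B. indicator (Y -` A \<inter> space M) \<omega> \<partial>M) = (\<integral>\<omega>\<in>B. measure (\<kappa> \<omega>) A \<partial>M)"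
      by (simp only: eq[OF A B])
  qed (use m in \<open>auto simp: integrable_indicator_iff emeasure_eq_measure\<close>)
qed

text \<open>The integrated identity has no exceptional null set, whereas the one in the definition
  depends on \<open>A\<close>; conditional laws are therefore built and exploited in this
  form.\<close>

lemma (in prob_space) regular_conditional_law_integral:
  assumes \<kappa>: "regular_conditional_law M F N Y \<kappa>" and A: "A \<in> sets N" and B: "B \<in> sets F"
  shows "(\<integral>\<omega>\<in>B. measure (\<kappa> \<omega>) A \<partial>M) = prob (B \<inter> (Y -` A \<inter> space M))"
proof -
  have sub: "subalgebra M F" using \<kappa> by (simp add: regular_conditional_law_def)
  interpret finite_measure_subalgebra M F
    by unfold_locales (rule sub)
  have [measurable]: "Y -` A \<inter> space M \<in> sets M" "B \<in> sets M"
    using \<kappa> A B sub by (auto simp: regular_conditional_law_def subalgebra_def)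
  have m: "(\<lambda>\<omega>. measure (\<kappa> \<omega>) A) \<in> borel_measurable M"
  proof (rule measurable_from_subalg[OF sub])
    have "\<kappa> \<in> F \<rightarrow>\<^sub>M prob_algebra N" using \<kappa> by (simp add: regular_conditional_law_def)
    from measurable_compose[OF measurable_prob_algebraD[OF this] measurable_measure_subprob_algebra[OF A]]
    show "(\<lambda>\<omega>. measure (\<kappa> \<omega>) A) \<in> borel_measurable F" .
  qed
  have ae: "AE \<omega> in M. real_cond_exp M F (indicator (Y -` A \<inter> space M)) \<omega> = measure (\<kappa> \<omega>) A"
    using \<kappa> A by (auto simp: regular_conditional_law_def)
  have "(\<integral>\<omega>\<in>B. measure (\<kappa> \<omega>) A \<partial>M)
      = (\<integral>\<omega>\<in>B. real_cond_exp M F (indicator (Y -` A \<inter> space M)) \<omega> \<partial>M)"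
    by (rule set_lebesgue_integral_cong_AE) (use ae m in \<open>auto intro: borel_measurable_cond_exp2\<close>)
  also have "\<dots> = (\<integral>\<omega>\<in>B. indicator (Y -` A \<inter> space M) \<omega> \<partial>M)"
    by (rule real_cond_exp_intA[symmetric]) (use B in \<open>auto simp: integrable_indicator_iff emeasure_eq_measure\<close>)
  also have "\<dots> = (\<integral>\<omega>. indicator (B \<inter> (Y -` A \<inter> space M)) \<omega> \<partial>M)"
    unfolding set_lebesgue_integral_def by (intro Bochner_Integration.integral_cong) (auto split: split_indicator)
  also have "\<dots> = prob (B \<inter> (Y -` A \<inter> space M))" by simp
  finally show ?thesis .
qed

text \<open>The classical construction: conditional distribution functions at rational points,
  corrected on a null set and regularised. Values in the unit interval turn the limits at infinity
  into exact values, 0 below 0 and 1 from 1 on.\<close>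

lemma (in prob_space) ex_regular_conditional_law_real:
  fixes Y :: "'a \<Rightarrow> real"
  assumes sub: "subalgebra M F" and Y[measurable]: "Y \<in> borel_measurable M"
    and bounds: "\<And>\<omega>. \<omega> \<in> space M \<Longrightarrow> 0 \<le> Y \<omega> \<and> Y \<omega> \<le> 1"
  shows "\<exists>\<kappa>. regular_conditional_law M F borel Y \<kappa>"
proof -
  interpret finite_measure_subalgebra M F
    by unfold_locales (rule sub)
  have spF: "space F = space M" using sub by (simp add: subalgebra_def)
  define E where "E r = Y -` {..of_rat r} \<inter> space M" for r :: rat
  have E[measurable]: "E r \<in> sets M" for r unfolding E_def by measurable
  define c where "c r = real_cond_exp M F (indicator (E r))" for r
  have c_meas[measurable]: "c r \<in> borel_measurable F" for r unfolding c_def by simp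
  \<comment> \<open>Only countably many relations are imposed, so that \<open>good\<close> is
    \<open>F\<close>-measurable and holds almost surely.\<close>
  define good where "good \<omega> \<longleftrightarrow> (\<forall>r s. r \<le> s \<longrightarrow> c r \<omega> \<le> c s \<omega>) \<and> (\<forall>r<0. c r \<omega> = 0) \<and> (\<forall>r\<ge>1. c r \<omega> = 1)" for \<omega>
  have "AE \<omega> in M. \<forall>r s. r \<le> s \<longrightarrow> c r \<omega> \<le> c s \<omega>"
    unfolding c_def AE_all_countable
  proof (intro allI AE_impI real_cond_exp_mono)
    fix r s :: rat assume "r \<le> s"
    then have "(of_rat r::real) \<le> of_rat s" by (simp only: of_rat_less_eq)
    then show "AE \<omega> in M. indicator (E r) \<omega> \<le> (indicator (E s) \<omega> :: real)"
      by (auto simp: E_def indicator_def)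
  qed (auto simp: integrable_indicator_iff emeasure_eq_measure)
  moreover have "AE \<omega> in M. \<forall>r<0. c r \<omega> = 0"
    unfolding AE_all_countable
  proof (intro allI AE_impI)
    fix r :: rat assume "r < 0"
    then have "(of_rat r::real) < 0" by simp
    then have "\<not> Y \<omega> \<le> of_rat r" if "\<omega> \<in> space M" for \<omega>
      using bounds[OF that] by linarith
    then have "E r = {}" by (auto simp: E_def)
    then show "AE \<omega> in M. c r \<omega> = 0"
      unfolding c_def using real_cond_exp_F_meas[of "indicator {}"] by simp
  qed
  moreover have "AE \<omega> in M. \<forall>r\<ge>1. c r \<omega> = 1"
    unfolding AE_all_countable
  proof (intro allI AE_impI)
    fix r :: rat assume "r \<ge> 1"
    then have "1 \<le> (of_rat r::real)" by simp
    then have "Y \<omega> \<le> of_rat r" if "\<omega> \<in> space M" for \<omega>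
      using bounds[OF that] by linarith
    then have "E r = space M" by (auto simp: E_def)
    moreover have "AE \<omega> in M. real_cond_exp M F (indicator (space M)) \<omega> = indicator (space M) \<omega>"
    proof (rule real_cond_exp_F_meas)
      show "indicator (space M) \<in> borel_measurable F"
        unfolding spF[symmetric] by simp
    qed (simp add: integrable_indicator_iff emeasure_eq_measure)
    ultimately show "AE \<omega> in M. c r \<omega> = 1"
      unfolding c_def by (auto elim!: eventually_mono[OF AE_conjI[OF _ AE_space]])
  qed
  ultimately have AE_good: "AE \<omega> in M. good \<omega>" by (auto simp: good_def)
  have good_meas[measurable]: "Measurable.pred F good" unfolding good_def by measurable
  \<comment> \<open>Where \<open>good\<close> fails, the distribution function of the unit mass at 0
    is substituted; the kernel then consists of probability measures everywhere.\<close>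
  define c' where "c' r \<omega> = (if good \<omega> then c r \<omega> else if r \<ge> 0 then 1 else 0)" for r \<omega>
  have c'_meas[measurable]: "c' r \<in> borel_measurable F" for r unfolding c'_def by measurable
  have c': "\<And>r s. r \<le> s \<Longrightarrow> c' r \<omega> \<le> c' s \<omega>" "\<And>r. r < 0 \<Longrightarrow> c' r \<omega> = 0" "\<And>r. r \<ge> 1 \<Longrightarrow> c' r \<omega> = 1" for \<omega>
    by (auto simp: c'_def good_def)
  define G where "G \<omega> x = (INF r\<in>{r. x < of_rat r}. c' r \<omega>)" for \<omega> and x :: real
  define \<kappa> where "\<kappa> \<omega> = interval_measure (G \<omega>)" for \<omega>
  have rd: "real_distribution (\<kappa> \<omega>)" and cdf: "cdf (\<kappa> \<omega>) = G \<omega>" for \<omega>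
    unfolding \<kappa>_def G_def by (rule interval_measure_INF_Rats[OF c'], assumption+)+
  have lim: "(\<And>n. x < of_rat (r n)) \<Longrightarrow> (\<lambda>n. of_rat (r n)) \<longlonglongrightarrow> x \<Longrightarrow> (\<lambda>n. c' (r n) \<omega>) \<longlonglongrightarrow> G \<omega> x" for x r \<omega>
    unfolding G_def by (rule interval_measure_INF_Rats(3)[OF c'])
  have G_meas[measurable]: "(\<lambda>\<omega>. G \<omega> x) \<in> borel_measurable F" for x
    unfolding G_def by measurable
  have \<kappa>_meas: "\<kappa> \<in> F \<rightarrow>\<^sub>M prob_algebra borel"
  proof (rule measurable_prob_algebra_generated)
    show "sets (borel::real measure) = sigma_sets UNIV (range atMost)"
      by (simp add: borel_eq_atMost)
    show "Int_stable (range (atMost :: real \<Rightarrow> _))"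
      by (rule Int_stableI) auto
    fix \<omega> show "prob_space (\<kappa> \<omega>)" "sets (\<kappa> \<omega>) = sets borel"
      using rd[of \<omega>] by (auto simp: real_distribution_def \<kappa>_def)
  next
    fix A :: "real set" assume "A \<in> range atMost"
    then obtain x where A: "A = {..x}" by auto
    have "emeasure (\<kappa> \<omega>) A = ennreal (G \<omega> x)" for \<omega>
    proof -
      interpret K: real_distribution "\<kappa> \<omega>" by (rule rd)
      show ?thesis using cdf[of \<omega>] by (simp add: A K.emeasure_eq_measure cdf_def fun_eq_iff)
    qed
    then show "(\<lambda>\<omega>. emeasure (\<kappa> \<omega>) A) \<in> borel_measurable F" by simp
  qed simp
  have "regular_conditional_law M F borel Y \<kappa>"
  proof (rule regular_conditional_law_charact[OF sub Y \<kappa>_meas])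
    fix A :: "real set" and B assume A: "A \<in> sets borel" and B: "B \<in> sets F"
    then have B'[measurable]: "B \<in> sets M" using sub by (auto simp: subalgebra_def)
    have \<kappa>_M: "\<kappa> \<in> M \<rightarrow>\<^sub>M subprob_algebra borel"
      using measurable_from_subalg[OF sub measurable_prob_algebraD[OF \<kappa>_meas]] .
    \<comment> \<open>For fixed \<open>B\<close> both sides of the identity are finite measures in
      \<open>A\<close>, so it is enough to compare their distribution functions.\<close>
    define D where "D = density M (indicator B)"
    have sD[measurable_cong, simp]: "sets D = sets M" "space D = space M" by (simp_all add: D_def)
    interpret D: finite_measure D
      unfolding D_def by (rule finite_measure_restricted) simp
    define \<nu>1 where "\<nu>1 = distr D borel Y"
    define \<nu>2 where "\<nu>2 = D \<bind> \<kappa>"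
    have \<kappa>D: "\<kappa> \<in> D \<rightarrow>\<^sub>M subprob_algebra borel"
      using \<kappa>_M by (simp cong: measurable_cong_sets)
    have e1: "emeasure \<nu>1 A = ennreal (prob (B \<inter> (Y -` A \<inter> space M)))" if "A \<in> sets borel" for A
      using that unfolding \<nu>1_def
      by (subst emeasure_distr)
         (auto simp: D_def emeasure_restricted emeasure_eq_measure Int_commute intro!: arg_cong[where f=prob])
    have k_int: "integrable M (\<lambda>\<omega>. measure (\<kappa> \<omega>) A)" if "A \<in> sets borel" for A
    proof (rule integrable_const_bound[of _ 1])
      show "AE \<omega> in M. norm (measure (\<kappa> \<omega>) A) \<le> 1"
        using rd by (auto simp: real_distribution_def intro!: prob_space.prob_le_1)
      show "(\<lambda>\<omega>. measure (\<kappa> \<omega>) A) \<in> borel_measurable M"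
        using measurable_compose[OF \<kappa>_M measurable_measure_subprob_algebra] that by blast
    qed
    have e2: "emeasure \<nu>2 A = ennreal (\<integral>\<omega>\<in>B. measure (\<kappa> \<omega>) A \<partial>M)" if "A \<in> sets borel" for A
    proof -
      have [measurable]: "(\<lambda>\<omega>. measure (\<kappa> \<omega>) A) \<in> borel_measurable M"
        using k_int[OF that] by simp
      have "emeasure \<nu>2 A = (\<integral>\<^sup>+\<omega>. emeasure (\<kappa> \<omega>) A \<partial>D)"
        unfolding \<nu>2_def using that \<kappa>D not_empty by (intro emeasure_bind) auto
      also have "\<dots> = (\<integral>\<^sup>+\<omega>. ennreal (measure (\<kappa> \<omega>) A) \<partial>D)"
        using rd by (intro nn_integral_cong) (auto simp: real_distribution_def prob_space_def finite_measure.emeasure_eq_measure)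
      also have "\<dots> = (\<integral>\<^sup>+\<omega>. ennreal (indicator B \<omega> * measure (\<kappa> \<omega>) A) \<partial>M)"
        unfolding D_def by (subst nn_integral_density) (auto intro!: nn_integral_cong split: split_indicator)
      also have "\<dots> = ennreal (\<integral>\<omega>\<in>B. measure (\<kappa> \<omega>) A \<partial>M)"
        unfolding set_lebesgue_integral_def
        using integrable_mult_indicator[OF B' k_int[OF that]] by (subst nn_integral_eq_integral) auto
      finally show ?thesis .
    qed
    have s1: "sets \<nu>1 = sets borel" "space \<nu>1 = UNIV" by (simp_all add: \<nu>1_def)
    have s2: "sets \<nu>2 = sets borel"
      unfolding \<nu>2_def using \<kappa>D not_empty by (intro sets_bind[OF sets_kernel]) auto
    then have s2': "space \<nu>2 = UNIV" using sets_eq_imp_space_eq by force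
    have "\<nu>1 = \<nu>2"
    proof (rule cdf_unique')
      show "finite_borel_measure \<nu>1" "finite_borel_measure \<nu>2"
        using s1 s2 s2' e1[of UNIV] e2[of UNIV]
        by (auto simp: finite_borel_measure_def finite_borel_measure_axioms_def intro!: finite_measureI)
      have "(\<integral>\<omega>\<in>B. measure (\<kappa> \<omega>) {..x} \<partial>M) = prob (B \<inter> (Y -` {..x} \<inter> space M))" for x
      proof -
        \<comment> \<open>The mass of a half-line under the kernel is a limit of \<open>c'\<close>
          from strictly above, so \<open>x\<close> is approached by rationals
          \<open>r n > x\<close>.\<close>
        have "\<exists>r. x < of_rat r \<and> of_rat r < x + 1 / real (Suc n)" for n
          using Rats_dense_in_real[of x "x + 1 / real (Suc n)"] by (auto elim!: Rats_cases)
        then obtain r where r: "x < of_rat (r n)" "of_rat (r n) < x + 1 / real (Suc n)" for n by metis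
        have r_lim: "(\<lambda>n. of_rat (r n)) \<longlonglongrightarrow> x"
        proof (rule tendsto_sandwich[where f="\<lambda>_. x" and h="\<lambda>n. x + 1 / real (Suc n)"])
          show "(\<lambda>n. x + 1 / real (Suc n)) \<longlonglongrightarrow> x"
            using tendsto_add[OF tendsto_const LIMSEQ_inverse_real_of_nat, of x] by (simp add: inverse_eq_divide)
        qed (use r in \<open>auto intro!: always_eventually less_imp_le simp del: of_nat_Suc\<close>)
        have mx: "measure (\<kappa> \<omega>) {..x} = G \<omega> x" for \<omega> using cdf[of \<omega>] by (simp add: cdf_def fun_eq_iff)
        have cM[measurable]: "c' r \<in> borel_measurable M" for r using measurable_from_subalg[OF sub c'_meas] .
        have GM[measurable]: "(\<lambda>\<omega>. G \<omega> x) \<in> borel_measurable M" using measurable_from_subalg[OF sub G_meas] .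
        have c'_b: "0 \<le> c' r \<omega> \<and> c' r \<omega> \<le> 1" for r \<omega>
          using c'(1)[of "min r (-1)" r \<omega>] c'(2)[of "min r (-1)" \<omega>]
            c'(1)[of r "max r 1" \<omega>] c'(3)[of "max r 1" \<omega>] by simp
        have "(\<lambda>n. \<integral>\<omega>. indicator B \<omega> * c' (r n) \<omega> \<partial>M) \<longlonglongrightarrow> (\<integral>\<omega>. indicator B \<omega> * G \<omega> x \<partial>M)"
          by (rule integral_dominated_convergence[where w="\<lambda>_. 1"])
             (use r(1) r_lim lim c'_b in \<open>auto intro!: tendsto_mult simp: abs_mult mult_le_one\<close>)
        moreover have "(\<integral>\<omega>. indicator B \<omega> * c' (r n) \<omega> \<partial>M) = prob (B \<inter> E (r n))" for n
        proof -
          have "(\<integral>\<omega>. indicator B \<omega> * c' (r n) \<omega> \<partial>M) = (\<integral>\<omega>. indicator B \<omega> * c (r n) \<omega> \<partial>M)"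
          proof (rule integral_cong_AE)
            show "AE \<omega> in M. indicator B \<omega> * c' (r n) \<omega> = indicator B \<omega> * c (r n) \<omega>"
              using AE_good by eventually_elim (simp add: c'_def)
          qed (use measurable_from_subalg[OF sub c_meas[of "r n"]] in measurable)
          also have "\<dots> = (\<integral>\<omega>\<in>B. indicator (E (r n)) \<omega> \<partial>M)"
            using real_cond_exp_intA[OF _ B, of "indicator (E (r n))"]
            by (simp add: c_def set_lebesgue_integral_def integrable_indicator_iff emeasure_eq_measure)
          also have "\<dots> = (\<integral>\<omega>. indicator (B \<inter> E (r n)) \<omega> \<partial>M)"
            unfolding set_lebesgue_integral_def
            by (intro Bochner_Integration.integral_cong) (auto split: split_indicator)
          finally show ?thesis by simp
        qed
        moreover have "(\<lambda>n. prob (B \<inter> E (r n))) \<longlonglongrightarrow> prob (B \<inter> (Y -` {..x} \<inter> space M))"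
        proof -
          have "(\<lambda>n. \<integral>\<omega>. indicator (B \<inter> E (r n)) \<omega> \<partial>M) \<longlonglongrightarrow> (\<integral>\<omega>. indicator (B \<inter> (Y -` {..x} \<inter> space M)) \<omega> \<partial>M :: real)"
          proof (rule integral_dominated_convergence[where w="\<lambda>_. 1"])
            show "AE \<omega> in M. (\<lambda>n. indicator (B \<inter> E (r n)) \<omega>) \<longlonglongrightarrow> (indicator (B \<inter> (Y -` {..x} \<inter> space M)) \<omega> :: real)"
            proof (rule AE_I2)
              fix \<omega> assume \<omega>: "\<omega> \<in> space M"
              have "\<forall>\<^sub>F n in sequentially. (Y \<omega> \<le> of_rat (r n)) = (Y \<omega> \<le> x)"
              proof (cases "Y \<omega> \<le> x")
                case True
                then show ?thesis using r(1) by (intro always_eventually) (auto intro: order.trans less_imp_le)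
              next
                case False
                then have "\<forall>\<^sub>F n in sequentially. of_rat (r n) < Y \<omega>"
                  using r_lim by (intro order_tendstoD(2)) auto
                then show ?thesis by eventually_elim (use False in auto)
              qed
              then have "\<forall>\<^sub>F n in sequentially. indicator (B \<inter> E (r n)) \<omega> = (indicator (B \<inter> (Y -` {..x} \<inter> space M)) \<omega> :: real)"
                by eventually_elim (auto simp: E_def indicator_def)
              then show "(\<lambda>n. indicator (B \<inter> E (r n)) \<omega>) \<longlonglongrightarrow> (indicator (B \<inter> (Y -` {..x} \<inter> space M)) \<omega> :: real)"
                by (rule tendsto_eventually)
            qed
          qed (auto simp: indicator_def)
          then show ?thesis by simp
        qed
        ultimately have "(\<integral>\<omega>. indicator B \<omega> * G \<omega> x \<partial>M) = prob (B \<inter> (Y -` {..x} \<inter> space M))"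
          using LIMSEQ_unique by force
        then show ?thesis by (simp add: mx set_lebesgue_integral_def)
      qed
      then show "cdf \<nu>1 = cdf \<nu>2"
        using e1[of "{.._}"] e2[of "{.._}"] by (auto simp: fun_eq_iff cdf_def measure_def)
    qed
    then have "ennreal (\<integral>\<omega>\<in>B. measure (\<kappa> \<omega>) A \<partial>M) = ennreal (prob (B \<inter> (Y -` A \<inter> space M)))"
      using e1[OF A] e2[OF A] by simp
    moreover have "(\<integral>\<omega>\<in>B. measure (\<kappa> \<omega>) A \<partial>M) \<ge> 0"
      unfolding set_lebesgue_integral_def by (intro integral_nonneg_AE) auto
    ultimately show "(\<integral>\<omega>\<in>B. measure (\<kappa> \<omega>) A \<partial>M) = prob (B \<inter> (Y -` A \<inter> space M))" by simp
  qed
  then show ?thesis by blast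
qed

text \<open>A Borel injection into the line with a Borel left inverse reduces the problem to real
  random variables: disintegrate \<open>e\<close> of \<open>Y\<close>, then push the kernel forward
  along \<open>d\<close>.\<close>

lemma (in prob_space) ex_regular_conditional_law_coded:
  fixes e :: "'b \<Rightarrow> real"
  assumes sub: "subalgebra M F" and Y[measurable]: "Y \<in> M \<rightarrow>\<^sub>M N"
    and e[measurable]: "e \<in> borel_measurable N" and d[measurable]: "d \<in> borel \<rightarrow>\<^sub>M N"
    and bounds: "\<And>x. x \<in> space N \<Longrightarrow> 0 \<le> e x \<and> e x \<le> 1"
    and de: "\<And>x. x \<in> space N \<Longrightarrow> d (e x) = x"
  shows "\<exists>\<kappa>. regular_conditional_law M F N Y \<kappa>"
proof -
  have "\<exists>\<kappa>. regular_conditional_law M F borel (\<lambda>\<omega>. e (Y \<omega>)) \<kappa>"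
    using bounds measurable_space[OF Y] by (intro ex_regular_conditional_law_real[OF sub]) auto
  then obtain \<kappa> where \<kappa>: "regular_conditional_law M F borel (\<lambda>\<omega>. e (Y \<omega>)) \<kappa>" by blast
  then have \<kappa>_meas: "\<kappa> \<in> F \<rightarrow>\<^sub>M prob_algebra borel" by (simp add: regular_conditional_law_def)
  have "regular_conditional_law M F N Y (\<lambda>\<omega>. distr (\<kappa> \<omega>) N d)"
  proof (rule regular_conditional_law_charact[OF sub Y])
    show "(\<lambda>\<omega>. distr (\<kappa> \<omega>) N d) \<in> F \<rightarrow>\<^sub>M prob_algebra N"
      by (rule measurable_compose[OF \<kappa>_meas measurable_distr_prob_space[OF d]])
    fix A B assume A: "A \<in> sets N" and B: "B \<in> sets F"
    have sB: "space F = space M" "B \<subseteq> space M"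
      using sub sets.sets_into_space[OF B] by (auto simp: subalgebra_def)
    have dA: "d -` A \<in> sets borel" using measurable_sets[OF d A] by simp
    have "measure (distr (\<kappa> \<omega>) N d) A = measure (\<kappa> \<omega>) (d -` A)" if "\<omega> \<in> space M" for \<omega>
    proof -
      have s: "sets (\<kappa> \<omega>) = sets borel"
        using measurable_space[OF \<kappa>_meas] that sB by (auto simp: space_prob_algebra)
      then have "space (\<kappa> \<omega>) = UNIV" using sets_eq_imp_space_eq by force
      moreover have "d \<in> \<kappa> \<omega> \<rightarrow>\<^sub>M N" using d s by (simp cong: measurable_cong_sets)
      ultimately show ?thesis using A by (simp add: measure_distr)
    qed
    then have "(\<integral>\<omega>\<in>B. measure (distr (\<kappa> \<omega>) N d) A \<partial>M) = (\<integral>\<omega>\<in>B. measure (\<kappa> \<omega>) (d -` A) \<partial>M)"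
      unfolding set_lebesgue_integral_def by (intro Bochner_Integration.integral_cong) auto
    also have "\<dots> = prob (B \<inter> ((\<lambda>\<omega>. e (Y \<omega>)) -` (d -` A) \<inter> space M))"
      by (rule regular_conditional_law_integral[OF \<kappa> dA B])
    also have "(\<lambda>\<omega>. e (Y \<omega>)) -` (d -` A) \<inter> space M = Y -` A \<inter> space M"
      using de measurable_space[OF Y] by auto
    finally show "(\<integral>\<omega>\<in>B. measure (distr (\<kappa> \<omega>) N d) A \<partial>M) = prob (B \<inter> (Y -` A \<inter> space M))" .
  qed
  then show ?thesis by blast
qed

section \<open>A Borel code of paths by real numbers\<close>

text \<open>A sequence of bits is coded as the ternary expansion with digits 0 and 1, whose digits are
  recovered greedily: the remainder is at least \<open>1/3\<close> iff the current bit is set.\<close>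

definition bits_code :: "(nat \<Rightarrow> bool) \<Rightarrow> real" where
  "bits_code b = (\<Sum>n. of_bool (b n) * (1/3) ^ Suc n)"

fun bits_rem :: "nat \<Rightarrow> real \<Rightarrow> real" where
  "bits_rem 0 y = y"
| "bits_rem (Suc n) y = 3 * bits_rem n y - of_bool (bits_rem n y \<ge> 1/3)"

lemma measurable_bits_rem [measurable]: "bits_rem n \<in> borel_measurable borel"
proof (induction n)
  case (Suc n)
  note Suc[measurable]
  show ?case by simp
qed (simp add: measurable_ident[unfolded id_def])

lemma summable_bits: "summable (\<lambda>n. of_bool (b n) * (1/3::real) ^ Suc n)"
  by (rule summable_comparison_test'[of "\<lambda>n. (1/3::real) ^ n" 0]) (auto intro!: summable_geometric)

lemma bits_code_Suc: "bits_code b = of_bool (b 0) / 3 + bits_code (\<lambda>n. b (Suc n)) / 3"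
  unfolding bits_code_def
  using suminf_split_head[OF summable_bits, of b] suminf_divide[OF summable_bits, of "\<lambda>n. b (Suc n)" 3]
  by (simp add: field_simps)

lemma bits_code_bounds: "0 \<le> bits_code b" "bits_code b \<le> 1/2"
proof -
  show "0 \<le> bits_code b" unfolding bits_code_def by (intro suminf_nonneg summable_bits) auto
  have "(\<lambda>n. (1/3::real) ^ Suc n) sums (1/3 * (1 / (1 - 1/3)))"
    unfolding power_Suc by (intro sums_mult geometric_sums) auto
  then have s: "(\<lambda>n. (1/3::real) ^ Suc n) sums (1/2)" by simp
  have "bits_code b \<le> (\<Sum>n. (1/3::real) ^ Suc n)"
    unfolding bits_code_def by (intro suminf_le summable_bits sums_summable[OF s]) auto
  also have "\<dots> = 1/2" using s by (rule sums_unique[symmetric])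
  finally show "bits_code b \<le> 1/2" .
qed

text \<open>The digits after the first contribute at most 1/6, which stays below the weight 1/3 of
  the first one. Base three leaves this gap; in base two the tail could equal the weight of the
  head.\<close>

lemma bits_code_head: "bits_code b \<ge> 1/3 \<longleftrightarrow> b 0"
  using bits_code_bounds[of "\<lambda>n. b (Suc n)"] bits_code_Suc[of b] by (cases "b 0") auto

lemma bits_rem_bits_code: "bits_rem n (bits_code b) = bits_code (\<lambda>m. b (n + m))"
proof (induction n)
  case (Suc n)
  have "3 * bits_code (\<lambda>m. b (n + m)) = of_bool (b n) + bits_code (\<lambda>m. b (Suc n + m))"
    using bits_code_Suc[of "\<lambda>m. b (n + m)"] by simp
  moreover have "bits_code (\<lambda>m. b (n + m)) \<ge> 1/3 \<longleftrightarrow> b n"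
    using bits_code_head[of "\<lambda>m. b (n + m)"] by simp
  ultimately show ?case using Suc by simp
qed simp

lemma bits_rem_decodes: "bits_rem n (bits_code b) \<ge> 1/3 \<longleftrightarrow> b n"
  unfolding bits_rem_bits_code bits_code_head by simp

text \<open>A path on a compact interval is uniformly continuous, and conversely a uniformly
  continuous function on a dense set extends. The criterion has countable quantifiers only, which
  makes the set of numbers that encode a path a Borel set.\<close>

lemma uniformly_continuous_dense_family:
  fixes x :: "rat \<Rightarrow> real"
  assumes uv: "u \<le> v"
  shows "(\<exists>f\<in>mspace (path_space u v UNIV). \<forall>r. f (rat_time u v r) = x r) \<longleftrightarrow>
    (\<forall>m. \<exists>n. \<forall>r s. \<bar>rat_time u v r - rat_time u v s\<bar> < 1 / real (Suc n) \<longrightarrow> \<bar>x r - x s\<bar> \<le> 1 / real (Suc m))"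
    (is "?L \<longleftrightarrow> ?R")
proof
  assume ?L
  then obtain f where f: "continuous_on {u..v} f" "\<And>r. f (rat_time u v r) = x r"
    by (auto simp: mspace_path_space_UNIV)
  have "uniformly_continuous_on {u..v} f"
    by (rule compact_uniformly_continuous[OF f(1)]) simp
  show ?R
  proof
    fix m :: nat
    have "1 / real (Suc m) > 0" by simp
    then obtain d where d: "d > 0"
      "\<And>a b. a \<in> {u..v} \<Longrightarrow> b \<in> {u..v} \<Longrightarrow> dist b a < d \<Longrightarrow> dist (f b) (f a) < 1 / real (Suc m)"
      using \<open>uniformly_continuous_on {u..v} f\<close> unfolding uniformly_continuous_on_def by metis
    obtain n where n: "1 / real (Suc n) < d" using reals_Archimedean[OF d(1)] by (auto simp: inverse_eq_divide)
    show "\<exists>n. \<forall>r s. \<bar>rat_time u v r - rat_time u v s\<bar> < 1 / real (Suc n) \<longrightarrow> \<bar>x r - x s\<bar> \<le> 1 / real (Suc m)"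
    proof (intro exI[of _ n] allI impI)
      fix r s assume "\<bar>rat_time u v r - rat_time u v s\<bar> < 1 / real (Suc n)"
      then have "dist (f (rat_time u v r)) (f (rat_time u v s)) < 1 / real (Suc m)"
        using n by (intro d rat_time_in uv) (auto simp: dist_real_def)
      then show "\<bar>x r - x s\<bar> \<le> 1 / real (Suc m)" by (simp add: f dist_real_def)
    qed
  qed
next
  assume R: ?R
  define D where "D = range (rat_time u v)"
  \<comment> \<open>Different rationals may name the same time because of the clamping;
    \<open>eq\<close> below shows that the choice is immaterial.\<close>
  define g where "g a = x (SOME r. rat_time u v r = a)" for a
  have R': "\<exists>d>0. \<forall>r s. \<bar>rat_time u v r - rat_time u v s\<bar> < d \<longrightarrow> \<bar>x r - x s\<bar> < e" if e: "e > 0" for e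
  proof -
    obtain m where m: "1 / real (Suc m) < e" using reals_Archimedean[OF e] by (auto simp: inverse_eq_divide)
    obtain n where n: "\<forall>r s. \<bar>rat_time u v r - rat_time u v s\<bar> < 1 / real (Suc n) \<longrightarrow> \<bar>x r - x s\<bar> \<le> 1 / real (Suc m)"
      using R by blast
    show ?thesis
      by (rule exI[of _ "1 / real (Suc n)"]) (use n m in \<open>auto intro: le_less_trans\<close>)
  qed
  have eq: "x r = x s" if "rat_time u v r = rat_time u v s" for r s
  proof (rule ccontr)
    assume "x r \<noteq> x s"
    then have "\<bar>x r - x s\<bar> > 0" by simp
    from R'[OF this] obtain d where "d > 0"
      "\<And>r' s'. \<bar>rat_time u v r' - rat_time u v s'\<bar> < d \<Longrightarrow> \<bar>x r' - x s'\<bar> < \<bar>x r - x s\<bar>"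
      by blast
    from this(1) this(2)[of r s] that show False by simp
  qed
  have g: "g (rat_time u v r) = x r" for r
    unfolding g_def by (rule eq) (rule someI, rule refl)
  have "uniformly_continuous_on D g"
    unfolding uniformly_continuous_on_def D_def
  proof (intro allI impI)
    fix e :: real assume "e > 0"
    from R'[OF this] obtain d where "d > 0" "\<forall>r s. \<bar>rat_time u v r - rat_time u v s\<bar> < d \<longrightarrow> \<bar>x r - x s\<bar> < e"
      by blast
    then show "\<exists>d>0. \<forall>a\<in>range (rat_time u v). \<forall>b\<in>range (rat_time u v). dist b a < d \<longrightarrow> dist (g b) (g a) < e"
      by (intro exI[of _ d]) (auto simp: g dist_real_def)
  qed
  then obtain h where h: "uniformly_continuous_on (closure D) h" "\<And>a. a \<in> D \<Longrightarrow> g a = h a"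
    using uniformly_continuous_on_extension_on_closure by metis
  have "continuous_on {u..v} h"
    using h(1) uniformly_continuous_imp_continuous by (simp add: D_def closure_rat_time uv)
  then have "continuous_on {u..v} (restrict h {u..v})" by (rule continuous_on_eq) simp
  moreover have "restrict h {u..v} (rat_time u v r) = x r" for r
    using h(2)[of "rat_time u v r"] rat_time_in[OF uv] by (simp add: g D_def)
  ultimately show ?L by (intro bexI[of _ "restrict h {u..v}"]) (auto simp: mspace_path_space_UNIV)
qed

lemma path_space_eqI:
  assumes "u \<le> v" "f \<in> mspace (path_space u v UNIV)" "g \<in> mspace (path_space u v UNIV)"
    and "\<And>r. f (rat_time u v r) = g (rat_time u v r)"
  shows "f = g"
proof (rule extensionalityI[of _ "{u..v}"])
  fix x assume "x \<in> {u..v}"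
  then show "f x = g x"
    using le_on_Icc_if_le_rat_time[of u v f g x] le_on_Icc_if_le_rat_time[of u v g f x] assms
    by (auto simp: mspace_path_space_UNIV)
qed (use assms in \<open>auto simp: mspace_path_space_UNIV\<close>)

text \<open>The code of a path lists the truth values of
  \<open>f (rat_time u v r) < of_rat s\<close> over all pairs of rationals. A value of the path is
  regained as the infimum of the rationals above it, and the path from its values on a dense
  set.\<close>

lemma path_space_coding:
  assumes uv: "u \<le> v"
  obtains e d where "e \<in> borel_measurable (borel_of (path_topology u v))"
    "d \<in> borel \<rightarrow>\<^sub>M borel_of (path_topology u v)"
    "\<And>f. f \<in> mspace (path_space u v UNIV) \<Longrightarrow> 0 \<le> e f \<and> e f \<le> (1::real)"
    "\<And>f. f \<in> mspace (path_space u v UNIV) \<Longrightarrow> d (e f) = f"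
proof -
  let ?C = "mspace (path_space u v UNIV)"
  define b where "b f n = (case from_nat n of (r, s) \<Rightarrow> f (rat_time u v r) < of_rat s)" for f :: "real \<Rightarrow> real" and n
  define e where "e f = bits_code (b f)" for f
  \<comment> \<open>For an arbitrary \<open>y\<close> the set of rationals with a set bit may be
    empty or unbounded below. In \<open>ereal\<close> the infimum exists in any case, and infinite
    values become 0.\<close>
  define xi where "xi y r = real_of_ereal (INF s. if bits_rem (to_nat (r, s)) y \<ge> 1/3 then ereal (of_rat s) else \<infinity>)" for y and r :: rat
  define good where "good y \<longleftrightarrow> (\<exists>f\<in>?C. \<forall>r. f (rat_time u v r) = xi y r)" for y
  \<comment> \<open>The zero path is the default for numbers whose decoded values do not extend to a
    continuous path; it keeps \<open>d\<close> total.\<close>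
  define d where "d y = (if good y then SOME f. f \<in> ?C \<and> (\<forall>r. f (rat_time u v r) = xi y r) else (\<lambda>x\<in>{u..v}. 0))" for y
  have [measurable]: "(\<lambda>y. xi y r) \<in> borel_measurable borel" for r
    unfolding xi_def by measurable
  have good_alt: "good y \<longleftrightarrow> (\<forall>m. \<exists>n. \<forall>r s. \<bar>rat_time u v r - rat_time u v s\<bar> < 1 / real (Suc n) \<longrightarrow>
      \<bar>xi y r - xi y s\<bar> \<le> 1 / real (Suc m))" for y
    unfolding good_def by (rule uniformly_continuous_dense_family[OF uv])
  have [measurable]: "Measurable.pred borel good"
    unfolding good_alt[abs_def] by measurable
  have d_good: "d y \<in> ?C \<and> (\<forall>r. d y (rat_time u v r) = xi y r)" if "good y" for y
    using someI_ex[of "\<lambda>f. f \<in> ?C \<and> (\<forall>r. f (rat_time u v r) = xi y r)"] that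
    unfolding d_def good_def by auto
  have d_bad: "d y = (\<lambda>x\<in>{u..v}. 0)" if "\<not> good y" for y using that by (simp add: d_def)
  have bad_C: "(\<lambda>x\<in>{u..v}. 0) \<in> ?C"
    by (auto simp: mspace_path_space_UNIV intro: continuous_on_eq[OF continuous_on_const])
  have d_C: "d y \<in> ?C" for y
    by (cases "good y") (use d_good d_bad bad_C in auto)
  have d_eval: "d y (rat_time u v r) = (if good y then xi y r else 0)" for y r
    using d_good d_bad rat_time_in[OF uv] by simp
  have bits: "bits_rem (to_nat (r, s)) (e f) \<ge> 1/3 \<longleftrightarrow> f (rat_time u v r) < of_rat s" for f r s
    unfolding e_def bits_rem_decodes by (simp add: b_def)
  have xi_e: "xi (e f) r = f (rat_time u v r)" for f r
  proof -
    let ?a = "f (rat_time u v r)"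
    have "(INF s. if ?a < of_rat s then ereal (of_rat s) else \<infinity>) = ereal ?a"
    proof (rule antisym)
      show "ereal ?a \<le> (INF s. if ?a < of_rat s then ereal (of_rat s) else \<infinity>)"
        by (rule INF_greatest) auto
      show "(INF s. if ?a < of_rat s then ereal (of_rat s) else \<infinity>) \<le> ereal ?a"
      proof (rule ereal_le_epsilon2)
        fix \<delta> :: real assume "\<delta> > 0"
        obtain q where "q \<in> \<rat>" "?a < q" "q < ?a + \<delta>"
          using Rats_dense_in_real[of ?a "?a + \<delta>"] \<open>\<delta> > 0\<close> by auto
        then obtain s where s: "?a < of_rat s" "of_rat s < ?a + \<delta>" by (auto elim!: Rats_cases)
        then show "(INF s. if ?a < of_rat s then ereal (of_rat s) else \<infinity>) \<le> ereal ?a + ereal \<delta>"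
          by (intro INF_lower2[of s]) auto
      qed
    qed
    then show ?thesis unfolding xi_def bits by simp
  qed
  show thesis
  proof (rule that)
    have [measurable]: "(\<lambda>f. f (rat_time u v r)) \<in> borel_measurable (borel_of (path_topology u v))" for r
      by (rule measurable_path_eval) (rule rat_time_in[OF uv])
    have [measurable]: "Measurable.pred (borel_of (path_topology u v)) (\<lambda>f. b f n)" for n
      unfolding b_def by (simp add: case_prod_beta)
    show "e \<in> borel_measurable (borel_of (path_topology u v))"
      unfolding e_def[abs_def] bits_code_def by measurable
    show "d \<in> borel \<rightarrow>\<^sub>M borel_of (path_topology u v)"
      by (rule measurable_into_path_space[OF uv]) (auto simp: d_C d_eval[abs_def])
    show "0 \<le> e f \<and> e f \<le> (1::real)" for f
      using bits_code_bounds[of "b f"] by (simp add: e_def)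
    fix f assume f: "f \<in> ?C"
    then have "good (e f)" unfolding good_def using xi_e by auto
    show "d (e f) = f"
      by (rule path_space_eqI[OF uv d_C f]) (simp add: d_eval \<open>good (e f)\<close> xi_e)
  qed
qed

lemma (in prob_space) ex_regular_conditional_law_path:
  assumes sub: "subalgebra M F" and Y: "Y \<in> M \<rightarrow>\<^sub>M borel_of (path_topology u v)" and uv: "u \<le> v"
  shows "\<exists>\<kappa>. regular_conditional_law M F (borel_of (path_topology u v)) Y \<kappa>"
proof -
  obtain e d where "e \<in> borel_measurable (borel_of (path_topology u v))"
    "d \<in> borel \<rightarrow>\<^sub>M borel_of (path_topology u v)"
    "\<And>f. f \<in> mspace (path_space u v UNIV) \<Longrightarrow> 0 \<le> e f \<and> e f \<le> (1::real)"
    "\<And>f. f \<in> mspace (path_space u v UNIV) \<Longrightarrow> d (e f) = f"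
    using path_space_coding[OF uv] by metis
  from ex_regular_conditional_law_coded[OF sub Y this(1,2)] this(3,4) show ?thesis by simp
qed

section \<open>Conditional full support via tubes\<close>

text \<open>Subtracting the value at \<open>u\<close> makes the set independent of the starting
  point. The starting point of the conditional law is random, and tubes of values would have to be
  indexed by it.\<close>

definition increment_tube :: "real \<Rightarrow> real \<Rightarrow> rat list \<Rightarrow> real \<Rightarrow> (real \<Rightarrow> real) set" where
  "increment_tube u v cs e = {f. \<forall>x\<in>{u..v}. \<bar>f x - f u - (rat_poly cs x - rat_poly cs u)\<bar> \<le> e}"

lemma increment_tube_iff_rat:
  assumes "u \<le> v" "continuous_on {u..v} f"
  shows "f \<in> increment_tube u v cs e \<longleftrightarrow>
    (\<forall>r. \<bar>f (rat_time u v r) - f u - (rat_poly cs (rat_time u v r) - rat_poly cs u)\<bar> \<le> e)"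
proof
  assume "\<forall>r. \<bar>f (rat_time u v r) - f u - (rat_poly cs (rat_time u v r) - rat_poly cs u)\<bar> \<le> e"
  moreover have "continuous_on {u..v} (\<lambda>x. \<bar>f x - f u - (rat_poly cs x - rat_poly cs u)\<bar>)"
    by (intro continuous_intros assms continuous_on_rat_poly)
  ultimately show "f \<in> increment_tube u v cs e"
    using le_on_Icc_if_le_rat_time[of u v "\<lambda>x. \<bar>f x - f u - (rat_poly cs x - rat_poly cs u)\<bar>" "\<lambda>_. e"] assms
    by (auto simp: increment_tube_def)
qed (use rat_time_in[OF assms(1)] in \<open>auto simp: increment_tube_def\<close>)

lemma increment_tube_in_sets:
  assumes uv: "u \<le> v"
  shows "increment_tube u v cs e \<inter> mspace (path_space u v UNIV) \<in> sets (borel_of (path_topology u v))"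
proof -
  let ?N = "borel_of (path_topology u v)"
  have [measurable]: "(\<lambda>f. f (rat_time u v r)) \<in> borel_measurable ?N" for r
    by (rule measurable_path_eval) (rule rat_time_in[OF uv])
  have [measurable]: "(\<lambda>f. f u) \<in> borel_measurable ?N"
    by (rule measurable_path_eval) (use uv in auto)
  have "{f \<in> space ?N. \<forall>r. \<bar>f (rat_time u v r) - f u - (rat_poly cs (rat_time u v r) - rat_poly cs u)\<bar> \<le> e} \<in> sets ?N"
    by measurable
  also have "{f \<in> space ?N. \<forall>r. \<bar>f (rat_time u v r) - f u - (rat_poly cs (rat_time u v r) - rat_poly cs u)\<bar> \<le> e}
    = increment_tube u v cs e \<inter> mspace (path_space u v UNIV)"
    using increment_tube_iff_rat[OF uv] by (auto simp: mspace_path_space_UNIV)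
  finally show ?thesis .
qed

lemma restrict_in_increment_tube: "restrict f {u..v} \<in> increment_tube u v cs e \<longleftrightarrow> u > v \<or> f \<in> increment_tube u v cs e"
  by (cases "u \<le> v") (auto simp: increment_tube_def)

text \<open>If a closed set of full measure missed some path from \<open>x\<close>, it would miss a
  ball around that path, and with it all paths from \<open>x\<close> in a suitable tube. That tube
  would be null, against \<open>pos\<close>.\<close>

lemma support_eq_paths_from:
  assumes uv: "u \<le> v" and \<mu>: "\<mu> \<in> space (prob_algebra (borel_of (path_topology u v)))"
    and start: "AE f in \<mu>. f u = x"
    and pos: "\<And>cs e. e > 0 \<Longrightarrow> measure \<mu> (increment_tube u v cs (of_rat e) \<inter> mspace (path_space u v UNIV)) > 0"
  shows "support (path_topology u v) \<mu> = paths_from u v UNIV x"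
proof -
  let ?C = "mspace (path_space u v UNIV)" and ?N = "borel_of (path_topology u v)"
  have sets: "sets \<mu> = sets ?N" using \<mu> by (simp add: space_prob_algebra)
  then have space: "space \<mu> = ?C" using sets_eq_imp_space_eq[of \<mu> ?N] by simp
  interpret \<mu>: prob_space \<mu> using \<mu> by (simp add: space_prob_algebra)
  have closed_sets: "S \<in> sets \<mu>" if "closedin (path_topology u v) S" for S
  proof -
    have "S = ?C - (?C - S)" using closedin_subset[OF that] by auto
    moreover have "?C - S \<in> sets \<mu>"
      using that unfolding sets sets_borel_of_path closedin_def by (intro sigma_sets.Basic) simp
    ultimately show ?thesis using sets.compl_sets[of "?C - S" \<mu>] by (simp add: space)
  qed
  have ev: "(\<lambda>f. f u) \<in> borel_measurable \<mu>"
    using measurable_path_eval[of u u v] uv by (simp add: measurable_cong_sets[OF sets])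
  have "closedin (path_topology u v) (paths_from u v UNIV x)"
    unfolding closedin_def openin_path_topology
  proof (intro conjI ballI)
    fix f assume f: "f \<in> topspace (path_topology u v) - paths_from u v UNIV x"
    then have fC: "f \<in> ?C" and fx: "\<bar>f u - x\<bar> > 0" by (auto simp: paths_from_def)
    show "\<exists>e>0. \<forall>g\<in>?C. mdist (path_space u v UNIV) f g < e \<longrightarrow> g \<in> topspace (path_topology u v) - paths_from u v UNIV x"
    proof (intro exI[of _ "\<bar>f u - x\<bar>"] conjI ballI impI fx)
      fix g assume g: "g \<in> ?C" "mdist (path_space u v UNIV) f g < \<bar>f u - x\<bar>"
      have "\<bar>f u - g u\<bar> \<le> mdist (path_space u v UNIV) f g"
        using mdist_path_space_le_iff[OF fC g(1) uv, of "mdist (path_space u v UNIV) f g"] uv by auto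
      then show "g \<in> topspace (path_topology u v) - paths_from u v UNIV x"
        using g by (auto simp: paths_from_def)
    qed
  qed (auto simp: paths_from_def)
  moreover have "emeasure \<mu> (paths_from u v UNIV x) = 1"
  proof -
    have "paths_from u v UNIV x = {f \<in> space \<mu>. f u = x}"
      by (auto simp: paths_from_def space)
    then show ?thesis
      using \<mu>.prob_Collect_eq_1[of "\<lambda>f. f u = x"] start ev by (simp add: \<mu>.emeasure_eq_measure)
  qed
  moreover have "paths_from u v UNIV x \<subseteq> S" if S: "closedin (path_topology u v) S" "emeasure \<mu> S = 1" for S
  proof
    fix f assume f: "f \<in> paths_from u v UNIV x"
    then have fC: "f \<in> ?C" and fu: "f u = x" by (auto simp: paths_from_def)
    show "f \<in> S"
    proof (rule ccontr)
      assume "f \<notin> S"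
      then have "openin (path_topology u v) (?C - S)" "f \<in> ?C - S"
        using S(1) fC by (auto simp: closedin_def)
      then obtain e where e: "e > 0" "\<And>g. g \<in> ?C \<Longrightarrow> \<forall>x\<in>{u..v}. \<bar>f x - g x\<bar> \<le> e \<Longrightarrow> g \<in> ?C - S"
        using openin_path_topology_le[OF _ _ uv] by blast
      \<comment> \<open>A third of \<open>e\<close>, because three errors occur: the width of the
        tube, and the distance of \<open>f\<close> from the polynomial at \<open>y\<close> and at
        the starting time.\<close>
      obtain q where "q \<in> \<rat>" "0 < q" "q < e/3" using Rats_dense_in_real[of 0 "e/3"] e by auto
      then obtain r where r: "0 < r" "of_rat r < e / 3" by (auto elim!: Rats_cases)
      obtain cs where cs: "\<forall>x\<in>{u..v}. \<bar>f x - rat_poly cs x\<bar> < e / 3"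
        using rat_poly_dense[of u v f "e/3"] fC e by (auto simp: mspace_path_space_UNIV)
      let ?E = "increment_tube u v cs (of_rat r) \<inter> ?C"
      have sub: "{g \<in> ?E. g u = x} \<subseteq> ?C - S"
      proof
        fix g assume g: "g \<in> {g \<in> ?E. g u = x}"
        have "\<bar>f y - g y\<bar> \<le> e" if y: "y \<in> {u..v}" for y
        proof -
          have "\<bar>g y - g u - (rat_poly cs y - rat_poly cs u)\<bar> \<le> of_rat r"
            using g y by (auto simp: increment_tube_def)
          moreover have "\<bar>f y - rat_poly cs y\<bar> < e / 3" "\<bar>f u - rat_poly cs u\<bar> < e / 3"
            using cs y uv by auto
          moreover have "g u = x" using g by simp
          ultimately show ?thesis using fu r(2) by linarith
        qed
        then show "g \<in> ?C - S" using g by (intro e(2)) auto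
      qed
      have "AE g in \<mu>. g \<in> S"
        using S \<mu>.prob_eq_1[OF closed_sets[OF S(1)]] by (simp add: \<mu>.emeasure_eq_measure)
      with start have "AE g in \<mu>. g \<notin> ?E" by eventually_elim (use sub in auto)
      moreover have "?E \<in> sets \<mu>" using increment_tube_in_sets[OF uv] sets by simp
      ultimately have "measure \<mu> ?E = 0" using \<mu>.prob_eq_0 by blast
      with pos[OF r(1), of cs] show False by simp
    qed
  qed
  ultimately show ?thesis
    unfolding support_def by (intro Least_equality) auto
qed

text \<open>The event that the conditional probability vanishes belongs to \<open>F\<close> and
  contributes zero to the probability of \<open>A\<close>, so by \<open>pos\<close> it is
  null.\<close>

lemma (in prob_space) regular_conditional_law_AE_pos:
  assumes \<kappa>: "regular_conditional_law M F N Y \<kappa>" and A: "A \<in> sets N"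
    and pos: "\<And>B. B \<in> sets F \<Longrightarrow> prob B > 0 \<Longrightarrow> prob (B \<inter> (Y -` A \<inter> space M)) > 0"
  shows "AE \<omega> in M. measure (\<kappa> \<omega>) A > 0"
proof -
  have sub: "subalgebra M F" and \<kappa>_meas: "\<kappa> \<in> F \<rightarrow>\<^sub>M prob_algebra N"
    using \<kappa> by (auto simp: regular_conditional_law_def)
  have [measurable]: "(\<lambda>\<omega>. measure (\<kappa> \<omega>) A) \<in> borel_measurable F"
    using measurable_compose[OF measurable_prob_algebraD[OF \<kappa>_meas] measurable_measure_subprob_algebra[OF A]] .
  define B where "B = {\<omega> \<in> space F. measure (\<kappa> \<omega>) A = 0}"
  have B: "B \<in> sets F" unfolding B_def by measurable
  then have BM: "B \<in> events" using sub by (auto simp: subalgebra_def)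
  have "prob (B \<inter> (Y -` A \<inter> space M)) = (\<integral>\<omega>\<in>B. measure (\<kappa> \<omega>) A \<partial>M)"
    by (rule regular_conditional_law_integral[OF \<kappa> A B, symmetric])
  also have "\<dots> = (\<integral>\<omega>. 0 \<partial>M)"
    unfolding set_lebesgue_integral_def
    by (intro Bochner_Integration.integral_cong) (auto simp: B_def indicator_def)
  finally have "prob B = 0" using pos[OF B] by (cases "prob B > 0") (auto simp: not_less measure_le_0_iff)
  then have "AE \<omega> in M. \<omega> \<notin> B" using prob_eq_0[OF BM] by simp
  then show ?thesis
    using AE_space by eventually_elim (use sub in \<open>auto simp: B_def subalgebra_def zero_less_measure_iff\<close>)
qed

section \<open>Natural filtrations and the reduction to tubes\<close>

lemma space_natural_filtration [simp]: "space (natural_filtration M X t) = space M"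
  unfolding natural_filtration_def by (rule space_measure_of) auto

lemma sets_natural_filtration:
  "sets (natural_filtration M X t) =
    sigma_sets (space M) (\<Union>s\<in>{0..t}. {X s -` A \<inter> space M | A. A \<in> sets borel})"
  unfolding natural_filtration_def by (rule sets_measure_of) auto

lemma measurable_natural_filtration:
  assumes "0 \<le> s" "s \<le> t"
  shows "X s \<in> borel_measurable (natural_filtration M X t)"
proof (rule measurableI)
  fix A :: "real set" assume "A \<in> sets borel"
  then have "X s -` A \<inter> space M \<in> (\<Union>s\<in>{0..t}. {X s -` A \<inter> space M | A. A \<in> sets borel})"
    using assms by (intro UN_I[of s]) auto
  then show "X s -` A \<inter> space (natural_filtration M X t) \<in> sets (natural_filtration M X t)"
    unfolding space_natural_filtration sets_natural_filtration by (rule sigma_sets.Basic)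
qed simp

lemma subalgebra_natural_filtration:
  assumes "\<And>s. 0 \<le> s \<Longrightarrow> s \<le> t \<Longrightarrow> X s \<in> borel_measurable M"
  shows "subalgebra M (natural_filtration M X t)"
  unfolding subalgebra_def sets_natural_filtration
  using assms by (auto intro!: sets.sigma_sets_subset)

text \<open>A support is determined by uncountably many open sets. The countable family of tubes
  replaces them by countably many almost sure statements, which then hold simultaneously for almost
  every kernel.\<close>

lemma (in prob_space) conditional_full_supportI:
  assumes Z: "continuous_process M T Z"
    and pos: "\<And>t B cs e. t \<in> {0..<T} \<Longrightarrow> B \<in> sets (natural_filtration M Z t) \<Longrightarrow> prob B > 0 \<Longrightarrow> e > 0 \<Longrightarrow>
      prob (B \<inter> {\<omega> \<in> space M. (\<lambda>u. Z u \<omega>) \<in> increment_tube t T cs e}) > 0"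
  shows "conditional_full_support M T (natural_filtration M Z) UNIV Z"
  unfolding conditional_full_support_def Let_def
proof (intro conjI ballI)
  show "adapted T (natural_filtration M Z) Z"
    by (auto simp: adapted_def intro: measurable_natural_filtration)
  fix t assume t: "t \<in> {0..<T}"
  then have tT: "t \<le> T" by simp
  have Z_meas[measurable]: "Z s \<in> borel_measurable M" if "0 \<le> s" "s \<le> T" for s
    using Z that by (auto simp: continuous_process_def)
  have Z_cont: "continuous_on {t..T} (\<lambda>u. Z u \<omega>)" if "\<omega> \<in> space M" for \<omega>
    using Z that t by (auto simp: continuous_process_def intro: continuous_on_subset)
  let ?F = "natural_filtration M Z t" and ?N = "borel_of (path_topology t T)"
  let ?Y = "\<lambda>\<omega>. \<lambda>u\<in>{t..T}. Z u \<omega>"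
  have sub: "subalgebra M ?F" using t by (intro subalgebra_natural_filtration) auto
  interpret finite_measure_subalgebra M ?F by unfold_locales (rule sub)
  have YC: "?Y \<omega> \<in> mspace (path_space t T UNIV)" if "\<omega> \<in> space M" for \<omega>
    using continuous_on_eq[OF Z_cont[OF that], of "?Y \<omega>"] by (simp add: mspace_path_space_UNIV)
  have Y: "?Y \<in> M \<rightarrow>\<^sub>M ?N"
  proof (rule measurable_into_path_space[OF tT YC])
    fix r
    show "(\<lambda>\<omega>. ?Y \<omega> (rat_time t T r)) \<in> borel_measurable M"
      using rat_time_in[OF tT, of r] t by (simp add: Z_meas)
  qed
  obtain \<kappa> where \<kappa>: "regular_conditional_law M ?F ?N ?Y \<kappa>"
    using ex_regular_conditional_law_path[OF sub Y tT] by blast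
  have \<kappa>_space: "\<kappa> \<omega> \<in> space (prob_algebra ?N)" if "\<omega> \<in> space M" for \<omega>
    using \<kappa> that by (auto simp: regular_conditional_law_def dest: measurable_space)
  \<comment> \<open>\<open>Z t\<close> is known at time \<open>t\<close>, so the conditional
    probability of \<open>f t < r\<close> is an indicator. Rational \<open>r\<close> suffice: they
    will show that \<open>f t\<close> equals the given value of \<open>Z t\<close> almost surely
    under the kernel.\<close>
  have "AE \<omega> in M. \<forall>r::rat. measure (\<kappa> \<omega>) {f \<in> space ?N. f t < of_rat r} = indicator {\<omega>. Z t \<omega> < of_rat r} \<omega>"
    unfolding AE_all_countable
  proof
    fix r :: rat
    let ?A = "{f \<in> space ?N. f t < of_rat r}"
    have [measurable]: "(\<lambda>f. f t) \<in> borel_measurable ?N" using tT by (intro measurable_path_eval) simp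
    have A: "?A \<in> sets ?N" by measurable
    have eq: "?Y -` ?A \<inter> space M = {\<omega> \<in> space M. Z t \<omega> < of_rat r}"
      using YC tT by auto
    have [measurable]: "Z t \<in> borel_measurable ?F" using t by (intro measurable_natural_filtration) auto
    have "AE \<omega> in M. real_cond_exp M ?F (indicator (?Y -` ?A \<inter> space M)) \<omega> = measure (\<kappa> \<omega>) ?A"
      using \<kappa> A by (auto simp: regular_conditional_law_def)
    moreover have "AE \<omega> in M. real_cond_exp M ?F (indicator (?Y -` ?A \<inter> space M)) \<omega> = indicator (?Y -` ?A \<inter> space M) \<omega>"
    proof (rule real_cond_exp_F_meas)
      have "{\<omega> \<in> space ?F. Z t \<omega> < of_rat r} \<in> sets ?F" by measurable
      then show "indicator (?Y -` ?A \<inter> space M) \<in> borel_measurable ?F" unfolding eq by simp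
      show "integrable M (indicator (?Y -` ?A \<inter> space M) :: _ \<Rightarrow> real)"
        using measurable_sets[OF Y A] by (simp add: integrable_indicator_iff emeasure_eq_measure)
    qed
    ultimately show "AE \<omega> in M. measure (\<kappa> \<omega>) ?A = indicator {\<omega>. Z t \<omega> < of_rat r} \<omega>"
      using AE_space by eventually_elim (simp only: eq, simp add: indicator_def)
  qed
  moreover have "AE \<omega> in M. \<forall>(cs::rat list) (e::rat). e > 0 \<longrightarrow>
      measure (\<kappa> \<omega>) (increment_tube t T cs (of_rat e) \<inter> mspace (path_space t T UNIV)) > 0"
    unfolding AE_all_countable
  proof (intro allI AE_impI)
    fix cs and e :: rat assume e: "e > 0"
    let ?A = "increment_tube t T cs (of_rat e) \<inter> mspace (path_space t T UNIV)"
    have eq: "?Y -` ?A \<inter> space M = {\<omega> \<in> space M. (\<lambda>u. Z u \<omega>) \<in> increment_tube t T cs (of_rat e)}"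
      using YC tT by (auto simp: restrict_in_increment_tube)
    show "AE \<omega> in M. measure (\<kappa> \<omega>) ?A > 0"
    proof (rule regular_conditional_law_AE_pos[OF \<kappa> increment_tube_in_sets[OF tT]])
      fix B assume "B \<in> sets ?F" "prob B > 0"
      then show "prob (B \<inter> (?Y -` ?A \<inter> space M)) > 0"
        unfolding eq using t e by (intro pos) auto
    qed
  qed
  ultimately have "AE \<omega> in M. support (path_topology t T) (\<kappa> \<omega>) = paths_from t T UNIV (Z t \<omega>)"
    using AE_space
  proof eventually_elim
    case (elim \<omega>)
    note \<mu> = \<kappa>_space[OF elim(3)]
    interpret \<mu>: prob_space "\<kappa> \<omega>" using \<mu> by (simp add: space_prob_algebra)
    have sets: "sets (\<kappa> \<omega>) = sets ?N" using \<mu> by (simp add: space_prob_algebra)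
    then have space: "space (\<kappa> \<omega>) = space ?N" by (rule sets_eq_imp_space_eq)
    have ev[measurable]: "(\<lambda>f. f t) \<in> borel_measurable (\<kappa> \<omega>)"
      using measurable_path_eval[of t t T] tT by (simp add: measurable_cong_sets[OF sets])
    have "AE f in \<kappa> \<omega>. \<forall>r. f t < of_rat r \<longleftrightarrow> Z t \<omega> < of_rat r"
      unfolding AE_all_countable
    proof
      fix r :: rat
      have "\<mu>.prob {f \<in> space (\<kappa> \<omega>). f t < of_rat r} = indicator {\<omega>. Z t \<omega> < of_rat r} \<omega>"
        using elim(1) by (simp add: space)
      then show "AE f in \<kappa> \<omega>. f t < of_rat r \<longleftrightarrow> Z t \<omega> < of_rat r"
        by (cases "Z t \<omega> < of_rat r") (simp_all add: \<mu>.prob_Collect_eq_1 \<mu>.prob_Collect_eq_0)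
    qed
    then have "AE f in \<kappa> \<omega>. f t = Z t \<omega>"
    proof eventually_elim
      case (elim f)
      show ?case
      proof (rule ccontr)
        assume "f t \<noteq> Z t \<omega>"
        then have "min (f t) (Z t \<omega>) < max (f t) (Z t \<omega>)" by auto
        then obtain q where "q \<in> \<rat>" "min (f t) (Z t \<omega>) < q" "q < max (f t) (Z t \<omega>)"
          using Rats_dense_in_real[of "min (f t) (Z t \<omega>)" "max (f t) (Z t \<omega>)"] by auto
        moreover obtain r where "q = of_rat r" using \<open>q \<in> \<rat>\<close> by (auto elim: Rats_cases)
        ultimately show False using elim[rule_format, of r] by (auto simp: min_def max_def split: if_splits)
      qed
    qed
    then show ?case
      using elim(2) by (intro support_eq_paths_from[OF tT \<mu>]) auto
  qed
  with \<kappa> show "\<exists>\<kappa>. regular_conditional_law M ?F ?N ?Y \<kappa> \<and>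
      (AE \<omega> in M. support (path_topology t T) (\<kappa> \<omega>) = paths_from t T UNIV (Z t \<omega>))"
    by blast
qed

section \<open>Elementary stochastic integrals\<close>

locale time_grid =
  fixes T :: real and N :: nat and p :: "nat \<Rightarrow> real"
  assumes p_0: "p 0 = 0" and p_N: "p N = T" and p_less_Suc: "\<And>i. i < N \<Longrightarrow> p i < p (Suc i)"
begin

lemma p_less: "i < j \<Longrightarrow> j \<le> N \<Longrightarrow> p i < p j"
proof (induction j)
  case (Suc j)
  then show ?case using p_less_Suc[of j] by (cases "i = j") auto
qed simp

lemma p_le: "i \<le> j \<Longrightarrow> j \<le> N \<Longrightarrow> p i \<le> p j"
  using p_less[of i j] by (cases "i = j") auto

lemma p_less_iff: "i \<le> N \<Longrightarrow> j \<le> N \<Longrightarrow> p i < p j \<longleftrightarrow> i < j"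
  using p_less[of i j] p_le[of j i] by (cases "i < j") (auto simp: not_less)

lemma p_le_iff: "i \<le> N \<Longrightarrow> j \<le> N \<Longrightarrow> p i \<le> p j \<longleftrightarrow> i \<le> j"
  using p_less_iff[of j i] by (auto simp: not_less[symmetric])

lemma p_in: "i \<le> N \<Longrightarrow> p i \<in> {0..T}"
  using p_le[of 0 i] p_le[of i N] by (simp add: p_0 p_N)

text \<open>Cells are open on the left and closed on the right, so no grid point separates a point
  of a cell from its right end point. Hence step functions over a coarser partition may be evaluated
  at \<open>p (Suc i)\<close>.\<close>

lemma in_cell_iff:
  assumes "i < N" "s \<in> {p i<..p (Suc i)}" "a \<in> p ` {..N}"
  shows "a < s \<longleftrightarrow> a < p (Suc i)" "s \<le> a \<longleftrightarrow> p (Suc i) \<le> a"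
proof -
  obtain j where j: "a = p j" "j \<le> N" using assms(3) by auto
  show "a < s \<longleftrightarrow> a < p (Suc i)"
    using assms(1,2) j p_less_iff[of j "Suc i"] p_le_iff[of j i] by auto
  show "s \<le> a \<longleftrightarrow> p (Suc i) \<le> a"
    using assms(1,2) j p_le_iff[of "Suc i" j] p_le_iff[of j i] by auto
qed

lemma telescope:
  fixes F :: "real \<Rightarrow> real"
  assumes "a \<in> p ` {..N}" "b \<in> p ` {..N}" "a \<le> b"
  shows "(\<Sum>i<N. indicator {a<..b} (p (Suc i)) * (F (p (Suc i)) - F (p i))) = F b - F a"
proof -
  obtain j l where j: "a = p j" "j \<le> N" and l: "b = p l" "l \<le> N" using assms by auto
  have jl: "j \<le> l" using assms(3) p_le_iff[of j l] j l by simp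
  have "(\<Sum>i<N. indicator {a<..b} (p (Suc i)) * (F (p (Suc i)) - F (p i)))
      = (\<Sum>i\<in>{j..<l}. F (p (Suc i)) - F (p i))"
  proof (rule sum.mono_neutral_cong_right)
    show "\<forall>i\<in>{..<N} - {j..<l}. indicator {a<..b} (p (Suc i)) * (F (p (Suc i)) - F (p i)) = 0"
      using j l p_le_iff[of "Suc _" l] p_less_iff[of j "Suc _"] by (auto simp: indicator_def)
    show "indicator {a<..b} (p (Suc i)) * (F (p (Suc i)) - F (p i)) = F (p (Suc i)) - F (p i)" if "i \<in> {j..<l}" for i
      using that j l p_le_iff[of "Suc i" l] p_less_iff[of j "Suc i"] by (auto simp: indicator_def)
  qed (use l in auto)
  also have "\<dots> = F b - F a"
    using sum_Suc_diff'[OF jl, of "\<lambda>i. F (p i)"] by (simp add: j l)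
  finally show ?thesis .
qed

lemma ex_cell:
  assumes "s \<in> {0<..T}"
  obtains i where "i < N" "s \<in> {p i<..p (Suc i)}"
proof -
  define j where "j = (LEAST j. s \<le> p j)"
  have s: "s \<le> p N" using assms by (simp add: p_N)
  have sj: "s \<le> p j" unfolding j_def by (rule LeastI[of _ N]) (rule s)
  have jN: "j \<le> N" unfolding j_def by (rule Least_le) (rule s)
  have "j \<noteq> 0" using sj assms p_0 by (auto intro: ccontr)
  then obtain i where i: "j = Suc i" by (cases j) auto
  have "\<not> s \<le> p i" using not_less_Least[of i "\<lambda>j. s \<le> p j"] i by (simp add: j_def)
  then show thesis using that[of i] sj i jN by auto
qed

lemma cell_sum:
  fixes c :: "nat \<Rightarrow> 'b::semiring_1"
  shows "i < N \<Longrightarrow> s \<in> {p i<..p (Suc i)} \<Longrightarrow> (\<Sum>j<N. c j * indicator {p j<..p (Suc j)} s) = c i"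
    and "s \<notin> {0<..T} \<Longrightarrow> (\<Sum>j<N. c j * indicator {p j<..p (Suc j)} s) = 0"
proof -
  assume i: "i < N" "s \<in> {p i<..p (Suc i)}"
  have "s \<notin> {p j<..p (Suc j)}" if "j < N" "j \<noteq> i" for j
  proof (cases "j < i")
    case True
    then have "p (Suc j) \<le> p i" using i by (intro p_le) auto
    then show ?thesis using i by auto
  next
    case False
    then have "p (Suc i) \<le> p j" using that by (intro p_le) auto
    then show ?thesis using i by auto
  qed
  then have "(\<Sum>j<N. c j * indicator {p j<..p (Suc j)} s) = (\<Sum>j<N. if j = i then c i else 0)"
    using i by (intro sum.cong) (auto simp: indicator_def)
  then show "(\<Sum>j<N. c j * indicator {p j<..p (Suc j)} s) = c i" using i by simp
next
  assume s: "s \<notin> {0<..T}"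
  have "s \<notin> {p j<..p (Suc j)}" if "j < N" for j
    using p_in[of j] p_in[of "Suc j"] that s by auto
  then show "(\<Sum>j<N. c j * indicator {p j<..p (Suc j)} s) = 0" by (intro sum.neutral) auto
qed

lemma elementary_process_cell:
  assumes "i < N" "s \<in> {p i<..p (Suc i)}" "\<tau> ` {..n} \<subseteq> p ` {..N}"
  shows "elementary_process n \<tau> \<xi> s \<omega> = elementary_process n \<tau> \<xi> (p (Suc i)) \<omega>"
proof -
  have "(s \<in> {\<tau> j<..\<tau> (Suc j)}) = (p (Suc i) \<in> {\<tau> j<..\<tau> (Suc j)})" if "j < n" for j
  proof -
    have "\<tau> j \<in> \<tau> ` {..n}" "\<tau> (Suc j) \<in> \<tau> ` {..n}" using that by auto
    then have "\<tau> j \<in> p ` {..N}" "\<tau> (Suc j) \<in> p ` {..N}" using assms(3) by blast+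
    note in_cell_iff(1)[OF assms(1,2) this(1)] in_cell_iff(2)[OF assms(1,2) this(2)]
    then show ?thesis by (simp only: greaterThanAtMost_iff)
  qed
  then show ?thesis
    unfolding elementary_process_def by (intro sum.cong) (auto simp: indicator_def)
qed

text \<open>On a refinement containing \<open>u\<close>, stopping at \<open>u\<close> becomes a
  factor of the integrand and the increments over each coarse cell telescope. Integrals over
  different partitions thereby become sums over the same increments.\<close>

lemma elementary_integral_grid:
  assumes \<tau>: "\<And>i. i < n \<Longrightarrow> \<tau> i < \<tau> (Suc i)" "\<tau> ` {..n} \<subseteq> p ` {..N}" and u: "u \<in> p ` {..N}"
  shows "elementary_integral W n \<tau> \<xi> u \<omega> =
    (\<Sum>i<N. elementary_process n \<tau> \<xi> (p (Suc i)) \<omega> * indicator {..u} (p (Suc i)) * (W (p (Suc i)) \<omega> - W (p i) \<omega>))"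
proof -
  have "(\<Sum>i<N. elementary_process n \<tau> \<xi> (p (Suc i)) \<omega> * indicator {..u} (p (Suc i)) * (W (p (Suc i)) \<omega> - W (p i) \<omega>))
     = (\<Sum>j<n. \<xi> j \<omega> * (\<Sum>i<N. indicator {min (\<tau> j) u<..min (\<tau> (Suc j)) u} (p (Suc i)) * (W (p (Suc i)) \<omega> - W (p i) \<omega>)))"
  proof -
    have ind: "indicator {\<tau> j<..\<tau> (Suc j)} x * indicator {..u} x = (indicator {min (\<tau> j) u<..min (\<tau> (Suc j)) u} x :: real)" for j x
      by (auto simp: indicator_def min_def)
    have "(\<Sum>i<N. elementary_process n \<tau> \<xi> (p (Suc i)) \<omega> * indicator {..u} (p (Suc i)) * (W (p (Suc i)) \<omega> - W (p i) \<omega>))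
      = (\<Sum>i<N. \<Sum>j<n. \<xi> j \<omega> * ((indicator {\<tau> j<..\<tau> (Suc j)} (p (Suc i)) * indicator {..u} (p (Suc i))) * (W (p (Suc i)) \<omega> - W (p i) \<omega>)))"
      unfolding elementary_process_def sum_distrib_right by (simp only: mult.assoc)
    also have "\<dots> = (\<Sum>j<n. \<Sum>i<N. \<xi> j \<omega> * ((indicator {\<tau> j<..\<tau> (Suc j)} (p (Suc i)) * indicator {..u} (p (Suc i))) * (W (p (Suc i)) \<omega> - W (p i) \<omega>)))"
      by (rule sum.swap)
    finally show ?thesis unfolding ind sum_distrib_left .
  qed
  also have "\<dots> = (\<Sum>j<n. \<xi> j \<omega> * (W (min (\<tau> (Suc j)) u) \<omega> - W (min (\<tau> j) u) \<omega>))"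
  proof (intro sum.cong refl arg_cong2[where f="(*)"] telescope)
    fix j assume "j \<in> {..<n}"
    then have "\<tau> j \<in> p ` {..N}" "\<tau> (Suc j) \<in> p ` {..N}" "\<tau> j < \<tau> (Suc j)" using \<tau> by auto
    then show "min (\<tau> j) u \<in> p ` {..N}" "min (\<tau> (Suc j)) u \<in> p ` {..N}" "min (\<tau> j) u \<le> min (\<tau> (Suc j)) u"
      using u by (auto simp: min_def)
  qed
  finally show ?thesis unfolding elementary_integral_def by simp
qed

lemma nn_integral_cells:
  assumes f: "\<And>i s. i < N \<Longrightarrow> s \<in> {p i<..p (Suc i)} \<Longrightarrow> f s = c i"
  shows "(\<integral>\<^sup>+s\<in>{0..T}. f s \<partial>lborel) = (\<Sum>i<N. c i * ennreal (p (Suc i) - p i))"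
proof -
  have "(\<integral>\<^sup>+s\<in>{0..T}. f s \<partial>lborel) = (\<integral>\<^sup>+s. (\<Sum>i<N. c i * indicator {p i<..p (Suc i)} s) \<partial>lborel)"
  proof (rule nn_integral_cong_AE)
    \<comment> \<open>The cells miss time 0, the only point at which the two sides may
      differ.\<close>
    show "AE s in lborel. f s * indicator {0..T} s = (\<Sum>i<N. c i * indicator {p i<..p (Suc i)} s)"
      using AE_lborel_singleton[of 0]
    proof eventually_elim
      case (elim s)
      show ?case
      proof (cases "s \<in> {0<..T}")
        case True
        then obtain i where i: "i < N" "s \<in> {p i<..p (Suc i)}" by (rule ex_cell)
        show ?thesis using True by (simp add: cell_sum(1)[OF i] f[OF i])
      next
        case False
        then show ?thesis unfolding cell_sum(2)[OF False] using elim by (auto simp: indicator_def)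
      qed
    qed
  qed
  also have "\<dots> = (\<Sum>i<N. c i * ennreal (p (Suc i) - p i))"
    using p_less_Suc by (subst nn_integral_sum) (auto simp: nn_integral_cmult_indicator less_imp_le)
  finally show ?thesis .
qed

end

lemma ex_time_grid:
  fixes P :: "real set"
  assumes "finite P" "0 \<in> P" "T \<in> P" "P \<subseteq> {0..T}"
  obtains N p where "time_grid T N p" "p ` {..N} = P"
proof -
  define xs where "xs = sorted_list_of_set P"
  have xs: "sorted xs" "distinct xs" "set xs = P" using assms by (simp_all add: xs_def)
  have len: "length xs > 0" using xs(3) assms(2) by (cases xs) auto
  define N where "N = length xs - 1"
  have SN: "length xs = Suc N" using len by (simp add: N_def)
  have strict: "xs ! i < xs ! j" if "i < j" "j < length xs" for i j
    using sorted_wrt_nth_less[of "(<)" xs i j] strict_sorted_iff[of xs] xs that by simp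
  have im: "(\<lambda>i. xs ! i) ` {..N} = P"
  proof -
    have "{..N} = {..<length xs}" by (auto simp: SN)
    moreover have "(\<lambda>i. xs ! i) ` {..<length xs} = set xs" unfolding set_conv_nth by blast
    ultimately show ?thesis using xs(3) by simp
  qed
  have le: "xs ! i \<le> xs ! j" if "i \<le> j" "j \<le> N" for i j
    using that xs(1) by (auto simp: SN intro: sorted_nth_mono)
  show thesis
  proof (rule that[of N "\<lambda>i. xs ! i"])
    show "time_grid T N (\<lambda>i. xs ! i)"
    proof
      have "0 \<in> (\<lambda>i. xs ! i) ` {..N}" using im assms(2) by simp
      then obtain i where "i \<le> N" "xs ! i = 0" by auto
      then have "xs ! 0 \<le> 0" using le[of 0 i] by simp
      moreover have "xs ! 0 \<in> {0..T}" using im assms(4) by auto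
      ultimately show "xs ! 0 = 0" by simp
      have "T \<in> (\<lambda>i. xs ! i) ` {..N}" using im assms(3) by simp
      then obtain j where "j \<le> N" "xs ! j = T" by auto
      then have "T \<le> xs ! N" using le[of j N] by simp
      moreover have "xs ! N \<in> {0..T}" using im assms(4) by auto
      ultimately show "xs ! N = T" by simp
      show "xs ! i < xs ! Suc i" if "i < N" for i using that by (intro strict) (auto simp: SN)
    qed
  qed (rule im)
qed

section \<open>Brownian increments and the Ito isometry\<close>

lemma (in prob_space) indep_var_compose_of_indep_set:
  assumes "indep_set (sets F) (sets (vimage_algebra (space M) Y S))"
    and F: "subalgebra M F" and X: "X \<in> F \<rightarrow>\<^sub>M R" and Y: "Y \<in> M \<rightarrow>\<^sub>M S" and f: "f \<in> S \<rightarrow>\<^sub>M R'"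
  shows "indep_var R X R' (\<lambda>\<omega>. f (Y \<omega>))"
  unfolding indep_var_eq
proof (intro conjI)
  show "random_variable R X" by (rule measurable_from_subalg[OF F X])
  show "random_variable R' (\<lambda>\<omega>. f (Y \<omega>))" by (rule measurable_compose[OF Y f])
  have sp: "space F = space M" using F by (simp add: subalgebra_def)
  have "sigma_sets (space M) {X -` A \<inter> space M |A. A \<in> sets R} \<subseteq> sets F"
    unfolding sp[symmetric] using X by (intro sets.sigma_sets_subset) (auto intro: measurable_sets)
  moreover have "sigma_sets (space M) {(\<lambda>\<omega>. f (Y \<omega>)) -` A \<inter> space M |A. A \<in> sets R'}
      \<subseteq> sets (vimage_algebra (space M) Y S)"
  proof -
    have "(\<lambda>\<omega>. f (Y \<omega>)) \<in> vimage_algebra (space M) Y S \<rightarrow>\<^sub>M R'"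
      using Y by (intro measurable_compose[OF measurable_vimage_algebra1 f]) (auto dest: measurable_space)
    from measurable_sets[OF this] show ?thesis
      by (intro sets.sigma_sets_subset[of _ "vimage_algebra (space M) Y S", simplified]) auto
  qed
  ultimately show "indep_set (sigma_sets (space M) {X -` A \<inter> space M |A. A \<in> sets R})
      (sigma_sets (space M) {(\<lambda>\<omega>. f (Y \<omega>)) -` A \<inter> space M |A. A \<in> sets R'})"
    using assms(1) unfolding indep_sets2_eq by blast
qed

locale filtered_brownian_motion = prob_space M for M :: "'a measure" +
  fixes T :: real and G :: "real \<Rightarrow> 'a measure" and W :: "real \<Rightarrow> 'a \<Rightarrow> real"
  assumes filtration: "filtration_on M T G" and brownian: "brownian_motion_wrt M T G W"
begin

lemma G_sub: "t \<in> {0..T} \<Longrightarrow> subalgebra M (G t)"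
  using filtration by (auto simp: filtration_on_def)

lemma G_mono:
  assumes "0 \<le> s" "s \<le> t" "t \<le> T" "X \<in> borel_measurable (G s)"
  shows "X \<in> borel_measurable (G t)"
proof -
  have "subalgebra (G t) (G s)"
    using filtration G_sub[of s] G_sub[of t] assms by (auto simp: filtration_on_def subalgebra_def)
  then show ?thesis using assms(4) measurable_from_subalg by blast
qed

lemma G_imp_M: "t \<in> {0..T} \<Longrightarrow> X \<in> borel_measurable (G t) \<Longrightarrow> X \<in> borel_measurable M"
  using G_sub measurable_from_subalg by blast

lemma W_meas_G: "t \<in> {0..T} \<Longrightarrow> W t \<in> borel_measurable (G t)"
  using brownian by (auto simp: brownian_motion_wrt_def adapted_def)

lemma W_meas: "t \<in> {0..T} \<Longrightarrow> W t \<in> borel_measurable M"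
  using G_imp_M W_meas_G by blast

lemma increment_distributed:
  "0 \<le> s \<Longrightarrow> s < t \<Longrightarrow> t \<le> T \<Longrightarrow>
    distributed M lborel (\<lambda>\<omega>. W t \<omega> - W s \<omega>) (normal_density 0 (sqrt (t - s)))"
  using brownian by (auto simp: brownian_motion_wrt_def)

lemma increment_indep:
  assumes "0 \<le> s" "s < t" "t \<le> T" and X: "X \<in> G s \<rightarrow>\<^sub>M R" and f: "f \<in> borel \<rightarrow>\<^sub>M R'"
  shows "indep_var R X R' (\<lambda>\<omega>. f (W t \<omega> - W s \<omega>))"
proof (rule indep_var_compose_of_indep_set[where F="G s" and S=borel])
  show "indep_set (sets (G s)) (sets (vimage_algebra (space M) (\<lambda>\<omega>. W t \<omega> - W s \<omega>) borel))"
    using brownian assms by (auto simp: brownian_motion_wrt_def)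
  show "(\<lambda>\<omega>. W t \<omega> - W s \<omega>) \<in> borel_measurable M"
    using assms by (intro borel_measurable_diff W_meas) auto
qed (use assms G_sub in auto)

lemma increment_moments:
  assumes st: "0 \<le> s" "s < t" "t \<le> T"
  defines "D \<equiv> \<lambda>\<omega>. W t \<omega> - W s \<omega>"
  shows "integrable M D" "expectation D = 0"
    "integrable M (\<lambda>\<omega>. (D \<omega>)\<^sup>2)" "expectation (\<lambda>\<omega>. (D \<omega>)\<^sup>2) = t - s"
proof -
  have sd: "0 < sqrt (t - s)" using st by simp
  note dist = increment_distributed[OF st, folded D_def]
  show "integrable M D"
    using distributed_integrable[OF dist, of "\<lambda>x. x"] integrable_normal_moment_nz_1[OF sd, of 0] by simp
  show E: "expectation D = 0" using normal_distributed_expectation[OF sd dist] .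
  show "integrable M (\<lambda>\<omega>. (D \<omega>)\<^sup>2)"
    using distributed_integrable[OF dist, of "\<lambda>x. x\<^sup>2"] integrable_normal_moment[OF sd, of 0 2] by simp
  show "expectation (\<lambda>\<omega>. (D \<omega>)\<^sup>2) = t - s"
    using normal_distributed_variance[OF sd dist] E st by simp
qed

text \<open>The cross terms vanish because the next increment is centred and independent of the
  past. Measurability of the partial sum belongs to the induction, as it is what places that sum in
  the past.\<close>

lemma ito_isometry:
  assumes "time_grid T N p"
    and \<zeta>: "\<And>i. i < N \<Longrightarrow> \<zeta> i \<in> borel_measurable (G (p i))"
    and b: "\<And>i \<omega>. i < N \<Longrightarrow> \<omega> \<in> space M \<Longrightarrow> \<bar>\<zeta> i \<omega>\<bar> \<le> c"
    and n: "n \<le> N"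
  defines "I \<equiv> \<lambda>n \<omega>. \<Sum>i<n. \<zeta> i \<omega> * (W (p (Suc i)) \<omega> - W (p i) \<omega>)"
  shows "I n \<in> borel_measurable (G (p n)) \<and> integrable M (\<lambda>\<omega>. (I n \<omega>)\<^sup>2) \<and>
    expectation (\<lambda>\<omega>. (I n \<omega>)\<^sup>2) = expectation (\<lambda>\<omega>. \<Sum>i<n. (\<zeta> i \<omega>)\<^sup>2 * (p (Suc i) - p i))"
  using n
proof (induction n)
  case 0
  then show ?case by (simp add: I_def)
next
  case (Suc n)
  interpret time_grid T N p by fact
  have nN: "n < N" using Suc.prems by simp
  have st: "0 \<le> p n" "p n < p (Suc n)" "p (Suc n) \<le> T" "p n \<le> T"
    using p_in[of n] p_in[of "Suc n"] p_less_Suc[OF nN] nN by auto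
  define D where "D \<omega> = W (p (Suc n)) \<omega> - W (p n) \<omega>" for \<omega>
  note mom = increment_moments[OF st(1,2,3), folded D_def]
  have IH: "I n \<in> borel_measurable (G (p n))" "integrable M (\<lambda>\<omega>. (I n \<omega>)\<^sup>2)"
    "expectation (\<lambda>\<omega>. (I n \<omega>)\<^sup>2) = expectation (\<lambda>\<omega>. \<Sum>i<n. (\<zeta> i \<omega>)\<^sup>2 * (p (Suc i) - p i))"
    using Suc nN by auto
  have \<zeta>n: "\<zeta> n \<in> borel_measurable (G (p n))" using \<zeta> nN by simp
  have [measurable]: "I n \<in> borel_measurable M" "\<zeta> n \<in> borel_measurable M"
    using IH(1) \<zeta>n G_imp_M[of "p n"] st by auto
  have [measurable]: "W (p (Suc n)) \<in> borel_measurable M" "W (p n) \<in> borel_measurable M"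
    using st by (auto intro: W_meas)
  have [measurable]: "D \<in> borel_measurable M" unfolding D_def[abs_def] by measurable
  have I_Suc: "I (Suc n) \<omega> = I n \<omega> + \<zeta> n \<omega> * D \<omega>" for \<omega> by (simp add: I_def D_def)
  have b\<zeta>: "AE \<omega> in M. norm (\<zeta> n \<omega>) \<le> c" using b[OF nN] by auto
  have b\<zeta>2: "AE \<omega> in M. norm ((\<zeta> n \<omega>)\<^sup>2) \<le> c\<^sup>2"
    using b[OF nN] by (intro AE_I2) (metis abs_ge_zero abs_power2 power2_abs power_mono real_norm_def)
  have int_I: "integrable M (I n)"
    by (rule square_integrable_imp_integrable[OF _ IH(2)]) simp
  have int_I\<zeta>: "integrable M (\<lambda>\<omega>. I n \<omega> * \<zeta> n \<omega>)"
  proof (rule Bochner_Integration.integrable_bound[OF integrable_mult_right[OF int_I, of c]])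
    show "AE \<omega> in M. norm (I n \<omega> * \<zeta> n \<omega>) \<le> norm (c * I n \<omega>)"
      using b\<zeta>
    proof eventually_elim
      case (elim \<omega>)
      then have "\<bar>\<zeta> n \<omega>\<bar> * \<bar>I n \<omega>\<bar> \<le> \<bar>c\<bar> * \<bar>I n \<omega>\<bar>" by (intro mult_right_mono) auto
      then show ?case by (simp add: abs_mult mult.commute)
    qed
  qed simp
  have int_\<zeta>2: "integrable M (\<lambda>\<omega>. (\<zeta> n \<omega>)\<^sup>2)"
    by (rule integrable_const_bound[OF b\<zeta>2]) simp
  have m1: "(\<lambda>\<omega>. I n \<omega> * \<zeta> n \<omega>) \<in> borel_measurable (G (p n))"
    and m2: "(\<lambda>\<omega>. (\<zeta> n \<omega>)\<^sup>2) \<in> borel_measurable (G (p n))"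
    using IH(1) \<zeta>n by auto
  have ind1: "indep_var borel (\<lambda>\<omega>. I n \<omega> * \<zeta> n \<omega>) borel D"
    using increment_indep[OF st(1,2,3) m1, of "\<lambda>x. x" borel] by (simp add: D_def[abs_def])
  have ind2: "indep_var borel (\<lambda>\<omega>. (\<zeta> n \<omega>)\<^sup>2) borel (\<lambda>\<omega>. (D \<omega>)\<^sup>2)"
    using increment_indep[OF st(1,2,3) m2, of "\<lambda>x. x\<^sup>2" borel] by (simp add: D_def[abs_def])
  have cross: "integrable M (\<lambda>\<omega>. I n \<omega> * \<zeta> n \<omega> * D \<omega>)" "expectation (\<lambda>\<omega>. I n \<omega> * \<zeta> n \<omega> * D \<omega>) = 0"
    using indep_var_integrable[OF ind1 int_I\<zeta> mom(1)] indep_var_lebesgue_integral[OF ind1 int_I\<zeta> mom(1)] mom(2)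
    by simp_all
  have sq: "integrable M (\<lambda>\<omega>. (\<zeta> n \<omega>)\<^sup>2 * (D \<omega>)\<^sup>2)"
    "expectation (\<lambda>\<omega>. (\<zeta> n \<omega>)\<^sup>2 * (D \<omega>)\<^sup>2) = expectation (\<lambda>\<omega>. (\<zeta> n \<omega>)\<^sup>2) * (p (Suc n) - p n)"
    using indep_var_integrable[OF ind2 int_\<zeta>2 mom(3)] indep_var_lebesgue_integral[OF ind2 int_\<zeta>2 mom(3)] mom(4)
    by simp_all
  have expand: "(I (Suc n) \<omega>)\<^sup>2 = (I n \<omega>)\<^sup>2 + 2 * (I n \<omega> * \<zeta> n \<omega> * D \<omega>) + (\<zeta> n \<omega>)\<^sup>2 * (D \<omega>)\<^sup>2" for \<omega>
    unfolding I_Suc by (simp add: power2_eq_square algebra_simps)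
  have int_sum: "integrable M (\<lambda>\<omega>. \<Sum>i<n. (\<zeta> i \<omega>)\<^sup>2 * (p (Suc i) - p i))"
  proof (intro Bochner_Integration.integrable_sum integrable_mult_left)
    fix i assume "i \<in> {..<n}"
    then have iN: "i < N" using nN by simp
    show "integrable M (\<lambda>\<omega>. (\<zeta> i \<omega>)\<^sup>2)"
    proof (rule integrable_const_bound[of _ "c\<^sup>2"])
      show "AE \<omega> in M. norm ((\<zeta> i \<omega>)\<^sup>2) \<le> c\<^sup>2"
        using b[OF iN] by (intro AE_I2) (metis abs_ge_zero abs_power2 power2_abs power_mono real_norm_def)
      show "(\<lambda>\<omega>. (\<zeta> i \<omega>)\<^sup>2) \<in> borel_measurable M"
        using G_imp_M[OF _ \<zeta>[OF iN]] p_in[of i] iN by (intro borel_measurable_power) auto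
    qed
  qed
  show ?case
  proof (intro conjI)
    note mono = G_mono[OF st(1) less_imp_le[OF st(2)] st(3)]
    have [measurable]: "I n \<in> borel_measurable (G (p (Suc n)))" "\<zeta> n \<in> borel_measurable (G (p (Suc n)))"
      by (rule mono[OF IH(1)], rule mono[OF \<zeta>n])
    have [measurable]: "W (p n) \<in> borel_measurable (G (p (Suc n)))"
      "W (p (Suc n)) \<in> borel_measurable (G (p (Suc n)))"
      using st by (intro mono[OF W_meas_G] W_meas_G; simp)+
    show "I (Suc n) \<in> borel_measurable (G (p (Suc n)))"
      unfolding I_Suc[abs_def] D_def[abs_def] by measurable
    show "integrable M (\<lambda>\<omega>. (I (Suc n) \<omega>)\<^sup>2)"
      unfolding expand using IH(2) cross(1) sq(1) by simp
    show "expectation (\<lambda>\<omega>. (I (Suc n) \<omega>)\<^sup>2) = expectation (\<lambda>\<omega>. \<Sum>i<Suc n. (\<zeta> i \<omega>)\<^sup>2 * (p (Suc i) - p i))"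
      unfolding expand sum.lessThan_Suc using IH(2,3) cross sq int_sum int_\<zeta>2 by simp
  qed
qed

text \<open>Lenglart-type domination, by cutting the integrand off once its quadratic variation would
  exceed \<open>\<delta>\<close>.\<close>

lemma expectation_min_elementary_le:
  assumes grid: "time_grid T N p"
    and \<zeta>: "\<And>i. i < N \<Longrightarrow> \<zeta> i \<in> borel_measurable (G (p i))"
    and b: "\<And>i \<omega>. i < N \<Longrightarrow> \<omega> \<in> space M \<Longrightarrow> \<bar>\<zeta> i \<omega>\<bar> \<le> c"
    and \<delta>: "\<delta> > 0"
  shows "expectation (\<lambda>\<omega>. min 1 \<bar>\<Sum>i<N. \<zeta> i \<omega> * (W (p (Suc i)) \<omega> - W (p i) \<omega>)\<bar>)
    \<le> sqrt \<delta> + prob {\<omega> \<in> space M. (\<Sum>i<N. (\<zeta> i \<omega>)\<^sup>2 * (p (Suc i) - p i)) > \<delta>}"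
proof -
  interpret time_grid T N p by fact
  define Q where "Q n \<omega> = (\<Sum>i<n. (\<zeta> i \<omega>)\<^sup>2 * (p (Suc i) - p i))" for n \<omega>
  \<comment> \<open>The cut-off looks at \<open>Q (Suc i)\<close>, which includes cell
    \<open>i\<close> itself. This is still known at time \<open>p i\<close>, and it keeps the total
    at most \<open>\<delta>\<close> without an overshoot by the last cell.\<close>
  define \<eta> where "\<eta> i \<omega> = \<zeta> i \<omega> * indicator {\<omega>. Q (Suc i) \<omega> \<le> \<delta>} \<omega>" for i \<omega>
  define I where "I \<omega> = (\<Sum>i<N. \<zeta> i \<omega> * (W (p (Suc i)) \<omega> - W (p i) \<omega>))" for \<omega>
  define I' where "I' \<omega> = (\<Sum>i<N. \<eta> i \<omega> * (W (p (Suc i)) \<omega> - W (p i) \<omega>))" for \<omega>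
  have dp: "0 \<le> p (Suc i) - p i" if "i < N" for i using p_less_Suc[OF that] by simp
  have \<zeta>_G: "\<zeta> j \<in> borel_measurable (G (p i))" if "j \<le> i" "i < N" for i j
    using that p_in[of j] p_in[of i] by (intro G_mono[OF _ _ _ \<zeta>]) (auto intro: p_le)
  have \<eta>_G: "\<eta> i \<in> borel_measurable (G (p i))" if i: "i < N" for i
  proof -
    have [measurable]: "\<zeta> j \<in> borel_measurable (G (p i))" if "j \<in> {..<Suc i}" for j
      using that i by (intro \<zeta>_G) auto
    have [measurable]: "Q (Suc i) \<in> borel_measurable (G (p i))" unfolding Q_def[abs_def] by measurable
    have [measurable]: "\<zeta> i \<in> borel_measurable (G (p i))" by (rule \<zeta>[OF i])
    show ?thesis unfolding \<eta>_def[abs_def] by measurable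
  qed
  have \<eta>_b: "\<bar>\<eta> i \<omega>\<bar> \<le> c" if "i < N" "\<omega> \<in> space M" for i \<omega>
    using b[OF that] by (auto simp: \<eta>_def indicator_def)
  have Q_mono: "Q m \<omega> \<le> Q n \<omega>" if "m \<le> n" "n \<le> N" for m n \<omega>
    unfolding Q_def using that dp by (intro sum_mono2) auto
  have Q\<eta>: "(\<Sum>i<n. (\<eta> i \<omega>)\<^sup>2 * (p (Suc i) - p i)) \<le> \<delta>" if "n \<le> N" for n \<omega>
    using that
  proof (induction n)
    case (Suc n)
    show ?case
    proof (cases "Q (Suc n) \<omega> \<le> \<delta>")
      case True
      have "(\<Sum>i<Suc n. (\<eta> i \<omega>)\<^sup>2 * (p (Suc i) - p i)) \<le> Q (Suc n) \<omega>"
        unfolding Q_def using Suc.prems dp by (intro sum_mono mult_right_mono) (auto simp: \<eta>_def indicator_def)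
      with True show ?thesis by simp
    next
      case False
      then have "\<eta> n \<omega> = 0" by (simp add: \<eta>_def)
      then show ?thesis using Suc by simp
    qed
  qed (use \<delta> in simp)
  have ito: "I' \<in> borel_measurable (G (p N))" "integrable M (\<lambda>\<omega>. (I' \<omega>)\<^sup>2)"
    "expectation (\<lambda>\<omega>. (I' \<omega>)\<^sup>2) = expectation (\<lambda>\<omega>. \<Sum>i<N. (\<eta> i \<omega>)\<^sup>2 * (p (Suc i) - p i))"
    using ito_isometry[OF grid \<eta>_G \<eta>_b order_refl] unfolding I'_def[abs_def] by auto
  have TT: "p N \<in> {0..T}" using p_in by simp
  have [measurable]: "I' \<in> borel_measurable M" using G_imp_M[OF TT ito(1)] .
  have [measurable]: "\<zeta> i \<in> borel_measurable M" if "i \<in> {..<N}" for i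
    using that p_in[of i] by (intro G_imp_M[OF _ \<zeta>]) auto
  have [measurable]: "W (p i) \<in> borel_measurable M" "W (p (Suc i)) \<in> borel_measurable M" if "i \<in> {..<N}" for i
    using that p_in[of i] p_in[of "Suc i"] by (auto intro: W_meas)
  have [measurable]: "I \<in> borel_measurable M" unfolding I_def[abs_def] by measurable
  have [measurable]: "Q N \<in> borel_measurable M" unfolding Q_def[abs_def] by measurable
  have int_I': "integrable M I'"
    by (rule square_integrable_imp_integrable[OF _ ito(2)]) simp
  have "expectation (\<lambda>\<omega>. (I' \<omega>)\<^sup>2) \<le> \<delta>"
  proof -
    have "expectation (\<lambda>\<omega>. \<Sum>i<N. (\<eta> i \<omega>)\<^sup>2 * (p (Suc i) - p i)) \<le> expectation (\<lambda>\<omega>. \<delta>)"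
      using Q\<eta>[OF order_refl] \<delta> by (intro integral_mono_AE') auto
    then show ?thesis using ito(3) by (simp add: prob_space)
  qed
  \<comment> \<open>The inequality between arithmetic and geometric mean with weight
    \<open>sqrt \<delta>\<close> turns the second moment bound \<open>\<delta>\<close> into a first
    moment bound \<open>sqrt \<delta>\<close>.\<close>
  moreover have "expectation (\<lambda>\<omega>. \<bar>I' \<omega>\<bar>) \<le> expectation (\<lambda>\<omega>. (sqrt \<delta> + (I' \<omega>)\<^sup>2 / sqrt \<delta>) / 2)"
  proof (rule integral_mono)
    fix \<omega> assume "\<omega> \<in> space M"
    have "0 \<le> (sqrt \<delta> - \<bar>I' \<omega>\<bar>)\<^sup>2" by simp
    then have "2 * sqrt \<delta> * \<bar>I' \<omega>\<bar> \<le> sqrt \<delta> * sqrt \<delta> + (I' \<omega>)\<^sup>2"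
      by (simp add: power2_eq_square algebra_simps abs_mult_self_eq)
    then show "\<bar>I' \<omega>\<bar> \<le> (sqrt \<delta> + (I' \<omega>)\<^sup>2 / sqrt \<delta>) / 2" using \<delta> by (simp add: field_simps)
  qed (use int_I' ito(2) in auto)
  ultimately have E1: "expectation (\<lambda>\<omega>. \<bar>I' \<omega>\<bar>) \<le> sqrt \<delta>"
  proof -
    assume a: "expectation (\<lambda>\<omega>. (I' \<omega>)\<^sup>2) \<le> \<delta>"
      and le: "expectation (\<lambda>\<omega>. \<bar>I' \<omega>\<bar>) \<le> expectation (\<lambda>\<omega>. (sqrt \<delta> + (I' \<omega>)\<^sup>2 / sqrt \<delta>) / 2)"
    have "expectation (\<lambda>\<omega>. (sqrt \<delta> + (I' \<omega>)\<^sup>2 / sqrt \<delta>) / 2) = (sqrt \<delta> + expectation (\<lambda>\<omega>. (I' \<omega>)\<^sup>2) / sqrt \<delta>) / 2"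
      using ito(2) by (simp add: prob_space add_divide_distrib)
    also have "\<dots> \<le> (sqrt \<delta> + \<delta> / sqrt \<delta>) / 2"
      using a \<delta> by (intro divide_right_mono add_left_mono) auto
    also have "\<dots> = sqrt \<delta>" using \<delta> by (simp add: real_div_sqrt)
    finally show ?thesis using le by simp
  qed
  \<comment> \<open>Where the full quadratic variation is at most \<open>\<delta>\<close> nothing is
    cut off and \<open>I' = I\<close>; elsewhere the truncated value is at most 1, which the
    indicator pays for.\<close>
  have "expectation (\<lambda>\<omega>. min 1 \<bar>I \<omega>\<bar>) \<le> expectation (\<lambda>\<omega>. \<bar>I' \<omega>\<bar> + indicator {\<omega> \<in> space M. Q N \<omega> > \<delta>} \<omega>)"
  proof (rule integral_mono)
    show "integrable M (\<lambda>\<omega>. min 1 \<bar>I \<omega>\<bar>)" by (rule integrable_const_bound[of _ 1]) auto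
    show "integrable M (\<lambda>\<omega>. \<bar>I' \<omega>\<bar> + indicator {\<omega> \<in> space M. Q N \<omega> > \<delta>} \<omega>)"
      using int_I' by (intro Bochner_Integration.integrable_add) (auto simp: integrable_indicator_iff emeasure_eq_measure)
    fix \<omega> assume \<omega>: "\<omega> \<in> space M"
    show "min 1 \<bar>I \<omega>\<bar> \<le> \<bar>I' \<omega>\<bar> + indicator {\<omega> \<in> space M. Q N \<omega> > \<delta>} \<omega>"
    proof (cases "Q N \<omega> > \<delta>")
      case False
      then have "Q (Suc i) \<omega> \<le> \<delta>" if "i < N" for i using Q_mono[of "Suc i" N \<omega>] that by simp
      then have "I' \<omega> = I \<omega>" unfolding I_def I'_def by (intro sum.cong) (auto simp: \<eta>_def)
      then have "min 1 \<bar>I \<omega>\<bar> \<le> \<bar>I' \<omega>\<bar>" by simp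
      also have "\<dots> \<le> \<bar>I' \<omega>\<bar> + indicator {\<omega> \<in> space M. Q N \<omega> > \<delta>} \<omega>" by simp
      finally show ?thesis .
    qed (use \<omega> in auto)
  qed
  also have "\<dots> = expectation (\<lambda>\<omega>. \<bar>I' \<omega>\<bar>) + prob {\<omega> \<in> space M. Q N \<omega> > \<delta>}"
    using int_I' by (subst Bochner_Integration.integral_add) (auto simp: integrable_indicator_iff emeasure_eq_measure)
  finally show ?thesis using E1 unfolding I_def Q_def by simp
qed

end

section \<open>Sampling of measurable processes\<close>

lemma nn_integral_shift_interval:
  fixes f :: "real \<Rightarrow> ennreal"
  assumes [measurable]: "f \<in> borel_measurable borel"
  shows "(\<integral>\<^sup>+x\<in>{a..b}. f (x + r) \<partial>lborel) = (\<integral>\<^sup>+x\<in>{a + r..b + r}. f x \<partial>lborel)"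
proof -
  have "(\<integral>\<^sup>+x\<in>{a + r..b + r}. f x \<partial>lborel) = (\<integral>\<^sup>+x. f (r + 1 * x) * indicator {a + r..b + r} (r + 1 * x) \<partial>lborel)"
    using nn_integral_real_affine[of "\<lambda>x. f x * indicator {a + r..b + r} x" 1 r] by simp
  also have "\<dots> = (\<integral>\<^sup>+x\<in>{a..b}. f (x + r) \<partial>lborel)"
    by (intro nn_integral_cong) (auto simp: indicator_def add.commute)
  finally show ?thesis by simp
qed

text \<open>For a bounded continuous function this is dominated convergence, and a bounded
  measurable function is an almost everywhere limit of uniformly bounded continuous ones.\<close>

lemma translation_L1_continuous:
  fixes f :: "real \<Rightarrow> real"
  assumes f[measurable]: "f \<in> borel_measurable borel" and C: "\<And>x. \<bar>f x\<bar> \<le> C"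
    and r: "r \<longlonglongrightarrow> 0" "\<And>n. 0 \<le> r n" "\<And>n. r n \<le> (1::real)"
  shows "(\<lambda>n. \<integral>\<^sup>+x\<in>{a..b}. ennreal \<bar>f (x + r n) - f x\<bar> \<partial>lborel) \<longlonglongrightarrow> 0"
proof -
  have "f \<in> borel_measurable lebesgue" using f by (simp add: measurable_completion)
  then have "f measurable_on UNIV" by (intro lebesgue_measurable_imp_measurable_on_real) auto
  then obtain S g0 where S: "negligible S" and g0: "\<And>n. continuous_on UNIV (g0 n)"
    and g0_lim: "\<And>x. x \<notin> S \<Longrightarrow> (\<lambda>n. g0 n x) \<longlonglongrightarrow> f x"
    unfolding measurable_on_def by auto
  \<comment> \<open>Clipping at \<open>C\<close> preserves continuity and the limit
    \<open>f\<close>, and supplies a common dominating constant.\<close>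
  define g where "g n x = max (- C) (min C (g0 n x))" for n x
  have g_cont: "continuous_on UNIV (g n)" for n unfolding g_def by (intro continuous_intros g0)
  then have [measurable]: "g n \<in> borel_measurable borel" for n by (rule borel_measurable_continuous_onI)
  have C0: "0 \<le> C" using C[of 0] by simp
  have g_b: "\<bar>g n x\<bar> \<le> C" for n x using C0 by (auto simp: g_def)
  have AE_S: "AE x in lborel. x \<notin> S"
    using S unfolding negligible_iff_null_sets
    by (auto simp: AE_iff_null_sets null_sets_completion_iff2 elim!: AE_I' dest: AE_not_in)
  have g_lim: "AE x in lborel. (\<lambda>n. g n x) \<longlonglongrightarrow> f x"
    using AE_S
  proof eventually_elim
    case (elim x)
    have "(\<lambda>n. g n x) \<longlonglongrightarrow> max (- C) (min C (f x))"
      unfolding g_def by (intro tendsto_max tendsto_min tendsto_const g0_lim elim)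
    moreover have "max (- C) (min C (f x)) = f x" using C[of x] by auto
    ultimately show ?case by simp
  qed
  have fin: "(\<integral>\<^sup>+x. ennreal (2 * C) * indicator {c..d} x \<partial>lborel) < \<infinity>" for c d :: real
    by (cases "c \<le> d") (auto simp: nn_integral_cmult_indicator ennreal_mult_less_top)
  have "(\<lambda>n. \<integral>\<^sup>+x\<in>{a..b+1}. ennreal \<bar>g n x - f x\<bar> \<partial>lborel) \<longlonglongrightarrow> (\<integral>\<^sup>+x\<in>{a..b+1}. 0 \<partial>lborel)"
  proof (rule nn_integral_dominated_convergence[where w="\<lambda>x. ennreal (2 * C) * indicator {a..b+1} x", OF _ _ _ _ fin])
    show "AE x in lborel. ennreal \<bar>g n x - f x\<bar> * indicator {a..b+1} x \<le> ennreal (2 * C) * indicator {a..b+1} x" for n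
    proof (rule AE_I2)
      fix x show "ennreal \<bar>g n x - f x\<bar> * indicator {a..b+1} x \<le> ennreal (2 * C) * indicator {a..b+1} x"
        using g_b[of n x] C[of x] by (intro mult_right_mono ennreal_leI) auto
    qed
    show "AE x in lborel. (\<lambda>n. ennreal \<bar>g n x - f x\<bar> * indicator {a..b+1} x) \<longlonglongrightarrow> 0 * indicator {a..b+1} x"
      using g_lim
    proof eventually_elim
      case (elim x)
      then have "(\<lambda>n. \<bar>g n x - f x\<bar>) \<longlonglongrightarrow> \<bar>f x - f x\<bar>" by (intro tendsto_intros)
      then have "(\<lambda>n. ennreal \<bar>g n x - f x\<bar>) \<longlonglongrightarrow> 0"
        using tendsto_ennrealI by fastforce
      then show ?case by (cases "x \<in> {a..b+1}") auto
    qed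
  qed measurable
  then have g_L1: "(\<lambda>n. \<integral>\<^sup>+x\<in>{a..b+1}. ennreal \<bar>g n x - f x\<bar> \<partial>lborel) \<longlonglongrightarrow> 0" by simp
  have g_trans: "(\<lambda>n. \<integral>\<^sup>+x\<in>{a..b}. ennreal \<bar>g j (x + r n) - g j x\<bar> \<partial>lborel) \<longlonglongrightarrow> 0" for j
  proof -
    have "(\<lambda>n. \<integral>\<^sup>+x\<in>{a..b}. ennreal \<bar>g j (x + r n) - g j x\<bar> \<partial>lborel) \<longlonglongrightarrow> (\<integral>\<^sup>+x\<in>{a..b}. 0 \<partial>lborel)"
    proof (rule nn_integral_dominated_convergence[where w="\<lambda>x. ennreal (2 * C) * indicator {a..b} x", OF _ _ _ _ fin])
      show "AE x in lborel. ennreal \<bar>g j (x + r n) - g j x\<bar> * indicator {a..b} x \<le> ennreal (2 * C) * indicator {a..b} x" for n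
      proof (rule AE_I2)
        fix x show "ennreal \<bar>g j (x + r n) - g j x\<bar> * indicator {a..b} x \<le> ennreal (2 * C) * indicator {a..b} x"
          using g_b[of j x] g_b[of j "x + r n"] by (intro mult_right_mono ennreal_leI) auto
      qed
      show "AE x in lborel. (\<lambda>n. ennreal \<bar>g j (x + r n) - g j x\<bar> * indicator {a..b} x) \<longlonglongrightarrow> 0 * indicator {a..b} x"
      proof (rule AE_I2)
        fix x
        have "(\<lambda>n. x + r n) \<longlonglongrightarrow> x + 0" by (intro tendsto_intros r)
        then have "(\<lambda>n. g j (x + r n)) \<longlonglongrightarrow> g j (x + 0)"
          using g_cont[of j] by (intro isCont_tendsto_compose[of _ "g j"]) (simp_all add: continuous_on_eq_continuous_at)
        then have "(\<lambda>n. \<bar>g j (x + r n) - g j x\<bar>) \<longlonglongrightarrow> \<bar>g j (x + 0) - g j x\<bar>" by (intro tendsto_intros)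
        then have "(\<lambda>n. ennreal \<bar>g j (x + r n) - g j x\<bar>) \<longlonglongrightarrow> 0"
          using tendsto_ennrealI by fastforce
        then show "(\<lambda>n. ennreal \<bar>g j (x + r n) - g j x\<bar> * indicator {a..b} x) \<longlonglongrightarrow> 0 * indicator {a..b} x"
          by (cases "x \<in> {a..b}") auto
      qed
    qed measurable
    then show ?thesis by simp
  qed
  \<comment> \<open>The three-term estimate through \<open>g j\<close>. In the translated term the
    window is moved to \<open>{a + r n..b + r n}\<close>, which lies in \<open>{a..b+1}\<close>
    since \<open>r n \<le> 1\<close>; hence the factor 2 on the larger window.\<close>
  have bound: "(\<integral>\<^sup>+x\<in>{a..b}. ennreal \<bar>f (x + r n) - f x\<bar> \<partial>lborel)
      \<le> 2 * (\<integral>\<^sup>+x\<in>{a..b+1}. ennreal \<bar>g j x - f x\<bar> \<partial>lborel) + (\<integral>\<^sup>+x\<in>{a..b}. ennreal \<bar>g j (x + r n) - g j x\<bar> \<partial>lborel)" for n j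
  proof -
    let ?D = "\<lambda>x. ennreal \<bar>g j x - f x\<bar>" and ?E = "\<lambda>x. ennreal \<bar>g j (x + r n) - g j x\<bar>"
    have "(\<integral>\<^sup>+x\<in>{a..b}. ennreal \<bar>f (x + r n) - f x\<bar> \<partial>lborel)
      \<le> (\<integral>\<^sup>+x. (?D (x + r n) * indicator {a..b} x + ?D x * indicator {a..b} x) + ?E x * indicator {a..b} x \<partial>lborel)"
    proof (rule nn_integral_mono)
      fix x
      have "ennreal \<bar>f (x + r n) - f x\<bar> \<le> ?D (x + r n) + ?D x + ?E x"
        by (simp del: ennreal_plus add: ennreal_plus[symmetric])
      then show "ennreal \<bar>f (x + r n) - f x\<bar> * indicator {a..b} x \<le>
          (?D (x + r n) * indicator {a..b} x + ?D x * indicator {a..b} x) + ?E x * indicator {a..b} x"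
        by (auto simp: indicator_def)
    qed
    also have "\<dots> = ((\<integral>\<^sup>+x\<in>{a..b}. ?D (x + r n) \<partial>lborel) + (\<integral>\<^sup>+x\<in>{a..b}. ?D x \<partial>lborel)) + (\<integral>\<^sup>+x\<in>{a..b}. ?E x \<partial>lborel)"
      by (simp add: nn_integral_add)
    also have "(\<integral>\<^sup>+x\<in>{a..b}. ?D (x + r n) \<partial>lborel) = (\<integral>\<^sup>+x\<in>{a + r n..b + r n}. ?D x \<partial>lborel)"
      by (rule nn_integral_shift_interval) measurable
    also have "\<dots> \<le> (\<integral>\<^sup>+x\<in>{a..b+1}. ?D x \<partial>lborel)"
      using r(2)[of n] r(3)[of n] by (intro nn_integral_mono) (auto simp: indicator_def)
    also have "(\<integral>\<^sup>+x\<in>{a..b}. ?D x \<partial>lborel) \<le> (\<integral>\<^sup>+x\<in>{a..b+1}. ?D x \<partial>lborel)"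
      by (intro nn_integral_mono) (auto simp: indicator_def)
    finally show ?thesis by (simp add: mult_2 add_mono add_right_mono)
  qed
  show ?thesis
  proof (rule order_tendstoI)
    fix e :: ennreal assume "0 < e"
    then obtain e' :: real where e': "0 < e'" "ennreal e' < e"
      using dense[of 0 e] by (metis ennreal_cases ennreal_less_zero_iff less_top_ennreal order_less_imp_not_less top.not_eq_extremum)
    have "\<forall>\<^sub>F j in sequentially. (\<integral>\<^sup>+x\<in>{a..b+1}. ennreal \<bar>g j x - f x\<bar> \<partial>lborel) < ennreal (e' / 4)"
      using order_tendstoD(2)[OF g_L1] e' by simp
    then obtain j where j: "(\<integral>\<^sup>+x\<in>{a..b+1}. ennreal \<bar>g j x - f x\<bar> \<partial>lborel) < ennreal (e' / 4)"
      by (auto dest: eventually_happens)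
    have "\<forall>\<^sub>F n in sequentially. (\<integral>\<^sup>+x\<in>{a..b}. ennreal \<bar>g j (x + r n) - g j x\<bar> \<partial>lborel) < ennreal (e' / 2)"
      using order_tendstoD(2)[OF g_trans] e' by simp
    then show "\<forall>\<^sub>F n in sequentially. (\<integral>\<^sup>+x\<in>{a..b}. ennreal \<bar>f (x + r n) - f x\<bar> \<partial>lborel) < e"
    proof eventually_elim
      case (elim n)
      have "(\<integral>\<^sup>+x\<in>{a..b}. ennreal \<bar>f (x + r n) - f x\<bar> \<partial>lborel) \<le> 2 * ennreal (e' / 4) + ennreal (e' / 2)"
        by (rule order_trans[OF bound[of n j]]) (intro add_mono mult_left_mono less_imp_le elim j; simp)
      also have "\<dots> = ennreal e'"
        using e' by (simp add: ennreal_plus[symmetric] mult_2 del: ennreal_plus)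
      finally show ?case using e' by simp
    qed
  qed simp
qed

lemma (in time_grid) nn_integral_split:
  assumes [measurable]: "f \<in> borel_measurable borel"
  shows "(\<integral>\<^sup>+s\<in>{0..T}. f s \<partial>lborel) = (\<Sum>i<N. \<integral>\<^sup>+s\<in>{p i<..p (Suc i)}. f s \<partial>lborel)"
proof -
  have "(\<integral>\<^sup>+s\<in>{0..T}. f s \<partial>lborel) = (\<integral>\<^sup>+s. (\<Sum>i<N. f s * indicator {p i<..p (Suc i)} s) \<partial>lborel)"
  proof (rule nn_integral_cong_AE)
    show "AE s in lborel. f s * indicator {0..T} s = (\<Sum>i<N. f s * indicator {p i<..p (Suc i)} s)"
      using AE_lborel_singleton[of 0]
    proof eventually_elim
      case (elim s)
      show ?case
      proof (cases "s \<in> {0<..T}")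
        case True
        then obtain i where i: "i < N" "s \<in> {p i<..p (Suc i)}" by (rule ex_cell)
        show ?thesis unfolding cell_sum(1)[OF i] using True by (auto simp: indicator_def)
      next
        case False
        then show ?thesis unfolding cell_sum(2)[OF False] using elim by (auto simp: indicator_def)
      qed
    qed
  qed
  also have "\<dots> = (\<Sum>i<N. \<integral>\<^sup>+s\<in>{p i<..p (Suc i)}. f s \<partial>lborel)"
    by (rule nn_integral_sum) measurable
  finally show ?thesis .
qed

lemma (in time_grid) elementary_process_on_cell:
  "i < N \<Longrightarrow> s \<in> {p i<..p (Suc i)} \<Longrightarrow> elementary_process N p \<xi> s \<omega> = \<xi> i \<omega>"
  "s \<notin> {0<..T} \<Longrightarrow> elementary_process N p \<xi> s \<omega> = 0"
  unfolding elementary_process_def by (rule cell_sum, assumption+)+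

text \<open>Fubini reduces the claim to single paths. A failure would give a sequence of shifts
  tending to 0 with errors above \<open>e\<close>, which dominated convergence over the paths
  excludes.\<close>

lemma (in prob_space) translation_L1_continuous_product:
  fixes Q :: "real \<times> 'a \<Rightarrow> real"
  assumes Q[measurable]: "Q \<in> borel_measurable (borel \<Otimes>\<^sub>M M)" and C: "\<And>z. \<bar>Q z\<bar> \<le> C" and e: "e > (0::real)"
  shows "\<exists>\<delta>>0. \<forall>r. 0 \<le> r \<and> r \<le> \<delta> \<longrightarrow>
    (\<integral>\<^sup>+x\<in>{a..b}. (\<integral>\<^sup>+\<omega>. ennreal \<bar>Q (x + r, \<omega>) - Q (x, \<omega>)\<bar> \<partial>M) \<partial>lborel) \<le> ennreal e"
proof (rule ccontr)
  interpret P: pair_sigma_finite lborel M ..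
  define \<Phi> where "\<Phi> r = (\<integral>\<^sup>+x\<in>{a..b}. (\<integral>\<^sup>+\<omega>. ennreal \<bar>Q (x + r, \<omega>) - Q (x, \<omega>)\<bar> \<partial>M) \<partial>lborel)" for r
  assume "\<not> ?thesis"
  then have neg: "\<exists>r. 0 \<le> r \<and> r \<le> \<delta> \<and> ennreal e < \<Phi> r" if "\<delta> > 0" for \<delta>
    using that by (auto simp: not_le \<Phi>_def)
  have "\<exists>r. 0 \<le> r \<and> r \<le> 1 / real (Suc n) \<and> ennreal e < \<Phi> r" for n
    by (rule neg) simp
  then obtain r where r: "0 \<le> r n" "r n \<le> 1 / real (Suc n)" "ennreal e < \<Phi> (r n)" for n by metis
  have r0: "r \<longlonglongrightarrow> 0"
    by (rule tendsto_sandwich[where f="\<lambda>_. 0" and h="\<lambda>n. 1 / real (Suc n)"])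
       (use r LIMSEQ_inverse_real_of_nat in \<open>auto simp: inverse_eq_divide\<close>)
  have r1: "r n \<le> 1" for n
    using r(2)[of n] by (rule order_trans) simp
  have C0: "0 \<le> C" using C[of undefined] by linarith
  have [measurable]: "(\<lambda>x. Q (x, \<omega>)) \<in> borel_measurable borel" if "\<omega> \<in> space M" for \<omega>
    using that by measurable
  have swap: "\<Phi> s = (\<integral>\<^sup>+\<omega>. (\<integral>\<^sup>+x\<in>{a..b}. ennreal \<bar>Q (x + s, \<omega>) - Q (x, \<omega>)\<bar> \<partial>lborel) \<partial>M)" for s
  proof -
    have "\<Phi> s = (\<integral>\<^sup>+x. (\<integral>\<^sup>+\<omega>. ennreal \<bar>Q (x + s, \<omega>) - Q (x, \<omega>)\<bar> * indicator {a..b} x \<partial>M) \<partial>lborel)"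
      unfolding \<Phi>_def by (intro nn_integral_cong nn_integral_multc[symmetric]) measurable
    also have "\<dots> = (\<integral>\<^sup>+\<omega>. (\<integral>\<^sup>+x. ennreal \<bar>Q (x + s, \<omega>) - Q (x, \<omega>)\<bar> * indicator {a..b} x \<partial>lborel) \<partial>M)"
      by (rule P.Fubini'[symmetric]) measurable
    finally show ?thesis .
  qed
  have "(\<lambda>n. \<Phi> (r n)) \<longlonglongrightarrow> (\<integral>\<^sup>+\<omega>. 0 \<partial>M)"
    unfolding swap
  proof (rule nn_integral_dominated_convergence[where w="\<lambda>_. ennreal (2 * C) * emeasure lborel {a..b}"])
    show "AE \<omega> in M. (\<integral>\<^sup>+x\<in>{a..b}. ennreal \<bar>Q (x + r n, \<omega>) - Q (x, \<omega>)\<bar> \<partial>lborel) \<le> ennreal (2 * C) * emeasure lborel {a..b}" for n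
    proof (rule AE_I2)
      fix \<omega>
      have "(\<integral>\<^sup>+x\<in>{a..b}. ennreal \<bar>Q (x + r n, \<omega>) - Q (x, \<omega>)\<bar> \<partial>lborel) \<le> (\<integral>\<^sup>+x\<in>{a..b}. ennreal (2 * C) \<partial>lborel)"
      proof (intro nn_integral_mono mult_right_mono ennreal_leI)
        fix x show "\<bar>Q (x + r n, \<omega>) - Q (x, \<omega>)\<bar> \<le> 2 * C"
          using C[of "(x + r n, \<omega>)"] C[of "(x, \<omega>)"] by linarith
      qed simp
      then show "(\<integral>\<^sup>+x\<in>{a..b}. ennreal \<bar>Q (x + r n, \<omega>) - Q (x, \<omega>)\<bar> \<partial>lborel) \<le> ennreal (2 * C) * emeasure lborel {a..b}"
        by (simp add: nn_integral_cmult_indicator)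
    qed
    show "AE \<omega> in M. (\<lambda>n. \<integral>\<^sup>+x\<in>{a..b}. ennreal \<bar>Q (x + r n, \<omega>) - Q (x, \<omega>)\<bar> \<partial>lborel) \<longlonglongrightarrow> 0"
    proof (rule AE_I2)
      fix \<omega> assume [simp]: "\<omega> \<in> space M"
      show "(\<lambda>n. \<integral>\<^sup>+x\<in>{a..b}. ennreal \<bar>Q (x + r n, \<omega>) - Q (x, \<omega>)\<bar> \<partial>lborel) \<longlonglongrightarrow> 0"
        by (rule translation_L1_continuous[of "\<lambda>x. Q (x, \<omega>)" C]) (use C r0 r r1 in auto)
    qed
    show "(\<integral>\<^sup>+\<omega>. ennreal (2 * C) * emeasure lborel {a..b} \<partial>M) < \<infinity>"
      by (cases "a \<le> b") (auto simp: ennreal_mult_less_top emeasure_space_1)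
  qed measurable
  then have "\<forall>\<^sub>F n in sequentially. \<Phi> (r n) < ennreal e"
    using e by (intro order_tendstoD) auto
  then obtain n where "\<Phi> (r n) < ennreal e" by (auto dest: eventually_happens)
  with r(3)[of n] show False by simp
qed

text \<open>The process is sampled at the left end points of a shifted equidistant grid. The sampling error
  averaged over the shift is a mean of translation errors, hence small for some shift.\<close>

lemma (in prob_space) ex_grid_sampling:
  fixes Q :: "real \<times> 'a \<Rightarrow> real"
  assumes Q[measurable]: "Q \<in> borel_measurable (borel \<Otimes>\<^sub>M M)" and C: "\<And>z. \<bar>Q z\<bar> \<le> C"
    and T: "T > 0" and e: "e > 0"
  obtains n \<tau> where "time_grid T n \<tau>"
    "(\<integral>\<^sup>+\<omega>. (\<integral>\<^sup>+s\<in>{0..T}. ennreal \<bar>elementary_process n \<tau> (\<lambda>i \<omega>. Q (\<tau> i, \<omega>)) s \<omega> - Q (s, \<omega>)\<bar> \<partial>lborel) \<partial>M) \<le> ennreal e"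
proof -
  interpret P: pair_sigma_finite lborel M ..
  define \<phi> where "\<phi> r x = (\<integral>\<^sup>+\<omega>. ennreal \<bar>Q (x + r, \<omega>) - Q (x, \<omega>)\<bar> \<partial>M)" for r x
  have [measurable]: "case_prod \<phi> \<in> borel_measurable (borel \<Otimes>\<^sub>M borel)"
    unfolding \<phi>_def[abs_def] by measurable
  have C0: "0 \<le> C" using C[of undefined] by linarith
  obtain \<delta> where \<delta>: "\<delta> > 0" "\<And>r. 0 \<le> r \<Longrightarrow> r \<le> \<delta> \<Longrightarrow> (\<integral>\<^sup>+x\<in>{0..T}. \<phi> r x \<partial>lborel) \<le> ennreal (e/4)"
    using translation_L1_continuous_product[OF Q C, of "e/4" 0 T] e unfolding \<phi>_def by auto
  \<comment> \<open>The mesh \<open>d\<close> will lie below \<open>\<eta>\<close>. The bound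
    \<open>\<delta>\<close> admits the translation estimate; the other bound makes the first cell,
    where only the crude estimate \<open>2 * C\<close> is available, cost at most
    \<open>e / 4\<close>.\<close>
  define \<eta> where "\<eta> = min \<delta> (e / (8 * C + 8))"
  have \<eta>: "\<eta> > 0" using \<delta> e C0 by (simp add: \<eta>_def)
  obtain N' where "T / \<eta> < real N'" using reals_Archimedean2 by blast
  define N where "N = Suc N'"
  define d where "d = T / real N"
  have N: "N > 0" "T / \<eta> < real N" using \<open>T / \<eta> < real N'\<close> by (simp_all add: N_def)
  have d: "d > 0" "d \<le> \<delta>" "real N * d = T"
  proof -
    show "d > 0" "real N * d = T" using T N by (auto simp: d_def)
    have "d < \<eta>" using T N \<eta> by (simp add: d_def field_simps)
    then show "d \<le> \<delta>" by (simp add: \<eta>_def)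
  qed
  have d2: "2 * C * d \<le> e / 4"
  proof -
    have "d < \<eta>" using T N \<eta> by (simp add: d_def field_simps)
    then have "d \<le> e / (8 * C + 8)" by (simp add: \<eta>_def)
    then have "2 * C * d \<le> 2 * C * (e / (8 * C + 8))" using C0 by (intro mult_left_mono) auto
    also have "\<dots> \<le> e / 4" using C0 e by (simp add: field_simps)
    finally show ?thesis .
  qed
  \<comment> \<open>The end points 0 and \<open>T\<close> stay fixed and \<open>N\<close> interior
    nodes are shifted by \<open>\<theta>\<close>. The first cell has length \<open>\<theta>\<close>
    and the last one \<open>d - \<theta>\<close>, so all cells have length at most
    \<open>d\<close>.\<close>
  define \<tau> where "\<tau> \<theta> j = (if j = 0 then 0 else if j = Suc N then T else \<theta> + real (j - 1) * d)" for \<theta> j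
  have grid: "time_grid T (Suc N) (\<tau> \<theta>)" if "0 < \<theta>" "\<theta> < d" for \<theta>
  proof
    fix i assume "i < Suc N"
    then consider "i = 0" | "i = N" "i \<noteq> 0" | "0 < i" "i < N" by linarith
    then show "\<tau> \<theta> i < \<tau> \<theta> (Suc i)"
    proof cases
      case 2
      have "\<theta> + (real N - 1) * d < T" using that d(3) by (simp add: algebra_simps)
      then show ?thesis using 2 N by (simp add: \<tau>_def of_nat_diff)
    next
      case 3
      then show ?thesis using d by (simp add: \<tau>_def of_nat_diff algebra_simps)
    qed (use that N in \<open>auto simp: \<tau>_def\<close>)
  qed (auto simp: \<tau>_def)
  define Err where "Err \<theta> = (\<integral>\<^sup>+\<omega>. (\<integral>\<^sup>+s\<in>{0..T}. ennreal \<bar>elementary_process (Suc N) (\<tau> \<theta>) (\<lambda>i \<omega>. Q (\<tau> \<theta> i, \<omega>)) s \<omega> - Q (s, \<omega>)\<bar> \<partial>lborel) \<partial>M)" for \<theta>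
  define A where "A \<theta> = (\<Sum>i<N. \<integral>\<^sup>+r\<in>{0..d}. \<phi> r (\<theta> + real i * d) \<partial>lborel)" for \<theta>
  have [measurable]: "A \<in> borel_measurable borel" unfolding A_def[abs_def] by measurable
  have Err_le: "Err \<theta> \<le> ennreal (2 * C * d) + A \<theta>" if \<theta>: "0 < \<theta>" "\<theta> < d" for \<theta>
  proof -
    interpret time_grid T "Suc N" "\<tau> \<theta>" by (rule grid[OF \<theta>])
    let ?S = "elementary_process (Suc N) (\<tau> \<theta>) (\<lambda>i \<omega>. Q (\<tau> \<theta> i, \<omega>))"
    let ?c = "\<lambda>i \<omega>. \<integral>\<^sup>+s\<in>{\<tau> \<theta> i<..\<tau> \<theta> (Suc i)}. ennreal \<bar>Q (\<tau> \<theta> i, \<omega>) - Q (s, \<omega>)\<bar> \<partial>lborel"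
    have "(\<integral>\<^sup>+s\<in>{0..T}. ennreal \<bar>?S s \<omega> - Q (s, \<omega>)\<bar> \<partial>lborel) = (\<Sum>i<Suc N. ?c i \<omega>)" if [simp]: "\<omega> \<in> space M" for \<omega>
    proof -
      have [measurable]: "(\<lambda>s. ?S s \<omega>) \<in> borel_measurable borel"
        unfolding elementary_process_def by measurable
      have "(\<integral>\<^sup>+s\<in>{0..T}. ennreal \<bar>?S s \<omega> - Q (s, \<omega>)\<bar> \<partial>lborel)
        = (\<Sum>i<Suc N. \<integral>\<^sup>+s\<in>{\<tau> \<theta> i<..\<tau> \<theta> (Suc i)}. ennreal \<bar>?S s \<omega> - Q (s, \<omega>)\<bar> \<partial>lborel)"
        by (rule nn_integral_split) measurable
      also have "\<dots> = (\<Sum>i<Suc N. ?c i \<omega>)"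
        by (intro sum.cong nn_integral_cong refl) (auto simp: indicator_def elementary_process_on_cell(1))
      finally show ?thesis .
    qed
    then have "Err \<theta> = (\<integral>\<^sup>+\<omega>. (\<Sum>i<Suc N. ?c i \<omega>) \<partial>M)"
      unfolding Err_def by (rule nn_integral_cong)
    also have "\<dots> = (\<Sum>i<Suc N. \<integral>\<^sup>+\<omega>. ?c i \<omega> \<partial>M)"
      by (rule nn_integral_sum) measurable
    also have "\<dots> = (\<integral>\<^sup>+\<omega>. ?c 0 \<omega> \<partial>M) + (\<Sum>i<N. \<integral>\<^sup>+\<omega>. ?c (Suc i) \<omega> \<partial>M)"
      by (rule sum.lessThan_Suc_shift)
    also have "\<dots> \<le> ennreal (2 * C * d) + A \<theta>"
    proof (rule add_mono)
      have "(\<integral>\<^sup>+\<omega>. ?c 0 \<omega> \<partial>M) \<le> (\<integral>\<^sup>+\<omega>. ennreal (2 * C * d) \<partial>M)"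
      proof (rule nn_integral_mono)
        fix \<omega>
        have "?c 0 \<omega> \<le> (\<integral>\<^sup>+s. ennreal (2 * C) * indicator {0..d} s \<partial>lborel)"
        proof (intro nn_integral_mono)
          fix s
          have "\<bar>Q (\<tau> \<theta> 0, \<omega>) - Q (s, \<omega>)\<bar> \<le> 2 * C"
            using C[of "(\<tau> \<theta> 0, \<omega>)"] C[of "(s, \<omega>)"] by linarith
          then show "ennreal \<bar>Q (\<tau> \<theta> 0, \<omega>) - Q (s, \<omega>)\<bar> * indicator {\<tau> \<theta> 0<..\<tau> \<theta> (Suc 0)} s \<le> ennreal (2 * C) * indicator {0..d} s"
            using \<theta> N by (auto simp: indicator_def \<tau>_def intro!: ennreal_leI)
        qed
        then show "?c 0 \<omega> \<le> ennreal (2 * C * d)"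
          using d C0 by (simp add: nn_integral_cmult_indicator ennreal_mult)
      qed
      then show "(\<integral>\<^sup>+\<omega>. ?c 0 \<omega> \<partial>M) \<le> ennreal (2 * C * d)" by (simp add: emeasure_space_1)
      show "(\<Sum>i<N. \<integral>\<^sup>+\<omega>. ?c (Suc i) \<omega> \<partial>M) \<le> A \<theta>"
        unfolding A_def
      proof (rule sum_mono)
        fix i assume i: "i \<in> {..<N}"
        let ?t = "\<theta> + real i * d"
        have t: "\<tau> \<theta> (Suc i) = ?t" using i by (auto simp: \<tau>_def)
        have t': "\<tau> \<theta> (Suc (Suc i)) \<le> ?t + d"
        proof (cases "Suc (Suc i) = Suc N")
          case True
          then have "T = (real i + 1) * d" using d(3) by auto
          then show ?thesis using True \<theta> by (simp add: \<tau>_def algebra_simps)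
        qed (auto simp: \<tau>_def algebra_simps)
        have "(\<integral>\<^sup>+\<omega>. ?c (Suc i) \<omega> \<partial>M) \<le> (\<integral>\<^sup>+\<omega>. (\<integral>\<^sup>+r\<in>{0..d}. ennreal \<bar>Q (?t + r, \<omega>) - Q (?t, \<omega>)\<bar> \<partial>lborel) \<partial>M)"
        proof (rule nn_integral_mono)
          fix \<omega> assume [simp]: "\<omega> \<in> space M"
          have "?c (Suc i) \<omega> \<le> (\<integral>\<^sup>+s\<in>{0 + ?t..d + ?t}. ennreal \<bar>Q (?t, \<omega>) - Q (s, \<omega>)\<bar> \<partial>lborel)"
            unfolding t using t' by (intro nn_integral_mono) (auto simp: indicator_def)
          also have "\<dots> = (\<integral>\<^sup>+r\<in>{0..d}. ennreal \<bar>Q (?t, \<omega>) - Q (r + ?t, \<omega>)\<bar> \<partial>lborel)"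
            by (rule nn_integral_shift_interval[symmetric]) measurable
          finally show "?c (Suc i) \<omega> \<le> (\<integral>\<^sup>+r\<in>{0..d}. ennreal \<bar>Q (?t + r, \<omega>) - Q (?t, \<omega>)\<bar> \<partial>lborel)"
            by (simp add: add.commute[of ?t] abs_minus_commute)
        qed
        also have "\<dots> = (\<integral>\<^sup>+r. (\<integral>\<^sup>+\<omega>. ennreal \<bar>Q (?t + r, \<omega>) - Q (?t, \<omega>)\<bar> * indicator {0..d} r \<partial>M) \<partial>lborel)"
          by (rule P.Fubini') measurable
        also have "\<dots> = (\<integral>\<^sup>+r\<in>{0..d}. \<phi> r ?t \<partial>lborel)"
          unfolding \<phi>_def by (intro nn_integral_cong nn_integral_multc) measurable
        finally show "(\<integral>\<^sup>+\<omega>. ?c (Suc i) \<omega> \<partial>M) \<le> (\<integral>\<^sup>+r\<in>{0..d}. \<phi> r ?t \<partial>lborel)" .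
      qed
    qed
    finally show ?thesis .
  qed
  \<comment> \<open>As \<open>\<theta>\<close> runs through \<open>(0, d)\<close>, the nodes
    \<open>\<theta> + real i * d\<close> sweep \<open>{0..T}\<close> once, so for each
    \<open>r\<close> the sum over the cells integrates to at most the translation error
    \<open>e / 4\<close>. Integration over \<open>r\<close> adds the factor \<open>d\<close>, and
    therefore some \<open>\<theta>\<close> satisfies \<open>A \<theta> \<le> e / 2\<close>.\<close>
  have A_int: "(\<integral>\<^sup>+\<theta>\<in>{0<..<d}. A \<theta> \<partial>lborel) \<le> ennreal (e/4 * d)"
  proof -
    have "(\<integral>\<^sup>+\<theta>\<in>{0<..<d}. A \<theta> \<partial>lborel)
        = (\<integral>\<^sup>+\<theta>. (\<integral>\<^sup>+r. (\<Sum>i<N. \<phi> r (\<theta> + real i * d)) * indicator {0..d} r * indicator {0<..<d} \<theta> \<partial>lborel) \<partial>lborel)"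
    proof (rule nn_integral_cong)
      fix \<theta> :: real
      have "(\<integral>\<^sup>+r. (\<Sum>i<N. \<phi> r (\<theta> + real i * d)) * indicator {0..d} r * indicator {0<..<d} \<theta> \<partial>lborel)
          = (\<integral>\<^sup>+r. (\<Sum>i<N. \<phi> r (\<theta> + real i * d)) * indicator {0..d} r \<partial>lborel) * indicator {0<..<d} \<theta>"
        by (rule nn_integral_multc) measurable
      also have "(\<integral>\<^sup>+r. (\<Sum>i<N. \<phi> r (\<theta> + real i * d)) * indicator {0..d} r \<partial>lborel) = A \<theta>"
        unfolding A_def sum_distrib_right by (rule nn_integral_sum) measurable
      finally show "A \<theta> * indicator {0<..<d} \<theta> =
          (\<integral>\<^sup>+r. (\<Sum>i<N. \<phi> r (\<theta> + real i * d)) * indicator {0..d} r * indicator {0<..<d} \<theta> \<partial>lborel)" by simp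
    qed
    also have "\<dots> = (\<integral>\<^sup>+r. (\<integral>\<^sup>+\<theta>. (\<Sum>i<N. \<phi> r (\<theta> + real i * d)) * indicator {0..d} r * indicator {0<..<d} \<theta> \<partial>lborel) \<partial>lborel)"
      by (rule lborel_pair.Fubini'[symmetric]) measurable
    also have "\<dots> \<le> (\<integral>\<^sup>+r. ennreal (e/4) * indicator {0..d} r \<partial>lborel)"
    proof (rule nn_integral_mono)
      fix r :: real
      have "(\<integral>\<^sup>+\<theta>\<in>{0<..<d}. (\<Sum>i<N. \<phi> r (\<theta> + real i * d)) \<partial>lborel)
          = (\<Sum>i<N. \<integral>\<^sup>+\<theta>\<in>{0<..<d}. \<phi> r (\<theta> + real i * d) \<partial>lborel)"
        unfolding sum_distrib_right by (rule nn_integral_sum) measurable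
      also have "\<dots> = (\<Sum>i<N. \<integral>\<^sup>+x. \<phi> r x * indicator {real i * d<..<real i * d + d} x \<partial>lborel)"
      proof (rule sum.cong[OF refl])
        fix i
        show "(\<integral>\<^sup>+\<theta>\<in>{0<..<d}. \<phi> r (\<theta> + real i * d) \<partial>lborel) = (\<integral>\<^sup>+x. \<phi> r x * indicator {real i * d<..<real i * d + d} x \<partial>lborel)"
          using nn_integral_real_affine[of "\<lambda>x. \<phi> r x * indicator {real i * d<..<real i * d + d} x" 1 "real i * d"]
          by (auto intro!: nn_integral_cong simp: indicator_def add.commute)
      qed
      also have "\<dots> = (\<integral>\<^sup>+x. \<phi> r x * (\<Sum>i<N. indicator {real i * d<..<real i * d + d} x) \<partial>lborel)"
        unfolding sum_distrib_left by (rule nn_integral_sum[symmetric]) measurable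
      also have "\<dots> \<le> (\<integral>\<^sup>+x\<in>{0..T}. \<phi> r x \<partial>lborel)"
      proof (intro nn_integral_mono mult_left_mono)
        fix x
        show "(\<Sum>i<N. indicator {real i * d<..<real i * d + d} x) \<le> (indicator {0..T} x :: ennreal)"
        proof (cases "\<exists>i<N. x \<in> {real i * d<..<real i * d + d}")
          case True
          then obtain i where i: "i < N" "x \<in> {real i * d<..<real i * d + d}" by blast
          have "x \<notin> {real j * d<..<real j * d + d}" if "j \<noteq> i" for j
          proof
            assume "x \<in> {real j * d<..<real j * d + d}"
            with i have "real j * d < (real i + 1) * d" "real i * d < (real j + 1) * d"
              by (auto simp: algebra_simps)
            then have "real j < real i + 1" "real i < real j + 1"
              using d(1) by (simp_all add: mult_less_cancel_right)
            with that show False by linarith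
          qed
          then have "(\<Sum>j<N. indicator {real j * d<..<real j * d + d} x) = (\<Sum>j<N. if j = i then 1 else 0 :: ennreal)"
            using i by (intro sum.cong) (auto simp: indicator_def)
          also have "\<dots> = 1" using i by simp
          finally have "(\<Sum>j<N. indicator {real j * d<..<real j * d + d} x) = (1 :: ennreal)" .
          moreover have "x \<in> {0..T}"
          proof -
            have "real i * d + d \<le> T"
            proof -
              have "real (Suc i) * d \<le> real N * d" using i(1) d(1) by (intro mult_right_mono) auto
              then show ?thesis using d(3) by (simp add: algebra_simps)
            qed
            moreover have "0 \<le> real i * d" using d by simp
            moreover have "real i * d < x" "x < real i * d + d" using i(2) by auto
            ultimately have "0 \<le> x" "x \<le> T" by linarith+
            then show ?thesis by simp
          qed
          ultimately show ?thesis by simp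
        next
          case False
          then have "(\<Sum>j<N. indicator {real j * d<..<real j * d + d} x) = (0::ennreal)"
            by (intro sum.neutral) (auto simp: indicator_def)
          then show ?thesis by simp
        qed
      qed simp
      finally have le: "(\<integral>\<^sup>+\<theta>\<in>{0<..<d}. (\<Sum>i<N. \<phi> r (\<theta> + real i * d)) \<partial>lborel) \<le> (\<integral>\<^sup>+x\<in>{0..T}. \<phi> r x \<partial>lborel)" .
      show "(\<integral>\<^sup>+\<theta>. (\<Sum>i<N. \<phi> r (\<theta> + real i * d)) * indicator {0..d} r * indicator {0<..<d} \<theta> \<partial>lborel) \<le> ennreal (e/4) * indicator {0..d} r"
      proof (cases "r \<in> {0..d}")
        case True
        then show ?thesis using le \<delta>(2)[of r] d(2) by (auto intro: order_trans)
      qed simp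
    qed
    also have "\<dots> = ennreal (e/4 * d)" using d e by (simp add: nn_integral_cmult_indicator ennreal_mult[symmetric])
    finally show ?thesis .
  qed
  have "\<exists>\<theta>. 0 < \<theta> \<and> \<theta> < d \<and> A \<theta> \<le> ennreal (e/2)"
  proof (rule ccontr)
    assume "\<not> ?thesis"
    then have "ennreal (e/2) * indicator {0<..<d} \<theta> \<le> A \<theta> * indicator {0<..<d} \<theta>" for \<theta>
      by (auto simp: indicator_def not_le less_imp_le)
    then have "(\<integral>\<^sup>+\<theta>. ennreal (e/2) * indicator {0<..<d} \<theta> \<partial>lborel) \<le> (\<integral>\<^sup>+\<theta>\<in>{0<..<d}. A \<theta> \<partial>lborel)"
      by (rule nn_integral_mono)
    also note A_int
    finally have "ennreal (e/2 * d) \<le> ennreal (e/4 * d)"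
      using d e by (simp add: nn_integral_cmult_indicator ennreal_mult[symmetric])
    then show False using d e by (simp add: ennreal_le_iff)
  qed
  then obtain \<theta> where \<theta>: "0 < \<theta>" "\<theta> < d" "A \<theta> \<le> ennreal (e/2)" by blast
  show thesis
  proof (rule that[OF grid[OF \<theta>(1,2)]])
    have "Err \<theta> \<le> ennreal (2 * C * d) + A \<theta>" by (rule Err_le[OF \<theta>(1,2)])
    also have "\<dots> \<le> ennreal (e/4) + ennreal (e/2)" by (intro add_mono \<theta>(3) ennreal_leI d2)
    also have "\<dots> \<le> ennreal e" using e by (simp add: ennreal_plus[symmetric] del: ennreal_plus)
    finally show "(\<integral>\<^sup>+\<omega>. (\<integral>\<^sup>+s\<in>{0..T}. ennreal \<bar>elementary_process (Suc N) (\<tau> \<theta>) (\<lambda>i \<omega>. Q (\<tau> \<theta> i, \<omega>)) s \<omega> - Q (s, \<omega>)\<bar> \<partial>lborel) \<partial>M) \<le> ennreal e"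
      unfolding Err_def .
  qed
qed

section \<open>Translation of Gaussian increments\<close>

definition centred_normal :: "real \<Rightarrow> real measure" where
  "centred_normal v = density lborel (normal_density 0 (sqrt v))"

lemma sets_centred_normal [simp, measurable_cong]: "sets (centred_normal v) = sets borel"
  and space_centred_normal [simp]: "space (centred_normal v) = UNIV"
  by (simp_all add: centred_normal_def)

lemma prob_space_centred_normal: "v > 0 \<Longrightarrow> prob_space (centred_normal v)"
  unfolding centred_normal_def by (rule prob_space_normal_density) simp

text \<open>Completing the square; this is the one-dimensional source of every density
  below.\<close>

lemma normal_density_translate:
  assumes v: "v > 0"
  shows "normal_density 0 (sqrt v) w * exp (a * w - a\<^sup>2 * v / 2) = normal_density 0 (sqrt v) (w - a * v)"
proof -
  have "- w\<^sup>2 / (2 * v) + (a * w - a\<^sup>2 * v / 2) = - (w - a * v)\<^sup>2 / (2 * v)"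
    using v by (simp add: field_simps power2_eq_square)
  then show ?thesis using v by (simp add: normal_density_def exp_add[symmetric])
qed

lemma centred_normal_translate:
  assumes v: "v > 0" and [measurable]: "f \<in> borel_measurable borel"
  shows "(\<integral>\<^sup>+w. f (w - a * v) * ennreal (exp (a * w - a\<^sup>2 * v / 2)) \<partial>centred_normal v) = (\<integral>\<^sup>+w. f w \<partial>centred_normal v)"
proof -
  let ?n = "\<lambda>w. ennreal (normal_density 0 (sqrt v) w)"
  have "(\<integral>\<^sup>+w. f (w - a * v) * ennreal (exp (a * w - a\<^sup>2 * v / 2)) \<partial>centred_normal v)
     = (\<integral>\<^sup>+w. ?n w * (f (w - a * v) * ennreal (exp (a * w - a\<^sup>2 * v / 2))) \<partial>lborel)"
    unfolding centred_normal_def by (rule nn_integral_density) measurable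
  also have "\<dots> = (\<integral>\<^sup>+w. ?n (- (a * v) + 1 * w) * f (- (a * v) + 1 * w) \<partial>lborel)"
  proof (rule nn_integral_cong)
    fix w
    have "?n w * ennreal (exp (a * w - a\<^sup>2 * v / 2)) = ?n (w - a * v)"
      unfolding normal_density_translate[OF v, symmetric] by (rule ennreal_mult[symmetric]) (auto intro: normal_density_nonneg)
    then show "?n w * (f (w - a * v) * ennreal (exp (a * w - a\<^sup>2 * v / 2))) = ?n (- (a * v) + 1 * w) * f (- (a * v) + 1 * w)"
      by (simp add: mult.left_commute mult.commute[of _ "f _"] mult.assoc[symmetric])
         (simp add: mult.assoc)
  qed
  also have "\<dots> = (\<integral>\<^sup>+w. ?n w * f w \<partial>lborel)"
    using nn_integral_real_affine[of "\<lambda>w. ?n w * f w" 1 "- (a * v)"] by simp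
  also have "\<dots> = (\<integral>\<^sup>+w. f w \<partial>centred_normal v)"
    unfolding centred_normal_def by (rule nn_integral_density[symmetric]) measurable
  finally show ?thesis .
qed

text \<open>The exponential factorises over the coordinates, so on rectangles the claim is a product
  of one-dimensional translations; rectangles determine the product measure.\<close>

lemma PiM_centred_normal_translate:
  fixes v a :: "nat \<Rightarrow> real"
  assumes v: "\<And>i. i < N \<Longrightarrow> v i > 0" and f: "f \<in> borel_measurable (\<Pi>\<^sub>M i\<in>{..<N}. borel)"
  shows "(\<integral>\<^sup>+w. f (\<lambda>i\<in>{..<N}. w i - a i * v i) * ennreal (exp (\<Sum>i<N. a i * w i - (a i)\<^sup>2 * v i / 2))
      \<partial>(\<Pi>\<^sub>M i\<in>{..<N}. centred_normal (v i)))
    = (\<integral>\<^sup>+w. f w \<partial>(\<Pi>\<^sub>M i\<in>{..<N}. centred_normal (v i)))"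
proof -
  \<comment> \<open>Indices from \<open>N\<close> on receive the standard normal law, so that every
    member of the family is a probability measure, as the product locale demands.\<close>
  define M where "M i = (if i < N then centred_normal (v i) else centred_normal 1)" for i
  have ps: "prob_space (M i)" for i using v by (simp add: M_def prob_space_centred_normal)
  interpret product_prob_space M "{..<N}" by (intro product_prob_spaceI ps)
  have sM[simp, measurable_cong]: "sets (M i) = sets borel" for i by (simp add: M_def)
  let ?P = "\<Pi>\<^sub>M i\<in>{..<N}. M i"
  have P_eq: "(\<Pi>\<^sub>M i\<in>{..<N}. centred_normal (v i)) = ?P" by (rule PiM_cong) (auto simp: M_def)
  have sP: "sets ?P = sets (\<Pi>\<^sub>M i\<in>{..<N}. borel)" by (rule sets_PiM_cong) auto
  have [measurable]: "f \<in> borel_measurable ?P" using f by (simp add: measurable_cong_sets[OF sP])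
  define S where "S w = (\<lambda>i\<in>{..<N}. w i - a i * v i)" for w
  have [measurable]: "S \<in> ?P \<rightarrow>\<^sub>M ?P" unfolding S_def[abs_def] by measurable
  define E where "E w = ennreal (exp (\<Sum>i<N. a i * w i - (a i)\<^sup>2 * v i / 2))" for w
  have [measurable]: "E \<in> borel_measurable ?P" unfolding E_def[abs_def] by measurable
  have E_prod: "E w = (\<Prod>i<N. ennreal (exp (a i * w i - (a i)\<^sup>2 * v i / 2)))" for w
    by (simp add: E_def exp_sum prod_ennreal)
  have "distr (density ?P E) ?P S = ?P"
  proof (rule PiM_eqI)
    fix A assume A: "\<And>i. i \<in> {..<N} \<Longrightarrow> A i \<in> sets (M i)"
    have [measurable]: "Pi\<^sub>E {..<N} A \<in> sets ?P" using A by (intro sets_PiM_I_finite) auto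
    have "emeasure (distr (density ?P E) ?P S) (Pi\<^sub>E {..<N} A) = (\<integral>\<^sup>+w. E w * indicator (Pi\<^sub>E {..<N} A) (S w) \<partial>?P)"
      by (subst emeasure_distr, simp, simp, subst emeasure_density)
         (auto intro!: nn_integral_cong simp: indicator_def measurable_space[OF \<open>S \<in> _\<close>])
    also have "\<dots> = (\<integral>\<^sup>+w. (\<Prod>i<N. indicator (A i) (w i - a i * v i) * ennreal (exp (a i * w i - (a i)\<^sup>2 * v i / 2))) \<partial>?P)"
    proof (rule nn_integral_cong)
      fix w
      have "indicator (Pi\<^sub>E {..<N} A) (S w) = (\<Prod>i<N. indicator (A i) (w i - a i * v i) :: ennreal)"
        by (auto simp: S_def indicator_def PiE_iff prod_eq_1_iff)
      then show "E w * indicator (Pi\<^sub>E {..<N} A) (S w) = (\<Prod>i<N. indicator (A i) (w i - a i * v i) * ennreal (exp (a i * w i - (a i)\<^sup>2 * v i / 2)))"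
        by (simp only: E_prod prod.distrib mult.commute)
    qed
    also have "\<dots> = (\<Prod>i<N. \<integral>\<^sup>+w. indicator (A i) (w - a i * v i) * ennreal (exp (a i * w - (a i)\<^sup>2 * v i / 2)) \<partial>M i)"
      by (rule product_nn_integral_prod) (use A in auto)
    also have "\<dots> = (\<Prod>i<N. emeasure (M i) (A i))"
    proof (rule prod.cong[OF refl])
      fix i assume i: "i \<in> {..<N}"
      have [measurable]: "A i \<in> sets borel" using A[OF i] by simp
      show "(\<integral>\<^sup>+w. indicator (A i) (w - a i * v i) * ennreal (exp (a i * w - (a i)\<^sup>2 * v i / 2)) \<partial>M i) = emeasure (M i) (A i)"
        using i centred_normal_translate[of "v i" "indicator (A i)" "a i"] v[of i] by (simp add: M_def)
    qed
    finally show "emeasure (distr (density ?P E) ?P S) (Pi\<^sub>E {..<N} A) = (\<Prod>i<N. emeasure (M i) (A i))" .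
  qed simp_all
  then have "(\<integral>\<^sup>+w. f w \<partial>?P) = (\<integral>\<^sup>+w. f w \<partial>distr (density ?P E) ?P S)" by simp
  also have "\<dots> = (\<integral>\<^sup>+w. f (S w) \<partial>density ?P E)" by (rule nn_integral_distr) measurable
  also have "\<dots> = (\<integral>\<^sup>+w. E w * f (S w) \<partial>?P)" by (rule nn_integral_density) measurable
  finally show ?thesis unfolding P_eq S_def E_def by (simp add: mult.commute)
qed

section \<open>Brownian increments along a grid and their translation\<close>

context filtered_brownian_motion
begin

definition grid_increments :: "nat \<Rightarrow> (nat \<Rightarrow> real) \<Rightarrow> 'a \<Rightarrow> nat \<Rightarrow> real" where
  "grid_increments N p \<omega> = (\<lambda>i\<in>{..<N}. W (p (Suc i)) \<omega> - W (p i) \<omega>)"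

text \<open>Joint independence is obtained by adding one increment at a time: the event concerning
  the first \<open>n\<close> increments lies in \<open>G (p n)\<close>, of which the next increment
  is independent.\<close>

lemma distr_grid_increments:
  assumes "time_grid T N p"
  shows "distr M (\<Pi>\<^sub>M i\<in>{..<N}. borel) (grid_increments N p) = (\<Pi>\<^sub>M i\<in>{..<N}. centred_normal (p (Suc i) - p i))"
proof -
  interpret time_grid T N p by fact
  define K where "K i = (if i < N then centred_normal (p (Suc i) - p i) else centred_normal 1)" for i
  have ps: "prob_space (K i)" for i using p_less_Suc by (simp add: K_def prob_space_centred_normal)
  interpret K: product_prob_space K "{..<N}" by (intro product_prob_spaceI ps)
  have sK[simp]: "sets (K i) = sets borel" for i by (simp add: K_def)
  have K_eq: "(\<Pi>\<^sub>M i\<in>{..<N}. centred_normal (p (Suc i) - p i)) = (\<Pi>\<^sub>M i\<in>{..<N}. K i)" by (rule PiM_cong) (auto simp: K_def)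
  have W_p[measurable]: "W (p i) \<in> borel_measurable M" if "i \<le> N" for i
    using p_in[OF that] by (rule W_meas)
  have inc_meas: "grid_increments N p \<in> M \<rightarrow>\<^sub>M (\<Pi>\<^sub>M i\<in>{..<N}. borel)"
    unfolding grid_increments_def[abs_def] by (intro measurable_restrict borel_measurable_diff W_p) auto
  show ?thesis
    unfolding K_eq
  proof (rule K.PiM_eqI)
    show "sets (distr M (\<Pi>\<^sub>M i\<in>{..<N}. borel) (grid_increments N p)) = sets (\<Pi>\<^sub>M i\<in>{..<N}. K i)"
      by (simp cong: sets_PiM_cong)
    fix A assume "\<And>i. i \<in> {..<N} \<Longrightarrow> A i \<in> sets (K i)"
    then have A: "A i \<in> sets borel" if "i < N" for i using that by auto
    define B where "B n = {\<omega> \<in> space M. \<forall>i<n. W (p (Suc i)) \<omega> - W (p i) \<omega> \<in> A i}" for n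
    have "n \<le> N \<Longrightarrow> emeasure M (B n) = (\<Prod>i<n. emeasure (K i) (A i))" for n
    proof (induction n)
      case 0
      then show ?case by (simp add: B_def emeasure_space_1)
    next
      case (Suc n)
      then have nN: "n < N" by simp
      have st: "0 \<le> p n" "p n < p (Suc n)" "p (Suc n) \<le> T"
        using p_in[of n] p_in[of "Suc n"] p_less_Suc[OF nN] nN by auto
      let ?D = "\<lambda>\<omega>. W (p (Suc n)) \<omega> - W (p n) \<omega>"
      have BG: "B n \<in> sets (G (p n))"
      proof -
        have sp: "space (G (p n)) = space M" using G_sub[of "p n"] p_in[of n] nN by (simp add: subalgebra_def)
        have "{\<omega> \<in> space (G (p n)). W (p (Suc i)) \<omega> - W (p i) \<omega> \<in> A i} \<in> sets (G (p n))" if "i < n" for i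
        proof -
          have [measurable]: "W (p (Suc i)) \<in> borel_measurable (G (p n))" "W (p i) \<in> borel_measurable (G (p n))"
            using that nN p_in[of i] p_in[of "Suc i"] p_in[of n]
            by (auto intro!: G_mono[OF _ _ _ W_meas_G] p_le)
          have [measurable]: "A i \<in> sets borel" using A that nN by simp
          show ?thesis by measurable
        qed
        then have "{\<omega> \<in> space (G (p n)). \<forall>i\<in>{..<n}. W (p (Suc i)) \<omega> - W (p i) \<omega> \<in> A i} \<in> sets (G (p n))"
          by (intro sets.sets_Collect_finite_All) auto
        moreover have "B n = {\<omega> \<in> space (G (p n)). \<forall>i\<in>{..<n}. W (p (Suc i)) \<omega> - W (p i) \<omega> \<in> A i}"
          unfolding B_def sp by blast
        ultimately show ?thesis by simp
      qed
      have ind: "indep_set (sets (G (p n))) (sets (vimage_algebra (space M) ?D borel))"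
        using brownian st by (auto simp: brownian_motion_wrt_def)
      have Dn: "?D -` A n \<inter> space M \<in> sets (vimage_algebra (space M) ?D borel)"
        unfolding sets_vimage_algebra using A[OF nN] by auto
      have "B (Suc n) = B n \<inter> (?D -` A n \<inter> space M)" by (auto simp: B_def less_Suc_eq)
      then have "emeasure M (B (Suc n)) = ennreal (prob (B n) * prob (?D -` A n \<inter> space M))"
        using indep_setD[OF ind BG Dn] by (simp add: emeasure_eq_measure)
      also have "\<dots> = emeasure M (B n) * emeasure M (?D -` A n \<inter> space M)"
        by (simp add: emeasure_eq_measure ennreal_mult)
      also have "emeasure M (?D -` A n \<inter> space M) = emeasure (K n) (A n)"
      proof -
        have d: "distr M lborel ?D = K n"
          using increment_distributed[OF st] nN by (simp add: distributed_def K_def centred_normal_def)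
        have "?D \<in> M \<rightarrow>\<^sub>M lborel" using increment_distributed[OF st] by (simp add: distributed_def)
        then show ?thesis using A[OF nN] unfolding d[symmetric] by (subst emeasure_distr) auto
      qed
      finally show ?case using Suc.IH nN by simp
    qed
    moreover have "grid_increments N p -` Pi\<^sub>E {..<N} A \<inter> space M = B N"
      unfolding B_def grid_increments_def vimage_def restrict_PiE_iff by blast
    moreover have "Pi\<^sub>E {..<N} A \<in> sets (\<Pi>\<^sub>M i\<in>{..<N}. borel)" using A by (intro sets_PiM_I_finite) auto
    ultimately show "emeasure (distr M (\<Pi>\<^sub>M i\<in>{..<N}. borel) (grid_increments N p)) (Pi\<^sub>E {..<N} A) = (\<Prod>i<N. emeasure (K i) (A i))"
      using emeasure_distr[OF inc_meas] by simp
  qed simp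
qed

text \<open>By independence the joint law of the increments and \<open>X\<close> is a product. For
  frozen \<open>X\<close> the drifts \<open>a i (X \<omega>)\<close> are constants, and the Gaussian
  translation applies before integrating over \<open>X\<close>.\<close>

lemma grid_girsanov:
  assumes grid: "time_grid T N p" and X: "X \<in> M \<rightarrow>\<^sub>M S"
    and ind: "indep_set (sets (vimage_algebra (space M) (\<lambda>\<omega>. \<lambda>t\<in>{0..T}. W t \<omega>) (\<Pi>\<^sub>M t\<in>{0..T}. borel)))
       (sets (vimage_algebra (space M) X S))"
    and a: "\<And>i. i < N \<Longrightarrow> a i \<in> borel_measurable S"
    and f: "f \<in> borel_measurable ((\<Pi>\<^sub>M i\<in>{..<N}. borel) \<Otimes>\<^sub>M S)"
  shows "(\<integral>\<^sup>+\<omega>. f (\<lambda>i\<in>{..<N}. grid_increments N p \<omega> i - a i (X \<omega>) * (p (Suc i) - p i), X \<omega>) *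
        ennreal (exp (\<Sum>i<N. a i (X \<omega>) * grid_increments N p \<omega> i - (a i (X \<omega>))\<^sup>2 * (p (Suc i) - p i) / 2)) \<partial>M)
     = (\<integral>\<^sup>+\<omega>. f (grid_increments N p \<omega>, X \<omega>) \<partial>M)"
proof -
  interpret time_grid T N p by fact
  let ?R = "\<Pi>\<^sub>M i\<in>{..<N}. borel :: real measure"
  let ?P = "\<Pi>\<^sub>M i\<in>{..<N}. centred_normal (p (Suc i) - p i)"
  let ?D = "grid_increments N p" and ?V = "\<Pi>\<^sub>M t\<in>{0..T}. borel :: real measure"
  have sP[measurable_cong]: "sets ?P = sets ?R" by (rule sets_PiM_cong) auto
  note f[measurable] X[measurable]
  have [measurable]: "(\<lambda>\<omega>. \<lambda>t\<in>{0..T}. W t \<omega>) \<in> M \<rightarrow>\<^sub>M ?V" by (intro measurable_restrict W_meas)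
  let ?F = "vimage_algebra (space M) (\<lambda>\<omega>. \<lambda>t\<in>{0..T}. W t \<omega>) ?V"
  have subF: "subalgebra M ?F"
    unfolding subalgebra_def by (auto simp: sets_vimage_algebra intro!: sets.sigma_sets_subset)
  have WF: "W t \<in> borel_measurable ?F" if "t \<in> {0..T}" for t
  proof -
    have "(\<lambda>\<omega>. \<lambda>t\<in>{0..T}. W t \<omega>) \<in> ?F \<rightarrow>\<^sub>M ?V"
      by (rule measurable_vimage_algebra1) (auto simp: space_PiM)
    from measurable_compose[OF this measurable_component_singleton[OF that]] that show ?thesis by simp
  qed
  have DF: "?D \<in> ?F \<rightarrow>\<^sub>M ?R"
    unfolding grid_increments_def[abs_def]
    using p_in by (intro measurable_restrict borel_measurable_diff WF) auto
  have D[measurable]: "?D \<in> M \<rightarrow>\<^sub>M ?R" using measurable_from_subalg[OF subF DF] .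
  interpret X: prob_space "distr M S X" by (rule prob_space_distr) (rule X)
  have "prob_space ?P" using p_less_Suc by (intro prob_space_PiM prob_space_centred_normal) auto
  then interpret P: prob_space ?P .
  interpret pair_sigma_finite ?P "distr M S X" ..
  have joint: "distr M (?R \<Otimes>\<^sub>M S) (\<lambda>\<omega>. (?D \<omega>, X \<omega>)) = ?P \<Otimes>\<^sub>M distr M S X"
  proof (rule pair_measure_eqI[symmetric])
    show "sigma_finite_measure ?P" "sigma_finite_measure (distr M S X)" by unfold_locales
    show "sets (?P \<Otimes>\<^sub>M distr M S X) = sets (distr M (?R \<Otimes>\<^sub>M S) (\<lambda>\<omega>. (?D \<omega>, X \<omega>)))"
      by (simp add: sP cong: sets_pair_measure_cong)
    fix A B assume A: "A \<in> sets ?P" and B: "B \<in> sets (distr M S X)"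
    then have [measurable]: "A \<in> sets ?R" "B \<in> sets S" using sP by auto
    have ev: "?D -` A \<inter> space M \<in> sets ?F" "X -` B \<inter> space M \<in> sets (vimage_algebra (space M) X S)"
      using measurable_sets[OF DF \<open>A \<in> sets ?R\<close>] in_vimage_algebra[OF \<open>B \<in> sets S\<close>] by auto
    have "emeasure (distr M (?R \<Otimes>\<^sub>M S) (\<lambda>\<omega>. (?D \<omega>, X \<omega>))) (A \<times> B) = emeasure M ((?D -` A \<inter> space M) \<inter> (X -` B \<inter> space M))"
      by (subst emeasure_distr) (auto intro!: arg_cong2[where f=emeasure])
    also have "\<dots> = emeasure M (?D -` A \<inter> space M) * emeasure M (X -` B \<inter> space M)"
      using indep_setD[OF ind ev] by (simp add: emeasure_eq_measure ennreal_mult)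
    also have "\<dots> = emeasure (distr M ?R ?D) A * emeasure (distr M S X) B"
      by (simp add: emeasure_distr)
    finally show "emeasure ?P A * emeasure (distr M S X) B = emeasure (distr M (?R \<Otimes>\<^sub>M S) (\<lambda>\<omega>. (?D \<omega>, X \<omega>))) (A \<times> B)"
      by (simp add: distr_grid_increments[OF grid])
  qed
  have a_meas[measurable]: "a i \<in> borel_measurable S" if "i \<in> {..<N}" for i using a that by simp
  have transfer: "(\<integral>\<^sup>+\<omega>. g (?D \<omega>, X \<omega>) \<partial>M) = (\<integral>\<^sup>+x. (\<integral>\<^sup>+w. g (w, x) \<partial>?P) \<partial>distr M S X)"
    if g[measurable]: "g \<in> borel_measurable (?R \<Otimes>\<^sub>M S)" for g
  proof -
    have "(\<integral>\<^sup>+\<omega>. g (?D \<omega>, X \<omega>) \<partial>M) = (\<integral>\<^sup>+z. g z \<partial>distr M (?R \<Otimes>\<^sub>M S) (\<lambda>\<omega>. (?D \<omega>, X \<omega>)))"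
      by (subst nn_integral_distr) (auto intro!: measurable_Pair)
    also have "\<dots> = (\<integral>\<^sup>+x. (\<integral>\<^sup>+w. g (w, x) \<partial>?P) \<partial>distr M S X)"
      unfolding joint by (rule nn_integral_snd[symmetric]) measurable
    finally show ?thesis .
  qed
  define g where "g z = f (\<lambda>i\<in>{..<N}. fst z i - a i (snd z) * (p (Suc i) - p i), snd z) *
      ennreal (exp (\<Sum>i<N. a i (snd z) * fst z i - (a i (snd z))\<^sup>2 * (p (Suc i) - p i) / 2))" for z
  have [measurable]: "g \<in> borel_measurable (?R \<Otimes>\<^sub>M S)" unfolding g_def[abs_def] by measurable
  have "(\<integral>\<^sup>+\<omega>. g (?D \<omega>, X \<omega>) \<partial>M) = (\<integral>\<^sup>+x. (\<integral>\<^sup>+w. g (w, x) \<partial>?P) \<partial>distr M S X)"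
    by (rule transfer) measurable
  also have "\<dots> = (\<integral>\<^sup>+x. (\<integral>\<^sup>+w. f (w, x) \<partial>?P) \<partial>distr M S X)"
  proof (rule nn_integral_cong)
    fix x assume "x \<in> space (distr M S X)"
    then have [simp]: "x \<in> space S" by simp
    show "(\<integral>\<^sup>+w. g (w, x) \<partial>?P) = (\<integral>\<^sup>+w. f (w, x) \<partial>?P)"
      unfolding g_def fst_conv snd_conv
      by (rule PiM_centred_normal_translate) (use p_less_Suc in auto)
  qed
  also have "\<dots> = (\<integral>\<^sup>+\<omega>. f (?D \<omega>, X \<omega>) \<partial>M)" by (rule transfer[symmetric]) measurable
  finally show ?thesis by (simp add: g_def)
qed

end

section \<open>Girsanov theorem for elementary drifts\<close>

text \<open>Finite-dimensional lower orthants are stable under intersection and generate the product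
  sigma-algebra, also over an uncountable index set.\<close>

lemma measure_eqI_PiM_atMost:
  fixes P Q :: "('i \<Rightarrow> real) measure"
  assumes sets: "sets P = sets (\<Pi>\<^sub>M i\<in>I. borel)" "sets Q = sets (\<Pi>\<^sub>M i\<in>I. borel)" and fin: "finite_measure P"
    and eq: "\<And>J a. finite J \<Longrightarrow> J \<subseteq> I \<Longrightarrow>
      emeasure P {f \<in> (\<Pi>\<^sub>E i\<in>I. UNIV). \<forall>j\<in>J. f j \<le> a j} = emeasure Q {f \<in> (\<Pi>\<^sub>E i\<in>I. UNIV). \<forall>j\<in>J. f j \<le> a j}"
  shows "P = Q"
proof -
  interpret P: finite_measure P by fact
  let ?\<Omega> = "\<Pi>\<^sub>E i\<in>I. UNIV :: real set"
  let ?c = "\<lambda>J a. {f \<in> ?\<Omega>. \<forall>j\<in>J. f j \<le> a j}"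
  define E where "E = {?c J a | J a. finite J \<and> J \<subseteq> I}"
  have E_Pow: "E \<subseteq> Pow ?\<Omega>" by (auto simp: E_def)
  have cE: "?c J a \<in> E" if "finite J" "J \<subseteq> I" for J a
    unfolding E_def mem_Collect_eq by (rule exI[of _ J], rule exI[of _ a]) (simp add: that)
  have gen: "sets (\<Pi>\<^sub>M i\<in>I. borel :: real measure) = sigma_sets ?\<Omega> E"
  proof
    show "sigma_sets ?\<Omega> E \<subseteq> sets (\<Pi>\<^sub>M i\<in>I. borel)"
    proof -
      have "?c J a \<in> sets (\<Pi>\<^sub>M i\<in>I. borel)" if "finite J" "J \<subseteq> I" for J a
      proof -
        have "{f \<in> space (\<Pi>\<^sub>M i\<in>I. borel :: real measure). \<forall>j\<in>J. f j \<le> a j} \<in> sets (\<Pi>\<^sub>M i\<in>I. borel)"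
          using that by (intro sets.sets_Collect_finite_All) (auto simp: subset_eq)
        then show ?thesis by (simp add: space_PiM)
      qed
      then have "E \<subseteq> sets (\<Pi>\<^sub>M i\<in>I. borel)" by (auto simp: E_def)
      then have "sigma_sets (space (\<Pi>\<^sub>M i\<in>I. borel :: real measure)) E \<subseteq> sets (\<Pi>\<^sub>M i\<in>I. borel)"
        by (rule sets.sigma_sets_subset)
      then show ?thesis by (simp add: space_PiM)
    qed
    have "(\<lambda>f. f) \<in> sigma ?\<Omega> E \<rightarrow>\<^sub>M (\<Pi>\<^sub>M i\<in>I. borel)"
    proof (rule measurable_PiM_single')
      fix i assume i: "i \<in> I"
      show "(\<lambda>f. f i) \<in> borel_measurable (sigma ?\<Omega> E)"
        unfolding borel_measurable_iff_le
      proof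
        fix x :: real
        have "{f \<in> space (sigma ?\<Omega> E). f i \<le> x} = ?c {i} (\<lambda>_. x)"
          using E_Pow by (simp add: space_measure_of_conv)
        moreover have "?c {i} (\<lambda>_. x) \<in> E" using i by (intro cE) auto
        ultimately show "{f \<in> space (sigma ?\<Omega> E). f i \<le> x} \<in> sets (sigma ?\<Omega> E)"
          using E_Pow by (simp add: sigma_sets.Basic)
      qed
    qed (use E_Pow in \<open>simp add: space_measure_of_conv\<close>)
    from measurable_sets[OF this] show "sets (\<Pi>\<^sub>M i\<in>I. borel :: real measure) \<subseteq> sigma_sets ?\<Omega> E"
      using E_Pow sets.sets_into_space[of _ "\<Pi>\<^sub>M i\<in>I. borel :: real measure"]
      by (auto simp: space_PiM space_measure_of_conv Int_absorb2)
  qed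
  show ?thesis
  proof (rule measure_eqI_generator_eq[where E=E and \<Omega>="?\<Omega>" and A="\<lambda>_. ?\<Omega>"])
    show "Int_stable E"
    proof (rule Int_stableI)
      fix A B assume "A \<in> E" "B \<in> E"
      then obtain J a J' a' where A: "A = ?c J a" "finite J" "J \<subseteq> I" and B: "B = ?c J' a'" "finite J'" "J' \<subseteq> I"
        by (auto simp: E_def)
      let ?b = "\<lambda>j. if j \<in> J then if j \<in> J' then min (a j) (a' j) else a j else a' j"
      have "(\<forall>j\<in>J \<union> J'. f j \<le> ?b j) \<longleftrightarrow> (\<forall>j\<in>J. f j \<le> a j) \<and> (\<forall>j\<in>J'. f j \<le> a' j)" for f :: "'i \<Rightarrow> real"
        by (auto split: if_splits)
      then have "A \<inter> B = ?c (J \<union> J') ?b" unfolding A B by blast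
      then show "A \<inter> B \<in> E" using A B cE[of "J \<union> J'" ?b] by simp
    qed
    show "emeasure P X = emeasure Q X" if "X \<in> E" for X using that eq by (auto simp: E_def)
    have "?\<Omega> \<in> E" using cE[of "{}"] by simp
    then show "range (\<lambda>_. ?\<Omega>) \<subseteq> E" by auto
  qed (use sets gen E_Pow in auto)
qed

text \<open>The expectation of the distance truncated at 1 metrises convergence in probability.
  Summing over the finite family yields one subsequence that serves all its members.\<close>

lemma (in prob_space) AE_subseq_finite_family:
  fixes d :: "nat \<Rightarrow> 'j \<Rightarrow> 'a \<Rightarrow> real"
  assumes J: "finite J" and d[measurable]: "\<And>m j. j \<in> J \<Longrightarrow> d m j \<in> borel_measurable M"
    and lim: "\<And>j. j \<in> J \<Longrightarrow> (\<lambda>m. expectation (\<lambda>\<omega>. min 1 \<bar>d m j \<omega>\<bar>)) \<longlonglongrightarrow> 0"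
  obtains r :: "nat \<Rightarrow> nat" where "strict_mono r" "AE \<omega> in M. \<forall>j\<in>J. (\<lambda>m. d (r m) j \<omega>) \<longlonglongrightarrow> 0"
proof -
  define u where "u m \<omega> = (\<Sum>j\<in>J. min 1 \<bar>d m j \<omega>\<bar>)" for m \<omega>
  have int: "integrable M (\<lambda>\<omega>. min 1 \<bar>d m j \<omega>\<bar>)" if [simp]: "j \<in> J" for m j
    by (rule integrable_const_bound[of _ 1]) auto
  have u_int: "integrable M (u m)" for m unfolding u_def by (intro Bochner_Integration.integrable_sum int)
  have u0: "0 \<le> u m \<omega>" for m \<omega> unfolding u_def by (intro sum_nonneg) auto
  have "(\<lambda>m. \<Sum>j\<in>J. expectation (\<lambda>\<omega>. min 1 \<bar>d m j \<omega>\<bar>)) \<longlonglongrightarrow> (\<Sum>j\<in>J. 0)"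
    by (intro tendsto_sum lim)
  moreover have "expectation (\<lambda>\<omega>. norm (u m \<omega>)) = (\<Sum>j\<in>J. expectation (\<lambda>\<omega>. min 1 \<bar>d m j \<omega>\<bar>))" for m
    using u0 by (simp add: u_def int Bochner_Integration.integral_sum abs_of_nonneg sum_nonneg)
  ultimately have "(\<lambda>m. expectation (\<lambda>\<omega>. norm (u m \<omega>))) \<longlonglongrightarrow> 0" by simp
  from tendsto_L1_AE_subseq[OF u_int this] obtain r where r: "strict_mono r" "AE \<omega> in M. (\<lambda>m. u (r m) \<omega>) \<longlonglongrightarrow> 0"
    by blast
  show thesis
  proof (rule that[OF r(1)])
    show "AE \<omega> in M. \<forall>j\<in>J. (\<lambda>m. d (r m) j \<omega>) \<longlonglongrightarrow> 0"
      using r(2)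
    proof eventually_elim
      case (elim \<omega>)
      show ?case
      proof
        fix j assume j: "j \<in> J"
        have le: "min 1 \<bar>d m j \<omega>\<bar> \<le> u m \<omega>" for m
          unfolding u_def using J j by (intro member_le_sum[of j J "\<lambda>j. min 1 \<bar>d m j \<omega>\<bar>"]) auto
        show "(\<lambda>m. d (r m) j \<omega>) \<longlonglongrightarrow> 0"
          unfolding tendsto_iff dist_real_def
        proof (intro allI impI)
          fix e :: real assume "e > 0"
          then have "\<forall>\<^sub>F m in sequentially. u (r m) \<omega> < min 1 e"
            using elim by (intro order_tendstoD(2)) auto
          then show "\<forall>\<^sub>F m in sequentially. \<bar>d (r m) j \<omega> - 0\<bar> < e"
          proof eventually_elim
            case (elim m)
            then show ?case using le[of "r m"] by (auto simp: min_def split: if_splits)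
          qed
        qed
      qed
    qed
  qed
qed

section \<open>Step functions on a common grid\<close>

context time_grid
begin

lemma integral_cells:
  fixes g :: "real \<Rightarrow> real"
  assumes g: "\<And>i s. i < N \<Longrightarrow> s \<in> {p i<..p (Suc i)} \<Longrightarrow> g s = c i" and u: "u \<in> p ` {..N}"
  shows "(LBINT s:{0..u}. g s) = (\<Sum>i<N. c i * indicator {..u} (p (Suc i)) * (p (Suc i) - p i))"
    and "set_integrable lborel {0..u} g"
proof -
  let ?G = "\<lambda>s. \<Sum>i<N. (c i * indicator {..u} (p (Suc i))) * indicator {p i<..p (Suc i)} s"
  have uT: "u \<le> T" using u p_in by auto
  have ae: "AE s in lborel. indicator {0..u} s *\<^sub>R g s = ?G s"
    using AE_lborel_singleton[of 0]
  proof eventually_elim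
    case (elim s)
    show ?case
    proof (cases "s \<in> {0<..T}")
      case True
      then obtain i where i: "i < N" "s \<in> {p i<..p (Suc i)}" by (rule ex_cell)
      have "s \<le> u \<longleftrightarrow> p (Suc i) \<le> u" by (rule in_cell_iff(2)[OF i u])
      then show ?thesis unfolding cell_sum(1)[OF i] using True g[OF i] by (auto simp: indicator_def)
    next
      case False
      then show ?thesis unfolding cell_sum(2)[OF False] using elim uT by (auto simp: indicator_def)
    qed
  qed
  have G_int: "integrable lborel ?G"
    using p_less_Suc
    by (intro Bochner_Integration.integrable_sum integrable_mult_right) (auto simp: integrable_indicator_iff less_imp_le)
  have "(\<integral>s. ?G s \<partial>lborel) = (\<Sum>i<N. c i * indicator {..u} (p (Suc i)) * (p (Suc i) - p i))"
    using p_less_Suc by (subst Bochner_Integration.integral_sum)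
      (auto simp: integrable_indicator_iff less_imp_le intro!: sum.cong)
  \<comment> \<open>Measurability of the integrand is read off from its values on the cells: on
    \<open>{0..u}\<close> it is a step function plus a correction at the single time 0.\<close>
  moreover have meas: "(\<lambda>s. indicator {0..u} s *\<^sub>R g s) \<in> borel_measurable lborel"
  proof -
    have "indicator {0..u} s *\<^sub>R g s = ?G s + indicator {0} s * (indicator {0..u} 0 * g 0)" for s
    proof (cases "s = 0")
      case True
      then have "s \<notin> {0<..T}" by simp
      from cell_sum(2)[OF this, of "\<lambda>i. c i * indicator {..u} (p (Suc i))"] True show ?thesis by simp
    next
      case s0: False
      show ?thesis
      proof (cases "s \<in> {0<..T}")
        case True
        then obtain i where i: "i < N" "s \<in> {p i<..p (Suc i)}" by (rule ex_cell)
        have "s \<le> u \<longleftrightarrow> p (Suc i) \<le> u" by (rule in_cell_iff(2)[OF i u])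
        then show ?thesis unfolding cell_sum(1)[OF i] using True g[OF i] s0 by (auto simp: indicator_def)
      next
        case False
        then show ?thesis unfolding cell_sum(2)[OF False] using s0 uT by (auto simp: indicator_def)
      qed
    qed
    then have eq: "(\<lambda>s. indicator {0..u} s *\<^sub>R g s) = (\<lambda>s. ?G s + indicator {0} s * (indicator {0..u} 0 * g 0))"
      by (rule ext)
    have "(\<lambda>s. ?G s + indicator {0} s * (indicator {0..u} 0 * g 0)) \<in> borel_measurable lborel"
      by measurable
    then show ?thesis unfolding eq .
  qed
  ultimately show "(LBINT s:{0..u}. g s) = (\<Sum>i<N. c i * indicator {..u} (p (Suc i)) * (p (Suc i) - p i))"
    unfolding set_lebesgue_integral_def
    using integral_cong_AE[OF meas borel_measurable_integrable[OF G_int] ae] by (simp only:)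
  show "set_integrable lborel {0..u} g"
    unfolding set_integrable_def using integrable_cong_AE[OF meas borel_measurable_integrable[OF G_int] ae] G_int by (simp only:)
qed

lemma elementary_process_power2:
  "elementary_process N p (\<lambda>i \<omega>. (\<xi> i \<omega>)\<^sup>2) s \<omega> = (elementary_process N p \<xi> s \<omega>)\<^sup>2"
proof (cases "s \<in> {0<..T}")
  case True
  then obtain i where i: "i < N" "s \<in> {p i<..p (Suc i)}" by (rule ex_cell)
  then show ?thesis by (simp only: elementary_process_on_cell(1)[OF i])
next
  case False
  then show ?thesis by (simp only: elementary_process_on_cell(2)[OF False]) simp
qed

lemma sub_cells_image: "p ` {..N} \<subseteq> {0..T}"
  using p_in by auto

end

lemma common_time_grid:
  assumes "time_grid T n \<tau>" "time_grid T n' \<tau>'" "finite U" "U \<subseteq> {0..T}"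
  obtains N p where "time_grid T N p" "\<tau> ` {..n} \<subseteq> p ` {..N}" "\<tau>' ` {..n'} \<subseteq> p ` {..N}" "U \<subseteq> p ` {..N}"
proof -
  interpret a: time_grid T n \<tau> by fact
  interpret b: time_grid T n' \<tau>' by fact
  obtain N p where "time_grid T N p" "p ` {..N} = \<tau> ` {..n} \<union> \<tau>' ` {..n'} \<union> U"
  proof (rule ex_time_grid[of "\<tau> ` {..n} \<union> \<tau>' ` {..n'} \<union> U" T])
    show "0 \<in> \<tau> ` {..n} \<union> \<tau>' ` {..n'} \<union> U" using a.p_0 by force
    show "T \<in> \<tau> ` {..n} \<union> \<tau>' ` {..n'} \<union> U" using a.p_N by force
  qed (use assms a.sub_cells_image b.sub_cells_image in auto)
  then show thesis by (intro that[of N p]) auto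
qed

text \<open>Continuous functions decreasing to the indicator of the closed negative half-line as
  \<open>r\<close> grows. Continuity permits limits in probability first; the limit in
  \<open>r\<close> then gives distribution functions.\<close>

definition clip :: "nat \<Rightarrow> real \<Rightarrow> real" where
  "clip r x = max 0 (min 1 (1 - real r * x))"

lemma clip_bounds: "0 \<le> clip r x" "clip r x \<le> 1"
  by (auto simp: clip_def)

lemma continuous_on_clip: "continuous_on A (clip r)"
  unfolding clip_def[abs_def] by (intro continuous_intros)

lemma measurable_clip [measurable]: "clip r \<in> borel_measurable borel"
  unfolding clip_def[abs_def] by measurable

lemma clip_tendsto_indicator: "(\<lambda>r. clip r x) \<longlonglongrightarrow> indicator {..0} x"
proof (cases "x \<le> 0")
  case True
  then have "clip r x = 1" for r by (auto simp: clip_def mult_nonneg_nonpos)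
  then show ?thesis using True by simp
next
  case False
  then have "x > 0" by simp
  then obtain n :: nat where n: "1 / x < real n" using reals_Archimedean2 by blast
  have "clip r x = 0" if "n \<le> r" for r
  proof -
    have "1 / x < real r" using n that by (meson le_less_trans not_le of_nat_le_iff order_less_trans leD less_le_trans)
    then have "1 < real r * x" using \<open>x > 0\<close> by (simp add: field_simps)
    then show ?thesis by (simp add: clip_def)
  qed
  then have "\<forall>\<^sub>F r in sequentially. clip r x = 0" by (auto simp: eventually_sequentially)
  then show ?thesis using False tendsto_eventually by fastforce
qed

text \<open>This carries a Girsanov identity from approximations to their limits. Coordinates
  converge in probability only, so the identity is passed on for products of continuous functions
  and afterwards for lower orthants.\<close>

lemma (in prob_space) distr_eq_if_limit:
  fixes V V' :: "'a \<Rightarrow> 'i \<Rightarrow> real" and D :: "'a \<Rightarrow> ennreal"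
  assumes V: "\<And>i. i \<in> I \<Longrightarrow> (\<lambda>\<omega>. V \<omega> i) \<in> borel_measurable M" "\<And>\<omega>. V \<omega> \<in> extensional I"
    and V': "\<And>i. i \<in> I \<Longrightarrow> (\<lambda>\<omega>. V' \<omega> i) \<in> borel_measurable M" "\<And>\<omega>. V' \<omega> \<in> extensional I"
    and D[measurable]: "D \<in> borel_measurable M" and D_fin: "(\<integral>\<^sup>+\<omega>. D \<omega> \<partial>M) < \<infinity>"
    and Vm: "\<And>m i. i \<in> I \<Longrightarrow> Vm m i \<in> borel_measurable M"
    and Vm': "\<And>m i. i \<in> I \<Longrightarrow> Vm' m i \<in> borel_measurable M"
    and lim: "\<And>i. i \<in> I \<Longrightarrow> (\<lambda>m. expectation (\<lambda>\<omega>. min 1 \<bar>Vm m i \<omega> - V \<omega> i\<bar>)) \<longlonglongrightarrow> 0"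
    and lim': "\<And>i. i \<in> I \<Longrightarrow> (\<lambda>m. expectation (\<lambda>\<omega>. min 1 \<bar>Vm' m i \<omega> - V' \<omega> i\<bar>)) \<longlonglongrightarrow> 0"
    and eq: "\<And>m J f. finite J \<Longrightarrow> J \<subseteq> I \<Longrightarrow> (\<And>j. j \<in> J \<Longrightarrow> f j \<in> borel_measurable borel) \<Longrightarrow>
      (\<integral>\<^sup>+\<omega>. (\<Prod>j\<in>J. ennreal (f j (Vm m j \<omega>))) \<partial>M) = (\<integral>\<^sup>+\<omega>. D \<omega> * (\<Prod>j\<in>J. ennreal (f j (Vm' m j \<omega>))) \<partial>M)"
  shows "distr M (\<Pi>\<^sub>M i\<in>I. borel) V = distr (density M D) (\<Pi>\<^sub>M i\<in>I. borel) V'"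
proof (rule measure_eqI_PiM_atMost)
  have mV[measurable]: "V \<in> M \<rightarrow>\<^sub>M (\<Pi>\<^sub>M i\<in>I. borel)" "V' \<in> M \<rightarrow>\<^sub>M (\<Pi>\<^sub>M i\<in>I. borel)"
    using V(1) V'(1) V(2)[THEN extensional_arb] V'(2)[THEN extensional_arb]
    by (auto intro!: measurable_PiM_single' simp: PiE_iff extensional_def)
  have mV': "V' \<in> density M D \<rightarrow>\<^sub>M (\<Pi>\<^sub>M i\<in>I. borel)" by simp
  show "finite_measure (distr M (\<Pi>\<^sub>M i\<in>I. borel) V)" by (intro finite_measure_distr mV)
  fix J a assume J: "finite J" "J \<subseteq> I"
  let ?c = "{f \<in> (\<Pi>\<^sub>E i\<in>I. UNIV). \<forall>j\<in>J. f j \<le> (a j :: real)}"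
  have [measurable]: "(\<lambda>\<omega>. V \<omega> j) \<in> borel_measurable M" "(\<lambda>\<omega>. V' \<omega> j) \<in> borel_measurable M"
    "Vm m j \<in> borel_measurable M" "Vm' m j \<in> borel_measurable M" if "j \<in> J" for m j
    using V V' Vm Vm' J that by auto
  \<comment> \<open>Both families share one subsequence; the disjoint sum of \<open>J\<close> with
    itself indexes them together.\<close>
  obtain r where r: "strict_mono r" and r_lim: "AE \<omega> in M. \<forall>j\<in>J <+> J.
      (\<lambda>m. case_sum (\<lambda>j \<omega>. Vm (r m) j \<omega> - V \<omega> j) (\<lambda>j \<omega>. Vm' (r m) j \<omega> - V' \<omega> j) j \<omega>) \<longlonglongrightarrow> 0"
  proof (rule AE_subseq_finite_family[of "J <+> J" "\<lambda>m. case_sum (\<lambda>j \<omega>. Vm m j \<omega> - V \<omega> j) (\<lambda>j \<omega>. Vm' m j \<omega> - V' \<omega> j)"])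
    show "finite (J <+> J)" using J by simp
    show "case_sum (\<lambda>j \<omega>. Vm m j \<omega> - V \<omega> j) (\<lambda>j \<omega>. Vm' m j \<omega> - V' \<omega> j) j \<in> borel_measurable M" if "j \<in> J <+> J" for m j
      using that by auto
    show "(\<lambda>m. expectation (\<lambda>\<omega>. min 1 \<bar>case_sum (\<lambda>j \<omega>. Vm m j \<omega> - V \<omega> j) (\<lambda>j \<omega>. Vm' m j \<omega> - V' \<omega> j) j \<omega>\<bar>)) \<longlonglongrightarrow> 0"
      if "j \<in> J <+> J" for j
      using that lim lim' J by auto
  qed
  have AE_V: "AE \<omega> in M. \<forall>j\<in>J. (\<lambda>m. Vm (r m) j \<omega>) \<longlonglongrightarrow> V \<omega> j"
    and AE_V': "AE \<omega> in M. \<forall>j\<in>J. (\<lambda>m. Vm' (r m) j \<omega>) \<longlonglongrightarrow> V' \<omega> j"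
    using r_lim by (auto elim!: eventually_mono simp: Plus_def ball_Un Lim_null[symmetric] intro: Lim_null[THEN iffD2])
  let ?f = "\<lambda>n X \<omega>. \<Prod>j\<in>J. ennreal (clip n (X j \<omega> - a j))"
  have f_le: "?f n X \<omega> \<le> 1" for n and X :: "'i \<Rightarrow> 'a \<Rightarrow> real" and \<omega>
    using clip_bounds by (intro prod_le_1) (auto simp: ennreal_le_1)
  have f_tendsto: "(\<lambda>m. ?f n (\<lambda>j. X m j) \<omega>) \<longlonglongrightarrow> ?f n Y \<omega>"
    if lim: "\<forall>j\<in>J. (\<lambda>m. X m j \<omega>) \<longlonglongrightarrow> Y j \<omega>" for n and X :: "nat \<Rightarrow> 'i \<Rightarrow> 'a \<Rightarrow> real" and Y \<omega>
  proof -
    have cont: "isCont (clip n) x" for x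
      using continuous_on_clip[of UNIV n] by (simp add: continuous_on_eq_continuous_at)
    have "(\<lambda>m. \<Prod>j\<in>J. clip n (X m j \<omega> - a j)) \<longlonglongrightarrow> (\<Prod>j\<in>J. clip n (Y j \<omega> - a j))"
      using lim by (intro tendsto_prod isCont_tendsto_compose[OF cont] tendsto_intros) auto
    then have "(\<lambda>m. ennreal (\<Prod>j\<in>J. clip n (X m j \<omega> - a j))) \<longlonglongrightarrow> ennreal (\<Prod>j\<in>J. clip n (Y j \<omega> - a j))"
      by (rule tendsto_ennrealI)
    then show ?thesis using clip_bounds by (simp add: prod_ennreal)
  qed
  have f_ind: "(\<lambda>n. ?f n Y \<omega>) \<longlonglongrightarrow> (if \<forall>j\<in>J. Y j \<omega> \<le> a j then 1 else 0)" for Y \<omega>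
  proof -
    have "(\<lambda>n. \<Prod>j\<in>J. clip n (Y j \<omega> - a j)) \<longlonglongrightarrow> (\<Prod>j\<in>J. indicator {..0} (Y j \<omega> - a j))"
      by (intro tendsto_prod clip_tendsto_indicator)
    also have "(\<Prod>j\<in>J. indicator {..0} (Y j \<omega> - a j)) = (if \<forall>j\<in>J. Y j \<omega> \<le> a j then 1 else 0 :: real)"
      using J by (auto simp: indicator_def prod_zero_iff)
    finally have "(\<lambda>n. ennreal (\<Prod>j\<in>J. clip n (Y j \<omega> - a j))) \<longlonglongrightarrow> ennreal (if \<forall>j\<in>J. Y j \<omega> \<le> a j then 1 else 0)"
      by (rule tendsto_ennrealI)
    moreover have "ennreal (if \<forall>j\<in>J. Y j \<omega> \<le> a j then 1 else 0) = (if \<forall>j\<in>J. Y j \<omega> \<le> a j then 1 else 0)" by simp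
    moreover have "ennreal (\<Prod>j\<in>J. clip n (Y j \<omega> - a j)) = ?f n Y \<omega>" for n
      using clip_bounds by (simp add: prod_ennreal)
    ultimately show ?thesis by (simp only:)
  qed
  let ?V = "\<lambda>j \<omega>. V \<omega> j" and ?V' = "\<lambda>j \<omega>. V' \<omega> j"
  \<comment> \<open>The products are bounded by 1, so constants dominate on the left and the
    integrable \<open>D\<close> dominates on the right.\<close>
  have eq_n: "(\<integral>\<^sup>+\<omega>. ?f n ?V \<omega> \<partial>M) = (\<integral>\<^sup>+\<omega>. D \<omega> * ?f n ?V' \<omega> \<partial>M)" for n
  proof (rule LIMSEQ_unique)
    show "(\<lambda>m. \<integral>\<^sup>+\<omega>. ?f n (Vm (r m)) \<omega> \<partial>M) \<longlonglongrightarrow> (\<integral>\<^sup>+\<omega>. ?f n ?V \<omega> \<partial>M)"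
    proof (rule nn_integral_dominated_convergence[where w="\<lambda>_. 1"])
      show "AE \<omega> in M. (\<lambda>m. ?f n (Vm (r m)) \<omega>) \<longlonglongrightarrow> ?f n ?V \<omega>"
        using AE_V by eventually_elim (rule f_tendsto)
    qed (use f_le in \<open>auto simp: emeasure_space_1\<close>)
    have "(\<lambda>m. \<integral>\<^sup>+\<omega>. D \<omega> * ?f n (Vm' (r m)) \<omega> \<partial>M) \<longlonglongrightarrow> (\<integral>\<^sup>+\<omega>. D \<omega> * ?f n ?V' \<omega> \<partial>M)"
    proof (rule nn_integral_dominated_convergence[where w=D])
      have "AE \<omega> in M. D \<omega> \<noteq> \<infinity>" using D_fin by (intro nn_integral_PInf_AE) auto
      then show "AE \<omega> in M. (\<lambda>m. D \<omega> * ?f n (Vm' (r m)) \<omega>) \<longlonglongrightarrow> D \<omega> * ?f n ?V' \<omega>"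
        using AE_V'
      proof eventually_elim
        case (elim \<omega>)
        show ?case
          using elim by (intro ennreal_tendsto_cmult f_tendsto[of "\<lambda>m. Vm' (r m)"]) (simp_all add: less_top)
      qed
      show "AE \<omega> in M. D \<omega> * ?f n (Vm' (r m)) \<omega> \<le> D \<omega>" for m
        by (rule AE_I2) (use mult_left_mono[OF f_le[of n "Vm' (r m)"], of "D _"] in simp)
    qed (use D_fin in auto)
    moreover have "(\<integral>\<^sup>+\<omega>. D \<omega> * ?f n (Vm' (r m)) \<omega> \<partial>M) = (\<integral>\<^sup>+\<omega>. ?f n (Vm (r m)) \<omega> \<partial>M)" for m
      using eq[OF J, of "\<lambda>j x. clip n (x - a j)" "r m"] by simp
    ultimately show "(\<lambda>m. \<integral>\<^sup>+\<omega>. ?f n (Vm (r m)) \<omega> \<partial>M) \<longlonglongrightarrow> (\<integral>\<^sup>+\<omega>. D \<omega> * ?f n ?V' \<omega> \<partial>M)" by simp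
  qed
  have lim_V: "(\<lambda>n. \<integral>\<^sup>+\<omega>. ?f n ?V \<omega> \<partial>M) \<longlonglongrightarrow> (\<integral>\<^sup>+\<omega>. (if \<forall>j\<in>J. V \<omega> j \<le> a j then 1 else 0) \<partial>M)"
  proof (rule nn_integral_dominated_convergence[where w="\<lambda>_. 1"])
    show "AE \<omega> in M. (\<lambda>n. ?f n ?V \<omega>) \<longlonglongrightarrow> (if \<forall>j\<in>J. V \<omega> j \<le> a j then 1 else 0)"
      by (intro AE_I2 f_ind)
    show "(\<lambda>\<omega>. if \<forall>j\<in>J. V \<omega> j \<le> a j then 1 else 0 :: ennreal) \<in> borel_measurable M"
      using J by measurable
    show "AE \<omega> in M. ?f n ?V \<omega> \<le> 1" for n by (rule AE_I2) (rule f_le)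
  qed (auto simp: emeasure_space_1)
  have lim_V': "(\<lambda>n. \<integral>\<^sup>+\<omega>. D \<omega> * ?f n ?V' \<omega> \<partial>M) \<longlonglongrightarrow> (\<integral>\<^sup>+\<omega>. D \<omega> * (if \<forall>j\<in>J. V' \<omega> j \<le> a j then 1 else 0) \<partial>M)"
  proof (rule nn_integral_dominated_convergence[where w=D])
    have "AE \<omega> in M. D \<omega> \<noteq> \<infinity>" using D_fin by (intro nn_integral_PInf_AE) auto
    then show "AE \<omega> in M. (\<lambda>n. D \<omega> * ?f n ?V' \<omega>) \<longlonglongrightarrow> D \<omega> * (if \<forall>j\<in>J. V' \<omega> j \<le> a j then 1 else 0)"
    proof eventually_elim
      case (elim \<omega>)
      then show ?case by (intro ennreal_tendsto_cmult f_ind) (simp add: less_top)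
    qed
    show "AE \<omega> in M. D \<omega> * ?f n ?V' \<omega> \<le> D \<omega>" for n
      by (rule AE_I2) (use mult_left_mono[OF f_le[of n ?V'], of "D _"] in simp)
    show "(\<lambda>\<omega>. D \<omega> * (if \<forall>j\<in>J. V' \<omega> j \<le> a j then 1 else 0 :: ennreal)) \<in> borel_measurable M"
      using J by measurable
  qed (use D_fin in auto)
  have cyl: "?c \<in> sets (\<Pi>\<^sub>M i\<in>I. borel)"
  proof -
    have "{f \<in> space (\<Pi>\<^sub>M i\<in>I. borel :: real measure). \<forall>j\<in>J. f j \<le> a j} \<in> sets (\<Pi>\<^sub>M i\<in>I. borel)"
      using J by (intro sets.sets_Collect_finite_All) (auto simp: subset_eq)
    then show ?thesis by (simp add: space_PiM)
  qed
  have V_in: "V \<omega> \<in> (\<Pi>\<^sub>E i\<in>I. UNIV)" "V' \<omega> \<in> (\<Pi>\<^sub>E i\<in>I. UNIV)" for \<omega>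
    using V(2) V'(2) by (auto simp: PiE_def)
  have "emeasure (distr M (\<Pi>\<^sub>M i\<in>I. borel) V) ?c = (\<integral>\<^sup>+\<omega>. (if \<forall>j\<in>J. V \<omega> j \<le> a j then 1 else 0) \<partial>M)"
  proof -
    have "emeasure (distr M (\<Pi>\<^sub>M i\<in>I. borel) V) ?c = (\<integral>\<^sup>+\<omega>. indicator ?c (V \<omega>) \<partial>M)"
      using nn_integral_distr[OF mV(1), of "indicator ?c"] cyl by (simp only: nn_integral_indicator sets_distr borel_measurable_indicator measurable_distr_eq1)
    also have "\<dots> = (\<integral>\<^sup>+\<omega>. (if \<forall>j\<in>J. V \<omega> j \<le> a j then 1 else 0) \<partial>M)"
      using V_in by (intro nn_integral_cong) (simp add: indicator_def)
    finally show ?thesis .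
  qed
  also have "\<dots> = (\<integral>\<^sup>+\<omega>. D \<omega> * (if \<forall>j\<in>J. V' \<omega> j \<le> a j then 1 else 0) \<partial>M)"
    using LIMSEQ_unique[OF lim_V lim_V'[folded eq_n]] .
  also have "\<dots> = emeasure (distr (density M D) (\<Pi>\<^sub>M i\<in>I. borel) V') ?c"
  proof -
    have "emeasure (distr (density M D) (\<Pi>\<^sub>M i\<in>I. borel) V') ?c = (\<integral>\<^sup>+\<omega>. indicator ?c (V' \<omega>) \<partial>density M D)"
      using nn_integral_distr[OF mV', of "indicator ?c"] cyl by (simp only: nn_integral_indicator sets_distr borel_measurable_indicator measurable_distr_eq1)
    also have "\<dots> = (\<integral>\<^sup>+\<omega>. D \<omega> * indicator ?c (V' \<omega>) \<partial>M)"
      using cyl by (intro nn_integral_density) auto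
    also have "\<dots> = (\<integral>\<^sup>+\<omega>. D \<omega> * (if \<forall>j\<in>J. V' \<omega> j \<le> a j then 1 else 0) \<partial>M)"
      using V_in by (intro nn_integral_cong) (simp add: indicator_def)
    finally show ?thesis by simp
  qed
  finally show "emeasure (distr M (\<Pi>\<^sub>M i\<in>I. borel) V) ?c = emeasure (distr (density M D) (\<Pi>\<^sub>M i\<in>I. borel) V') ?c" .
qed simp_all

text \<open>The stochastic exponential of the integral of \<open>\<eta>\<close> against
  \<open>W\<close>. The second elementary integral is taken against the identity path, so it is the
  time integral of the squared integrand.\<close>

definition elementary_density ::
  "(real \<Rightarrow> 'a \<Rightarrow> real) \<Rightarrow> real \<Rightarrow> nat \<Rightarrow> (nat \<Rightarrow> real) \<Rightarrow> (nat \<Rightarrow> 'a \<Rightarrow> real) \<Rightarrow> 'a \<Rightarrow> ennreal" where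
  "elementary_density W T n \<tau> \<eta> \<omega> =
     ennreal (exp (elementary_integral W n \<tau> \<eta> T \<omega> - elementary_integral (\<lambda>s _. s) n \<tau> (\<lambda>i \<omega>. (\<eta> i \<omega>)\<^sup>2) T \<omega> / 2))"

context filtered_brownian_motion
begin

lemma elementary_integral_measurable:
  assumes "time_grid T n \<tau>" "\<And>i. i < n \<Longrightarrow> \<xi> i \<in> borel_measurable M" "u \<in> {0..T}"
  shows "(\<lambda>\<omega>. elementary_integral W n \<tau> \<xi> u \<omega>) \<in> borel_measurable M"
proof -
  interpret time_grid T n \<tau> by fact
  have [measurable]: "W (min (\<tau> i) u) \<in> borel_measurable M" if "i \<le> n" for i
    using p_in[OF that] assms(3) by (intro W_meas) auto
  note assms(2)[measurable]
  show ?thesis unfolding elementary_integral_def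
    by (intro borel_measurable_sum borel_measurable_times borel_measurable_diff assms(2)) auto
qed

lemma elementary_density_measurable:
  assumes "time_grid T n \<tau>" "\<And>i. i < n \<Longrightarrow> \<eta> i \<in> borel_measurable M" "T \<ge> 0"
  shows "elementary_density W T n \<tau> \<eta> \<in> borel_measurable M"
proof -
  have [measurable]: "(\<lambda>\<omega>. elementary_integral W n \<tau> \<eta> T \<omega>) \<in> borel_measurable M"
    using assms by (intro elementary_integral_measurable) auto
  have [measurable]: "(\<lambda>\<omega>. elementary_integral (\<lambda>s _. s) n \<tau> (\<lambda>i \<omega>. (\<eta> i \<omega>)\<^sup>2) T \<omega>) \<in> borel_measurable M"
    unfolding elementary_integral_def using assms(2)
    by (intro borel_measurable_sum borel_measurable_times borel_measurable_power borel_measurable_const) auto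
  show ?thesis unfolding elementary_density_def[abs_def] by measurable
qed

text \<open>On a grid refining both partitions and containing all times of \<open>J\<close>, the
  quantities are functions of the increments and of \<open>X\<close>. Shifting each increment by its
  drift turns \<open>I\<close> into \<open>I - K\<close> and leaves \<open>K\<close>, a function of
  \<open>X\<close> alone, unchanged. The Boolean in the index selects between the two
  components.\<close>

lemma elementary_girsanov:
  assumes X: "X \<in> M \<rightarrow>\<^sub>M S"
    and ind: "indep_set (sets (vimage_algebra (space M) (\<lambda>\<omega>. \<lambda>t\<in>{0..T}. W t \<omega>) (\<Pi>\<^sub>M t\<in>{0..T}. borel)))
       (sets (vimage_algebra (space M) X S))"
    and \<tau>: "time_grid T n \<tau>" and b: "\<And>i. i < n \<Longrightarrow> b i \<in> borel_measurable S"
    and \<tau>': "time_grid T n' \<tau>'" and c: "\<And>i. i < n' \<Longrightarrow> c i \<in> borel_measurable S"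
    and H: "\<And>u. u \<in> {0..T} \<Longrightarrow> H u \<in> borel_measurable S"
    and J: "finite J" "J \<subseteq> {0..T} \<times> UNIV" and f: "\<And>j. j \<in> J \<Longrightarrow> f j \<in> borel_measurable borel"
  defines "I \<equiv> \<lambda>u \<omega>. H u (X \<omega>) + elementary_integral W n' \<tau>' (\<lambda>i \<omega>. c i (X \<omega>)) u \<omega>"
    and "K \<equiv> \<lambda>u \<omega>. LBINT s:{0..u}. elementary_process n' \<tau>' (\<lambda>i \<omega>. c i (X \<omega>)) s \<omega> * elementary_process n \<tau> (\<lambda>i \<omega>. b i (X \<omega>)) s \<omega>"
  shows "(\<integral>\<^sup>+\<omega>. (\<Prod>j\<in>J. ennreal (f j (if snd j then I (fst j) \<omega> else K (fst j) \<omega>))) \<partial>M)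
    = (\<integral>\<^sup>+\<omega>. elementary_density W T n \<tau> (\<lambda>i \<omega>. b i (X \<omega>)) \<omega> *
        (\<Prod>j\<in>J. ennreal (f j (if snd j then I (fst j) \<omega> - K (fst j) \<omega> else K (fst j) \<omega>))) \<partial>M)"
proof -
  have "finite (fst ` J)" "fst ` J \<subseteq> {0..T}" using J by auto
  then obtain N p where p: "time_grid T N p" and sub: "\<tau> ` {..n} \<subseteq> p ` {..N}" "\<tau>' ` {..n'} \<subseteq> p ` {..N}" "fst ` J \<subseteq> p ` {..N}"
    using common_time_grid[OF \<tau> \<tau>'] by metis
  interpret time_grid T N p by (rule p)
  interpret a: time_grid T n \<tau> by (rule \<tau>)
  interpret a': time_grid T n' \<tau>' by (rule \<tau>')
  let ?D = "grid_increments N p"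
  define \<theta> where "\<theta> i = elementary_process n \<tau> b (p (Suc i))" for i
  define \<kappa> where "\<kappa> i = elementary_process n' \<tau>' c (p (Suc i))" for i
  have [measurable]: "\<theta> i \<in> borel_measurable S" for i
    unfolding \<theta>_def elementary_process_def[abs_def]
    by (intro borel_measurable_sum borel_measurable_times borel_measurable_const b) auto
  have [measurable]: "\<kappa> i \<in> borel_measurable S" for i
    unfolding \<kappa>_def elementary_process_def[abs_def]
    by (intro borel_measurable_sum borel_measurable_times borel_measurable_const c) auto
  have TN: "T \<in> p ` {..N}" using p_N by force
  have pT: "indicator {..T} (p (Suc i)) = (1::real)" if "i < N" for i using p_in[of "Suc i"] that by simp
  have I_grid: "I u \<omega> = H u (X \<omega>) + (\<Sum>i<N. \<kappa> i (X \<omega>) * indicator {..u} (p (Suc i)) * ?D \<omega> i)" if "u \<in> fst ` J" for u \<omega>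
    unfolding I_def using that sub
    by (subst elementary_integral_grid[OF a'.p_less_Suc sub(2)])
       (auto simp: \<kappa>_def grid_increments_def elementary_process_def intro!: sum.cong)
  have K_grid: "K u \<omega> = (\<Sum>i<N. \<kappa> i (X \<omega>) * \<theta> i (X \<omega>) * indicator {..u} (p (Suc i)) * (p (Suc i) - p i))" if "u \<in> fst ` J" for u \<omega>
    unfolding K_def
  proof (rule integral_cells(1))
    show "elementary_process n' \<tau>' (\<lambda>i \<omega>. c i (X \<omega>)) s \<omega> * elementary_process n \<tau> (\<lambda>i \<omega>. b i (X \<omega>)) s \<omega>
        = \<kappa> i (X \<omega>) * \<theta> i (X \<omega>)" if "i < N" "s \<in> {p i<..p (Suc i)}" for i s
      unfolding elementary_process_cell[OF that sub(1)] elementary_process_cell[OF that sub(2)]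
      by (simp add: \<kappa>_def \<theta>_def elementary_process_def)
  qed (use that sub(3) in auto)
  have E1: "elementary_integral W n \<tau> (\<lambda>i \<omega>. b i (X \<omega>)) T \<omega> = (\<Sum>i<N. \<theta> i (X \<omega>) * ?D \<omega> i)" for \<omega>
    by (subst elementary_integral_grid[OF a.p_less_Suc sub(1) TN])
       (auto simp: \<theta>_def grid_increments_def elementary_process_def pT intro!: sum.cong)
  have E2: "elementary_integral (\<lambda>s _. s) n \<tau> (\<lambda>i \<omega>. (b i (X \<omega>))\<^sup>2) T \<omega> = (\<Sum>i<N. (\<theta> i (X \<omega>))\<^sup>2 * (p (Suc i) - p i))" for \<omega>
  proof -
    have "elementary_process n \<tau> (\<lambda>i \<omega>. b i (X \<omega>)) s \<omega> = elementary_process n \<tau> b s (X \<omega>)" for s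
      by (simp add: elementary_process_def)
    then have "elementary_process n \<tau> (\<lambda>i \<omega>. (b i (X \<omega>))\<^sup>2) (p (Suc i)) \<omega> = (\<theta> i (X \<omega>))\<^sup>2" for i
      unfolding a.elementary_process_power2 by (simp add: \<theta>_def)
    then show ?thesis
      by (subst elementary_integral_grid[OF a.p_less_Suc sub(1) TN]) (auto simp: pT intro!: sum.cong)
  qed
  define F where "F z = (\<Prod>j\<in>J. ennreal (f j (if snd j
      then H (fst j) (snd z) + (\<Sum>i<N. \<kappa> i (snd z) * indicator {..fst j} (p (Suc i)) * fst z i)
      else (\<Sum>i<N. \<kappa> i (snd z) * \<theta> i (snd z) * indicator {..fst j} (p (Suc i)) * (p (Suc i) - p i)))))" for z
  have [measurable]: "F \<in> borel_measurable ((\<Pi>\<^sub>M i\<in>{..<N}. borel) \<Otimes>\<^sub>M S)"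
  proof -
    have [measurable]: "H (fst j) \<in> borel_measurable S" "f j \<in> borel_measurable borel" if "j \<in> J" for j
      using H f J that by auto
    have "(\<lambda>z. f j (if snd j
      then H (fst j) (snd z) + (\<Sum>i<N. \<kappa> i (snd z) * indicator {..fst j} (p (Suc i)) * fst z i)
      else (\<Sum>i<N. \<kappa> i (snd z) * \<theta> i (snd z) * indicator {..fst j} (p (Suc i)) * (p (Suc i) - p i))))
      \<in> borel_measurable ((\<Pi>\<^sub>M i\<in>{..<N}. borel) \<Otimes>\<^sub>M S)" if "j \<in> J" for j
      using that by (cases "snd j") (simp_all, measurable)
    then show ?thesis unfolding F_def[abs_def] by (intro borel_measurable_prod_ennreal measurable_compose[OF _ measurable_ennreal])
  qed
  have "(\<integral>\<^sup>+\<omega>. (\<Prod>j\<in>J. ennreal (f j (if snd j then I (fst j) \<omega> else K (fst j) \<omega>))) \<partial>M)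
     = (\<integral>\<^sup>+\<omega>. F (?D \<omega>, X \<omega>) \<partial>M)"
    unfolding F_def by (intro nn_integral_cong prod.cong refl) (simp add: I_grid K_grid)
  also have "\<dots> = (\<integral>\<^sup>+\<omega>. F (\<lambda>i\<in>{..<N}. ?D \<omega> i - \<theta> i (X \<omega>) * (p (Suc i) - p i), X \<omega>) *
        ennreal (exp (\<Sum>i<N. \<theta> i (X \<omega>) * ?D \<omega> i - (\<theta> i (X \<omega>))\<^sup>2 * (p (Suc i) - p i) / 2)) \<partial>M)"
    by (rule grid_girsanov[OF p X ind, symmetric]) measurable
  also have "\<dots> = (\<integral>\<^sup>+\<omega>. elementary_density W T n \<tau> (\<lambda>i \<omega>. b i (X \<omega>)) \<omega> *
        (\<Prod>j\<in>J. ennreal (f j (if snd j then I (fst j) \<omega> - K (fst j) \<omega> else K (fst j) \<omega>))) \<partial>M)"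
  proof (rule nn_integral_cong)
    fix \<omega>
    have 1: "ennreal (exp (\<Sum>i<N. \<theta> i (X \<omega>) * ?D \<omega> i - (\<theta> i (X \<omega>))\<^sup>2 * (p (Suc i) - p i) / 2))
        = elementary_density W T n \<tau> (\<lambda>i \<omega>. b i (X \<omega>)) \<omega>"
      unfolding elementary_density_def E1 E2 by (simp add: sum_subtractf sum_divide_distrib)
    have 2: "F (\<lambda>i\<in>{..<N}. ?D \<omega> i - \<theta> i (X \<omega>) * (p (Suc i) - p i), X \<omega>)
        = (\<Prod>j\<in>J. ennreal (f j (if snd j then I (fst j) \<omega> - K (fst j) \<omega> else K (fst j) \<omega>)))"
      unfolding F_def
    proof (intro prod.cong refl arg_cong[where f=ennreal])
      fix j assume j: "j \<in> J"
      have "(\<Sum>i<N. \<kappa> i (X \<omega>) * indicator {..fst j} (p (Suc i)) * (\<lambda>i\<in>{..<N}. ?D \<omega> i - \<theta> i (X \<omega>) * (p (Suc i) - p i)) i)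
          = (\<Sum>i<N. \<kappa> i (X \<omega>) * indicator {..fst j} (p (Suc i)) * ?D \<omega> i
              - \<kappa> i (X \<omega>) * \<theta> i (X \<omega>) * indicator {..fst j} (p (Suc i)) * (p (Suc i) - p i))"
        by (intro sum.cong refl) (simp add: algebra_simps)
      also have "\<dots> = I (fst j) \<omega> - H (fst j) (X \<omega>) - K (fst j) \<omega>"
        using j by (simp add: I_grid K_grid sum_subtractf)
      finally show "f j (if snd j
          then H (fst j) (snd (\<lambda>i\<in>{..<N}. ?D \<omega> i - \<theta> i (X \<omega>) * (p (Suc i) - p i), X \<omega>)) +
            (\<Sum>i<N. \<kappa> i (snd (\<lambda>i\<in>{..<N}. ?D \<omega> i - \<theta> i (X \<omega>) * (p (Suc i) - p i), X \<omega>)) * indicator {..fst j} (p (Suc i)) *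
              fst (\<lambda>i\<in>{..<N}. ?D \<omega> i - \<theta> i (X \<omega>) * (p (Suc i) - p i), X \<omega>) i)
          else (\<Sum>i<N. \<kappa> i (snd (\<lambda>i\<in>{..<N}. ?D \<omega> i - \<theta> i (X \<omega>) * (p (Suc i) - p i), X \<omega>)) *
              \<theta> i (snd (\<lambda>i\<in>{..<N}. ?D \<omega> i - \<theta> i (X \<omega>) * (p (Suc i) - p i), X \<omega>)) * indicator {..fst j} (p (Suc i)) * (p (Suc i) - p i)))
        = f j (if snd j then I (fst j) \<omega> - K (fst j) \<omega> else K (fst j) \<omega>)"
        unfolding fst_conv snd_conv using j by (simp only: K_grid[symmetric] imageI) (simp add: algebra_simps)
    qed
    show "F (\<lambda>i\<in>{..<N}. ?D \<omega> i - \<theta> i (X \<omega>) * (p (Suc i) - p i), X \<omega>) *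
        ennreal (exp (\<Sum>i<N. \<theta> i (X \<omega>) * ?D \<omega> i - (\<theta> i (X \<omega>))\<^sup>2 * (p (Suc i) - p i) / 2))
      = elementary_density W T n \<tau> (\<lambda>i \<omega>. b i (X \<omega>)) \<omega> *
        (\<Prod>j\<in>J. ennreal (f j (if snd j then I (fst j) \<omega> - K (fst j) \<omega> else K (fst j) \<omega>)))"
      unfolding 1 2 by (rule mult.commute)
  qed
  finally show ?thesis .
qed

end

section \<open>Approximation by bounded sampled step processes\<close>

definition truncate :: "nat \<Rightarrow> real \<Rightarrow> real" where
  "truncate c x = max (- real c) (min (real c) x)"

lemma truncate_bound: "\<bar>truncate c x\<bar> \<le> real c"
  by (auto simp: truncate_def)

lemma truncate_diff_le: "\<bar>truncate c x - x\<bar> \<le> \<bar>x\<bar>"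
  by (auto simp: truncate_def)

lemma truncate_tendsto: "(\<lambda>c. truncate c x) \<longlonglongrightarrow> x"
proof -
  obtain n :: nat where n: "\<bar>x\<bar> < real n" using reals_Archimedean2 by blast
  have "truncate c x = x" if "n \<le> c" for c
  proof -
    have "\<bar>x\<bar> < real c" using n that by (meson less_le_trans of_nat_le_iff)
    then show ?thesis by (auto simp: truncate_def)
  qed
  then have "\<forall>\<^sub>F c in sequentially. truncate c x = x" by (auto simp: eventually_sequentially)
  then show ?thesis by (rule tendsto_eventually)
qed

lemma measurable_truncate [measurable]: "truncate c \<in> borel_measurable borel"
  unfolding truncate_def[abs_def] by measurable

lemma (in time_grid) elementary_process_bound:
  assumes "\<And>i. i < N \<Longrightarrow> \<bar>\<xi> i \<omega>\<bar> \<le> c" "0 \<le> c"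
  shows "\<bar>elementary_process N p \<xi> s \<omega>\<bar> \<le> c"
proof (cases "s \<in> {0<..T}")
  case True
  then obtain i where i: "i < N" "s \<in> {p i<..p (Suc i)}" by (rule ex_cell)
  show ?thesis unfolding elementary_process_on_cell(1)[OF i] by (rule assms(1)[OF i(1)])
next
  case False
  show ?thesis unfolding elementary_process_on_cell(2)[OF False] using assms(2) by simp
qed

lemma measurable_elementary_process:
  assumes "\<And>i. i < n \<Longrightarrow> \<xi> i \<in> borel_measurable M"
  shows "(\<lambda>(s, \<omega>). elementary_process n \<tau> \<xi> s \<omega>) \<in> borel_measurable (borel \<Otimes>\<^sub>M M)"
proof -
  have [measurable]: "\<xi> i \<in> borel_measurable M" if "i \<in> {..<n}" for i using assms that by simp
  show ?thesis unfolding elementary_process_def case_prod_beta by measurable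
qed

text \<open>After truncation at level \<open>c\<close>, the square of the sampling error is at most
  a multiple of its absolute value, so the sampling result in mean is enough for mean squares. The
  truncation error itself vanishes pathwise by square integrability.\<close>

lemma (in prob_space) ex_elementary_approx:
  fixes Q :: "real \<times> 'a \<Rightarrow> real"
  assumes Q[measurable]: "Q \<in> borel_measurable (borel \<Otimes>\<^sub>M M)"
    and sq: "AE \<omega> in M. (\<integral>\<^sup>+s\<in>{0..T}. ennreal ((Q (s, \<omega>))\<^sup>2) \<partial>lborel) < \<infinity>"
    and T: "T > 0" and e: "e > 0"
  obtains c n \<tau> where "time_grid T n \<tau>"
    "(\<integral>\<^sup>+\<omega>. min 1 (\<integral>\<^sup>+s\<in>{0..T}. ennreal ((elementary_process n \<tau> (\<lambda>i \<omega>. truncate c (Q (\<tau> i, \<omega>))) s \<omega> - Q (s, \<omega>))\<^sup>2) \<partial>lborel) \<partial>M) \<le> ennreal e"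
proof -
  define B where "B c \<omega> = (\<integral>\<^sup>+s\<in>{0..T}. ennreal ((truncate c (Q (s, \<omega>)) - Q (s, \<omega>))\<^sup>2) \<partial>lborel)" for c \<omega>
  have [measurable]: "B c \<in> borel_measurable M" for c unfolding B_def[abs_def] by measurable
  have B_lim: "AE \<omega> in M. (\<lambda>c. B c \<omega>) \<longlonglongrightarrow> 0"
    using sq AE_space
  proof eventually_elim
    case (elim \<omega>)
    note [simp] = elim(2)
    have "(\<lambda>c. B c \<omega>) \<longlonglongrightarrow> (\<integral>\<^sup>+s\<in>{0..T}. 0 \<partial>lborel)"
      unfolding B_def
    proof (rule nn_integral_dominated_convergence[where w="\<lambda>s. ennreal ((Q (s, \<omega>))\<^sup>2) * indicator {0..T} s"])
      show "AE s in lborel. ennreal ((truncate c (Q (s, \<omega>)) - Q (s, \<omega>))\<^sup>2) * indicator {0..T} s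
          \<le> ennreal ((Q (s, \<omega>))\<^sup>2) * indicator {0..T} s" for c
        using truncate_diff_le by (intro AE_I2 mult_right_mono ennreal_leI) (simp_all add: abs_le_square_iff)
      show "AE s in lborel. (\<lambda>c. ennreal ((truncate c (Q (s, \<omega>)) - Q (s, \<omega>))\<^sup>2) * indicator {0..T} s)
          \<longlonglongrightarrow> 0 * indicator {0..T} s"
      proof (rule AE_I2)
        fix s
        have "(\<lambda>c. (truncate c (Q (s, \<omega>)) - Q (s, \<omega>))\<^sup>2) \<longlonglongrightarrow> (Q (s, \<omega>) - Q (s, \<omega>))\<^sup>2"
          by (intro tendsto_intros truncate_tendsto)
        then have "(\<lambda>c. ennreal ((truncate c (Q (s, \<omega>)) - Q (s, \<omega>))\<^sup>2)) \<longlonglongrightarrow> 0"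
          using tendsto_ennrealI by fastforce
        then show "(\<lambda>c. ennreal ((truncate c (Q (s, \<omega>)) - Q (s, \<omega>))\<^sup>2) * indicator {0..T} s) \<longlonglongrightarrow> 0 * indicator {0..T} s"
          by (cases "s \<in> {0..T}") auto
      qed
    qed (use elim(1) in \<open>auto\<close>)
    then show ?case by simp
  qed
  \<comment> \<open>The factor 2 anticipates the splitting
    \<open>(x + y)\<^sup>2 \<le> 2 * x\<^sup>2 + 2 * y\<^sup>2\<close> of the total error.\<close>
  have "(\<lambda>c. \<integral>\<^sup>+\<omega>. min 1 (2 * B c \<omega>) \<partial>M) \<longlonglongrightarrow> (\<integral>\<^sup>+\<omega>. 0 \<partial>M)"
  proof (rule nn_integral_dominated_convergence[where w="\<lambda>_. 1"])
    show "AE \<omega> in M. (\<lambda>c. min 1 (2 * B c \<omega>)) \<longlonglongrightarrow> 0"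
      using B_lim
    proof eventually_elim
      case (elim \<omega>)
      have "(\<lambda>c. 2 * B c \<omega>) \<longlonglongrightarrow> 2 * 0" by (intro ennreal_tendsto_cmult elim) simp
      then have "(\<lambda>c. min 1 (2 * B c \<omega>)) \<longlonglongrightarrow> min 1 (2 * 0)" by (intro tendsto_min tendsto_const)
      then show ?case by simp
    qed
  qed (auto simp: emeasure_space_1)
  then have "\<forall>\<^sub>F c in sequentially. (\<integral>\<^sup>+\<omega>. min 1 (2 * B c \<omega>) \<partial>M) < ennreal (e / 2)"
    using e by (intro order_tendstoD) auto
  then obtain c where c: "(\<integral>\<^sup>+\<omega>. min 1 (2 * B c \<omega>) \<partial>M) < ennreal (e / 2)"
    by (auto dest: eventually_happens)
  define q where "q z = truncate c (Q z)" for z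
  have [measurable]: "q \<in> borel_measurable (borel \<Otimes>\<^sub>M M)" unfolding q_def[abs_def] by measurable
  have q_b: "\<bar>q z\<bar> \<le> real c" for z unfolding q_def by (rule truncate_bound)
  \<comment> \<open>The squared sampling error is bounded by \<open>2 * real c\<close> times its
    absolute value and counted twice, whence \<open>4 * real c * e' \<le> e / 2\<close>; the summand
    8 covers \<open>c = 0\<close>.\<close>
  define e' where "e' = e / (8 * real c + 8)"
  have e': "e' > 0" "4 * real c * e' \<le> e / 2" using e by (auto simp: e'_def field_simps)
  obtain n \<tau> where grid: "time_grid T n \<tau>"
    and le: "(\<integral>\<^sup>+\<omega>. (\<integral>\<^sup>+s\<in>{0..T}. ennreal \<bar>elementary_process n \<tau> (\<lambda>i \<omega>. q (\<tau> i, \<omega>)) s \<omega> - q (s, \<omega>)\<bar> \<partial>lborel) \<partial>M) \<le> ennreal e'"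
    by (rule ex_grid_sampling[of q "real c" T e']) (use q_b T e' in auto)
  interpret time_grid T n \<tau> by (rule grid)
  let ?S = "elementary_process n \<tau> (\<lambda>i \<omega>. q (\<tau> i, \<omega>))"
  have [measurable]: "(\<lambda>(s, \<omega>). ?S s \<omega>) \<in> borel_measurable (borel \<Otimes>\<^sub>M M)"
    by (rule measurable_elementary_process) measurable
  define A where "A \<omega> = (\<integral>\<^sup>+s\<in>{0..T}. ennreal \<bar>?S s \<omega> - q (s, \<omega>)\<bar> \<partial>lborel)" for \<omega>
  have [measurable]: "A \<in> borel_measurable M" unfolding A_def[abs_def] by measurable
  have pt: "(?S s \<omega> - Q (s, \<omega>))\<^sup>2 \<le> 4 * real c * \<bar>?S s \<omega> - q (s, \<omega>)\<bar> + 2 * (q (s, \<omega>) - Q (s, \<omega>))\<^sup>2" for s \<omega>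
  proof -
    have b: "\<bar>?S s \<omega> - q (s, \<omega>)\<bar> \<le> 2 * real c"
      using elementary_process_bound[of "\<lambda>i \<omega>. q (\<tau> i, \<omega>)" \<omega> "real c" s] q_b[of "(s, \<omega>)"] q_b by fastforce
    have "(?S s \<omega> - Q (s, \<omega>))\<^sup>2 \<le> 2 * (?S s \<omega> - q (s, \<omega>))\<^sup>2 + 2 * (q (s, \<omega>) - Q (s, \<omega>))\<^sup>2"
    proof -
      have "0 \<le> ((?S s \<omega> - q (s, \<omega>)) - (q (s, \<omega>) - Q (s, \<omega>)))\<^sup>2" by simp
      then show ?thesis by (simp add: power2_eq_square algebra_simps)
    qed
    also have "(?S s \<omega> - q (s, \<omega>))\<^sup>2 \<le> 2 * real c * \<bar>?S s \<omega> - q (s, \<omega>)\<bar>"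
      using mult_right_mono[OF b, of "\<bar>?S s \<omega> - q (s, \<omega>)\<bar>"] by (simp add: power2_eq_square abs_mult[symmetric])
    finally show ?thesis by simp
  qed
  show thesis
  proof (rule that[OF grid, of c])
    have "(\<integral>\<^sup>+\<omega>. min 1 (\<integral>\<^sup>+s\<in>{0..T}. ennreal ((?S s \<omega> - Q (s, \<omega>))\<^sup>2) \<partial>lborel) \<partial>M)
      \<le> (\<integral>\<^sup>+\<omega>. ennreal (4 * real c) * A \<omega> + min 1 (2 * B c \<omega>) \<partial>M)"
    proof (rule nn_integral_mono)
      fix \<omega> assume [simp]: "\<omega> \<in> space M"
      have [measurable]: "(\<lambda>s. ?S s \<omega>) \<in> borel_measurable borel"
        unfolding elementary_process_def by measurable
      have "(\<integral>\<^sup>+s\<in>{0..T}. ennreal ((?S s \<omega> - Q (s, \<omega>))\<^sup>2) \<partial>lborel)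
        \<le> (\<integral>\<^sup>+s. ennreal (4 * real c) * (ennreal \<bar>?S s \<omega> - q (s, \<omega>)\<bar> * indicator {0..T} s)
              + 2 * (ennreal ((q (s, \<omega>) - Q (s, \<omega>))\<^sup>2) * indicator {0..T} s) \<partial>lborel)"
      proof (rule nn_integral_mono)
        fix s
        have "ennreal ((?S s \<omega> - Q (s, \<omega>))\<^sup>2) \<le> ennreal (4 * real c) * ennreal \<bar>?S s \<omega> - q (s, \<omega>)\<bar> + 2 * ennreal ((q (s, \<omega>) - Q (s, \<omega>))\<^sup>2)"
        proof -
          have "ennreal ((?S s \<omega> - Q (s, \<omega>))\<^sup>2) \<le> ennreal (4 * real c * \<bar>?S s \<omega> - q (s, \<omega>)\<bar> + 2 * (q (s, \<omega>) - Q (s, \<omega>))\<^sup>2)"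
            by (rule ennreal_leI[OF pt])
          also have "\<dots> = ennreal (4 * real c) * ennreal \<bar>?S s \<omega> - q (s, \<omega>)\<bar> + ennreal 2 * ennreal ((q (s, \<omega>) - Q (s, \<omega>))\<^sup>2)"
            by (subst ennreal_plus) (simp_all only: ennreal_mult mult_nonneg_nonneg zero_le_power2 abs_ge_zero of_nat_0_le_iff zero_le_numeral)
          finally show ?thesis by simp
        qed
        then show "ennreal ((?S s \<omega> - Q (s, \<omega>))\<^sup>2) * indicator {0..T} s \<le>
            ennreal (4 * real c) * (ennreal \<bar>?S s \<omega> - q (s, \<omega>)\<bar> * indicator {0..T} s)
              + 2 * (ennreal ((q (s, \<omega>) - Q (s, \<omega>))\<^sup>2) * indicator {0..T} s)"
          by (auto simp: indicator_def)
      qed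
      also have "\<dots> = ennreal (4 * real c) * A \<omega> + 2 * B c \<omega>"
        unfolding A_def B_def q_def[symmetric] by (subst nn_integral_add; (subst nn_integral_cmult)?; simp add: nn_integral_cmult)
      finally have "min 1 (\<integral>\<^sup>+s\<in>{0..T}. ennreal ((?S s \<omega> - Q (s, \<omega>))\<^sup>2) \<partial>lborel) \<le> min 1 (ennreal (4 * real c) * A \<omega> + 2 * B c \<omega>)"
        by (intro min.mono order_refl)
      also have "\<dots> \<le> ennreal (4 * real c) * A \<omega> + min 1 (2 * B c \<omega>)"
        by (cases "2 * B c \<omega> \<le> 1") (auto simp: min_def intro: add_increasing)
      finally show "min 1 (\<integral>\<^sup>+s\<in>{0..T}. ennreal ((?S s \<omega> - Q (s, \<omega>))\<^sup>2) \<partial>lborel) \<le> ennreal (4 * real c) * A \<omega> + min 1 (2 * B c \<omega>)" .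
    qed
    also have "\<dots> = ennreal (4 * real c) * (\<integral>\<^sup>+\<omega>. A \<omega> \<partial>M) + (\<integral>\<^sup>+\<omega>. min 1 (2 * B c \<omega>) \<partial>M)"
      by (simp add: nn_integral_add nn_integral_cmult)
    also have "\<dots> \<le> ennreal (4 * real c) * ennreal e' + ennreal (e / 2)"
      by (intro add_mono mult_left_mono less_imp_le[OF c]) (use le in \<open>auto simp: A_def\<close>)
    also have "\<dots> = ennreal (4 * real c * e' + e / 2)"
      using e e' by (simp add: ennreal_mult ennreal_plus)
    also have "\<dots> \<le> ennreal e" using e' by (intro ennreal_leI) simp
    finally show "(\<integral>\<^sup>+\<omega>. min 1 (\<integral>\<^sup>+s\<in>{0..T}. ennreal ((elementary_process n \<tau> (\<lambda>i \<omega>. truncate c (Q (\<tau> i, \<omega>))) s \<omega> - Q (s, \<omega>))\<^sup>2) \<partial>lborel) \<partial>M) \<le> ennreal e"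
      unfolding q_def .
  qed
qed

section \<open>Comparison of elementary integrals\<close>

context filtered_brownian_motion
begin

text \<open>The value at \<open>p (Suc i)\<close> involves only those \<open>\<xi> j\<close> with
  \<open>\<tau> j < p (Suc i)\<close>. As \<open>\<tau> j\<close> is a grid point, this means
  \<open>\<tau> j \<le> p i\<close>.\<close>

lemma elementary_process_previsible:
  assumes p: "time_grid T N p" and i: "i < N" and sub: "\<tau> ` {..n} \<subseteq> p ` {..N}"
    and \<xi>: "\<And>j. j < n \<Longrightarrow> \<xi> j \<in> borel_measurable (G (\<tau> j))"
  shows "elementary_process n \<tau> \<xi> (p (Suc i)) \<in> borel_measurable (G (p i))"
proof -
  interpret time_grid T N p by (rule p)
  have "(\<lambda>\<omega>. \<xi> j \<omega> * indicator {\<tau> j<..\<tau> (Suc j)} (p (Suc i))) \<in> borel_measurable (G (p i))" if j: "j < n" for j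
  proof (cases "\<tau> j < p (Suc i)")
    case True
    have "\<tau> j \<in> \<tau> ` {..n}" using j by simp
    then obtain l where l: "\<tau> j = p l" "l \<le> N" using sub by blast
    with True i have "l \<le> i" using p_less_iff[of l "Suc i"] by simp
    then have le: "\<tau> j \<le> p i" using p_le[of l i] i l by simp
    have "0 \<le> \<tau> j" "p i \<le> T" using p_in[OF l(2)] p_in[of i] i l by auto
    then have "\<xi> j \<in> borel_measurable (G (p i))" using G_mono[OF _ le _ \<xi>[OF j]] by simp
    then show ?thesis by simp
  next
    case False
    then have "indicator {\<tau> j<..\<tau> (Suc j)} (p (Suc i)) = (0::real)" by simp
    then show ?thesis by simp
  qed
  then show ?thesis unfolding elementary_process_def[abs_def] by (intro borel_measurable_sum) auto
qed

text \<open>On a common grid the difference is again an elementary integral with a bounded adapted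
  integrand, to which the domination estimate applies; stopping at \<open>u\<close> only reduces the
  quadratic variation.\<close>

lemma elementary_integral_diff_le:
  assumes \<tau>: "time_grid T n \<tau>" and \<tau>': "time_grid T n' \<tau>'"
    and \<xi>: "\<And>j. j < n \<Longrightarrow> \<xi> j \<in> borel_measurable (G (\<tau> j))" and \<xi>': "\<And>j. j < n' \<Longrightarrow> \<xi>' j \<in> borel_measurable (G (\<tau>' j))"
    and b: "\<And>j \<omega>. j < n \<Longrightarrow> \<omega> \<in> space M \<Longrightarrow> \<bar>\<xi> j \<omega>\<bar> \<le> c" and b': "\<And>j \<omega>. j < n' \<Longrightarrow> \<omega> \<in> space M \<Longrightarrow> \<bar>\<xi>' j \<omega>\<bar> \<le> c'"
    and u: "u \<in> {0..T}" and \<delta>: "\<delta> > 0"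
  shows "expectation (\<lambda>\<omega>. min 1 \<bar>elementary_integral W n \<tau> \<xi> u \<omega> - elementary_integral W n' \<tau>' \<xi>' u \<omega>\<bar>)
    \<le> sqrt \<delta> + prob {\<omega> \<in> space M. (\<integral>\<^sup>+s\<in>{0..T}. ennreal ((elementary_process n \<tau> \<xi> s \<omega> - elementary_process n' \<tau>' \<xi>' s \<omega>)\<^sup>2) \<partial>lborel) > ennreal \<delta>}"
proof -
  obtain N p where p: "time_grid T N p" and sub: "\<tau> ` {..n} \<subseteq> p ` {..N}" "\<tau>' ` {..n'} \<subseteq> p ` {..N}" "{u} \<subseteq> p ` {..N}"
    using common_time_grid[OF \<tau> \<tau>', of "{u}"] u by auto
  interpret time_grid T N p by (rule p)
  interpret a: time_grid T n \<tau> by (rule \<tau>)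
  interpret a': time_grid T n' \<tau>' by (rule \<tau>')
  let ?S = "elementary_process n \<tau> \<xi>" and ?S' = "elementary_process n' \<tau>' \<xi>'"
  define \<zeta> where "\<zeta> i \<omega> = (?S (p (Suc i)) \<omega> - ?S' (p (Suc i)) \<omega>) * indicator {..u} (p (Suc i))" for i \<omega>
  have up: "u \<in> p ` {..N}" using sub by auto
  have diff: "elementary_integral W n \<tau> \<xi> u \<omega> - elementary_integral W n' \<tau>' \<xi>' u \<omega>
      = (\<Sum>i<N. \<zeta> i \<omega> * (W (p (Suc i)) \<omega> - W (p i) \<omega>))" for \<omega>
    by (simp add: elementary_integral_grid[OF _ sub(1) up] elementary_integral_grid[OF _ sub(2) up]
      a.p_less_Suc a'.p_less_Suc \<zeta>_def left_diff_distrib sum_subtractf)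
  have \<zeta>_G: "\<zeta> i \<in> borel_measurable (G (p i))" if "i < N" for i
    unfolding \<zeta>_def[abs_def]
    using elementary_process_previsible[where \<xi>=\<xi>, OF p that sub(1) \<xi>] elementary_process_previsible[where \<xi>=\<xi>', OF p that sub(2) \<xi>']
    by (intro borel_measurable_times borel_measurable_diff) auto
  have \<zeta>_b: "\<bar>\<zeta> i \<omega>\<bar> \<le> max 0 c + max 0 c'" if "i < N" "\<omega> \<in> space M" for i \<omega>
  proof -
    have "\<bar>?S (p (Suc i)) \<omega>\<bar> \<le> max 0 c" "\<bar>?S' (p (Suc i)) \<omega>\<bar> \<le> max 0 c'"
      using b b' that by (intro a.elementary_process_bound a'.elementary_process_bound; force)+
    then show ?thesis by (auto simp: \<zeta>_def indicator_def)
  qed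
  have nn: "(\<integral>\<^sup>+s\<in>{0..T}. ennreal ((?S s \<omega> - ?S' s \<omega>)\<^sup>2) \<partial>lborel)
      = ennreal (\<Sum>i<N. (?S (p (Suc i)) \<omega> - ?S' (p (Suc i)) \<omega>)\<^sup>2 * (p (Suc i) - p i))" for \<omega>
  proof -
    have "(\<integral>\<^sup>+s\<in>{0..T}. ennreal ((?S s \<omega> - ?S' s \<omega>)\<^sup>2) \<partial>lborel)
      = (\<Sum>i<N. ennreal ((?S (p (Suc i)) \<omega> - ?S' (p (Suc i)) \<omega>)\<^sup>2) * ennreal (p (Suc i) - p i))"
    proof (rule nn_integral_cells)
      fix i s assume i: "i < N" "s \<in> {p i<..p (Suc i)}"
      show "ennreal ((?S s \<omega> - ?S' s \<omega>)\<^sup>2) = ennreal ((?S (p (Suc i)) \<omega> - ?S' (p (Suc i)) \<omega>)\<^sup>2)"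
        using elementary_process_cell[OF i sub(1), of \<xi> \<omega>] elementary_process_cell[OF i sub(2), of \<xi>' \<omega>] by simp
    qed
    also have "\<dots> = (\<Sum>i<N. ennreal ((?S (p (Suc i)) \<omega> - ?S' (p (Suc i)) \<omega>)\<^sup>2 * (p (Suc i) - p i)))"
      using p_less_Suc by (intro sum.cong refl ennreal_mult[symmetric]) (auto simp: less_imp_le)
    also have "\<dots> = ennreal (\<Sum>i<N. (?S (p (Suc i)) \<omega> - ?S' (p (Suc i)) \<omega>)\<^sup>2 * (p (Suc i) - p i))"
      using p_less_Suc by (intro sum_ennreal mult_nonneg_nonneg) (auto simp: less_imp_le)
    finally show ?thesis .
  qed
  have [measurable]: "\<xi> j \<in> borel_measurable M" if "j < n" for j using that a.p_in[of j] by (intro G_imp_M[OF _ \<xi>]) auto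
  have [measurable]: "\<xi>' j \<in> borel_measurable M" if "j < n'" for j using that a'.p_in[of j] by (intro G_imp_M[OF _ \<xi>']) auto
  have [measurable]: "(\<lambda>(s, \<omega>). ?S s \<omega>) \<in> borel_measurable (borel \<Otimes>\<^sub>M M)" "(\<lambda>(s, \<omega>). ?S' s \<omega>) \<in> borel_measurable (borel \<Otimes>\<^sub>M M)"
    by (rule measurable_elementary_process; simp)+
  have "expectation (\<lambda>\<omega>. min 1 \<bar>elementary_integral W n \<tau> \<xi> u \<omega> - elementary_integral W n' \<tau>' \<xi>' u \<omega>\<bar>)
    \<le> sqrt \<delta> + prob {\<omega> \<in> space M. (\<Sum>i<N. (\<zeta> i \<omega>)\<^sup>2 * (p (Suc i) - p i)) > \<delta>}"
    unfolding diff by (rule expectation_min_elementary_le[OF p \<zeta>_G \<zeta>_b \<delta>])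
  also have "prob {\<omega> \<in> space M. (\<Sum>i<N. (\<zeta> i \<omega>)\<^sup>2 * (p (Suc i) - p i)) > \<delta>}
      \<le> prob {\<omega> \<in> space M. (\<integral>\<^sup>+s\<in>{0..T}. ennreal ((?S s \<omega> - ?S' s \<omega>)\<^sup>2) \<partial>lborel) > ennreal \<delta>}"
  proof (rule finite_measure_mono)
    show "{\<omega> \<in> space M. (\<Sum>i<N. (\<zeta> i \<omega>)\<^sup>2 * (p (Suc i) - p i)) > \<delta>}
      \<subseteq> {\<omega> \<in> space M. (\<integral>\<^sup>+s\<in>{0..T}. ennreal ((?S s \<omega> - ?S' s \<omega>)\<^sup>2) \<partial>lborel) > ennreal \<delta>}"
    proof safe
      fix \<omega> assume "\<delta> < (\<Sum>i<N. (\<zeta> i \<omega>)\<^sup>2 * (p (Suc i) - p i))"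
      also have "\<dots> \<le> (\<Sum>i<N. (?S (p (Suc i)) \<omega> - ?S' (p (Suc i)) \<omega>)\<^sup>2 * (p (Suc i) - p i))"
        using p_less_Suc by (intro sum_mono mult_right_mono) (auto simp: \<zeta>_def indicator_def less_imp_le)
      finally show "ennreal \<delta> < (\<integral>\<^sup>+s\<in>{0..T}. ennreal ((?S s \<omega> - ?S' s \<omega>)\<^sup>2) \<partial>lborel)"
        unfolding nn using \<delta> by (intro ennreal_lessI) auto
    qed
    show "{\<omega> \<in> space M. (\<integral>\<^sup>+s\<in>{0..T}. ennreal ((?S s \<omega> - ?S' s \<omega>)\<^sup>2) \<partial>lborel) > ennreal \<delta>} \<in> events"
      by measurable
  qed
  finally show ?thesis by simp
qed

end

text \<open>Markov's inequality for \<open>min 1 D\<close>, which exceeds \<open>\<delta>\<close>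
  together with \<open>D\<close> up to the boundary case \<open>\<delta> = 1\<close>, where the weak
  inequality suffices.\<close>

lemma (in prob_space) prob_gt_le_nn_integral_min:
  fixes D :: "'a \<Rightarrow> ennreal"
  assumes [measurable]: "D \<in> borel_measurable M" and \<delta>: "0 < \<delta>" "\<delta> \<le> 1"
    and le: "(\<integral>\<^sup>+\<omega>. min 1 (D \<omega>) \<partial>M) \<le> ennreal e" and e: "0 \<le> e"
  shows "prob {\<omega> \<in> space M. D \<omega> > ennreal \<delta>} \<le> e / \<delta>"
proof -
  have "ennreal \<delta> * emeasure M {\<omega> \<in> space M. D \<omega> > ennreal \<delta>}
      = (\<integral>\<^sup>+\<omega>. ennreal \<delta> * indicator {\<omega> \<in> space M. D \<omega> > ennreal \<delta>} \<omega> \<partial>M)"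
    by (rule nn_integral_cmult_indicator[symmetric]) measurable
  also have "\<dots> \<le> (\<integral>\<^sup>+\<omega>. min 1 (D \<omega>) \<partial>M)"
    using \<delta> by (intro nn_integral_mono) (auto simp: indicator_def ennreal_le_1 less_imp_le)
  also note le
  finally have "\<delta> * prob {\<omega> \<in> space M. D \<omega> > ennreal \<delta>} \<le> e"
    using \<delta> e by (simp add: emeasure_eq_measure ennreal_mult[symmetric])
  then show ?thesis using \<delta> by (simp add: field_simps)
qed

lemma (in prob_space) expectation_min_le_prob:
  fixes X :: "'a \<Rightarrow> real"
  assumes [measurable]: "X \<in> borel_measurable M" and \<delta>: "0 \<le> \<delta>" and S: "S \<in> events"
    and le: "\<And>\<omega>. \<omega> \<in> space M \<Longrightarrow> \<bar>X \<omega>\<bar> > \<delta> \<Longrightarrow> \<omega> \<in> S"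
  shows "expectation (\<lambda>\<omega>. min 1 \<bar>X \<omega>\<bar>) \<le> \<delta> + prob S"
proof -
  have "expectation (\<lambda>\<omega>. min 1 \<bar>X \<omega>\<bar>) \<le> expectation (\<lambda>\<omega>. \<delta> + indicator S \<omega>)"
  proof (rule integral_mono)
    show "integrable M (\<lambda>\<omega>. min 1 \<bar>X \<omega>\<bar>)" by (rule integrable_const_bound[of _ 1]) auto
    show "integrable M (\<lambda>\<omega>. \<delta> + indicator S \<omega>)"
      using S by (intro Bochner_Integration.integrable_add) (auto simp: integrable_indicator_iff emeasure_eq_measure)
    show "min 1 \<bar>X \<omega>\<bar> \<le> \<delta> + indicator S \<omega>" if "\<omega> \<in> space M" for \<omega>
      using le[OF that] \<delta> by (cases "\<bar>X \<omega>\<bar> > \<delta>") (auto intro: min.coboundedI2 add_increasing2)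
  qed
  also have "\<dots> = \<delta> + prob S"
    using S by (subst Bochner_Integration.integral_add) (auto simp: integrable_indicator_iff emeasure_eq_measure prob_space)
  finally show ?thesis .
qed

lemma (in prob_space) expectation_min_triangle:
  fixes X Y Z :: "'a \<Rightarrow> real"
  assumes [measurable]: "X \<in> borel_measurable M" "Y \<in> borel_measurable M" "Z \<in> borel_measurable M"
  shows "expectation (\<lambda>\<omega>. min 1 \<bar>X \<omega> - Z \<omega>\<bar>) \<le> expectation (\<lambda>\<omega>. min 1 \<bar>X \<omega> - Y \<omega>\<bar>) + expectation (\<lambda>\<omega>. min 1 \<bar>Y \<omega> - Z \<omega>\<bar>)"
proof -
  have i: "integrable M (\<lambda>\<omega>. min 1 \<bar>A \<omega> - B \<omega>\<bar>)" if [measurable]: "A \<in> borel_measurable M" "B \<in> borel_measurable M" for A B :: "'a \<Rightarrow> real"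
    by (rule integrable_const_bound[of _ 1]) auto
  have "expectation (\<lambda>\<omega>. min 1 \<bar>X \<omega> - Z \<omega>\<bar>) \<le> expectation (\<lambda>\<omega>. min 1 \<bar>X \<omega> - Y \<omega>\<bar> + min 1 \<bar>Y \<omega> - Z \<omega>\<bar>)"
    by (intro integral_mono Bochner_Integration.integrable_add i) auto
  then show ?thesis by (simp add: i)
qed

lemma nn_integral_square_diff_le:
  fixes f g h :: "real \<Rightarrow> real"
  assumes [measurable]: "f \<in> borel_measurable borel" "g \<in> borel_measurable borel" "h \<in> borel_measurable borel"
    "A \<in> sets borel"
  shows "(\<integral>\<^sup>+s\<in>A. ennreal ((f s - g s)\<^sup>2) \<partial>lborel)
    \<le> 2 * (\<integral>\<^sup>+s. ennreal ((f s - h s)\<^sup>2) * indicator A s \<partial>lborel) + 2 * (\<integral>\<^sup>+s. ennreal ((g s - h s)\<^sup>2) * indicator A s \<partial>lborel)"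
proof -
  have "(\<integral>\<^sup>+s\<in>A. ennreal ((f s - g s)\<^sup>2) \<partial>lborel)
    \<le> (\<integral>\<^sup>+s. 2 * (ennreal ((f s - h s)\<^sup>2) * indicator A s) + 2 * (ennreal ((g s - h s)\<^sup>2) * indicator A s) \<partial>lborel)"
  proof (rule nn_integral_mono)
    fix s
    have "0 \<le> ((f s - h s) + (g s - h s))\<^sup>2" by simp
    then have "(f s - g s)\<^sup>2 \<le> 2 * (f s - h s)\<^sup>2 + 2 * (g s - h s)\<^sup>2" by (simp add: power2_eq_square algebra_simps)
    then have "ennreal ((f s - g s)\<^sup>2) \<le> ennreal (2 * (f s - h s)\<^sup>2 + 2 * (g s - h s)\<^sup>2)" by (rule ennreal_leI)
    also have "\<dots> = ennreal 2 * ennreal ((f s - h s)\<^sup>2) + ennreal 2 * ennreal ((g s - h s)\<^sup>2)"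
      by (subst ennreal_plus) (simp_all only: ennreal_mult mult_nonneg_nonneg zero_le_power2 zero_le_numeral)
    finally show "ennreal ((f s - g s)\<^sup>2) * indicator A s
        \<le> 2 * (ennreal ((f s - h s)\<^sup>2) * indicator A s) + 2 * (ennreal ((g s - h s)\<^sup>2) * indicator A s)"
      by (auto simp: indicator_def)
  qed
  then show ?thesis by (simp add: nn_integral_add nn_integral_cmult)
qed

section \<open>The Ito integral as a limit of sums sampled from the integrand\<close>

locale adapted_integrand = filtered_brownian_motion M T G W
  for M :: "'a measure" and T G W +
  fixes k J :: "real \<Rightarrow> 'a \<Rightarrow> real"
  assumes T_pos: "T > 0"
    and k_joint: "(\<lambda>(t, \<omega>). k t \<omega>) \<in> borel_measurable (restrict_space borel {0..T} \<Otimes>\<^sub>M M)"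
    and k_square_integrable: "AE \<omega> in M. (\<integral>\<^sup>+s\<in>{0..T}. ennreal ((k s \<omega>)\<^sup>2) \<partial>lborel) < \<infinity>"
    and k_adapted: "adapted T G k"
    and ito: "ito_integral M T G W k J"
begin

text \<open>\<open>k\<close> is arbitrary outside \<^term>\<open>{0..T}\<close>, so it is extended by zero.\<close>

definition k0 :: "real \<times> 'a \<Rightarrow> real" where
  "k0 z = (if fst z \<in> {0..T} then k (fst z) (snd z) else 0)"

lemma k0_measurable [measurable]: "k0 \<in> borel_measurable (borel \<Otimes>\<^sub>M M)"
proof -
  \<comment> \<open>Clamping the time sends every point into the restricted space on which joint
    measurability is assumed; the conditional in \<open>k0\<close> discards the values at clamped
    times.\<close>
  have g: "(\<lambda>z. (max 0 (min T (fst z)), snd z)) \<in> borel \<Otimes>\<^sub>M M \<rightarrow>\<^sub>M restrict_space borel {0..T} \<Otimes>\<^sub>M M"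
    using T_pos by (intro measurable_Pair measurable_restrict_space2) auto
  have [measurable]: "(\<lambda>z. k (max 0 (min T (fst z))) (snd z)) \<in> borel_measurable (borel \<Otimes>\<^sub>M M)"
    using measurable_compose[OF g k_joint] by simp
  have "k0 = (\<lambda>z. if fst z \<in> {0..T} then k (max 0 (min T (fst z))) (snd z) else 0)"
    by (auto simp: k0_def fun_eq_iff)
  then show ?thesis by simp
qed

lemma k0_eq: "s \<in> {0..T} \<Longrightarrow> k0 (s, \<omega>) = k s \<omega>"
  by (simp add: k0_def)

lemma nn_integral_k0: "(\<integral>\<^sup>+s\<in>{0..T}. f (k0 (s, \<omega>)) s \<partial>lborel) = (\<integral>\<^sup>+s\<in>{0..T}. f (k s \<omega>) s \<partial>lborel)"
  by (intro nn_integral_cong) (auto simp: k0_eq indicator_def)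

lemma k_measurable: "t \<in> {0..T} \<Longrightarrow> k t \<in> borel_measurable (G t)"
  using k_adapted by (simp add: adapted_def)

lemma J_measurable: "t \<in> {0..T} \<Longrightarrow> J t \<in> borel_measurable M"
  using ito by (simp add: ito_integral_def continuous_process_def)

definition sampled_error :: "nat \<Rightarrow> nat \<Rightarrow> (nat \<Rightarrow> real) \<Rightarrow> 'a \<Rightarrow> ennreal" where
  "sampled_error c n \<tau> \<omega> = (\<integral>\<^sup>+s\<in>{0..T}. ennreal ((elementary_process n \<tau> (\<lambda>i \<omega>. truncate c (k (\<tau> i) \<omega>)) s \<omega> - k0 (s, \<omega>))\<^sup>2) \<partial>lborel)"

lemma truncate_k_measurable:
  assumes "time_grid T n \<tau>" "i < n"
  shows "(\<lambda>\<omega>. truncate c (k (\<tau> i) \<omega>)) \<in> borel_measurable (G (\<tau> i))"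
    and "(\<lambda>\<omega>. truncate c (k (\<tau> i) \<omega>)) \<in> borel_measurable M"
proof -
  interpret time_grid T n \<tau> by fact
  have i: "\<tau> i \<in> {0..T}" using p_in assms by simp
  note k_measurable[OF i, measurable]
  show 1: "(\<lambda>\<omega>. truncate c (k (\<tau> i) \<omega>)) \<in> borel_measurable (G (\<tau> i))" by measurable
  show "(\<lambda>\<omega>. truncate c (k (\<tau> i) \<omega>)) \<in> borel_measurable M" by (rule G_imp_M[OF i 1])
qed

lemma sampled_process_measurable:
  assumes "time_grid T n \<tau>"
  shows "(\<lambda>(s, \<omega>). elementary_process n \<tau> (\<lambda>i \<omega>. truncate c (k (\<tau> i) \<omega>)) s \<omega>) \<in> borel_measurable (borel \<Otimes>\<^sub>M M)"
  using truncate_k_measurable[OF assms] by (intro measurable_elementary_process)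

lemma sampled_error_measurable:
  assumes "time_grid T n \<tau>"
  shows "sampled_error c n \<tau> \<in> borel_measurable M"
proof -
  note sampled_process_measurable[OF assms, measurable]
  show ?thesis unfolding sampled_error_def[abs_def] by measurable
qed

lemma ex_sampled_approx:
  obtains c n \<tau> where "\<And>m. time_grid T (n m) (\<tau> m)"
    "\<And>m. (\<integral>\<^sup>+\<omega>. min 1 (sampled_error (c m) (n m) (\<tau> m) \<omega>) \<partial>M) \<le> ennreal (1 / real (Suc m))"
proof -
  have "\<exists>c n \<tau>. time_grid T n \<tau> \<and> (\<integral>\<^sup>+\<omega>. min 1 (sampled_error c n \<tau> \<omega>) \<partial>M) \<le> ennreal (1 / real (Suc m))" for m
  proof -
    have sq: "AE \<omega> in M. (\<integral>\<^sup>+s\<in>{0..T}. ennreal ((k0 (s, \<omega>))\<^sup>2) \<partial>lborel) < \<infinity>"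
      using k_square_integrable nn_integral_k0[of "\<lambda>x _. ennreal (x\<^sup>2)"] by simp
    obtain c n \<tau> where grid: "time_grid T n \<tau>" and
      le: "(\<integral>\<^sup>+\<omega>. min 1 (\<integral>\<^sup>+s\<in>{0..T}. ennreal ((elementary_process n \<tau> (\<lambda>i \<omega>. truncate c (k0 (\<tau> i, \<omega>))) s \<omega> - k0 (s, \<omega>))\<^sup>2) \<partial>lborel) \<partial>M) \<le> ennreal (1 / real (Suc m))"
      by (rule ex_elementary_approx[OF k0_measurable sq T_pos, of "1 / real (Suc m)"]) auto
    interpret time_grid T n \<tau> by (rule grid)
    have "elementary_process n \<tau> (\<lambda>i \<omega>. truncate c (k0 (\<tau> i, \<omega>))) s \<omega> = elementary_process n \<tau> (\<lambda>i \<omega>. truncate c (k (\<tau> i) \<omega>)) s \<omega>" for s \<omega>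
      unfolding elementary_process_def using p_in by (intro sum.cong refl) (simp add: k0_eq)
    then show ?thesis using grid le unfolding sampled_error_def by auto
  qed
  then show thesis using that by metis
qed

text \<open>The sampled step processes and those from the definition of the integral both
  approximate \<open>k\<close> in mean square in probability, hence each other. The domination
  estimate carries this over to the integrals.\<close>

lemma sampled_integral_tendsto:
  assumes grid: "\<And>m. time_grid T (n m) (\<tau> m)"
    and err: "\<And>m. (\<integral>\<^sup>+\<omega>. min 1 (sampled_error (c m) (n m) (\<tau> m) \<omega>) \<partial>M) \<le> ennreal (1 / real (Suc m))"
    and u: "u \<in> {0..T}"
  shows "(\<lambda>m. expectation (\<lambda>\<omega>. min 1 \<bar>elementary_integral W (n m) (\<tau> m) (\<lambda>i \<omega>. truncate (c m) (k (\<tau> m i) \<omega>)) u \<omega> - J u \<omega>\<bar>)) \<longlonglongrightarrow> 0"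
    (is "?E \<longlonglongrightarrow> 0")
proof -
  obtain n' \<tau>' \<xi> where data: "\<And>m. elementary_data M T G (n' m) (\<tau>' m) (\<xi> m)"
    and lim_k: "tends_to_0_in_probability M (\<lambda>m \<omega>. \<integral>\<^sup>+s\<in>{0..T}. ennreal ((elementary_process (n' m) (\<tau>' m) (\<xi> m) s \<omega> - k s \<omega>)\<^sup>2) \<partial>lborel)"
    and lim_J: "tends_to_0_in_probability M (\<lambda>m \<omega>. SUP t\<in>{0..T}. ennreal \<bar>elementary_integral W (n' m) (\<tau>' m) (\<xi> m) t \<omega> - J t \<omega>\<bar>)"
    using ito unfolding ito_integral_def by blast
  have grid': "time_grid T (n' m) (\<tau>' m)" for m
    using data[of m] by (auto simp: elementary_data_def intro!: time_grid.intro)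
  have \<xi>_G: "\<xi> m i \<in> borel_measurable (G (\<tau>' m i))" if "i < n' m" for m i
    using data[of m] that by (auto simp: elementary_data_def)
  have \<xi>_M[measurable]: "\<xi> m i \<in> borel_measurable M" if "i < n' m" for m i
    using time_grid.p_in[OF grid'[of m], of i] that by (intro G_imp_M[OF _ \<xi>_G]) auto
  have \<xi>_b: "\<exists>c. \<forall>i<n' m. \<forall>\<omega>\<in>space M. \<bar>\<xi> m i \<omega>\<bar> \<le> c" for m
  proof -
    have "\<forall>i\<in>{..<n' m}. \<exists>c. \<forall>\<omega>\<in>space M. \<bar>\<xi> m i \<omega>\<bar> \<le> c"
      using data[of m] by (auto simp: elementary_data_def)
    then obtain c where c: "\<forall>i\<in>{..<n' m}. \<forall>\<omega>\<in>space M. \<bar>\<xi> m i \<omega>\<bar> \<le> c i" by metis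
    have "\<bar>\<xi> m i \<omega>\<bar> \<le> (\<Sum>i<n' m. \<bar>c i\<bar>)" if "i < n' m" "\<omega> \<in> space M" for i \<omega>
    proof -
      have "\<bar>\<xi> m i \<omega>\<bar> \<le> \<bar>c i\<bar>" using c that by force
      also have "\<dots> \<le> (\<Sum>i<n' m. \<bar>c i\<bar>)" using that by (intro member_le_sum) auto
      finally show ?thesis .
    qed
    then show ?thesis by blast
  qed
  let ?I = "\<lambda>m. elementary_integral W (n m) (\<tau> m) (\<lambda>i \<omega>. truncate (c m) (k (\<tau> m i) \<omega>)) u"
  let ?S = "\<lambda>m. elementary_process (n m) (\<tau> m) (\<lambda>i \<omega>. truncate (c m) (k (\<tau> m i) \<omega>))"
  let ?I' = "\<lambda>m. elementary_integral W (n' m) (\<tau>' m) (\<xi> m) u"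
  let ?S' = "\<lambda>m. elementary_process (n' m) (\<tau>' m) (\<xi> m)"
  let ?X = "\<lambda>j \<omega>. SUP t\<in>{0..T}. ennreal \<bar>elementary_integral W (n' j) (\<tau>' j) (\<xi> j) t \<omega> - J t \<omega>\<bar>"
  let ?D = "\<lambda>m. sampled_error (c m) (n m) (\<tau> m)"
  let ?D' = "\<lambda>m \<omega>. \<integral>\<^sup>+s\<in>{0..T}. ennreal ((?S' m s \<omega> - k s \<omega>)\<^sup>2) \<partial>lborel"
  have [measurable]: "?I m \<in> borel_measurable M" for m
    using elementary_integral_measurable[OF grid truncate_k_measurable(2)[OF grid] u] by simp
  have [measurable]: "?I' m \<in> borel_measurable M" for m
    using elementary_integral_measurable[OF grid' \<xi>_M u] by simp
  have [measurable]: "J u \<in> borel_measurable M" by (rule J_measurable[OF u])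
  have [measurable]: "(\<lambda>(s, \<omega>). ?S m s \<omega>) \<in> borel_measurable (borel \<Otimes>\<^sub>M M)" for m
    by (rule sampled_process_measurable[OF grid])
  have [measurable]: "(\<lambda>(s, \<omega>). ?S' m s \<omega>) \<in> borel_measurable (borel \<Otimes>\<^sub>M M)" for m
    by (rule measurable_elementary_process) (rule \<xi>_M)
  have [measurable]: "?D m \<in> borel_measurable M" for m by (rule sampled_error_measurable[OF grid])
  have [measurable]: "?D' m \<in> borel_measurable M" for m
    using lim_k unfolding tends_to_0_in_probability_def by blast
  \<comment> \<open>The indices \<open>m\<close> and \<open>j\<close> are independent, so
    \<open>j\<close> can be fixed while \<open>m\<close> grows. The level
    \<open>\<delta> / 4\<close> for each distance to \<open>k\<close> comes from the factor 2 in
    splitting a square and from having two summands.\<close>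
  have bound: "?E m \<le> sqrt \<delta> + prob {\<omega> \<in> space M. ?D m \<omega> > ennreal (\<delta>/4)} + prob {\<omega> \<in> space M. ?D' j \<omega> > ennreal (\<delta>/4)}
      + (\<delta> + prob {\<omega> \<in> space M. ?X j \<omega> > ennreal \<delta>})"
    if \<delta>: "\<delta> > 0" for m j \<delta>
  proof -
    obtain c' where c': "\<And>i \<omega>. i < n' j \<Longrightarrow> \<omega> \<in> space M \<Longrightarrow> \<bar>\<xi> j i \<omega>\<bar> \<le> c'" using \<xi>_b[of j] by blast
    have "?E m \<le> expectation (\<lambda>\<omega>. min 1 \<bar>?I m \<omega> - ?I' j \<omega>\<bar>) + expectation (\<lambda>\<omega>. min 1 \<bar>?I' j \<omega> - J u \<omega>\<bar>)"
      by (rule expectation_min_triangle) measurable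
    moreover have "expectation (\<lambda>\<omega>. min 1 \<bar>?I' j \<omega> - J u \<omega>\<bar>)
        \<le> \<delta> + prob {\<omega> \<in> space M. ?X j \<omega> > ennreal \<delta>}"
    proof (rule expectation_min_le_prob)
      have [measurable]: "?X j \<in> borel_measurable M"
        using lim_J unfolding tends_to_0_in_probability_def by blast
      show "{\<omega> \<in> space M. ?X j \<omega> > ennreal \<delta>} \<in> events"
        by measurable
      fix \<omega> assume \<omega>: "\<omega> \<in> space M" "\<delta> < \<bar>?I' j \<omega> - J u \<omega>\<bar>"
      have "ennreal \<delta> < ennreal \<bar>?I' j \<omega> - J u \<omega>\<bar>" using \<omega>(2) \<delta> by (intro ennreal_lessI) auto
      also have "\<dots> \<le> ?X j \<omega>"
        by (rule SUP_upper[OF u])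
      finally show "\<omega> \<in> {\<omega> \<in> space M. ?X j \<omega> > ennreal \<delta>}"
        using \<omega>(1) by simp
    qed (use \<delta> in auto)
    moreover have "expectation (\<lambda>\<omega>. min 1 \<bar>?I m \<omega> - ?I' j \<omega>\<bar>)
        \<le> sqrt \<delta> + prob {\<omega> \<in> space M. (\<integral>\<^sup>+s\<in>{0..T}. ennreal ((?S m s \<omega> - ?S' j s \<omega>)\<^sup>2) \<partial>lborel) > ennreal \<delta>}"
      by (rule elementary_integral_diff_le[OF grid grid' truncate_k_measurable(1)[OF grid] \<xi>_G truncate_bound c' u \<delta>])
    moreover have "prob {\<omega> \<in> space M. (\<integral>\<^sup>+s\<in>{0..T}. ennreal ((?S m s \<omega> - ?S' j s \<omega>)\<^sup>2) \<partial>lborel) > ennreal \<delta>}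
        \<le> prob ({\<omega> \<in> space M. ?D m \<omega> > ennreal (\<delta>/4)} \<union> {\<omega> \<in> space M. ?D' j \<omega> > ennreal (\<delta>/4)})"
    proof (rule finite_measure_mono)
      show "{\<omega> \<in> space M. (\<integral>\<^sup>+s\<in>{0..T}. ennreal ((?S m s \<omega> - ?S' j s \<omega>)\<^sup>2) \<partial>lborel) > ennreal \<delta>}
        \<subseteq> {\<omega> \<in> space M. ?D m \<omega> > ennreal (\<delta>/4)} \<union> {\<omega> \<in> space M. ?D' j \<omega> > ennreal (\<delta>/4)}"
      proof (safe, rule ccontr)
        fix \<omega> assume [simp]: "\<omega> \<in> space M"
          and gt: "ennreal \<delta> < (\<integral>\<^sup>+s\<in>{0..T}. ennreal ((?S m s \<omega> - ?S' j s \<omega>)\<^sup>2) \<partial>lborel)"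
          and "\<not> ennreal (\<delta>/4) < ?D m \<omega>" "\<not> ennreal (\<delta>/4) < ?D' j \<omega>"
        then have le: "?D m \<omega> \<le> ennreal (\<delta>/4)" "?D' j \<omega> \<le> ennreal (\<delta>/4)" by auto
        have D'_k0: "?D' j \<omega> = (\<integral>\<^sup>+s. ennreal ((?S' j s \<omega> - k0 (s, \<omega>))\<^sup>2) * indicator {0..T} s \<partial>lborel)"
          by (intro nn_integral_cong) (auto simp: k0_eq indicator_def)
        have "(\<integral>\<^sup>+s\<in>{0..T}. ennreal ((?S m s \<omega> - ?S' j s \<omega>)\<^sup>2) \<partial>lborel) \<le> 2 * ?D m \<omega> + 2 * ?D' j \<omega>"
          unfolding D'_k0 sampled_error_def by (rule nn_integral_square_diff_le) measurable
        also have "\<dots> \<le> 2 * ennreal (\<delta>/4) + 2 * ennreal (\<delta>/4)"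
          using le by (intro add_mono mult_left_mono) auto
        also have "\<dots> = ennreal \<delta>"
          using \<delta> by (simp add: mult_2 ennreal_plus[symmetric] del: ennreal_plus)
        finally show False using gt by simp
      qed
      show "{\<omega> \<in> space M. ?D m \<omega> > ennreal (\<delta>/4)} \<union> {\<omega> \<in> space M. ?D' j \<omega> > ennreal (\<delta>/4)} \<in> events"
        by measurable
    qed
    moreover have "prob ({\<omega> \<in> space M. ?D m \<omega> > ennreal (\<delta>/4)} \<union> {\<omega> \<in> space M. ?D' j \<omega> > ennreal (\<delta>/4)})
        \<le> prob {\<omega> \<in> space M. ?D m \<omega> > ennreal (\<delta>/4)} + prob {\<omega> \<in> space M. ?D' j \<omega> > ennreal (\<delta>/4)}"
      by (rule measure_Un_le) measurable
    ultimately show ?thesis by linarith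
  qed
  have E0: "0 \<le> ?E m" for m by (intro integral_nonneg_AE AE_I2) auto
  show ?thesis
  proof (rule LIMSEQ_I)
    fix e :: real assume e: "e > 0"
    \<comment> \<open>Both \<open>\<delta>\<close> and \<open>sqrt \<delta>\<close> are at most
      \<open>e / 6\<close>, so the five terms of \<open>bound\<close> stay below \<open>e\<close>
      together; the cap at 1 is for Markov's inequality.\<close>
    define \<delta> where "\<delta> = min 1 (min (e/6) ((e/6)\<^sup>2))"
    have \<delta>: "\<delta> > 0" "\<delta> \<le> 1" "\<delta> \<le> e/6" "\<delta> \<le> (e/6)\<^sup>2"
      using e by (auto simp: \<delta>_def)
    have sqrt_\<delta>: "sqrt \<delta> \<le> e/6"
      by (rule real_le_lsqrt) (use \<delta> e in auto)
    have "\<forall>\<^sub>F j in sequentially. prob {\<omega> \<in> space M. ?D' j \<omega> > ennreal (\<delta>/4)} < e/6"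
      using lim_k \<delta> e unfolding tends_to_0_in_probability_def by (intro order_tendstoD(2)[of _ 0]) auto
    moreover have "\<forall>\<^sub>F j in sequentially. prob {\<omega> \<in> space M. ?X j \<omega> > ennreal \<delta>} < e/6"
      using lim_J \<delta> e unfolding tends_to_0_in_probability_def by (intro order_tendstoD(2)[of _ 0]) auto
    ultimately have "\<forall>\<^sub>F j in sequentially. prob {\<omega> \<in> space M. ?D' j \<omega> > ennreal (\<delta>/4)} < e/6 \<and>
      prob {\<omega> \<in> space M. ?X j \<omega> > ennreal \<delta>} < e/6"
      by (rule eventually_conj)
    then obtain j where j: "prob {\<omega> \<in> space M. ?D' j \<omega> > ennreal (\<delta>/4)} < e/6"
      "prob {\<omega> \<in> space M. ?X j \<omega> > ennreal \<delta>} < e/6"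
      by (auto dest: eventually_happens)
    have "(\<lambda>m. (4 / \<delta>) * (1 / real (Suc m))) \<longlonglongrightarrow> (4 / \<delta>) * 0"
      using LIMSEQ_inverse_real_of_nat by (intro tendsto_mult tendsto_const) (simp add: inverse_eq_divide)
    then have "\<forall>\<^sub>F m in sequentially. (4 / \<delta>) * (1 / real (Suc m)) < e/6"
      using e by (intro order_tendstoD(2)) auto
    then obtain m0 where m0: "\<And>m. m \<ge> m0 \<Longrightarrow> (4 / \<delta>) * (1 / real (Suc m)) < e/6"
      by (auto simp: eventually_sequentially)
    show "\<exists>m0. \<forall>m\<ge>m0. norm (?E m - 0) < e"
    proof (intro exI[of _ m0] allI impI)
      fix m assume m: "m \<ge> m0"
      have "prob {\<omega> \<in> space M. ?D m \<omega> > ennreal (\<delta>/4)} \<le> (1 / real (Suc m)) / (\<delta>/4)"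
        by (rule prob_gt_le_nn_integral_min) (use \<delta> err in auto)
      also have "\<dots> < e/6" using m0[OF m] by (simp add: field_simps)
      finally have "?E m < e" using bound[OF \<delta>(1), of m j] j \<delta>(3) sqrt_\<delta> e by linarith
      then show "norm (?E m - 0) < e" using E0[of m] by simp
    qed
  qed
qed

end

section \<open>Drift integrals and the Girsanov identity in the limit\<close>

context adapted_integrand
begin

text \<open>The absolutely continuous shift caused by moving \<open>W\<close> with velocity
  \<open>\<eta>\<close>. For bounded measurable data it converges on almost every path; elsewhere
  the Lebesgue integral has its default value 0.\<close>

definition drift :: "nat \<Rightarrow> (nat \<Rightarrow> real) \<Rightarrow> (nat \<Rightarrow> 'a \<Rightarrow> real) \<Rightarrow> real \<Rightarrow> 'a \<Rightarrow> real" where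
  "drift n \<tau> \<eta> u \<omega> = (LBINT s:{0..u}. k0 (s, \<omega>) * elementary_process n \<tau> \<eta> s \<omega>)"

lemma drift_measurable:
  assumes \<eta>: "\<And>i. i < n \<Longrightarrow> \<eta> i \<in> borel_measurable M"
  shows "drift n \<tau> \<eta> u \<in> borel_measurable M"
proof -
  have [measurable]: "(\<lambda>(s, \<omega>). elementary_process n \<tau> \<eta> s \<omega>) \<in> borel_measurable (borel \<Otimes>\<^sub>M M)"
    by (rule measurable_elementary_process[OF \<eta>])
  show ?thesis unfolding drift_def[abs_def] set_lebesgue_integral_def by measurable
qed

lemma set_integrable_drift:
  assumes h: "(\<lambda>s. h s) \<in> borel_measurable borel" and b: "\<And>s. \<bar>h s\<bar> \<le> C"
    and \<omega>: "\<omega> \<in> space M" and fin: "(\<integral>\<^sup>+s\<in>{0..T}. ennreal ((k s \<omega>)\<^sup>2) \<partial>lborel) < \<infinity>" and u: "u \<le> T"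
  shows "set_integrable lborel {0..u} (\<lambda>s. k0 (s, \<omega>) * h s)"
  unfolding set_integrable_def
proof (rule integrableI_bounded)
  have C: "0 \<le> C" using b[of 0] by linarith
  note \<omega>[simp] h[measurable]
  show "(\<lambda>s. indicator {0..u} s *\<^sub>R (k0 (s, \<omega>) * h s)) \<in> borel_measurable lborel" by measurable
  have "(\<integral>\<^sup>+s. ennreal (norm (indicator {0..u} s *\<^sub>R (k0 (s, \<omega>) * h s))) \<partial>lborel)
      \<le> (\<integral>\<^sup>+s. ennreal C * indicator {0..T} s + ennreal C * (ennreal ((k0 (s, \<omega>))\<^sup>2) * indicator {0..T} s) \<partial>lborel)"
  proof (rule nn_integral_mono)
    fix s
    show "ennreal (norm (indicator {0..u} s *\<^sub>R (k0 (s, \<omega>) * h s)))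
        \<le> ennreal C * indicator {0..T} s + ennreal C * (ennreal ((k0 (s, \<omega>))\<^sup>2) * indicator {0..T} s)"
    proof (cases "s \<in> {0..u}")
      case True
      \<comment> \<open>A linear bound by the square: integrability over the finite interval follows
        from square integrability.\<close>
      have "\<bar>k0 (s, \<omega>)\<bar> \<le> 1 + (k0 (s, \<omega>))\<^sup>2"
      proof -
        have "0 \<le> (\<bar>k0 (s, \<omega>)\<bar> - 1)\<^sup>2" by simp
        then show ?thesis by (simp add: power2_eq_square algebra_simps abs_mult_self_eq)
      qed
      then have "\<bar>k0 (s, \<omega>)\<bar> * \<bar>h s\<bar> \<le> (1 + (k0 (s, \<omega>))\<^sup>2) * C" using b[of s] by (intro mult_mono) auto
      then have "ennreal \<bar>k0 (s, \<omega>) * h s\<bar> \<le> ennreal (C + C * (k0 (s, \<omega>))\<^sup>2)"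
        by (intro ennreal_leI) (simp add: abs_mult algebra_simps)
      also have "\<dots> = ennreal C + ennreal C * ennreal ((k0 (s, \<omega>))\<^sup>2)"
        using C by (simp add: ennreal_plus ennreal_mult)
      finally show ?thesis using True u by simp
    qed simp
  qed
  also have "\<dots> = ennreal C * emeasure lborel {0..T} + ennreal C * (\<integral>\<^sup>+s\<in>{0..T}. ennreal ((k s \<omega>)\<^sup>2) \<partial>lborel)"
    using nn_integral_k0[of "\<lambda>x _. ennreal (x\<^sup>2)" \<omega>]
    by (simp add: nn_integral_add nn_integral_cmult nn_integral_cmult_indicator)
  also have "\<dots> < \<infinity>"
    using fin T_pos by (simp add: ennreal_mult_less_top)
  finally show "(\<integral>\<^sup>+s. ennreal (norm (indicator {0..u} s *\<^sub>R (k0 (s, \<omega>) * h s))) \<partial>lborel) < \<infinity>" .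
qed

text \<open>The sampling error is controlled in mean square, while the drift needs it in the mean.
  The weighted inequality \<open>\<bar>x\<bar> * B \<le> a + B\<^sup>2 / (4 * a) * x\<^sup>2\<close>
  bridges the gap: fix a small \<open>a\<close>, then let \<open>m\<close> grow.\<close>

lemma sampled_drift_tendsto:
  assumes grid: "\<And>m. time_grid T (n m) (\<tau> m)"
    and err: "\<And>m. (\<integral>\<^sup>+\<omega>. min 1 (sampled_error (c m) (n m) (\<tau> m) \<omega>) \<partial>M) \<le> ennreal (1 / real (Suc m))"
    and h: "time_grid T nh \<tau>h" and \<eta>: "\<And>i. i < nh \<Longrightarrow> \<eta> i \<in> borel_measurable M"
    and b: "\<And>i \<omega>. i < nh \<Longrightarrow> \<bar>\<eta> i \<omega>\<bar> \<le> C"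
    and u: "u \<in> {0..T}"
  shows "(\<lambda>m. expectation (\<lambda>\<omega>. min 1 \<bar>(LBINT s:{0..u}. elementary_process (n m) (\<tau> m) (\<lambda>i \<omega>. truncate (c m) (k (\<tau> m i) \<omega>)) s \<omega> *
      elementary_process nh \<tau>h \<eta> s \<omega>) - drift nh \<tau>h \<eta> u \<omega>\<bar>)) \<longlonglongrightarrow> 0"
    (is "?E \<longlonglongrightarrow> 0")
proof -
  interpret h: time_grid T nh \<tau>h by (rule h)
  let ?S = "\<lambda>m. elementary_process (n m) (\<tau> m) (\<lambda>i \<omega>. truncate (c m) (k (\<tau> m i) \<omega>))"
  let ?h = "elementary_process nh \<tau>h \<eta>"
  let ?K = "\<lambda>m \<omega>. LBINT s:{0..u}. ?S m s \<omega> * ?h s \<omega>"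
  let ?D = "\<lambda>m. sampled_error (c m) (n m) (\<tau> m)"
  define B where "B = max 0 C"
  have B0: "0 \<le> B" by (simp add: B_def)
  have hb: "\<bar>?h s \<omega>\<bar> \<le> B" for s \<omega>
    by (rule h.elementary_process_bound) (auto simp: B_def intro: max.coboundedI2 b)
  have hm[measurable]: "(\<lambda>(s, \<omega>). ?h s \<omega>) \<in> borel_measurable (borel \<Otimes>\<^sub>M M)"
    by (rule measurable_elementary_process[OF \<eta>])
  have Sm[measurable]: "(\<lambda>(s, \<omega>). ?S m s \<omega>) \<in> borel_measurable (borel \<Otimes>\<^sub>M M)" for m
    by (rule sampled_process_measurable[OF grid])
  have [measurable]: "?D m \<in> borel_measurable M" for m by (rule sampled_error_measurable[OF grid])
  have [measurable]: "?K m \<in> borel_measurable M" for m unfolding set_lebesgue_integral_def by measurable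
  have [measurable]: "drift nh \<tau>h \<eta> u \<in> borel_measurable M" by (rule drift_measurable[OF \<eta>])
  have pointwise: "ennreal \<bar>?K m \<omega> - drift nh \<tau>h \<eta> u \<omega>\<bar> \<le> ennreal (a * T) + ennreal (B\<^sup>2 / (4 * a)) * ?D m \<omega>"
    if a: "a > 0" and \<omega>: "\<omega> \<in> space M" and fin: "(\<integral>\<^sup>+s\<in>{0..T}. ennreal ((k s \<omega>)\<^sup>2) \<partial>lborel) < \<infinity>" for m a \<omega>
  proof -
    note \<omega>[simp]
    have [measurable]: "(\<lambda>s. ?h s \<omega>) \<in> borel_measurable borel" "(\<lambda>s. ?S m s \<omega>) \<in> borel_measurable borel"
      unfolding elementary_process_def by measurable
    obtain N p where p: "time_grid T N p" and sub: "\<tau> m ` {..n m} \<subseteq> p ` {..N}" "\<tau>h ` {..nh} \<subseteq> p ` {..N}" "{u} \<subseteq> p ` {..N}"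
      using common_time_grid[OF grid[of m] h, of "{u}"] u by auto
    have i1: "set_integrable lborel {0..u} (\<lambda>s. ?S m s \<omega> * ?h s \<omega>)"
    proof (rule time_grid.integral_cells(2)[OF p])
      fix i s assume cell: "i < N" "s \<in> {p i<..p (Suc i)}"
      show "?S m s \<omega> * ?h s \<omega> = ?S m (p (Suc i)) \<omega> * ?h (p (Suc i)) \<omega>"
        using time_grid.elementary_process_cell[OF p cell sub(1), of "\<lambda>i \<omega>. truncate (c m) (k (\<tau> m i) \<omega>)" \<omega>]
          time_grid.elementary_process_cell[OF p cell sub(2), of \<eta> \<omega>] by simp
    qed (use sub in auto)
    have i2: "set_integrable lborel {0..u} (\<lambda>s. k0 (s, \<omega>) * ?h s \<omega>)"
      by (rule set_integrable_drift[OF _ hb \<omega> fin]) (use u in auto)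
    have "?K m \<omega> - drift nh \<tau>h \<eta> u \<omega> = (LBINT s:{0..u}. ?S m s \<omega> * ?h s \<omega> - k0 (s, \<omega>) * ?h s \<omega>)"
      unfolding drift_def by (rule set_integral_diff(2)[OF i1 i2, symmetric])
    then have "ennreal \<bar>?K m \<omega> - drift nh \<tau>h \<eta> u \<omega>\<bar>
        = ennreal (norm (LBINT s. indicator {0..u} s *\<^sub>R (?S m s \<omega> * ?h s \<omega> - k0 (s, \<omega>) * ?h s \<omega>)))"
      by (simp add: set_lebesgue_integral_def)
    also have "\<dots> \<le> (\<integral>\<^sup>+s. ennreal (norm (indicator {0..u} s *\<^sub>R (?S m s \<omega> * ?h s \<omega> - k0 (s, \<omega>) * ?h s \<omega>))) \<partial>lborel)"
      by (rule integral_norm_bound_ennreal) (rule set_integral_diff(1)[OF i1 i2, unfolded set_integrable_def])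
    also have "\<dots> \<le> (\<integral>\<^sup>+s. ennreal a * indicator {0..T} s + ennreal (B\<^sup>2 / (4 * a)) * (ennreal ((?S m s \<omega> - k0 (s, \<omega>))\<^sup>2) * indicator {0..T} s) \<partial>lborel)"
    proof (rule nn_integral_mono)
      fix s
      show "ennreal (norm (indicator {0..u} s *\<^sub>R (?S m s \<omega> * ?h s \<omega> - k0 (s, \<omega>) * ?h s \<omega>)))
          \<le> ennreal a * indicator {0..T} s + ennreal (B\<^sup>2 / (4 * a)) * (ennreal ((?S m s \<omega> - k0 (s, \<omega>))\<^sup>2) * indicator {0..T} s)"
      proof (cases "s \<in> {0..u}")
        case True
        define x where "x = ?S m s \<omega> - k0 (s, \<omega>)"
        have "\<bar>?S m s \<omega> * ?h s \<omega> - k0 (s, \<omega>) * ?h s \<omega>\<bar> = \<bar>x\<bar> * \<bar>?h s \<omega>\<bar>"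
          by (simp add: x_def abs_mult[symmetric] algebra_simps)
        also have "\<dots> \<le> \<bar>x\<bar> * B" using hb by (intro mult_left_mono) auto
        also have "\<dots> \<le> a + B\<^sup>2 / (4 * a) * x\<^sup>2"
        proof -
          have "0 \<le> (2 * a - B * \<bar>x\<bar>)\<^sup>2 / (4 * a)" using a by simp
          also have "(2 * a - B * \<bar>x\<bar>)\<^sup>2 / (4 * a) = a - \<bar>x\<bar> * B + B\<^sup>2 / (4 * a) * x\<^sup>2"
            using a by (simp add: power2_eq_square field_simps abs_mult_self_eq)
          finally show ?thesis by simp
        qed
        finally have "ennreal \<bar>?S m s \<omega> * ?h s \<omega> - k0 (s, \<omega>) * ?h s \<omega>\<bar> \<le> ennreal (a + B\<^sup>2 / (4 * a) * x\<^sup>2)"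
          by (rule ennreal_leI)
        also have "\<dots> = ennreal a + ennreal (B\<^sup>2 / (4 * a)) * ennreal (x\<^sup>2)"
          using a by (simp add: ennreal_plus ennreal_mult[symmetric])
        finally show ?thesis using True u by (simp add: x_def)
      qed simp
    qed
    also have "\<dots> = ennreal (a * T) + ennreal (B\<^sup>2 / (4 * a)) * ?D m \<omega>"
      unfolding sampled_error_def using a T_pos
      by (simp add: nn_integral_add nn_integral_cmult nn_integral_cmult_indicator ennreal_mult)
    finally show ?thesis .
  qed
  have bound: "?E m \<le> a * T + max 1 (B\<^sup>2 / (4 * a)) * (1 / real (Suc m))" if a: "a > 0" for m a
  proof -
    \<comment> \<open>With a factor of at least 1, the term
      \<open>?b * min 1 (?D m \<omega>)\<close> also covers the paths with error above 1, where the
      left side is at most 1.\<close>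
    let ?b = "max 1 (B\<^sup>2 / (4 * a))"
    have int: "integrable M (\<lambda>\<omega>. min 1 \<bar>?K m \<omega> - drift nh \<tau>h \<eta> u \<omega>\<bar>)"
      by (rule integrable_const_bound[of _ 1]) auto
    have "ennreal (?E m) = (\<integral>\<^sup>+\<omega>. ennreal (min 1 \<bar>?K m \<omega> - drift nh \<tau>h \<eta> u \<omega>\<bar>) \<partial>M)"
      by (rule nn_integral_eq_integral[symmetric, OF int]) auto
    also have "\<dots> \<le> (\<integral>\<^sup>+\<omega>. ennreal (a * T) + ennreal ?b * min 1 (?D m \<omega>) \<partial>M)"
    proof (rule nn_integral_mono_AE)
      show "AE \<omega> in M. ennreal (min 1 \<bar>?K m \<omega> - drift nh \<tau>h \<eta> u \<omega>\<bar>) \<le> ennreal (a * T) + ennreal ?b * min 1 (?D m \<omega>)"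
        using k_square_integrable AE_space
      proof eventually_elim
        case (elim \<omega>)
        have "ennreal (min 1 \<bar>?K m \<omega> - drift nh \<tau>h \<eta> u \<omega>\<bar>) = min 1 (ennreal \<bar>?K m \<omega> - drift nh \<tau>h \<eta> u \<omega>\<bar>)"
          by (simp add: min_def ennreal_le_1)
        show ?case
        proof (cases "?D m \<omega> \<le> 1")
          case True
          have "ennreal (min 1 \<bar>?K m \<omega> - drift nh \<tau>h \<eta> u \<omega>\<bar>) \<le> ennreal \<bar>?K m \<omega> - drift nh \<tau>h \<eta> u \<omega>\<bar>"
            by (intro ennreal_leI) simp
          also have "\<dots> \<le> ennreal (a * T) + ennreal (B\<^sup>2 / (4 * a)) * ?D m \<omega>"
            by (rule pointwise[OF a elim(2,1)])
          also have "\<dots> \<le> ennreal (a * T) + ennreal ?b * ?D m \<omega>"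
            by (intro add_left_mono mult_right_mono ennreal_leI) auto
          finally show ?thesis using True by (simp add: min_def)
        next
          case False
          have "ennreal (min 1 \<bar>?K m \<omega> - drift nh \<tau>h \<eta> u \<omega>\<bar>) \<le> ennreal 1" by (intro ennreal_leI) simp
          also have "\<dots> \<le> ennreal ?b" by (intro ennreal_leI) simp
          also have "\<dots> \<le> ennreal (a * T) + ennreal ?b * min 1 (?D m \<omega>)"
          proof -
            have "min 1 (?D m \<omega>) = 1" using False by (intro min_absorb1) simp
            then show ?thesis by simp
          qed
          finally show ?thesis .
        qed
      qed
    qed
    also have "\<dots> = ennreal (a * T) + ennreal ?b * (\<integral>\<^sup>+\<omega>. min 1 (?D m \<omega>) \<partial>M)"
      by (simp add: nn_integral_add nn_integral_cmult emeasure_space_1)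
    also have "\<dots> \<le> ennreal (a * T) + ennreal ?b * ennreal (1 / real (Suc m))"
      by (intro add_left_mono mult_left_mono err) simp
    also have "\<dots> = ennreal (a * T + ?b * (1 / real (Suc m)))"
      using a T_pos by (subst ennreal_mult[symmetric]) (auto simp: ennreal_plus[symmetric] simp del: ennreal_plus)
    finally show ?thesis using a T_pos by (subst (asm) ennreal_le_iff) auto
  qed
  have E0: "0 \<le> ?E m" for m by (intro integral_nonneg_AE AE_I2) auto
  show ?thesis
  proof (rule LIMSEQ_I)
    fix e :: real assume e: "e > 0"
    define a where "a = e / (4 * T)"
    have a: "a > 0" "a * T = e / 4" using e T_pos by (auto simp: a_def)
    let ?b = "max 1 (B\<^sup>2 / (4 * a))"
    have "(\<lambda>m. ?b * (1 / real (Suc m))) \<longlonglongrightarrow> ?b * 0"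
      using LIMSEQ_inverse_real_of_nat by (intro tendsto_mult tendsto_const) (simp add: inverse_eq_divide)
    then have "\<forall>\<^sub>F m in sequentially. ?b * (1 / real (Suc m)) < e / 4"
      using e by (intro order_tendstoD(2)) auto
    then obtain m0 where m0: "\<And>m. m \<ge> m0 \<Longrightarrow> ?b * (1 / real (Suc m)) < e / 4"
      by (auto simp: eventually_sequentially)
    show "\<exists>m0. \<forall>m\<ge>m0. norm (?E m - 0) < e"
    proof (intro exI[of _ m0] allI impI)
      fix m assume "m \<ge> m0"
      then have "?E m < e" using bound[OF a(1), of m] a(2) m0[of m] e by linarith
      then show "norm (?E m - 0) < e" using E0[of m] by simp
    qed
  qed
qed

text \<open>The sampled sums and the drift velocity depend on \<open>(H, k)\<close> and
  \<open>W\<close> in the way that the elementary theorem requires, and the sampled quantities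
  converge in probability. The drift is kept as a second component because later events involve its
  random value together with the path.\<close>

lemma girsanov_law:
  assumes H: "\<And>t. t \<in> {0..T} \<Longrightarrow> H t \<in> borel_measurable M"
    and ind: "indep_set (sets (vimage_algebra (space M) (\<lambda>\<omega>. \<lambda>t\<in>{0..T}. W t \<omega>) (\<Pi>\<^sub>M t\<in>{0..T}. borel)))
       (sets (vimage_algebra (space M) (\<lambda>\<omega>. \<lambda>t\<in>{0..T}. (H t \<omega>, k t \<omega>)) (\<Pi>\<^sub>M t\<in>{0..T}. borel)))"
    and h: "time_grid T n \<tau>" and b: "\<And>i. i < n \<Longrightarrow> b i \<in> borel_measurable borel" and b_bound: "\<And>i x. i < n \<Longrightarrow> \<bar>b i x\<bar> \<le> C"
  defines "\<eta> \<equiv> \<lambda>i \<omega>. b i (k (\<tau> i) \<omega>)"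
  shows "distr M (\<Pi>\<^sub>M j\<in>{0..T} \<times> (UNIV :: bool set). borel)
      (\<lambda>\<omega>. \<lambda>j\<in>{0..T} \<times> UNIV. if snd j then H (fst j) \<omega> + J (fst j) \<omega> else drift n \<tau> \<eta> (fst j) \<omega>)
    = distr (density M (elementary_density W T n \<tau> \<eta>)) (\<Pi>\<^sub>M j\<in>{0..T} \<times> (UNIV :: bool set). borel)
      (\<lambda>\<omega>. \<lambda>j\<in>{0..T} \<times> UNIV. if snd j then H (fst j) \<omega> + J (fst j) \<omega> - drift n \<tau> \<eta> (fst j) \<omega> else drift n \<tau> \<eta> (fst j) \<omega>)"
proof -
  interpret h: time_grid T n \<tau> by (rule h)
  have kM: "k t \<in> borel_measurable M" if "t \<in> {0..T}" for t using G_imp_M[OF that k_measurable[OF that]] .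
  have \<eta>_meas: "\<eta> i \<in> borel_measurable M" if "i < n" for i
    unfolding \<eta>_def using that h.p_in[of i] by (intro measurable_compose[OF kM b]) auto
  let ?S = "\<Pi>\<^sub>M t\<in>{0..T}. borel :: (real \<times> real) measure"
  define X where "X \<omega> = (\<lambda>t\<in>{0..T}. (H t \<omega>, k t \<omega>))" for \<omega>
  have X: "X \<in> M \<rightarrow>\<^sub>M ?S"
    unfolding X_def[abs_def] using H kM by (intro measurable_restrict borel_measurable_Pair) auto
  have X_eq: "fst (X \<omega> t) = H t \<omega>" "snd (X \<omega> t) = k t \<omega>" if "t \<in> {0..T}" for t \<omega> using that by (simp_all add: X_def)
  have comp: "(\<lambda>x. x t) \<in> borel_measurable ?S" if "t \<in> {0..T}" for t
    by (rule measurable_component_singleton[OF that])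
  obtain c nn \<tau>\<tau> where grid: "\<And>m. time_grid T (nn m) (\<tau>\<tau> m)"
    and err: "\<And>m. (\<integral>\<^sup>+\<omega>. min 1 (sampled_error (c m) (nn m) (\<tau>\<tau> m) \<omega>) \<partial>M) \<le> ennreal (1 / real (Suc m))"
    using ex_sampled_approx by metis
  define \<xi> where "\<xi> m i \<omega> = truncate (c m) (k (\<tau>\<tau> m i) \<omega>)" for m i \<omega>
  let ?I = "\<lambda>m u \<omega>. H u \<omega> + elementary_integral W (nn m) (\<tau>\<tau> m) (\<xi> m) u \<omega>"
  let ?K = "\<lambda>m u \<omega>. LBINT s:{0..u}. elementary_process (nn m) (\<tau>\<tau> m) (\<xi> m) s \<omega> * elementary_process n \<tau> \<eta> s \<omega>"
  let ?D = "elementary_density W T n \<tau> \<eta>"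
  have \<xi>_meas: "\<xi> m i \<in> borel_measurable M" if "i < nn m" for m i
    unfolding \<xi>_def by (rule truncate_k_measurable(2)[OF grid that])
  have I_meas[measurable]: "?I m u \<in> borel_measurable M" if "u \<in> {0..T}" for m u
    using that by (intro borel_measurable_add H elementary_integral_measurable[OF grid \<xi>_meas])
  have [measurable]: "(\<lambda>(s, \<omega>). elementary_process (nn m) (\<tau>\<tau> m) (\<xi> m) s \<omega>) \<in> borel_measurable (borel \<Otimes>\<^sub>M M)" for m
    by (rule measurable_elementary_process[OF \<xi>_meas])
  have [measurable]: "(\<lambda>(s, \<omega>). elementary_process n \<tau> \<eta> s \<omega>) \<in> borel_measurable (borel \<Otimes>\<^sub>M M)"
    by (rule measurable_elementary_process[OF \<eta>_meas])
  have K_meas[measurable]: "?K m u \<in> borel_measurable M" for m u unfolding set_lebesgue_integral_def by measurable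
  have drift_meas[measurable]: "drift n \<tau> \<eta> u \<in> borel_measurable M" for u by (rule drift_measurable[OF \<eta>_meas])
  have J_meas[measurable]: "J u \<in> borel_measurable M" if "u \<in> {0..T}" for u by (rule J_measurable[OF that])
  note H[measurable]
  have D_meas: "?D \<in> borel_measurable M"
    using T_pos by (intro elementary_density_measurable[OF h \<eta>_meas]) auto
  have I_lim: "(\<lambda>m. expectation (\<lambda>\<omega>. min 1 \<bar>?I m u \<omega> - (H u \<omega> + J u \<omega>)\<bar>)) \<longlonglongrightarrow> 0" if "u \<in> {0..T}" for u
    using sampled_integral_tendsto[OF grid err that] by (simp add: \<xi>_def[abs_def])
  have K_lim: "(\<lambda>m. expectation (\<lambda>\<omega>. min 1 \<bar>?K m u \<omega> - drift n \<tau> \<eta> u \<omega>\<bar>)) \<longlonglongrightarrow> 0" if "u \<in> {0..T}" for u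
    unfolding \<xi>_def
  proof (rule sampled_drift_tendsto[OF grid err h \<eta>_meas _ that])
    show "\<bar>\<eta> i \<omega>\<bar> \<le> C" if "i < n" for i \<omega> unfolding \<eta>_def by (rule b_bound[OF that])
  qed
  have IK_lim: "(\<lambda>m. expectation (\<lambda>\<omega>. min 1 \<bar>(?I m u \<omega> - ?K m u \<omega>) - (H u \<omega> + J u \<omega> - drift n \<tau> \<eta> u \<omega>)\<bar>)) \<longlonglongrightarrow> 0"
    if u: "u \<in> {0..T}" for u
  proof (rule tendsto_sandwich[OF _ _ tendsto_const])
    let ?ik = "\<lambda>m \<omega>. min 1 \<bar>(?I m u \<omega> - ?K m u \<omega>) - (H u \<omega> + J u \<omega> - drift n \<tau> \<eta> u \<omega>)\<bar>"
    let ?i = "\<lambda>m \<omega>. min 1 \<bar>?I m u \<omega> - (H u \<omega> + J u \<omega>)\<bar>"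
    let ?k = "\<lambda>m \<omega>. min 1 \<bar>?K m u \<omega> - drift n \<tau> \<eta> u \<omega>\<bar>"
    show "(\<lambda>m. expectation (?i m) + expectation (?k m)) \<longlonglongrightarrow> 0"
      using tendsto_add[OF I_lim[OF u] K_lim[OF u]] by simp
    have i: "integrable M (\<lambda>\<omega>. min 1 \<bar>A \<omega>\<bar>)" if "A \<in> borel_measurable M" for A :: "'a \<Rightarrow> real"
      using that by (intro integrable_const_bound[of _ 1]) auto
    show "\<forall>\<^sub>F m in sequentially. expectation (?ik m)
        \<le> expectation (?i m) + expectation (?k m)"
    proof (rule always_eventually, rule allI)
      fix m
      have "expectation (?ik m)
        \<le> expectation (\<lambda>\<omega>. ?i m \<omega> + ?k m \<omega>)"
        by (intro integral_mono Bochner_Integration.integrable_add i borel_measurable_diff borel_measurable_add I_meas[OF u] K_meas H[OF u] J_meas[OF u] drift_meas) auto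
      also have "\<dots> = expectation (?i m) + expectation (?k m)"
        by (intro Bochner_Integration.integral_add i borel_measurable_diff borel_measurable_add I_meas[OF u] K_meas H[OF u] J_meas[OF u] drift_meas)
      finally show "expectation (?ik m)
        \<le> expectation (?i m) + expectation (?k m)" .
    qed
  qed (auto intro!: always_eventually integral_nonneg_AE)
  have eq: "(\<integral>\<^sup>+\<omega>. (\<Prod>j\<in>A. ennreal (f j (if snd j then ?I m (fst j) \<omega> else ?K m (fst j) \<omega>))) \<partial>M)
      = (\<integral>\<^sup>+\<omega>. ?D \<omega> * (\<Prod>j\<in>A. ennreal (f j (if snd j then ?I m (fst j) \<omega> - ?K m (fst j) \<omega> else ?K m (fst j) \<omega>))) \<partial>M)"
    if A: "finite A" "A \<subseteq> {0..T} \<times> UNIV" and f: "\<And>j. j \<in> A \<Longrightarrow> f j \<in> borel_measurable borel" for m A and f :: "real \<times> bool \<Rightarrow> real \<Rightarrow> real"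
  proof -
    interpret g: time_grid T "nn m" "\<tau>\<tau> m" by (rule grid)
    define b' where "b' i x = b i (snd (x (\<tau> i) :: real \<times> real))" for i x
    define c' where "c' i x = truncate (c m) (snd (x (\<tau>\<tau> m i) :: real \<times> real))" for i x
    have b'X: "elementary_process n \<tau> (\<lambda>i \<omega>. b' i (X \<omega>)) = elementary_process n \<tau> \<eta>"
      "elementary_density W T n \<tau> (\<lambda>i \<omega>. b' i (X \<omega>)) = ?D"
      unfolding elementary_process_def elementary_density_def elementary_integral_def
      using h.p_in by (auto simp: fun_eq_iff b'_def \<eta>_def X_eq intro!: sum.cong)
    have c'X: "elementary_process (nn m) (\<tau>\<tau> m) (\<lambda>i \<omega>. c' i (X \<omega>)) = elementary_process (nn m) (\<tau>\<tau> m) (\<xi> m)"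
      "elementary_integral W (nn m) (\<tau>\<tau> m) (\<lambda>i \<omega>. c' i (X \<omega>)) = elementary_integral W (nn m) (\<tau>\<tau> m) (\<xi> m)"
      unfolding elementary_process_def elementary_integral_def
      using g.p_in by (auto simp: fun_eq_iff c'_def \<xi>_def X_eq intro!: sum.cong)
    have snd_m: "(\<lambda>x. snd (x t)) \<in> borel_measurable ?S" "(\<lambda>x. fst (x t)) \<in> borel_measurable ?S" if "t \<in> {0..T}" for t
      using measurable_compose[OF comp[OF that], of snd borel] measurable_compose[OF comp[OF that], of fst borel]
      by (simp_all add: borel_prod[symmetric])
    have b'_m: "b' i \<in> borel_measurable ?S" if "i < n" for i
      unfolding b'_def[abs_def] using that h.p_in[of i] by (intro measurable_compose[OF snd_m(1) b]) auto
    have c'_m: "c' i \<in> borel_measurable ?S" if "i < nn m" for i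
      unfolding c'_def[abs_def] using that g.p_in[of i] by (intro measurable_compose[OF snd_m(1) measurable_truncate]) auto
    have fstA: "fst j \<in> {0..T}" if "j \<in> A" for j using A that by auto
    have "(\<integral>\<^sup>+\<omega>. (\<Prod>j\<in>A. ennreal (f j (if snd j then ?I m (fst j) \<omega> else ?K m (fst j) \<omega>))) \<partial>M)
      = (\<integral>\<^sup>+\<omega>. (\<Prod>j\<in>A. ennreal (f j (if snd j then fst (X \<omega> (fst j)) + elementary_integral W (nn m) (\<tau>\<tau> m) (\<xi> m) (fst j) \<omega> else ?K m (fst j) \<omega>))) \<partial>M)"
      by (intro nn_integral_cong prod.cong refl) (simp only: X_eq(1)[OF fstA])
    also have "\<dots> = (\<integral>\<^sup>+\<omega>. ?D \<omega> * (\<Prod>j\<in>A. ennreal (f j (if snd j then fst (X \<omega> (fst j)) + elementary_integral W (nn m) (\<tau>\<tau> m) (\<xi> m) (fst j) \<omega> - ?K m (fst j) \<omega> else ?K m (fst j) \<omega>))) \<partial>M)"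
      by (rule elementary_girsanov[where b=b' and c=c' and n'="nn m" and \<tau>'="\<tau>\<tau> m" and H="\<lambda>u x. fst (x u)" and f=f and J=A,
            OF X ind[folded X_def] h _ grid _ _ A(1) A(2), unfolded b'X c'X])
         ((rule b'_m c'_m snd_m(2) f; assumption)+)
    also have "\<dots> = (\<integral>\<^sup>+\<omega>. ?D \<omega> * (\<Prod>j\<in>A. ennreal (f j (if snd j then ?I m (fst j) \<omega> - ?K m (fst j) \<omega> else ?K m (fst j) \<omega>))) \<partial>M)"
      by (intro nn_integral_cong arg_cong2[where f="(*)"] prod.cong refl) (simp only: X_eq(1)[OF fstA])
    finally show ?thesis .
  qed
  \<comment> \<open>The identity for the empty family of times says that the density has total mass
    one; its integrability makes it a dominating function.\<close>
  have D_1: "(\<integral>\<^sup>+\<omega>. ?D \<omega> \<partial>M) = 1" using eq[of "{}"] by (simp add: emeasure_space_1)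
  show ?thesis
  proof (rule distr_eq_if_limit[where Vm="\<lambda>m j. if snd j then ?I m (fst j) else ?K m (fst j)"
        and Vm'="\<lambda>m j \<omega>. if snd j then ?I m (fst j) \<omega> - ?K m (fst j) \<omega> else ?K m (fst j) \<omega>"])
    fix j :: "real \<times> bool" assume j: "j \<in> {0..T} \<times> UNIV"
    then have u: "fst j \<in> {0..T}" by auto
    note I_meas[OF u, measurable] J_meas[OF u, measurable] H[OF u, measurable]
    show "(\<lambda>\<omega>. (\<lambda>j\<in>{0..T} \<times> UNIV. if snd j then H (fst j) \<omega> + J (fst j) \<omega> else drift n \<tau> \<eta> (fst j) \<omega>) j) \<in> borel_measurable M"
      using j by (cases "snd j") simp_all
    show "(\<lambda>\<omega>. (\<lambda>j\<in>{0..T} \<times> UNIV. if snd j then H (fst j) \<omega> + J (fst j) \<omega> - drift n \<tau> \<eta> (fst j) \<omega> else drift n \<tau> \<eta> (fst j) \<omega>) j) \<in> borel_measurable M"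
      using j by (cases "snd j") simp_all
    show "(if snd j then ?I m (fst j) else ?K m (fst j)) \<in> borel_measurable M" for m
      using I_meas[OF u] K_meas by (cases "snd j") simp_all
    show "(\<lambda>\<omega>. if snd j then ?I m (fst j) \<omega> - ?K m (fst j) \<omega> else ?K m (fst j) \<omega>) \<in> borel_measurable M" for m
      using borel_measurable_diff[OF I_meas[OF u] K_meas] K_meas by (cases "snd j") simp_all
    show "(\<lambda>m. expectation (\<lambda>\<omega>. min 1 \<bar>(if snd j then ?I m (fst j) else ?K m (fst j)) \<omega> -
        (\<lambda>j\<in>{0..T} \<times> UNIV. if snd j then H (fst j) \<omega> + J (fst j) \<omega> else drift n \<tau> \<eta> (fst j) \<omega>) j\<bar>)) \<longlonglongrightarrow> 0"
      using j I_lim[OF u] K_lim[OF u] by (cases "snd j") simp_all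
    show "(\<lambda>m. expectation (\<lambda>\<omega>. min 1 \<bar>(if snd j then ?I m (fst j) \<omega> - ?K m (fst j) \<omega> else ?K m (fst j) \<omega>) -
        (\<lambda>j\<in>{0..T} \<times> UNIV. if snd j then H (fst j) \<omega> + J (fst j) \<omega> - drift n \<tau> \<eta> (fst j) \<omega> else drift n \<tau> \<eta> (fst j) \<omega>) j\<bar>)) \<longlonglongrightarrow> 0"
      using j IK_lim[OF u] K_lim[OF u] by (cases "snd j") simp_all
  next
    fix m A and f :: "real \<times> bool \<Rightarrow> real \<Rightarrow> real"
    assume A: "finite A" "A \<subseteq> {0..T} \<times> (UNIV :: bool set)" and f: "\<And>j. j \<in> A \<Longrightarrow> f j \<in> borel_measurable borel"
    have if_app: "(if c then g else g') \<omega> = (if c then g \<omega> else g' \<omega>)" for c and g g' :: "'a \<Rightarrow> real" and \<omega>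
      by simp
    show "(\<integral>\<^sup>+\<omega>. (\<Prod>j\<in>A. ennreal (f j ((if snd j then ?I m (fst j) else ?K m (fst j)) \<omega>))) \<partial>M)
      = (\<integral>\<^sup>+\<omega>. ?D \<omega> * (\<Prod>j\<in>A. ennreal (f j (if snd j then ?I m (fst j) \<omega> - ?K m (fst j) \<omega> else ?K m (fst j) \<omega>))) \<partial>M)"
      unfolding if_app by (rule eq[OF A]) (rule f)
  qed (use D_meas D_1 in auto)
qed

end

section \<open>Choice of the drift\<close>

context adapted_integrand
begin

text \<open>The velocity is \<open>q / k\<close> where \<open>k\<close> exceeds a small threshold,
  and zero elsewhere. Three errors arise: the times at which \<open>k\<close> is small, the sampling
  of the velocity, and the multiplication of the sampling error by the unbounded
  \<open>k\<close>.\<close>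

lemma ex_inverting_drift:
  assumes nz: "AE \<omega> in M. emeasure lborel {t \<in> {0..T}. k t \<omega> = 0} = 0"
    and q[measurable]: "q \<in> borel_measurable borel" and q_b: "\<And>s. \<bar>q s\<bar> \<le> C"
    and t: "0 \<le> t" and e: "e > (0::real)"
  obtains n \<tau> b C' where "time_grid T n \<tau>" "\<And>i. i < n \<Longrightarrow> b i \<in> borel_measurable borel"
    "\<And>i x. i < n \<Longrightarrow> \<bar>b i x\<bar> \<le> (C' :: real)"
    "\<And>s \<omega>. s \<le> t \<Longrightarrow> elementary_process n \<tau> (\<lambda>i \<omega>. b i (k (\<tau> i) \<omega>)) s \<omega> = 0"
    "(\<integral>\<^sup>+\<omega>. min 1 (\<integral>\<^sup>+s\<in>{t<..T}. ennreal \<bar>k0 (s, \<omega>) * elementary_process n \<tau> (\<lambda>i \<omega>. b i (k (\<tau> i) \<omega>)) s \<omega> - q s\<bar> \<partial>lborel) \<partial>M) \<le> ennreal e"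
proof -
  have C: "0 \<le> C" using q_b[of 0] by linarith
  define \<delta> where "\<delta> j = 1 / real (Suc j)" for j
  have \<delta>0: "\<delta> j > 0" for j by (simp add: \<delta>_def)
  have \<delta>_lim: "\<delta> \<longlonglongrightarrow> 0"
    using LIMSEQ_inverse_real_of_nat by (simp add: \<delta>_def[abs_def] inverse_eq_divide)
  \<comment> \<open>The loss from the times at which the velocity is set to zero. It tends to 0 with
    the threshold because \<open>k\<close> is almost nowhere zero.\<close>
  define R1 where "R1 j \<omega> = (\<integral>\<^sup>+s\<in>{0..T}. (ennreal C * indicator {x. \<bar>x\<bar> \<le> \<delta> j} (k0 (s, \<omega>))) \<partial>lborel)" for j \<omega>
  have [measurable]: "R1 j \<in> borel_measurable M" for j unfolding R1_def[abs_def] by measurable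
  have "(\<lambda>j. \<integral>\<^sup>+\<omega>. min 1 (R1 j \<omega>) \<partial>M) \<longlonglongrightarrow> (\<integral>\<^sup>+\<omega>. 0 \<partial>M)"
  proof (rule nn_integral_dominated_convergence[where w="\<lambda>_. 1"])
    show "AE \<omega> in M. (\<lambda>j. min 1 (R1 j \<omega>)) \<longlonglongrightarrow> 0"
      using nz AE_space
    proof eventually_elim
      case (elim \<omega>)
      note [simp] = elim(2)
      have "(\<lambda>j. R1 j \<omega>) \<longlonglongrightarrow> (\<integral>\<^sup>+s\<in>{0..T}. 0 \<partial>lborel)"
        unfolding R1_def
      proof (rule nn_integral_dominated_convergence[where w="\<lambda>s. ennreal C * indicator {0..T} s"])
        show "AE s in lborel. ennreal C * indicator {x. \<bar>x\<bar> \<le> \<delta> j} (k0 (s, \<omega>)) * indicator {0..T} s \<le> ennreal C * indicator {0..T} s" for j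
          by (intro AE_I2) (auto simp: indicator_def)
        show "(\<integral>\<^sup>+s. ennreal C * indicator {0..T} s \<partial>lborel) < \<infinity>"
          using T_pos by (simp add: nn_integral_cmult_indicator ennreal_mult_less_top)
        have "{s \<in> space lborel. s \<in> {0..T} \<and> k0 (s, \<omega>) = 0} \<in> sets lborel" by measurable
        moreover have "{s \<in> space lborel. s \<in> {0..T} \<and> k0 (s, \<omega>) = 0} = {t \<in> {0..T}. k t \<omega> = 0}"
          by (auto simp: k0_eq)
        ultimately have "{t \<in> {0..T}. k t \<omega> = 0} \<in> sets lborel" by (simp only:)
        then have "{t \<in> {0..T}. k t \<omega> = 0} \<in> null_sets lborel" using elim(1) by (intro null_setsI)
        then have "AE s in lborel. s \<notin> {t \<in> {0..T}. k t \<omega> = 0}" by (rule AE_not_in)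
        then show "AE s in lborel. (\<lambda>j. ennreal C * indicator {x. \<bar>x\<bar> \<le> \<delta> j} (k0 (s, \<omega>)) * indicator {0..T} s) \<longlonglongrightarrow> 0 * indicator {0..T} s"
        proof eventually_elim
          case (elim s)
          show ?case
          proof (cases "s \<in> {0..T}")
            case True
            with elim have "\<bar>k0 (s, \<omega>)\<bar> > 0" by (auto simp: k0_eq)
            then have "\<forall>\<^sub>F j in sequentially. \<delta> j < \<bar>k0 (s, \<omega>)\<bar>" by (rule order_tendstoD(2)[OF \<delta>_lim])
            then have "\<forall>\<^sub>F j in sequentially. ennreal C * indicator {x. \<bar>x\<bar> \<le> \<delta> j} (k0 (s, \<omega>)) * indicator {0..T} s = 0 * indicator {0..T} s"
              by eventually_elim (auto simp: indicator_def)
            then show ?thesis by (rule tendsto_eventually)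
          qed simp
        qed
      qed measurable
      then have "(\<lambda>j. min 1 (R1 j \<omega>)) \<longlonglongrightarrow> min 1 0" by (intro tendsto_min tendsto_const) simp
      then show ?case by simp
    qed
  qed (auto simp: emeasure_space_1)
  then have "\<forall>\<^sub>F j in sequentially. (\<integral>\<^sup>+\<omega>. min 1 (R1 j \<omega>) \<partial>M) < ennreal (e / 3)"
    using e by (intro order_tendstoD(2)) auto
  then obtain j where j: "(\<integral>\<^sup>+\<omega>. min 1 (R1 j \<omega>) \<partial>M) < ennreal (e / 3)" by (auto dest: eventually_happens)
  \<comment> \<open>Part of the cost of multiplying the sampling error by \<open>k\<close>; the
    almost surely finite square integral is damped by a small weight.\<close>
  define R2 where "R2 m \<omega> = ennreal (\<delta> m) * (\<integral>\<^sup>+s\<in>{0..T}. ennreal ((k0 (s, \<omega>))\<^sup>2) \<partial>lborel)" for m \<omega>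
  have [measurable]: "R2 m \<in> borel_measurable M" for m unfolding R2_def[abs_def] by measurable
  have "(\<lambda>m. \<integral>\<^sup>+\<omega>. min 1 (R2 m \<omega>) \<partial>M) \<longlonglongrightarrow> (\<integral>\<^sup>+\<omega>. 0 \<partial>M)"
  proof (rule nn_integral_dominated_convergence[where w="\<lambda>_. 1"])
    show "AE \<omega> in M. (\<lambda>m. min 1 (R2 m \<omega>)) \<longlonglongrightarrow> 0"
      using k_square_integrable
    proof eventually_elim
      case (elim \<omega>)
      then have fin: "(\<integral>\<^sup>+s\<in>{0..T}. ennreal ((k0 (s, \<omega>))\<^sup>2) \<partial>lborel) < \<infinity>"
        using nn_integral_k0[of "\<lambda>x _. ennreal (x\<^sup>2)" \<omega>] by simp
      have "(\<lambda>m. ennreal (\<delta> m)) \<longlonglongrightarrow> 0" using tendsto_ennrealI[OF \<delta>_lim] by simp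
      then have "(\<lambda>m. (\<integral>\<^sup>+s\<in>{0..T}. ennreal ((k0 (s, \<omega>))\<^sup>2) \<partial>lborel) * ennreal (\<delta> m))
          \<longlonglongrightarrow> (\<integral>\<^sup>+s\<in>{0..T}. ennreal ((k0 (s, \<omega>))\<^sup>2) \<partial>lborel) * 0"
        using fin by (intro ennreal_tendsto_cmult) auto
      then have "(\<lambda>m. R2 m \<omega>) \<longlonglongrightarrow> 0" by (simp add: R2_def mult.commute)
      then have "(\<lambda>m. min 1 (R2 m \<omega>)) \<longlonglongrightarrow> min 1 0" by (intro tendsto_min tendsto_const)
      then show ?case by simp
    qed
  qed (auto simp: emeasure_space_1)
  then have "\<forall>\<^sub>F m in sequentially. (\<integral>\<^sup>+\<omega>. min 1 (R2 m \<omega>) \<partial>M) < ennreal (e / 3)"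
    using e by (intro order_tendstoD(2)) auto
  then obtain m where m: "(\<integral>\<^sup>+\<omega>. min 1 (R2 m \<omega>) \<partial>M) < ennreal (e / 3)" by (auto dest: eventually_happens)
  \<comment> \<open>The threshold \<open>\<delta> j\<close> bounds the quotient by
    \<open>C / \<delta> j\<close>, and the condition \<open>t < s\<close> keeps the past free of
    drift.\<close>
  define \<psi> where "\<psi> s x = (if t < s \<and> \<delta> j < \<bar>x\<bar> then q s / x else 0)" for s x
  have [measurable]: "(\<lambda>(s, x). \<psi> s x) \<in> borel_measurable (borel \<Otimes>\<^sub>M borel)" unfolding \<psi>_def by measurable
  define C' where "C' = C / \<delta> j"
  have C': "0 \<le> C'" using C \<delta>0 by (simp add: C'_def less_imp_le)
  have \<psi>_b: "\<bar>\<psi> s x\<bar> \<le> C'" for s x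
  proof (cases "t < s \<and> \<delta> j < \<bar>x\<bar>")
    case True
    then have "\<bar>\<psi> s x\<bar> = \<bar>q s\<bar> / \<bar>x\<bar>" by (simp add: \<psi>_def abs_divide)
    also have "\<dots> \<le> C / \<delta> j" using True q_b[of s] \<delta>0[of j] C by (intro frac_le) auto
    finally show ?thesis by (simp add: C'_def)
  next
    case False
    then have "\<psi> s x = 0" by (simp only: \<psi>_def if_False)
    then show ?thesis using C' by simp
  qed
  define Q where "Q z = \<psi> (fst z) (k0 z)" for z
  have Qm[measurable]: "Q \<in> borel_measurable (borel \<Otimes>\<^sub>M M)" unfolding Q_def[abs_def] by measurable
  \<comment> \<open>The constants are chosen in the order \<open>j\<close>, then \<open>m\<close>,
    then \<open>e'\<close>: the bound \<open>C'\<close> depends on \<open>j\<close>, and the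
    sampling error is multiplied by \<open>C' / \<delta> m\<close>. The summand 1 covers
    \<open>C' = 0\<close>.\<close>
  define e' where "e' = e * \<delta> m / (3 * (C' + 1))"
  have e': "e' > 0" "C' / \<delta> m * e' \<le> e / 3"
  proof -
    show "e' > 0" using e \<delta>0 C' by (simp add: e'_def)
    have "C' / \<delta> m * e' = (C' / (C' + 1)) * (e / 3)" using \<delta>0[of m] C' by (simp add: e'_def field_simps)
    also have "\<dots> \<le> 1 * (e / 3)" using C' e by (intro mult_right_mono) (auto simp: field_simps)
    finally show "C' / \<delta> m * e' \<le> e / 3" by simp
  qed
  obtain n \<tau> where grid: "time_grid T n \<tau>" and
    le: "(\<integral>\<^sup>+\<omega>. (\<integral>\<^sup>+s\<in>{0..T}. ennreal \<bar>elementary_process n \<tau> (\<lambda>i \<omega>. Q (\<tau> i, \<omega>)) s \<omega> - Q (s, \<omega>)\<bar> \<partial>lborel) \<partial>M) \<le> ennreal e'"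
    by (rule ex_grid_sampling[OF Qm _ T_pos e'(1), of C']) (auto simp: Q_def \<psi>_b)
  interpret time_grid T n \<tau> by (rule grid)
  define b where "b i x = \<psi> (\<tau> i) x" for i x
  let ?h = "elementary_process n \<tau> (\<lambda>i \<omega>. b i (k (\<tau> i) \<omega>))"
  have h_Q: "elementary_process n \<tau> (\<lambda>i \<omega>. Q (\<tau> i, \<omega>)) s \<omega> = ?h s \<omega>" for s \<omega>
    unfolding elementary_process_def using p_in by (intro sum.cong refl) (simp add: Q_def b_def k0_eq)
  have b_m[measurable]: "b i \<in> borel_measurable borel" for i unfolding b_def[abs_def] by measurable
  have h_b: "\<bar>?h s \<omega>\<bar> \<le> C'" for s \<omega>
    by (rule elementary_process_bound) (use \<psi>_b C' in \<open>auto simp: b_def\<close>)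
  have h_m[measurable]: "(\<lambda>(s, \<omega>). ?h s \<omega>) \<in> borel_measurable (borel \<Otimes>\<^sub>M M)"
  proof (rule measurable_elementary_process)
    fix i assume "i < n"
    then have "\<tau> i \<in> {0..T}" by (intro p_in) simp
    then show "(\<lambda>\<omega>. b i (k (\<tau> i) \<omega>)) \<in> borel_measurable M"
      by (intro measurable_compose[OF G_imp_M[OF _ k_measurable] b_m])
  qed
  define R3 where "R3 \<omega> = (\<integral>\<^sup>+s\<in>{0..T}. ennreal \<bar>?h s \<omega> - Q (s, \<omega>)\<bar> \<partial>lborel)" for \<omega>
  have [measurable]: "R3 \<in> borel_measurable M" unfolding R3_def[abs_def] by measurable
  have R3_le: "(\<integral>\<^sup>+\<omega>. R3 \<omega> \<partial>M) \<le> ennreal e'" using le unfolding R3_def h_Q .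
  have pt: "\<bar>k0 (s, \<omega>) * ?h s \<omega> - q s\<bar> \<le> C * indicator {x. \<bar>x\<bar> \<le> \<delta> j} (k0 (s, \<omega>)) + \<delta> m * (k0 (s, \<omega>))\<^sup>2 + C' / \<delta> m * \<bar>?h s \<omega> - Q (s, \<omega>)\<bar>"
    if s: "t < s" for s \<omega>
  proof -
    define x where "x = \<bar>k0 (s, \<omega>)\<bar>"
    define y where "y = \<bar>?h s \<omega> - Q (s, \<omega>)\<bar>"
    have "\<bar>k0 (s, \<omega>) * Q (s, \<omega>) - q s\<bar> \<le> C * indicator {x. \<bar>x\<bar> \<le> \<delta> j} (k0 (s, \<omega>))"
    proof (cases "\<delta> j < \<bar>k0 (s, \<omega>)\<bar>")
      case True
      then have "k0 (s, \<omega>) \<noteq> 0" using \<delta>0[of j] by auto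
      then show ?thesis using True s C by (simp add: Q_def \<psi>_def indicator_def)
    next
      case False
      then have "Q (s, \<omega>) = 0" by (simp add: Q_def \<psi>_def)
      then show ?thesis using False q_b[of s] by (simp add: indicator_def)
    qed
    moreover have "\<bar>k0 (s, \<omega>) * ?h s \<omega> - k0 (s, \<omega>) * Q (s, \<omega>)\<bar> = x * y"
      by (simp add: x_def y_def abs_mult[symmetric] algebra_simps)
    \<comment> \<open>The square of \<open>2 * \<delta> m * x - y\<close> is nonnegative, and one
      factor of \<open>y\<^sup>2\<close> is replaced by the bound \<open>2 * C'\<close>, so the
      sampling error enters linearly and can be averaged.\<close>
    moreover have "x * y \<le> \<delta> m * x\<^sup>2 + C' / \<delta> m * y"
    proof -
      have y: "0 \<le> y" "y \<le> 2 * C'"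
        using h_b[of s \<omega>] \<psi>_b[of s "k0 (s, \<omega>)"] by (auto simp: y_def Q_def)
      have "0 \<le> (2 * \<delta> m * x - y)\<^sup>2" by simp
      then have "4 * \<delta> m * (x * y) \<le> 4 * (\<delta> m)\<^sup>2 * x\<^sup>2 + y\<^sup>2" by (simp add: power2_eq_square algebra_simps)
      also have "y\<^sup>2 \<le> 2 * C' * y" using y by (simp add: power2_eq_square mult_right_mono)
      also have "2 * C' * y \<le> 4 * C' * y" using y C' by (intro mult_right_mono) auto
      finally have "4 * \<delta> m * (x * y) \<le> 4 * (\<delta> m)\<^sup>2 * x\<^sup>2 + 4 * C' * y" by simp
      also have "\<dots> = 4 * \<delta> m * (\<delta> m * x\<^sup>2 + C' / \<delta> m * y)"
        using \<delta>0[of m] by (simp add: field_simps power2_eq_square)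
      finally show ?thesis using \<delta>0[of m] by (subst (asm) mult_le_cancel_left_pos) auto
    qed
    ultimately show ?thesis unfolding x_def y_def power2_abs by linarith
  qed
  show thesis
  proof (rule that[of n \<tau> b C', OF grid b_m])
    show "\<bar>b i x\<bar> \<le> C'" for i x by (simp add: b_def \<psi>_b)
    \<comment> \<open>Sampling at left end points matters here: a cell reached at a time
      \<open>s \<le> t\<close> starts before \<open>t\<close>, where \<open>\<psi>\<close> vanishes,
      even if the cell extends beyond \<open>t\<close>.\<close>
    show "?h s \<omega> = 0" if "s \<le> t" for s \<omega>
    proof (cases "s \<in> {0<..T}")
      case True
      then obtain i where i: "i < n" "s \<in> {\<tau> i<..\<tau> (Suc i)}" by (rule ex_cell)
      then have "\<tau> i \<le> t" using that by auto
      then show ?thesis unfolding elementary_process_on_cell(1)[OF i] by (simp add: b_def \<psi>_def)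
    next
      case False
      then show ?thesis by (rule elementary_process_on_cell(2))
    qed
    have "(\<integral>\<^sup>+\<omega>. min 1 (\<integral>\<^sup>+s\<in>{t<..T}. ennreal \<bar>k0 (s, \<omega>) * ?h s \<omega> - q s\<bar> \<partial>lborel) \<partial>M)
      \<le> (\<integral>\<^sup>+\<omega>. min 1 (R1 j \<omega>) + min 1 (R2 m \<omega>) + ennreal (C' / \<delta> m) * R3 \<omega> \<partial>M)"
    proof (rule nn_integral_mono)
      fix \<omega> assume [simp]: "\<omega> \<in> space M"
      have [measurable]: "(\<lambda>s. ?h s \<omega>) \<in> borel_measurable borel" unfolding elementary_process_def by measurable
      have "(\<integral>\<^sup>+s\<in>{t<..T}. ennreal \<bar>k0 (s, \<omega>) * ?h s \<omega> - q s\<bar> \<partial>lborel)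
        \<le> (\<integral>\<^sup>+s. ennreal C * indicator {x. \<bar>x\<bar> \<le> \<delta> j} (k0 (s, \<omega>)) * indicator {0..T} s
             + ennreal (\<delta> m) * (ennreal ((k0 (s, \<omega>))\<^sup>2) * indicator {0..T} s)
             + ennreal (C' / \<delta> m) * (ennreal \<bar>?h s \<omega> - Q (s, \<omega>)\<bar> * indicator {0..T} s) \<partial>lborel)"
      proof (rule nn_integral_mono)
        fix s
        show "ennreal \<bar>k0 (s, \<omega>) * ?h s \<omega> - q s\<bar> * indicator {t<..T} s
          \<le> ennreal C * indicator {x. \<bar>x\<bar> \<le> \<delta> j} (k0 (s, \<omega>)) * indicator {0..T} s
             + ennreal (\<delta> m) * (ennreal ((k0 (s, \<omega>))\<^sup>2) * indicator {0..T} s)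
             + ennreal (C' / \<delta> m) * (ennreal \<bar>?h s \<omega> - Q (s, \<omega>)\<bar> * indicator {0..T} s)"
        proof (cases "s \<in> {t<..T}")
          case True
          then have s: "t < s" "s \<in> {0..T}" using t by auto
          have "ennreal \<bar>k0 (s, \<omega>) * ?h s \<omega> - q s\<bar>
            \<le> ennreal (C * indicator {x. \<bar>x\<bar> \<le> \<delta> j} (k0 (s, \<omega>)) + \<delta> m * (k0 (s, \<omega>))\<^sup>2 + C' / \<delta> m * \<bar>?h s \<omega> - Q (s, \<omega>)\<bar>)"
            by (rule ennreal_leI[OF pt[OF s(1)]])
          also have "\<dots> = ennreal (C * indicator {x. \<bar>x\<bar> \<le> \<delta> j} (k0 (s, \<omega>))) + ennreal (\<delta> m * (k0 (s, \<omega>))\<^sup>2) + ennreal (C' / \<delta> m * \<bar>?h s \<omega> - Q (s, \<omega>)\<bar>)"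
            using C C' \<delta>0[of m] by (simp add: ennreal_plus less_imp_le)
          also have "ennreal (C * indicator {x. \<bar>x\<bar> \<le> \<delta> j} (k0 (s, \<omega>))) = ennreal C * indicator {x. \<bar>x\<bar> \<le> \<delta> j} (k0 (s, \<omega>))"
            by (simp add: indicator_def)
          also have "ennreal (\<delta> m * (k0 (s, \<omega>))\<^sup>2) = ennreal (\<delta> m) * ennreal ((k0 (s, \<omega>))\<^sup>2)"
            using \<delta>0[of m] by (intro ennreal_mult) auto
          also have "ennreal (C' / \<delta> m * \<bar>?h s \<omega> - Q (s, \<omega>)\<bar>) = ennreal (C' / \<delta> m) * ennreal \<bar>?h s \<omega> - Q (s, \<omega>)\<bar>"
            using C' \<delta>0[of m] by (intro ennreal_mult) auto
          finally show ?thesis using True s(2) by (simp only: indicator_simps mult_1_right)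
        qed simp
      qed
      also have "\<dots> = R1 j \<omega> + R2 m \<omega> + ennreal (C' / \<delta> m) * R3 \<omega>"
        unfolding R1_def R2_def R3_def by (simp add: nn_integral_add nn_integral_cmult)
      finally have "min 1 (\<integral>\<^sup>+s\<in>{t<..T}. ennreal \<bar>k0 (s, \<omega>) * ?h s \<omega> - q s\<bar> \<partial>lborel) \<le> min 1 (R1 j \<omega> + R2 m \<omega> + ennreal (C' / \<delta> m) * R3 \<omega>)"
        by (intro min.mono order_refl)
      also have "\<dots> \<le> min 1 (R1 j \<omega>) + min 1 (R2 m \<omega>) + ennreal (C' / \<delta> m) * R3 \<omega>"
      proof (cases "R1 j \<omega> \<le> 1 \<and> R2 m \<omega> \<le> 1")
        case True
        then show ?thesis by (simp add: min_absorb2)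
      next
        case False
        then have "1 \<le> min 1 (R1 j \<omega>) + min 1 (R2 m \<omega>)"
          by (auto simp: not_le min_absorb1 less_imp_le intro: add_increasing add_increasing2)
        then have "1 \<le> min 1 (R1 j \<omega>) + min 1 (R2 m \<omega>) + ennreal (C' / \<delta> m) * R3 \<omega>"
          by (rule add_increasing2[rotated]) simp
        then show ?thesis by (intro min.coboundedI1)
      qed
      finally show "min 1 (\<integral>\<^sup>+s\<in>{t<..T}. ennreal \<bar>k0 (s, \<omega>) * ?h s \<omega> - q s\<bar> \<partial>lborel) \<le> min 1 (R1 j \<omega>) + min 1 (R2 m \<omega>) + ennreal (C' / \<delta> m) * R3 \<omega>" .
    qed
    also have "\<dots> = (\<integral>\<^sup>+\<omega>. min 1 (R1 j \<omega>) \<partial>M) + (\<integral>\<^sup>+\<omega>. min 1 (R2 m \<omega>) \<partial>M) + ennreal (C' / \<delta> m) * (\<integral>\<^sup>+\<omega>. R3 \<omega> \<partial>M)"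
      by (simp add: nn_integral_add nn_integral_cmult)
    also have "\<dots> \<le> ennreal (e / 3) + ennreal (e / 3) + ennreal (C' / \<delta> m) * ennreal e'"
      by (intro add_mono less_imp_le[OF j] less_imp_le[OF m] mult_left_mono R3_le) simp
    also have "\<dots> = ennreal (e / 3 + e / 3 + C' / \<delta> m * e')"
    proof -
      have "ennreal x + ennreal w + ennreal y * ennreal z = ennreal (x + w + y * z)"
        if "0 \<le> x" "0 \<le> w" "0 \<le> y" "0 \<le> z" for w x y z
        using that by (simp add: ennreal_plus ennreal_mult)
      then show ?thesis using e e' C' \<delta>0[of m] by (simp only: less_imp_le divide_nonneg_nonneg zero_le_numeral)
    qed
    also have "\<dots> \<le> ennreal e" using e' by (intro ennreal_leI) linarith
    finally show "(\<integral>\<^sup>+\<omega>. min 1 (\<integral>\<^sup>+s\<in>{t<..T}. ennreal \<bar>k0 (s, \<omega>) * ?h s \<omega> - q s\<bar> \<partial>lborel) \<partial>M) \<le> ennreal e" .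
  qed
qed

end

section \<open>Positive probability of tubes\<close>

lemma continuous_process_add:
  "continuous_process M T X \<Longrightarrow> continuous_process M T Y \<Longrightarrow> continuous_process M T (\<lambda>t \<omega>. X t \<omega> + Y t \<omega>)"
  unfolding continuous_process_def by (auto intro!: borel_measurable_add continuous_on_add)

text \<open>An event of the past is decided by the path up to \<open>t\<close>. Quantifying over all
  \<open>v\<close> that agree with \<open>Z\<close> up to \<open>t\<close> allows the same set
  \<open>A\<close> to be used for the original and for the translated path.\<close>

lemma natural_filtration_factors:
  assumes "D \<in> sets (natural_filtration M Z t)" and t: "t \<le> T"
  shows "\<exists>A \<in> sets (\<Pi>\<^sub>M j\<in>{0..T} \<times> (UNIV :: bool set). borel). \<forall>\<omega>\<in>space M. \<forall>v \<in> space (\<Pi>\<^sub>M j\<in>{0..T} \<times> (UNIV :: bool set). borel).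
    (\<forall>s\<in>{0..t}. v (s, True) = (Z s \<omega> :: real)) \<longrightarrow> (v \<in> A \<longleftrightarrow> \<omega> \<in> D)"
  using assms(1) unfolding sets_natural_filtration
proof (induction rule: sigma_sets.induct)
  let ?P = "\<Pi>\<^sub>M j\<in>{0..T} \<times> (UNIV :: bool set). borel :: real measure"
  {
    case (Basic D)
    then obtain s B where s: "s \<in> {0..t}" and B: "B \<in> sets borel" and D: "D = Z s -` B \<inter> space M" by auto
    have [measurable]: "(\<lambda>v. v (s, True)) \<in> borel_measurable ?P"
      using s t by (intro measurable_component_singleton) auto
    note B[measurable]
    have "{v \<in> space ?P. v (s, True) \<in> B} \<in> sets ?P" by measurable
    then show ?case using s D by (intro bexI[of _ "{v \<in> space ?P. v (s, True) \<in> B}"]) auto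
  next
    case Empty
    show ?case by (intro bexI[of _ "{}"]) auto
  next
    case (Compl D)
    then obtain A where A: "A \<in> sets ?P" "\<forall>\<omega>\<in>space M. \<forall>v \<in> space ?P. (\<forall>s\<in>{0..t}. v (s, True) = Z s \<omega>) \<longrightarrow> (v \<in> A \<longleftrightarrow> \<omega> \<in> D)"
      by blast
    then show ?case by (intro bexI[of _ "space ?P - A"]) auto
  next
    case (Union D)
    then have "\<forall>i. \<exists>A. A \<in> sets ?P \<and> (\<forall>\<omega>\<in>space M. \<forall>v \<in> space ?P. (\<forall>s\<in>{0..t}. v (s, True) = Z s \<omega>) \<longrightarrow> (v \<in> A \<longleftrightarrow> \<omega> \<in> D i))"
      unfolding Bex_def by (intro allI)
    from choice[OF this] obtain A where *: "\<forall>i. A i \<in> sets ?P \<and> (\<forall>\<omega>\<in>space M. \<forall>v \<in> space ?P.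
        (\<forall>s\<in>{0..t}. v (s, True) = Z s \<omega>) \<longrightarrow> (v \<in> A i \<longleftrightarrow> \<omega> \<in> D i))"
      by (elim exE)
    have A: "A i \<in> sets ?P"
      "\<forall>\<omega>\<in>space M. \<forall>v \<in> space ?P. (\<forall>s\<in>{0..t}. v (s, True) = Z s \<omega>) \<longrightarrow> (v \<in> A i \<longleftrightarrow> \<omega> \<in> D i)" for i
      by (rule *[THEN spec, THEN conjunct1], rule *[THEN spec, THEN conjunct2])
    have "(\<Union>i. A i) \<in> sets ?P" using A(1) by (intro sets.countable_UN) auto
    with A(2) show ?case by (intro bexI[of _ "\<Union>i. A i"]) blast+
  }
qed

text \<open>By density of the polynomials, countably many tubes cover \<open>B\<close>; if all
  intersections were null, so would be \<open>B\<close>.\<close>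

lemma (in prob_space) ex_increment_tube_pos:
  assumes Z: "continuous_process M T Z" and t: "t \<in> {0..T}" and B: "B \<in> events" "prob B > 0" and e: "e > 0"
  shows "\<exists>cs. prob (B \<inter> {\<omega> \<in> space M. (\<lambda>u. Z u \<omega>) \<in> increment_tube t T cs e}) > 0"
    and "{\<omega> \<in> space M. (\<lambda>u. Z u \<omega>) \<in> increment_tube t T cs e} \<in> events"
proof -
  have tT: "t \<le> T" using t by simp
  have Z_cont: "continuous_on {t..T} (\<lambda>u. Z u \<omega>)" if "\<omega> \<in> space M" for \<omega>
    using Z that t by (auto simp: continuous_process_def intro: continuous_on_subset)
  have [measurable]: "Z t \<in> borel_measurable M" "Z (rat_time t T r) \<in> borel_measurable M" for r
    using Z t rat_time_in[OF tT, of r] by (auto simp: continuous_process_def)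
  have "{\<omega> \<in> space M. (\<lambda>u. Z u \<omega>) \<in> increment_tube t T cs e} = {\<omega> \<in> space M.
     \<forall>r. \<bar>Z (rat_time t T r) \<omega> - Z t \<omega> - (rat_poly cs (rat_time t T r) - rat_poly cs t)\<bar> \<le> e}" for cs
    using increment_tube_iff_rat[OF tT Z_cont] by blast
  then show meas: "{\<omega> \<in> space M. (\<lambda>u. Z u \<omega>) \<in> increment_tube t T cs e} \<in> events" for cs by simp
  show "\<exists>cs. prob (B \<inter> {\<omega> \<in> space M. (\<lambda>u. Z u \<omega>) \<in> increment_tube t T cs e}) > 0"
  proof (rule ccontr)
    assume "\<not> ?thesis"
    then have "prob (B \<inter> {\<omega> \<in> space M. (\<lambda>u. Z u \<omega>) \<in> increment_tube t T cs e}) = 0" for cs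
      by (simp add: not_less measure_le_0_iff)
    then have "B \<inter> {\<omega> \<in> space M. (\<lambda>u. Z u \<omega>) \<in> increment_tube t T cs e} \<in> null_sets M" for cs
      using B meas by (intro null_setsI) (auto simp: emeasure_eq_measure)
    then have "(\<Union>cs. B \<inter> {\<omega> \<in> space M. (\<lambda>u. Z u \<omega>) \<in> increment_tube t T cs e}) \<in> null_sets M"
      by (intro null_sets_UN)
    moreover have "B \<subseteq> (\<Union>cs. B \<inter> {\<omega> \<in> space M. (\<lambda>u. Z u \<omega>) \<in> increment_tube t T cs e})"
    proof
      fix \<omega> assume \<omega>: "\<omega> \<in> B"
      then have \<omega>M: "\<omega> \<in> space M" using sets.sets_into_space[OF B(1)] by auto
      \<comment> \<open>Half of \<open>e\<close>, because an increment involves the approximation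
        error at two times.\<close>
      obtain cs where cs: "\<forall>u\<in>{t..T}. \<bar>Z u \<omega> - rat_poly cs u\<bar> < e / 2"
        using rat_poly_dense[OF Z_cont[OF \<omega>M], of "e/2"] e by auto
      have "(\<lambda>u. Z u \<omega>) \<in> increment_tube t T cs e"
        unfolding increment_tube_def mem_Collect_eq
      proof
        fix x assume "x \<in> {t..T}"
        then have "\<bar>Z x \<omega> - rat_poly cs x\<bar> < e / 2" "\<bar>Z t \<omega> - rat_poly cs t\<bar> < e / 2" using cs tT by auto
        then show "\<bar>Z x \<omega> - Z t \<omega> - (rat_poly cs x - rat_poly cs t)\<bar> \<le> e" by linarith
      qed
      then show "\<omega> \<in> (\<Union>cs. B \<inter> {\<omega> \<in> space M. (\<lambda>u. Z u \<omega>) \<in> increment_tube t T cs e})" using \<omega> \<omega>M by auto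
    qed
    ultimately have "B \<in> null_sets M" using B(1) null_sets_subset by blast
    then show False using B(2) by (auto simp: null_sets_def measure_def)
  qed
qed

context adapted_integrand
begin

text \<open>Since the velocity vanishes up to \<open>t\<close>, the drift at \<open>u\<close> is an
  integral over \<open>{t..u}\<close>. The fundamental theorem of calculus writes
  \<open>P u - P t\<close> over the same interval, and \<open>R\<close> bounds the difference for
  all \<open>u\<close> at once.\<close>

lemma drift_near_primitive:
  fixes P q :: "real \<Rightarrow> real"
  assumes \<omega>: "\<omega> \<in> space M" and fin: "(\<integral>\<^sup>+s\<in>{0..T}. ennreal ((k s \<omega>)\<^sup>2) \<partial>lborel) < \<infinity>"
    and h_m: "(\<lambda>s. elementary_process n \<tau> \<eta> s \<omega>) \<in> borel_measurable borel" and h_b: "\<And>s. \<bar>elementary_process n \<tau> \<eta> s \<omega>\<bar> \<le> C"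
    and h0: "\<And>s. s \<le> t \<Longrightarrow> elementary_process n \<tau> \<eta> s \<omega> = 0"
    and P: "\<And>s. (P has_real_derivative q s) (at s)" and q: "continuous_on UNIV q"
    and R: "(\<integral>\<^sup>+s\<in>{t<..T}. ennreal \<bar>k0 (s, \<omega>) * elementary_process n \<tau> \<eta> s \<omega> - q s\<bar> \<partial>lborel) \<le> ennreal e" and e: "0 \<le> e"
    and u: "0 \<le> t" "t \<le> u" "u \<le> T"
  shows "\<bar>drift n \<tau> \<eta> u \<omega> - (P u - P t)\<bar> \<le> e"
proof -
  let ?h = "\<lambda>s. elementary_process n \<tau> \<eta> s \<omega>"
  note \<omega>[simp] h_m[measurable]
  have i1: "set_integrable lborel {0..u} (\<lambda>s. k0 (s, \<omega>) * ?h s)"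
    by (rule set_integrable_drift[OF h_m h_b \<omega> fin u(3)])
  have ind: "indicator {0..u} s *\<^sub>R (k0 (s, \<omega>) * ?h s) = indicator {t..u} s *\<^sub>R (k0 (s, \<omega>) * ?h s)" for s
    using h0[of s] u by (auto simp: indicator_def)
  have i2: "set_integrable lborel {t..u} (\<lambda>s. k0 (s, \<omega>) * ?h s)"
    using i1 unfolding set_integrable_def ind .
  have i3: "set_integrable lborel {t..u} q"
    unfolding set_integrable_def by (rule borel_integrable_compact) (auto intro: continuous_on_subset[OF q])
  have P_int: "(LBINT s:{t..u}. q s) = P u - P t"
    unfolding set_lebesgue_integral_def
    using integral_FTC_atLeastAtMost[OF u(2), of P q] P continuous_on_subset[OF q]
    by (auto simp: has_real_derivative_iff_has_vector_derivative intro: has_vector_derivative_at_within)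
  have "drift n \<tau> \<eta> u \<omega> = (LBINT s:{t..u}. k0 (s, \<omega>) * ?h s)"
    unfolding drift_def set_lebesgue_integral_def ind ..
  then have "drift n \<tau> \<eta> u \<omega> - (P u - P t) = (LBINT s:{t..u}. k0 (s, \<omega>) * ?h s - q s)"
    unfolding P_int[symmetric] by (simp add: set_integral_diff(2)[OF i2 i3])
  then have "ennreal \<bar>drift n \<tau> \<eta> u \<omega> - (P u - P t)\<bar>
      = ennreal (norm (LBINT s. indicator {t..u} s *\<^sub>R (k0 (s, \<omega>) * ?h s - q s)))"
    by (simp add: set_lebesgue_integral_def)
  also have "\<dots> \<le> (\<integral>\<^sup>+s. ennreal (norm (indicator {t..u} s *\<^sub>R (k0 (s, \<omega>) * ?h s - q s))) \<partial>lborel)"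
    by (rule integral_norm_bound_ennreal) (rule set_integral_diff(1)[OF i2 i3, unfolded set_integrable_def])
  also have "\<dots> \<le> (\<integral>\<^sup>+s\<in>{t<..T}. ennreal \<bar>k0 (s, \<omega>) * ?h s - q s\<bar> \<partial>lborel)"
  proof (rule nn_integral_mono_AE)
    show "AE s in lborel. ennreal (norm (indicator {t..u} s *\<^sub>R (k0 (s, \<omega>) * ?h s - q s))) \<le> ennreal \<bar>k0 (s, \<omega>) * ?h s - q s\<bar> * indicator {t<..T} s"
      using AE_lborel_singleton[of t] by eventually_elim (use u in \<open>auto simp: indicator_def\<close>)
  qed
  also note R
  finally show ?thesis using e by simp
qed

text \<open>Some tube around a polynomial \<open>cs'\<close> is entered on \<open>B\<close> with
  positive probability. The drift is made to follow \<open>cs - cs'\<close>, and the change of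
  measure replaces \<open>Z\<close> by \<open>Z\<close> minus the drift: if the latter lies in the
  tube around \<open>cs'\<close>, then \<open>Z\<close> lies in the one around
  \<open>cs\<close>.\<close>

lemma increment_tube_pos:
  assumes H: "continuous_process M T H"
    and ind: "indep_set (sets (vimage_algebra (space M) (\<lambda>\<omega>. \<lambda>t\<in>{0..T}. W t \<omega>) (\<Pi>\<^sub>M t\<in>{0..T}. borel)))
       (sets (vimage_algebra (space M) (\<lambda>\<omega>. \<lambda>t\<in>{0..T}. (H t \<omega>, k t \<omega>)) (\<Pi>\<^sub>M t\<in>{0..T}. borel)))"
    and nz: "AE \<omega> in M. emeasure lborel {t \<in> {0..T}. k t \<omega> = 0} = 0"
    and Z: "Z = (\<lambda>t \<omega>. H t \<omega> + J t \<omega>)"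
    and t: "t \<in> {0..<T}" and B: "B \<in> sets (natural_filtration M Z t)" "prob B > 0" and e: "e > 0"
  shows "prob (B \<inter> {\<omega> \<in> space M. (\<lambda>u. Z u \<omega>) \<in> increment_tube t T cs e}) > 0"
proof -
  have t0: "0 \<le> t" "t \<le> T" "t \<in> {0..T}" using t by auto
  have Z_process: "continuous_process M T Z"
    using ito unfolding Z ito_integral_def by (intro continuous_process_add H) simp
  have H_meas: "H s \<in> borel_measurable M" if "s \<in> {0..T}" for s using H that by (simp add: continuous_process_def)
  have Z_meas[measurable]: "Z s \<in> borel_measurable M" if "s \<in> {0..T}" for s using Z_process that by (simp add: continuous_process_def)
  have "subalgebra M (natural_filtration M Z t)" using t0 by (intro subalgebra_natural_filtration Z_meas) auto
  then have BM: "B \<in> events" using B(1) by (auto simp: subalgebra_def)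
  \<comment> \<open>Half the width is reserved here; the other half pays for the deviation of the
    random drift from the primitive \<open>P\<close>.\<close>
  obtain cs' where cs': "prob (B \<inter> {\<omega> \<in> space M. (\<lambda>u. Z u \<omega>) \<in> increment_tube t T cs' (e/2)}) > 0"
    using ex_increment_tube_pos(1)[OF Z_process t0(3) BM B(2), of "e/2"] e by auto
  define A where "A = B \<inter> {\<omega> \<in> space M. (\<lambda>u. Z u \<omega>) \<in> increment_tube t T cs' (e/2)}"
  have A: "A \<in> events" "prob A > 0"
    using cs' BM ex_increment_tube_pos(2)[OF Z_process t0(3) BM B(2), of "e/2"] e by (auto simp: A_def)
  define P where "P s = rat_poly cs s - rat_poly cs' s" for s
  define q0 where "q0 s = rat_poly_deriv cs s - rat_poly_deriv cs' s" for s
  have q0_cont: "continuous_on S q0" for S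
    unfolding q0_def by (intro continuous_on_diff continuous_on_rat_poly_deriv)
  have P_deriv: "(P has_real_derivative q0 s) (at s)" for s
    unfolding P_def[abs_def] q0_def by (intro DERIV_diff rat_poly_has_derivative)
  obtain C where C: "\<And>s. s \<in> {0..T} \<Longrightarrow> \<bar>q0 s\<bar> \<le> C"
  proof -
    have "bounded (q0 ` {0..T})" by (intro compact_imp_bounded compact_continuous_image q0_cont) simp
    then obtain a where "\<forall>s\<in>{0..T}. \<bar>q0 s\<bar> \<le> a" by (auto simp: bounded_iff)
    then show thesis by (intro that[of a]) blast
  qed
  \<comment> \<open>Freezing the derivative outside \<open>{0..T}\<close> makes it globally bounded,
    as the construction of the drift requires; on \<open>{0..T}\<close> nothing changes.\<close>
  define q where "q s = q0 (max 0 (min T s))" for s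
  have q_b: "\<bar>q s\<bar> \<le> C" for s unfolding q_def using T_pos by (intro C) auto
  have q_m: "q \<in> borel_measurable borel"
  proof -
    have [measurable]: "q0 \<in> borel_measurable borel" by (rule borel_measurable_continuous_onI[OF q0_cont])
    show ?thesis unfolding q_def[abs_def] by measurable
  qed
  \<comment> \<open>Markov's inequality at level \<open>min 1 (e/2)\<close> then bounds the
    probability of a bad drift by \<open>prob A / 2\<close>, which leaves a good part of
    \<open>A\<close> with positive probability.\<close>
  define \<epsilon> where "\<epsilon> = prob A * min 1 (e/2) / 2"
  have \<epsilon>: "\<epsilon> > 0" using A e by (simp add: \<epsilon>_def)
  have "\<exists>n \<tau> b C'. time_grid T n \<tau> \<and> (\<forall>i<n. b i \<in> borel_measurable borel) \<and> (\<forall>i x. i < n \<longrightarrow> \<bar>b i x\<bar> \<le> (C' :: real)) \<and>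
    (\<forall>s \<omega>. s \<le> t \<longrightarrow> elementary_process n \<tau> (\<lambda>i \<omega>. b i (k (\<tau> i) \<omega>)) s \<omega> = 0) \<and>
    (\<integral>\<^sup>+\<omega>. min 1 (\<integral>\<^sup>+s\<in>{t<..T}. ennreal \<bar>k0 (s, \<omega>) * elementary_process n \<tau> (\<lambda>i \<omega>. b i (k (\<tau> i) \<omega>)) s \<omega> - q s\<bar> \<partial>lborel) \<partial>M) \<le> ennreal \<epsilon>"
    (is "\<exists>n \<tau> b C'. ?Q n \<tau> b C'")
  proof (rule ex_inverting_drift[OF nz q_m q_b t0(1) \<epsilon>])
    fix n \<tau> b C'
    assume "time_grid T n \<tau>" "\<And>i. i < n \<Longrightarrow> b i \<in> borel_measurable borel" "\<And>i x. i < n \<Longrightarrow> \<bar>b i x\<bar> \<le> (C' :: real)"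
      "\<And>s \<omega>. s \<le> t \<Longrightarrow> elementary_process n \<tau> (\<lambda>i \<omega>. b i (k (\<tau> i) \<omega>)) s \<omega> = 0"
      "(\<integral>\<^sup>+\<omega>. min 1 (\<integral>\<^sup>+s\<in>{t<..T}. ennreal \<bar>k0 (s, \<omega>) * elementary_process n \<tau> (\<lambda>i \<omega>. b i (k (\<tau> i) \<omega>)) s \<omega> - q s\<bar> \<partial>lborel) \<partial>M) \<le> ennreal \<epsilon>"
    then have "?Q n \<tau> b C'" by (intro conjI allI impI)
    then show "\<exists>n \<tau> b C'. ?Q n \<tau> b C'" by (intro exI)
  qed
  then obtain n \<tau> b C' where Q: "?Q n \<tau> b C'" by (elim exE)
  have grid: "time_grid T n \<tau>" by (rule Q[THEN conjunct1])
  have b_m: "b i \<in> borel_measurable borel" and b_b: "\<bar>b i x\<bar> \<le> C'" if "i < n" for i x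
    using Q that by simp_all
  have h0: "elementary_process n \<tau> (\<lambda>i \<omega>. b i (k (\<tau> i) \<omega>)) s \<omega> = 0" if "s \<le> t" for s \<omega>
    using Q that by simp
  note R_le = Q[THEN conjunct2, THEN conjunct2, THEN conjunct2, THEN conjunct2]
  interpret time_grid T n \<tau> by (rule grid)
  define \<eta> where "\<eta> i \<omega> = b i (k (\<tau> i) \<omega>)" for i \<omega>
  let ?h = "elementary_process n \<tau> \<eta>"
  have \<eta>_meas: "\<eta> i \<in> borel_measurable M" if "i < n" for i
  proof -
    have "\<tau> i \<in> {0..T}" using that by (intro p_in) simp
    then show ?thesis unfolding \<eta>_def using that by (intro measurable_compose[OF G_imp_M[OF _ k_measurable] b_m])
  qed
  have [measurable]: "(\<lambda>(s, \<omega>). ?h s \<omega>) \<in> borel_measurable (borel \<Otimes>\<^sub>M M)"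
    by (rule measurable_elementary_process[OF \<eta>_meas])
  have h_b: "\<bar>?h s \<omega>\<bar> \<le> max 0 C'" for s \<omega>
    by (rule elementary_process_bound) (auto simp: \<eta>_def intro: max.coboundedI2 b_b)
  have drift_m[measurable]: "drift n \<tau> \<eta> u \<in> borel_measurable M" for u by (rule drift_measurable[OF \<eta>_meas])
  define R where "R \<omega> = (\<integral>\<^sup>+s\<in>{t<..T}. ennreal \<bar>k0 (s, \<omega>) * ?h s \<omega> - q s\<bar> \<partial>lborel)" for \<omega>
  note q_m[measurable]
  have [measurable]: "R \<in> borel_measurable M" unfolding R_def[abs_def] by measurable
  define \<delta> where "\<delta> = min 1 (e/2)"
  have \<delta>: "0 < \<delta>" "\<delta> \<le> 1" "\<delta> \<le> e/2" using e by (auto simp: \<delta>_def)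
  have "prob {\<omega> \<in> space M. R \<omega> > ennreal \<delta>} \<le> \<epsilon> / \<delta>"
  proof (rule prob_gt_le_nn_integral_min)
    show "(\<integral>\<^sup>+\<omega>. min 1 (R \<omega>) \<partial>M) \<le> ennreal \<epsilon>" using R_le unfolding R_def \<eta>_def[abs_def] .
  qed (use \<delta> \<epsilon> in auto)
  also have "\<epsilon> / \<delta> = prob A / 2" using \<delta> by (simp add: \<epsilon>_def \<delta>_def[symmetric])
  finally have R_small: "prob {\<omega> \<in> space M. R \<omega> > ennreal \<delta>} \<le> prob A / 2" .
  \<comment> \<open>Restricting to the countable set of times keeps the event measurable, and the
    tubes are tested at the same times.\<close>
  define near where "near \<omega> \<longleftrightarrow> (\<forall>r. \<bar>drift n \<tau> \<eta> (rat_time t T r) \<omega> - (P (rat_time t T r) - P t)\<bar> \<le> e/2)" for \<omega>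
  have near_AE: "AE \<omega> in M. R \<omega> \<le> ennreal \<delta> \<longrightarrow> near \<omega>"
    using k_square_integrable AE_space
  proof eventually_elim
    case (elim \<omega>)
    show ?case
    proof
      assume le: "R \<omega> \<le> ennreal \<delta>"
      show "near \<omega>" unfolding near_def
      proof
        fix r
        have u: "t \<le> rat_time t T r" "rat_time t T r \<le> T" using rat_time_in[OF t0(2), of r] by auto
        have "\<bar>drift n \<tau> \<eta> (rat_time t T r) \<omega> - (P (rat_time t T r) - P t)\<bar> \<le> \<delta>"
        proof (rule drift_near_primitive[OF elim(2,1) _ h_b _ P_deriv q0_cont _ _ t0(1) u])
          show "(\<lambda>s. ?h s \<omega>) \<in> borel_measurable borel" unfolding elementary_process_def by measurable
          show "?h s \<omega> = 0" if "s \<le> t" for s unfolding \<eta>_def by (rule h0[OF that])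
          have "(\<integral>\<^sup>+s\<in>{t<..T}. ennreal \<bar>k0 (s, \<omega>) * ?h s \<omega> - q0 s\<bar> \<partial>lborel) = R \<omega>"
            unfolding R_def using t0 by (intro nn_integral_cong) (auto simp: indicator_def q_def)
          then show "(\<integral>\<^sup>+s\<in>{t<..T}. ennreal \<bar>k0 (s, \<omega>) * ?h s \<omega> - q0 s\<bar> \<partial>lborel) \<le> ennreal \<delta>" using le by simp
        qed (use \<delta> in simp)
        then show "\<bar>drift n \<tau> \<eta> (rat_time t T r) \<omega> - (P (rat_time t T r) - P t)\<bar> \<le> e/2" using \<delta>(3) by linarith
      qed
    qed
  qed
  have near_m: "{\<omega> \<in> space M. near \<omega>} \<in> events" unfolding near_def by measurable
  have AN: "prob (A \<inter> {\<omega> \<in> space M. near \<omega>}) > 0"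
  proof -
    have "prob A \<le> prob ((A \<inter> {\<omega> \<in> space M. near \<omega>}) \<union> {\<omega> \<in> space M. R \<omega> > ennreal \<delta>})"
    proof (rule finite_measure_mono_AE)
      show "AE \<omega> in M. \<omega> \<in> A \<longrightarrow> \<omega> \<in> (A \<inter> {\<omega> \<in> space M. near \<omega>}) \<union> {\<omega> \<in> space M. R \<omega> > ennreal \<delta>}"
        using near_AE AE_space by eventually_elim auto
      show "(A \<inter> {\<omega> \<in> space M. near \<omega>}) \<union> {\<omega> \<in> space M. R \<omega> > ennreal \<delta>} \<in> events"
        using A near_m by measurable
    qed
    also have "\<dots> \<le> prob (A \<inter> {\<omega> \<in> space M. near \<omega>}) + prob {\<omega> \<in> space M. R \<omega> > ennreal \<delta>}"
      using A near_m by (intro measure_Un_le) auto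
    finally show ?thesis using R_small A(2) by linarith
  qed
  let ?I = "{0..T} \<times> (UNIV :: bool set)"
  let ?P = "\<Pi>\<^sub>M j\<in>?I. borel :: real measure"
  let ?V = "\<lambda>\<omega>. \<lambda>j\<in>?I. if snd j then H (fst j) \<omega> + J (fst j) \<omega> else drift n \<tau> \<eta> (fst j) \<omega>"
  let ?V' = "\<lambda>\<omega>. \<lambda>j\<in>?I. if snd j then H (fst j) \<omega> + J (fst j) \<omega> - drift n \<tau> \<eta> (fst j) \<omega> else drift n \<tau> \<eta> (fst j) \<omega>"
  let ?D = "elementary_density W T n \<tau> \<eta>"
  have law: "distr M ?P ?V = distr (density M ?D) ?P ?V'"
    using girsanov_law[where H=H, OF H_meas ind grid b_m b_b] unfolding \<eta>_def[abs_def] by simp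
  have Vm: "?V \<in> M \<rightarrow>\<^sub>M ?P"
  proof (rule measurable_restrict)
    fix j assume j: "j \<in> ?I"
    then have "fst j \<in> {0..T}" by auto
    then show "(\<lambda>\<omega>. if snd j then H (fst j) \<omega> + J (fst j) \<omega> else drift n \<tau> \<eta> (fst j) \<omega>) \<in> borel_measurable M"
      using H_meas J_measurable drift_m by (cases "snd j") simp_all
  qed
  have V'm: "?V' \<in> M \<rightarrow>\<^sub>M ?P"
  proof (rule measurable_restrict)
    fix j assume j: "j \<in> ?I"
    then have "fst j \<in> {0..T}" by auto
    then show "(\<lambda>\<omega>. if snd j then H (fst j) \<omega> + J (fst j) \<omega> - drift n \<tau> \<eta> (fst j) \<omega> else drift n \<tau> \<eta> (fst j) \<omega>) \<in> borel_measurable M"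
      using H_meas J_measurable drift_m by (cases "snd j") simp_all
  qed
  have V_space: "?V \<omega> \<in> space ?P" "?V' \<omega> \<in> space ?P" for \<omega> by (auto simp: space_PiM)
  have V_True: "?V \<omega> (s, True) = Z s \<omega>" and V_False: "?V \<omega> (s, False) = drift n \<tau> \<eta> s \<omega>"
    and V'_True: "?V' \<omega> (s, True) = Z s \<omega> - drift n \<tau> \<eta> s \<omega>" and V'_False: "?V' \<omega> (s, False) = drift n \<tau> \<eta> s \<omega>"
    if "s \<in> {0..T}" for s \<omega>
    using that by (simp_all add: Z)
  have drift_0: "drift n \<tau> \<eta> s \<omega> = 0" if "s \<le> t" for s \<omega>
  proof -
    have z: "indicator {0..s} x *\<^sub>R (k0 (x, \<omega>) * ?h x \<omega>) = 0" for x
      using h0[of x \<omega>] that by (auto simp: indicator_def \<eta>_def[abs_def])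
    show ?thesis unfolding drift_def set_lebesgue_integral_def z by simp
  qed
  obtain \<B> where \<B>0: "\<B> \<in> sets ?P" "\<forall>\<omega>\<in>space M. \<forall>v \<in> space ?P. (\<forall>s\<in>{0..t}. v (s, True) = Z s \<omega>) \<longrightarrow> (v \<in> \<B> \<longleftrightarrow> \<omega> \<in> B)"
    using natural_filtration_factors[OF B(1) t0(2)] by (rule bexE)
  have \<B>: "\<B> \<in> sets ?P"
    "v \<in> \<B> \<longleftrightarrow> \<omega> \<in> B" if "\<omega> \<in> space M" "v \<in> space ?P" "\<And>s. s \<in> {0..t} \<Longrightarrow> v (s, True) = Z s \<omega>" for \<omega> v
    using \<B>0 that by blast+
  \<comment> \<open>One event in the space of pairs, with \<open>True\<close> marking the path and
    \<open>False\<close> the drift. For \<open>?V\<close> it says that \<open>Z\<close> is near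
    \<open>cs'\<close>; for \<open>?V'\<close> it says this of \<open>Z\<close> minus the drift. The
    condition on the drift is the same for both.\<close>
  define \<E> where "\<E> = {v \<in> space ?P. v \<in> \<B> \<and>
    (\<forall>r. \<bar>v (rat_time t T r, True) - v (t, True) - (rat_poly cs' (rat_time t T r) - rat_poly cs' t)\<bar> \<le> e/2 \<and>
         \<bar>v (rat_time t T r, False) - (P (rat_time t T r) - P t)\<bar> \<le> e/2)}"
  have rt: "rat_time t T r \<in> {0..T}" for r using rat_time_in[OF t0(2), of r] t0 by auto
  have \<E>: "\<E> \<in> sets ?P"
  proof -
    have [measurable]: "(\<lambda>v. v (rat_time t T r, b)) \<in> borel_measurable ?P" "(\<lambda>v. v (t, b)) \<in> borel_measurable ?P" for r b
      using rt t0 by (auto intro!: measurable_component_singleton)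
    note \<B>0(1)[measurable]
    show ?thesis unfolding \<E>_def by measurable
  qed
  \<comment> \<open>The drift vanishes up to \<open>t\<close>, so both \<open>?V\<close> and
    \<open>?V'\<close> display the path of \<open>Z\<close> there and decide membership in
    \<open>B\<close> alike.\<close>
  have V_B: "?V \<omega> \<in> \<B> \<longleftrightarrow> \<omega> \<in> B" "?V' \<omega> \<in> \<B> \<longleftrightarrow> \<omega> \<in> B" if "\<omega> \<in> space M" for \<omega>
    using t0 by (intro \<B>(2)[OF that V_space(1)] \<B>(2)[OF that V_space(2)]; simp add: Z drift_0)+
  have Z_cont: "continuous_on {t..T} (\<lambda>u. Z u \<omega>)" if "\<omega> \<in> space M" for \<omega>
    using Z_process that t0 by (auto simp: continuous_process_def intro: continuous_on_subset)
  have "A \<inter> {\<omega> \<in> space M. near \<omega>} \<subseteq> ?V -` \<E> \<inter> space M"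
  proof
    fix \<omega> assume \<omega>: "\<omega> \<in> A \<inter> {\<omega> \<in> space M. near \<omega>}"
    then have \<omega>M: "\<omega> \<in> space M" and "\<omega> \<in> B" and tube: "(\<lambda>u. Z u \<omega>) \<in> increment_tube t T cs' (e/2)" and near: "near \<omega>"
      by (auto simp: A_def)
    have "?V \<omega> \<in> \<E>"
      unfolding \<E>_def mem_Collect_eq V_B(1)[OF \<omega>M] V_True[OF rt] V_True[OF t0(3)] V_False[OF rt]
      using V_space(1) \<open>\<omega> \<in> B\<close> tube near increment_tube_iff_rat[OF t0(2) Z_cont[OF \<omega>M]]
      by (simp only: near_def) simp
    then show "\<omega> \<in> ?V -` \<E> \<inter> space M" using \<omega>M by blast
  qed
  then have "0 < prob (?V -` \<E> \<inter> space M)"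
    using AN finite_measure_mono[of "A \<inter> {\<omega> \<in> space M. near \<omega>}" "?V -` \<E> \<inter> space M"] measurable_sets[OF Vm \<E>] by linarith
  then have "0 < emeasure (distr M ?P ?V) \<E>"
    using emeasure_distr[OF Vm \<E>] by (simp add: emeasure_eq_measure)
  then have pos: "0 < emeasure (density M ?D) (?V' -` \<E> \<inter> space M)"
    unfolding law using emeasure_distr[of ?V' "density M ?D" ?P \<E>] V'm \<E> by simp
  \<comment> \<open>The two halves of the width add up: the translated path is within
    \<open>e / 2\<close> of the increments of \<open>cs'\<close>, and the drift is within
    \<open>e / 2\<close> of those of \<open>cs - cs'\<close>.\<close>
  have sub: "?V' -` \<E> \<inter> space M \<subseteq> B \<inter> {\<omega> \<in> space M. (\<lambda>u. Z u \<omega>) \<in> increment_tube t T cs e}"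
  proof
    fix \<omega> assume "\<omega> \<in> ?V' -` \<E> \<inter> space M"
    then have \<omega>M: "\<omega> \<in> space M" and V': "?V' \<omega> \<in> \<E>" by auto
    have "\<omega> \<in> B" using V' V_B(2)[OF \<omega>M] unfolding \<E>_def by blast
    moreover have "(\<lambda>u. Z u \<omega>) \<in> increment_tube t T cs e"
      unfolding increment_tube_iff_rat[OF t0(2) Z_cont[OF \<omega>M]]
    proof
      fix r
      let ?u = "rat_time t T r"
      have "\<bar>(Z ?u \<omega> - drift n \<tau> \<eta> ?u \<omega>) - (Z t \<omega> - drift n \<tau> \<eta> t \<omega>) - (rat_poly cs' ?u - rat_poly cs' t)\<bar> \<le> e/2"
        "\<bar>drift n \<tau> \<eta> ?u \<omega> - (P ?u - P t)\<bar> \<le> e/2"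
        using V' unfolding \<E>_def mem_Collect_eq V'_True[OF rt] V'_True[OF t0(3)] V'_False[OF rt] by blast+
      moreover have "drift n \<tau> \<eta> t \<omega> = 0" by (rule drift_0) simp
      ultimately show "\<bar>Z ?u \<omega> - Z t \<omega> - (rat_poly cs ?u - rat_poly cs t)\<bar> \<le> e"
        unfolding P_def by linarith
    qed
    ultimately show "\<omega> \<in> B \<inter> {\<omega> \<in> space M. (\<lambda>u. Z u \<omega>) \<in> increment_tube t T cs e}" using \<omega>M by simp
  qed
  have target: "B \<inter> {\<omega> \<in> space M. (\<lambda>u. Z u \<omega>) \<in> increment_tube t T cs e} \<in> events"
    using BM ex_increment_tube_pos(2)[OF Z_process t0(3) BM B(2) e] by auto
  have D_m: "?D \<in> borel_measurable M"
    using T_pos by (intro elementary_density_measurable[OF grid \<eta>_meas]) auto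
  have "prob (B \<inter> {\<omega> \<in> space M. (\<lambda>u. Z u \<omega>) \<in> increment_tube t T cs e}) \<noteq> 0"
  proof
    assume "prob (B \<inter> {\<omega> \<in> space M. (\<lambda>u. Z u \<omega>) \<in> increment_tube t T cs e}) = 0"
    then have "B \<inter> {\<omega> \<in> space M. (\<lambda>u. Z u \<omega>) \<in> increment_tube t T cs e} \<in> null_sets M"
      using target by (auto simp: null_sets_def emeasure_eq_measure)
    then have "?V' -` \<E> \<inter> space M \<in> null_sets M"
      using sub measurable_sets[OF V'm \<E>] null_sets_subset by blast
    \<comment> \<open>Absolute continuity with respect to \<open>M\<close> transfers null sets to
      the density measure, which contradicts the positive mass found in \<open>pos\<close>.\<close>
    then have "?V' -` \<E> \<inter> space M \<in> null_sets (density M ?D)"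
      using absolutely_continuousI_density[OF D_m] unfolding absolutely_continuous_def by blast
    then show False using pos by (simp add: null_sets_def)
  qed
  then show ?thesis by (simp add: zero_less_measure_iff)
qed

end

theorem theorem3p1:
  fixes M :: "'a measure" and T :: real
    and H k W J Z :: "real \<Rightarrow> 'a \<Rightarrow> real" and G :: "real \<Rightarrow> 'a measure"
  assumes "prob_space M" and "complete_measure M"
    and "T > 0"
    and "continuous_process M T H"
    and "(\<lambda>(t, \<omega>). k t \<omega>) \<in> borel_measurable (restrict_space borel {0..T} \<Otimes>\<^sub>M M)"
    and "AE \<omega> in M. (\<integral>\<^sup>+s\<in>{0..T}. ennreal ((k s \<omega>)\<^sup>2) \<partial>lborel) < \<infinity>"
    and "brownian_motion M T W"
    and "prob_space.indep_set M
           (sets (vimage_algebra (space M) (\<lambda>\<omega>. \<lambda>t\<in>{0..T}. W t \<omega>) (\<Pi>\<^sub>M t\<in>{0..T}. borel)))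
           (sets (vimage_algebra (space M) (\<lambda>\<omega>. \<lambda>t\<in>{0..T}. (H t \<omega>, k t \<omega>)) (\<Pi>\<^sub>M t\<in>{0..T}. borel)))"
    and "AE \<omega> in M. emeasure lborel {t \<in> {0..T}. k t \<omega> = 0} = 0"
    and "filtration_on M T G" and "brownian_motion_wrt M T G W" and "adapted T G k"
    and "ito_integral M T G W k J"
    and "Z = (\<lambda>t \<omega>. H t \<omega> + J t \<omega>)"
  shows "conditional_full_support M T (natural_filtration M Z) UNIV Z"
proof -
  interpret prob_space M by fact
  interpret adapted_integrand M T G W k J
    using assms by unfold_locales auto
  have "continuous_process M T Z"
    using ito unfolding assms(14) ito_integral_def by (intro continuous_process_add assms(4)) simp
  then show ?thesis
    by (rule conditional_full_supportI) (rule increment_tube_pos[OF assms(4,8,9,14)])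
qed

end
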